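(* Let $N\ge2$ and let $t(z)$ be the trace-like generating function of central elements of the elliptic quantum algebra ${\cal A}_{q,p}(\widehat{sl}(N)_{c})$ at the critical level $c=-N$. The Poisson bracket $\{t(z),t(w)\}$ defined in the context (as the coefficient of $c+N$ at first order in $t(z)t(w)-t(w)t(z)$ around $c=-N$) is given by \[ \{t(z),t(w)\}=f(w/z)\,t(z)\,t(w), \] where \begin{eqnarray*} f(x)&=&-2\ln q\left[\sum_{l\ge0}\left(\frac{2x^2q^{2Nl}}{1-x^2q^{2Nl}}-\frac{x^2q^{2Nl+2}}{1-x^2q^{2Nl+2}}-\frac{x^2q^{2Nl-2}}{1-x^2q^{2Nl-2}}\right)\right.\\ &&\left.-\frac{x^2}{1-x^2}+\frac12\,\frac{x^2q^2}{1-x^2q^2}+\frac12\,\frac{x^2q^{-2}}{1-x^2q^{-2}}-(x\leftrightarrow x^{-1})\right], \end{eqnarray*} and $-(x\leftrightarrow x^{-1})$ means that one subtracts the whole preceding expression in the bracket with $x$ replaced by $x^{-1}$. In particular this Poisson structure does not depend on $p$.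
   Context: Notation. $N\ge2$ is an integer, ${\mathbb Z}_N={\mathbb Z}/N{\mathbb Z}$, $z=e^{i\pi\xi}$, $q=e^{i\pi\zeta}$, $p=e^{2i\pi\tau}$ (fractional powers of $q,p$ are understood through $\zeta,\tau$, e.g. $p^{1/2}=e^{i\pi\tau}$, and $\ln q=i\pi\zeta$), $\omega=e^{2i\pi/N}$. Infinite products are $(x;p_1,\dots,p_m)_\infty=\prod_{n_i\ge0}(1-xp_1^{n_1}\cdots p_m^{n_m})$ (convergent for $|p_i|<1$) and $\Theta_a(x)=(x;a)_\infty(ax^{-1};a)_\infty(a;a)_\infty$. Jacobi theta functions with rational characteristics $(\gamma_1,\gamma_2)$ are \[ \vartheta\left[\begin{array}{c}\gamma_1\\ \gamma_2\end{array}\right](\xi,\tau)=\sum_{m\in{\mathbb Z}}\exp\big(i\pi(m+\gamma_1)^2\tau+2i\pi(m+\gamma_1)(\xi+\gamma_2)\big). \] The $R$-matrix. Let $g,h$ be the $N\times N$ matrices $g_{ij}=\omega^i\delta_{ij}$, $h_{ij}=\delta_{i+1,j}$ (indices mod $N$), $g^{1/2}$ a fixed diagonal square root of $g$, and $I_{(\alpha_1,\alpha_2)}=g^{\alpha_2}h^{\alpha_1}$ for $(\alpha_1,\alpha_2)\in{\mathbb Z}_N\times{\mathbb Z}_N$. Set \[ W_{(\alpha_1,\alpha_2)}(\xi,\zeta,\tau)=\frac1N\,\frac{\vartheta\left[\begin{array}{c}\frac12+\alpha_1/N\\ \frac12+\alpha_2/N\end{array}\right](\xi+\zeta/N,\tau)}{\vartheta\left[\begin{array}{c}\frac12+\alpha_1/N\\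 \frac12+\alpha_2/N\end{array}\right](\zeta/N,\tau)}, \] \[ \frac1{\kappa(z^2)}=\frac{(q^{2N}z^{-2};p,q^{2N})_\infty(q^2z^2;p,q^{2N})_\infty(pz^{-2};p,q^{2N})_\infty(pq^{2N-2}z^2;p,q^{2N})_\infty}{(q^{2N}z^2;p,q^{2N})_\infty(q^2z^{-2};p,q^{2N})_\infty(pz^2;p,q^{2N})_\infty(pq^{2N-2}z^{-2};p,q^{2N})_\infty}, \] \[ \widetilde R(z,q,p)=\frac{z^{2/N-2}}{\kappa(z^2)}\,\frac{\vartheta\left[\begin{array}{c}\frac12\\ \frac12\end{array}\right](\zeta,\tau)}{\vartheta\left[\begin{array}{c}\frac12\\ \frac12\end{array}\right](\xi+\zeta,\tau)}\sum_{(\alpha_1,\alpha_2)\in{\mathbb Z}_N\times{\mathbb Z}_N}W_{(\alpha_1,\alpha_2)}(\xi,\zeta,\tau)\,I_{(\alpha_1,\alpha_2)}\otimes I_{(\alpha_1,\alpha_2)}^{-1}, \] \[ R(z,q,p)=(g^{1/2}\otimes g^{1/2})\,\widetilde R(z,q,p)\,(g^{-1/2}\otimes g^{-1/2}), \] \[ \tau_N(z)=z^{\frac2N-2}\,\frac{\Theta_{q^{2N}}(qz^2)}{\Theta_{q^{2N}}(qz^{-2})},\qquad \widehat R_{12}(x)=\tau_N(q^{1/2}x^{-1})\,R_{12}(x). \] Write $\widehat R^{*}_{12}(z)=\widehat R^*_{12}(z,q,p)=\widehat R_{12}(z,q,p^* )$ with $p^*=pq^{-2c}$. $R_{21}$ is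 $R_{12}$ with the two tensor factors exchanged, and $t_2$ is transposition in the second factor. The algebra. ${\cal A}_{q,p}(\widehat{gl}(N)_c)$ is the algebra of operators $L_{ij}(z)=\sum_{n\in{\mathbb Z}}L_{ij}(n)z^n$, $i,j\in{\mathbb Z}_N$, gathered in the $N\times N$ matrix $L(z)=(L_{ij}(z))$, with relations \[ \widehat R_{12}(z/w)\,L_1(z)\,L_2(w)=L_2(w)\,L_1(z)\,\widehat R^*_{12}(z/w), \] where $L_1(z)=L(z)\otimes{\mathbb I}$, $L_2(z)={\mathbb I}\otimes L(z)$. The $q$-determinant \[ q\mbox{-}\det L(z)=\sum_{\sigma\in{\mathfrak S}_N}\varepsilon(\sigma)\prod_{i=1}^N L_{i,\sigma(i)}(zq^{i-N-1}) \] ($\varepsilon(\sigma)$ the signature of $\sigma$) is central, and ${\cal A}_{q,p}(\widehat{sl}(N)_c)={\cal A}_{q,p}(\widehat{gl}(N)_c)/\langle q\mbox{-}\det L-q^{c/2}\rangle$. Generating matrices. $L^+(z)=L(q^{c/2}z)$, $L^-(z)=g^{1/2}hg^{1/2}\,L(-p^{1/2}z)\,(g^{1/2}hg^{1/2})^{-1}$, ${\cal L}(z)=L^+(q^{c/2}z)\,L^-(z)^{-1}$ and $t(z)={\rm Tr}\,{\cal L}(z)$. At $c=-N$ the $t(z)$ are central and commute with each other. The Poisson bracket. For general $c$ one has (summation over repeated indices) \[ t(z)t(w)={\cal Y}(w/z)^{i_1i_2}_{j_1j_2}\,{\cal L}(w)^{j_2}_{i_2}\,{\cal L}(z)^{j_1}_{i_1},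 \] where ${\cal Y}(x)=T(x)\,{\cal M}(x)$ with \[ T(x)=\frac{\tau_N(q^{\frac12}x^{-1})\,\tau_N(q^{\frac12-c}x)}{\tau_N(q^{\frac12}x)\,\tau_N(q^{\frac12-c}x^{-1})}, \] \[ {\cal M}(x)=\left(\left(R_{21}(x)\,R_{21}(q^{c+N}x)^{-1}\,R_{12}(x^{-1})^{-1}\right)^{t_2}R_{12}(q^cx^{-1})^{t_2}\right)^{t_2}; \] at $c=-N$ one has $T(x)=1$ and ${\cal M}(x)={\mathbb I}\otimes{\mathbb I}$. Hence \[ t(z)t(w)=t(w)t(z)+(c+N)\left(\frac{d{\cal Y}}{dc}\Big(\frac wz\Big)\right)^{i_1i_2}_{j_1j_2}{\cal L}(w)^{j_2}_{i_2}{\cal L}(z)^{j_1}_{i_1}\Big|_{c=-N}+\cdots, \] and the Poisson bracket is defined by \[ \{t(z),t(w)\}=\left(\frac{d{\cal Y}}{dc}\Big(\frac wz\Big)\right)^{i_1i_2}_{j_1j_2}{\cal L}(w)^{j_2}_{i_2}\,{\cal L}(z)^{j_1}_{i_1}\Big|_{c=-N}. \] *)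

theory Defs
  imports "HOL-Analysis.Analysis" "Berlekamp_Zassenhaus.Finite_Field"
begin

text \<open>
  The index set is the ring of integers modulo N, rendered by the type \<open>'n mod_ring\<close> with
  \<open>N = CARD('n)\<close>; the class \<open>nontriv\<close> says exactly that \<open>CARD('n) > 1\<close>.

  Spectral parameters and \<open>q\<close>, \<open>p\<close> are given by their logarithms \<open>\<xi>\<close>, \<open>\<zeta>\<close>, \<open>\<tau>\<close>:
  \<open>z = exp (i\<pi>\<xi>)\<close>, \<open>q = exp (i\<pi>\<zeta>)\<close>, \<open>p = exp (2i\<pi>\<tau>)\<close>. This fixes all fractional powers; for
  instance \<open>z \<mapsto> q\<^sup>a z\<^sup>-\<^sup>1\<close> is \<open>\<xi> \<mapsto> a\<zeta> - \<xi>\<close>, and \<open>z \<mapsto> - p\<^sup>1\<^sup>/\<^sup>2 z\<close> is \<open>\<xi> \<mapsto> \<xi> + \<tau> + 1\<close>. The R-matrix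
  is not single-valued in \<open>z\<close> when \<open>N > 2\<close>.
\<close>

type_synonym ('a, 'n) zmat = "(('a, 'n mod_ring) vec, 'n mod_ring) vec"
type_synonym ('a, 'n) zmat2 =
  "(('a, 'n mod_ring \<times> 'n mod_ring) vec, 'n mod_ring \<times> 'n mod_ring) vec"

section \<open>Theta functions and infinite products\<close>

definition jtheta :: "real \<Rightarrow> real \<Rightarrow> complex \<Rightarrow> complex \<Rightarrow> complex" where
  "jtheta \<gamma>1 \<gamma>2 \<xi> \<tau> = (\<Sum>\<^sub>\<infinity>m\<in>(UNIV :: int set).
     exp (\<i> * pi * (of_int m + \<gamma>1)\<^sup>2 * \<tau> + 2 * \<i> * pi * (of_int m + \<gamma>1) * (\<xi> + \<gamma>2)))"

definition qpoch1 :: "complex \<Rightarrow> complex \<Rightarrow> complex" where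
  "qpoch1 x a = (\<Prod>n. 1 - x * a ^ n)"

definition qpoch2 :: "complex \<Rightarrow> complex \<Rightarrow> complex \<Rightarrow> complex" where
  "qpoch2 x a b = (\<Prod>m. \<Prod>n. 1 - x * a ^ m * b ^ n)"

definition Theta :: "complex \<Rightarrow> complex \<Rightarrow> complex" where
  "Theta a x = qpoch1 x a * qpoch1 (a / x) a * qpoch1 a a"

section \<open>Matrices\<close>

definition tensor :: "('a::semiring_1, 'n::finite) zmat \<Rightarrow> ('a, 'n) zmat \<Rightarrow> ('a, 'n) zmat2" where
  "tensor A B = (\<chi> i j. A $ fst i $ fst j * B $ snd i $ snd j)"

definition flip :: "('a, 'n::finite) zmat2 \<Rightarrow> ('a, 'n) zmat2" where
  "flip A = (\<chi> i j. A $ prod.swap i $ prod.swap j)"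

definition transp2 :: "('a, 'n::finite) zmat2 \<Rightarrow> ('a, 'n) zmat2" where
  "transp2 A = (\<chi> i j. A $ (fst i, snd j) $ (fst j, snd i))"

text \<open>The library's \<open>^\<close> on matrices is componentwise.\<close>

definition matpow :: "('a::semiring_1, 'n::finite) zmat \<Rightarrow> nat \<Rightarrow> ('a, 'n) zmat" where
  "matpow A k = (((**) A) ^^ k) (mat 1)"

definition zrep :: "'n::finite mod_ring \<Rightarrow> nat" where
  "zrep i = nat (to_int_mod_ring i)"

definition omega :: "nat \<Rightarrow> complex" where
  "omega N = exp (2 * \<i> * pi / of_nat N)"

definition gmat :: "(complex, 'n::nontriv) zmat" where
  "gmat = (\<chi> i j. if i = j then omega CARD('n) ^ zrep i else 0)"

definition hmat :: "(complex, 'n::nontriv) zmat" where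
  "hmat = (\<chi> i j. if i + 1 = j then 1 else 0)"

definition diag_sqrt_g :: "(complex, 'n::nontriv) zmat \<Rightarrow> bool" where
  "diag_sqrt_g G \<longleftrightarrow> (\<forall>i j. i \<noteq> j \<longrightarrow> G $ i $ j = 0) \<and> G ** G = gmat"

definition Imat :: "'n::nontriv mod_ring \<times> 'n mod_ring \<Rightarrow> (complex, 'n) zmat" where
  "Imat \<alpha> = matpow gmat (zrep (snd \<alpha>)) ** matpow hmat (zrep (fst \<alpha>))"

section \<open>The R-matrix\<close>

definition Wfun :: "'n::nontriv mod_ring \<times> 'n mod_ring \<Rightarrow> complex \<Rightarrow> complex \<Rightarrow> complex \<Rightarrow> complex"
  where
  "Wfun \<alpha> \<xi> \<zeta> \<tau> =
     (let N = CARD('n);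
          \<gamma>1 = 1/2 + real (zrep (fst \<alpha>)) / real N;
          \<gamma>2 = 1/2 + real (zrep (snd \<alpha>)) / real N
      in 1 / of_nat N * (jtheta \<gamma>1 \<gamma>2 (\<xi> + \<zeta> / of_nat N) \<tau> / jtheta \<gamma>1 \<gamma>2 (\<zeta> / of_nat N) \<tau>))"

definition inv_kappa :: "nat \<Rightarrow> complex \<Rightarrow> complex \<Rightarrow> complex \<Rightarrow> complex" where
  "inv_kappa N \<zeta> \<tau> \<xi> =
     (let q = exp (\<i> * pi * \<zeta>); p = exp (2 * \<i> * pi * \<tau>); y = exp (2 * \<i> * pi * \<xi>); Q = q ^ (2 * N)
      in (qpoch2 (Q / y) p Q * qpoch2 (q\<^sup>2 * y) p Q
            * qpoch2 (p / y) p Q * qpoch2 (p * q ^ (2 * N - 2) * y) p Q)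
         / (qpoch2 (Q * y) p Q * qpoch2 (q\<^sup>2 / y) p Q
            * qpoch2 (p * y) p Q * qpoch2 (p * q ^ (2 * N - 2) / y) p Q))"

definition Rtilde :: "complex \<Rightarrow> complex \<Rightarrow> complex \<Rightarrow> (complex, 'n::nontriv) zmat2" where
  "Rtilde \<zeta> \<tau> \<xi> =
     map_matrix ((*) (exp (\<i> * pi * \<xi> * (2 / of_nat CARD('n) - 2)) * inv_kappa CARD('n) \<zeta> \<tau> \<xi>
                      * (jtheta (1/2) (1/2) \<zeta> \<tau> / jtheta (1/2) (1/2) (\<xi> + \<zeta>) \<tau>)))
       (\<Sum>\<alpha>\<in>(UNIV :: ('n mod_ring \<times> 'n mod_ring) set).
          map_matrix ((*) (Wfun \<alpha> \<xi> \<zeta> \<tau>)) (tensor (Imat \<alpha>) (matrix_inv (Imat \<alpha>))))"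

text \<open>\<open>G\<close> stands for the fixed diagonal square root of \<open>g\<close>.\<close>

definition Rmat ::
  "(complex, 'n::nontriv) zmat \<Rightarrow> complex \<Rightarrow> complex \<Rightarrow> complex \<Rightarrow> (complex, 'n) zmat2" where
  "Rmat G \<zeta> \<tau> \<xi> = tensor G G ** Rtilde \<zeta> \<tau> \<xi> ** tensor (matrix_inv G) (matrix_inv G)"

definition tauN :: "nat \<Rightarrow> complex \<Rightarrow> complex \<Rightarrow> complex" where
  "tauN N \<zeta> \<xi> =
     (let q = exp (\<i> * pi * \<zeta>); y = exp (2 * \<i> * pi * \<xi>)
      in exp (\<i> * pi * \<xi> * (2 / of_nat N - 2)) * (Theta (q ^ (2 * N)) (q * y) / Theta (q ^ (2 * N)) (q / y)))"

definition Rhat ::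
  "(complex, 'n::nontriv) zmat \<Rightarrow> complex \<Rightarrow> complex \<Rightarrow> complex \<Rightarrow> (complex, 'n) zmat2" where
  "Rhat G \<zeta> \<tau> \<xi> = map_matrix ((*) (tauN CARD('n) \<zeta> (\<zeta> / 2 - \<xi>))) (Rmat G \<zeta> \<tau> \<xi>)"

section \<open>Genericity\<close>

text \<open>
  The identities of the theory are identities of meromorphic functions. The following two
  conditions keep all of these functions away from their zeros and poles:
  \<open>q\<^sup>2\<close> is not an integral power of \<open>p\<close>, so that \<open>Wfun\<close> has nonzero denominators, and
  the square of the spectral parameter \<open>exp (i\<pi>\<xi>)\<close> is not of the form \<open>q\<^sup>2\<^sup>l p\<^sup>m\<close>.
\<close>

definition generic_qp :: "complex \<Rightarrow> complex \<Rightarrow> bool" where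
  "generic_qp \<zeta> \<tau> \<longleftrightarrow> (\<forall>k m :: int. \<zeta> \<noteq> of_int k + of_int m * \<tau>)"

definition generic_arg :: "complex \<Rightarrow> complex \<Rightarrow> complex \<Rightarrow> bool" where
  "generic_arg \<zeta> \<tau> \<xi> \<longleftrightarrow> (\<forall>k l m :: int. \<xi> \<noteq> of_int k + of_int l * \<zeta> + of_int m * \<tau>)"

section \<open>The elliptic algebras\<close>

text \<open>\<open>sc\<close> is the structure map of a unital associative complex algebra.\<close>

definition complex_algebra :: "(complex \<Rightarrow> 'a::ring_1) \<Rightarrow> bool" where
  "complex_algebra sc \<longleftrightarrow>
     (\<forall>a b. sc (a + b) = sc a + sc b) \<and> (\<forall>a b. sc (a * b) = sc a * sc b) \<and> sc 1 = 1 \<and>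
     (\<forall>a x. sc a * x = x * sc a)"

definition Lterm ::
  "(complex \<Rightarrow> 'a::ring_1) \<Rightarrow> (int \<Rightarrow> ('a, 'n::nontriv) zmat) \<Rightarrow> complex
     \<Rightarrow> 'n mod_ring \<Rightarrow> 'n mod_ring \<Rightarrow> int \<Rightarrow> 'a" where
  "Lterm sc Lm \<xi> i j n = sc (exp (\<i> * pi * of_int n * \<xi>)) * Lm n $ i $ j"

definition Lop ::
  "(complex \<Rightarrow> 'a::{ring_1, t2_space}) \<Rightarrow> (int \<Rightarrow> ('a, 'n::nontriv) zmat) \<Rightarrow> complex \<Rightarrow> ('a, 'n) zmat"
  where
  "Lop sc Lm \<xi> = (\<chi> i j. \<Sum>\<^sub>\<infinity>n. Lterm sc Lm \<xi> i j n)"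

text \<open>
  A realization of the \<open>gl\<close> algebra at level \<open>c\<close>: a complex algebra with a Hausdorff topology
  (needed only to give a meaning to the generating series), modes \<open>Lm n\<close>, and a set \<open>D\<close> of
  spectral parameters at which the series converge and the exchange relations hold. \<open>D\<close> is arbitrary;
  in particular it need not be invariant under \<open>\<xi> \<mapsto> \<xi> + 2\<close>, under which \<open>Lop\<close> is periodic but,
  for \<open>N > 2\<close>, \<open>Rhat\<close> is not. With \<open>p\<^sup>* = p q\<^sup>-\<^sup>2\<^sup>c\<close> one has \<open>\<tau>\<^sup>* = \<tau> - c \<zeta>\<close>.
\<close>

definition elliptic_gl ::
  "(complex \<Rightarrow> 'a::{ring_1, t2_space}) \<Rightarrow> (complex, 'n::nontriv) zmat \<Rightarrow> complex \<Rightarrow> complex \<Rightarrow> complex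
     \<Rightarrow> complex set \<Rightarrow> (int \<Rightarrow> ('a, 'n) zmat) \<Rightarrow> bool" where
  "elliptic_gl sc G \<zeta> \<tau> c D Lm \<longleftrightarrow>
     complex_algebra sc \<and>
     (\<forall>u\<in>D. \<forall>i j. Lterm sc Lm u i j summable_on UNIV) \<and>
     (\<forall>u\<in>D. \<forall>v\<in>D. generic_arg \<zeta> \<tau> (u - v) \<longrightarrow> generic_arg \<zeta> (\<tau> - c * \<zeta>) (u - v) \<longrightarrow>
        map_matrix sc (Rhat G \<zeta> \<tau> (u - v)) ** tensor (Lop sc Lm u) (mat 1) ** tensor (mat 1) (Lop sc Lm v)
        = tensor (mat 1) (Lop sc Lm v) ** tensor (Lop sc Lm u) (mat 1)
            ** map_matrix sc (Rhat G \<zeta> (\<tau> - c * \<zeta>) (u - v)))"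

text \<open>The factors are multiplied in the order \<open>i = 1, \<dots>, N\<close>.\<close>

definition qdet ::
  "(complex \<Rightarrow> 'a::{ring_1, t2_space}) \<Rightarrow> complex \<Rightarrow> (int \<Rightarrow> ('a, 'n::nontriv) zmat) \<Rightarrow> complex \<Rightarrow> 'a"
  where
  "qdet sc \<zeta> Lm u =
     (\<Sum>\<sigma> | \<sigma> permutes (UNIV :: 'n mod_ring set). of_int (sign \<sigma>) *
        prod_list (map (\<lambda>i. Lop sc Lm (u + (of_nat i - of_nat CARD('n) - 1) * \<zeta>)
                              $ of_nat i $ \<sigma> (of_nat i)) [1..<CARD('n) + 1]))"

definition elliptic_sl ::
  "(complex \<Rightarrow> 'a::{ring_1, t2_space}) \<Rightarrow> (complex, 'n::nontriv) zmat \<Rightarrow> complex \<Rightarrow> complex \<Rightarrow> complex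
     \<Rightarrow> complex set \<Rightarrow> (int \<Rightarrow> ('a, 'n) zmat) \<Rightarrow> bool" where
  "elliptic_sl sc G \<zeta> \<tau> c D Lm \<longleftrightarrow>
     elliptic_gl sc G \<zeta> \<tau> c D Lm \<and>
     (\<forall>u. (\<forall>i\<in>{1..CARD('n)}. u + (of_nat i - of_nat CARD('n) - 1) * \<zeta> \<in> D) \<longrightarrow>
        qdet sc \<zeta> Lm u = sc (exp (\<i> * pi * \<zeta> * (c / 2))))"

section \<open>The generating function\<close>

definition Lplus ::
  "(complex \<Rightarrow> 'a::{ring_1, t2_space}) \<Rightarrow> complex \<Rightarrow> complex \<Rightarrow> (int \<Rightarrow> ('a, 'n::nontriv) zmat)
     \<Rightarrow> complex \<Rightarrow> ('a, 'n) zmat" where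
  "Lplus sc \<zeta> c Lm u = Lop sc Lm (u + c / 2 * \<zeta>)"

definition Lminus ::
  "(complex \<Rightarrow> 'a::{ring_1, t2_space}) \<Rightarrow> (complex, 'n::nontriv) zmat \<Rightarrow> complex
     \<Rightarrow> (int \<Rightarrow> ('a, 'n) zmat) \<Rightarrow> complex \<Rightarrow> ('a, 'n) zmat" where
  "Lminus sc G \<tau> Lm u =
     map_matrix sc (G ** hmat ** G) ** Lop sc Lm (u + \<tau> + 1)
       ** map_matrix sc (matrix_inv (G ** hmat ** G))"

definition Lcal ::
  "(complex \<Rightarrow> 'a::{ring_1, t2_space}) \<Rightarrow> (complex, 'n::nontriv) zmat \<Rightarrow> complex \<Rightarrow> complex \<Rightarrow> complex
     \<Rightarrow> (int \<Rightarrow> ('a, 'n) zmat) \<Rightarrow> complex \<Rightarrow> ('a, 'n) zmat" where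
  "Lcal sc G \<zeta> \<tau> c Lm u = Lplus sc \<zeta> c Lm (u + c / 2 * \<zeta>) ** matrix_inv (Lminus sc G \<tau> Lm u)"

definition tgen ::
  "(complex \<Rightarrow> 'a::{ring_1, t2_space}) \<Rightarrow> (complex, 'n::nontriv) zmat \<Rightarrow> complex \<Rightarrow> complex \<Rightarrow> complex
     \<Rightarrow> (int \<Rightarrow> ('a, 'n) zmat) \<Rightarrow> complex \<Rightarrow> 'a" where
  "tgen sc G \<zeta> \<tau> c Lm u = trace (Lcal sc G \<zeta> \<tau> c Lm u)"

section \<open>The Poisson bracket\<close>

definition Tfun :: "nat \<Rightarrow> complex \<Rightarrow> complex \<Rightarrow> complex \<Rightarrow> complex" where
  "Tfun N \<zeta> c \<xi> =
     (tauN N \<zeta> (\<zeta> / 2 - \<xi>) * tauN N \<zeta> ((1/2 - c) * \<zeta> + \<xi>))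
     / (tauN N \<zeta> (\<zeta> / 2 + \<xi>) * tauN N \<zeta> ((1/2 - c) * \<zeta> - \<xi>))"

definition Mmat ::
  "(complex, 'n::nontriv) zmat \<Rightarrow> complex \<Rightarrow> complex \<Rightarrow> complex \<Rightarrow> complex \<Rightarrow> (complex, 'n) zmat2" where
  "Mmat G \<zeta> \<tau> c \<xi> =
     transp2
       (transp2 (flip (Rmat G \<zeta> \<tau> \<xi>)
                 ** matrix_inv (flip (Rmat G \<zeta> \<tau> ((c + of_nat CARD('n)) * \<zeta> + \<xi>)))
                 ** matrix_inv (Rmat G \<zeta> \<tau> (- \<xi>)))
        ** transp2 (Rmat G \<zeta> \<tau> (c * \<zeta> - \<xi>)))"

definition Ymat ::
  "(complex, 'n::nontriv) zmat \<Rightarrow> complex \<Rightarrow> complex \<Rightarrow> complex \<Rightarrow> complex \<Rightarrow> (complex, 'n) zmat2" where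
  "Ymat G \<zeta> \<tau> c \<xi> = map_matrix ((*) (Tfun CARD('n) \<zeta> c \<xi>)) (Mmat G \<zeta> \<tau> c \<xi>)"

definition dYmat ::
  "(complex, 'n::nontriv) zmat \<Rightarrow> complex \<Rightarrow> complex \<Rightarrow> complex \<Rightarrow> (complex, 'n) zmat2" where
  "dYmat G \<zeta> \<tau> \<xi> = (\<chi> i j. deriv (\<lambda>c. Ymat G \<zeta> \<tau> c \<xi> $ i $ j) (- of_nat CARD('n)))"

text \<open>Upper indices are row indices; all quantities are taken at the critical level \<open>c = - N\<close>.\<close>

definition poisson_t ::
  "(complex \<Rightarrow> 'a::{ring_1, t2_space}) \<Rightarrow> (complex, 'n::nontriv) zmat \<Rightarrow> complex \<Rightarrow> complex
     \<Rightarrow> (int \<Rightarrow> ('a, 'n) zmat) \<Rightarrow> complex \<Rightarrow> complex \<Rightarrow> 'a" where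
  "poisson_t sc G \<zeta> \<tau> Lm u v =
     (\<Sum>i1\<in>UNIV. \<Sum>i2\<in>UNIV. \<Sum>j1\<in>UNIV. \<Sum>j2\<in>UNIV.
        sc (dYmat G \<zeta> \<tau> (v - u) $ (i1, i2) $ (j1, j2))
          * Lcal sc G \<zeta> \<tau> (- of_nat CARD('n)) Lm v $ j2 $ i2
          * Lcal sc G \<zeta> \<tau> (- of_nat CARD('n)) Lm u $ j1 $ i1)"

definition f_bracket :: "nat \<Rightarrow> complex \<Rightarrow> complex \<Rightarrow> complex" where
  "f_bracket N q x =
     (\<Sum>l. 2 * x\<^sup>2 * q ^ (2 * N * l) / (1 - x\<^sup>2 * q ^ (2 * N * l))
          - x\<^sup>2 * q ^ (2 * N * l + 2) / (1 - x\<^sup>2 * q ^ (2 * N * l + 2))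
          - x\<^sup>2 * q powi (2 * int N * int l - 2) / (1 - x\<^sup>2 * q powi (2 * int N * int l - 2)))
     - x\<^sup>2 / (1 - x\<^sup>2)
     + 1/2 * (x\<^sup>2 * q\<^sup>2 / (1 - x\<^sup>2 * q\<^sup>2))
     + 1/2 * (x\<^sup>2 * q powi (-2) / (1 - x\<^sup>2 * q powi (-2)))"

text \<open>Here \<open>ln q\<close> is \<open>i\<pi>\<zeta>\<close>.\<close>

definition f_poisson :: "nat \<Rightarrow> complex \<Rightarrow> complex \<Rightarrow> complex" where
  "f_poisson N \<zeta> x =
     - 2 * (\<i> * pi * \<zeta>) * (f_bracket N (exp (\<i> * pi * \<zeta>)) x - f_bracket N (exp (\<i> * pi * \<zeta>)) (inverse x))"

end

(*
  The R-matrix satisfies unitarity R12(x) R21(1/x) = 1 and the crossing relation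
  R21(x)^(t2) R12(1/(x q^N))^(t2) = 1. They follow from theta function identities: sums over Z_N x Z_N
  of products of two of the weights are quasi-periodic entire (or doubly periodic) functions, and a
  comparison of zeros determines them up to a constant.

  At c = -N the two relations give M = 1, and differentiating them shows that dM/dc = 0 there, because the
  derivatives of the two R-matrices that contain c cancel. Hence dY/dc = (dT/dc) 1 is scalar, and
  dT/dc is a combination of logarithmic derivatives of Theta_{q^(2N)}, that is, of Lambert series in
  q^(2N); the nome p has dropped out.

  The bracket is therefore f t(w) t(z), and it remains to exchange t(z) and t(w). The
  RLL relations, together with the quasi-periodicity of R under z -> -p^(1/2) z, give exchange
  relations between L^+ and L^-. Their multipliers are tau_N-factors that agree for p and p*
  at c = -N, since tau_N(q^N z) = tau_N(z). These relations combine to a reflection-type relation for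
  calL = L^+ (L^-)^(-1), and crossing evaluates the traces of its two sides as t(z) t(w) and t(w) t(z).
*)
theory Submission
  imports Defs "HOL-Complex_Analysis.Complex_Analysis"
begin

section \<open>Infinite products\<close>

text \<open>The definitions describe related functions in two ways: the weights are theta series,
  \<open>inv_kappa\<close> and \<open>tauN\<close> are infinite products. The scalar part of
  crossing mixes them, so series and product must be identified; the constant of this identification
  cancels and stays undetermined. Each sum of products of weights is a function of one variable with
  two known zeros. For unitarity both zeros lie at 0, and the second logarithmic derivative of theta
  supplies the constant. For crossing they lie at 0 and at \<open>N * \<zeta>\<close>, because the
  plain sum of all weights vanishes at \<open>- N * \<zeta>\<close>. That sum is computed as a
  function of \<zeta>, since in the spectral parameter its terms have different multipliers; its
  derivative in \<zeta> also yields the crossing constant. The conjugating matrix of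
  \<open>Lminus\<close> is forced: \<open>h g\<close> commutes with the Heisenberg matrices up to
  exactly the phase that the weights acquire under a shift by \<open>\<tau> + 1\<close>, and
  conjugation by the square root of \<open>g\<close> turns \<open>h g\<close> into that
  matrix.\<close>

lemma prodinf_locally_uniform:
  fixes f :: "nat \<Rightarrow> complex \<Rightarrow> complex"
  assumes holo: "\<And>n. f n holomorphic_on UNIV"
    and bound: "\<And>R n x. norm x \<le> R \<Longrightarrow> norm (f n x - 1) \<le> M R n"
    and summ: "\<And>R. summable (M R)"
  shows convergent_prod_of_bound: "convergent_prod (\<lambda>n. f n x)"
    and uniform_limit_prod_of_bound:
      "uniform_limit (cball 0 R) (\<lambda>n x. \<Prod>k<n. f k x) (\<lambda>x. \<Prod>k. f k x) sequentially"
    and holomorphic_prodinf_of_bound: "(\<lambda>x. \<Prod>k. f k x) holomorphic_on UNIV"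
proof -
  have conv: "convergent_prod (\<lambda>n. f n x)" for x
  proof -
    have "summable (\<lambda>n. norm (f n x - 1))"
      by (rule summable_comparison_test'[OF summ[of "norm x"]]) (use bound in auto)
    then show ?thesis
      by (intro abs_convergent_prod_imp_convergent_prod summable_imp_abs_convergent_prod)
  qed
  show "convergent_prod (\<lambda>n. f n x)" by (rule conv)
  have ul: "uniform_limit (cball 0 R) (\<lambda>n x. \<Prod>k<n. f k x) (\<lambda>x. \<Prod>k. f k x) sequentially" for R
  proof -
    have "uniformly_convergent_on (cball 0 R) (\<lambda>N x. \<Prod>n<N. f n x)"
    proof (rule uniformly_convergent_on_prod')
      show "continuous_on (cball 0 R) (f n)" for n
        using holo holomorphic_on_imp_continuous_on continuous_on_subset by blast
      show "uniformly_convergent_on (cball 0 R) (\<lambda>N x. \<Sum>n<N. norm (f n x - 1))"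
        by (rule Weierstrass_m_test'[OF _ summ[of R]]) (use bound in auto)
    qed auto
    then obtain g where g: "uniform_limit (cball 0 R) (\<lambda>n x. \<Prod>k<n. f k x) g sequentially"
      by (auto simp: uniformly_convergent_on_def)
    have eq: "g x = (\<Prod>k. f k x)" if "x \<in> cball 0 R" for x
    proof -
      have "(\<lambda>n. \<Prod>k<n. f k x) \<longlonglongrightarrow> g x"
        by (rule tendsto_uniform_limitI[OF g that])
      moreover have "(\<lambda>n. \<Prod>k<n. f k x) \<longlonglongrightarrow> (\<Prod>k. f k x)"
        using convergent_prod_has_prod[OF conv] by (rule has_prod_imp_tendsto')
      ultimately show ?thesis using LIMSEQ_unique by blast
    qed
    show ?thesis
      using g by (rule uniform_limit_cong'[THEN iffD1, rotated 2]) (use eq in auto)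
  qed
  show "uniform_limit (cball 0 R) (\<lambda>n x. \<Prod>k<n. f k x) (\<lambda>x. \<Prod>k. f k x) sequentially"
    by (rule ul)
  show "(\<lambda>x. \<Prod>k. f k x) holomorphic_on UNIV"
  proof (rule holomorphic_uniform_sequence[where f = "\<lambda>n x. \<Prod>k<n. f k x"])
    show "(\<lambda>x. \<Prod>k<n. f k x) holomorphic_on UNIV" for n
      by (intro holomorphic_intros holo)
    show "\<exists>d>0. cball x d \<subseteq> UNIV \<and>
        uniform_limit (cball x d) (\<lambda>n x. \<Prod>k<n. f k x) (\<lambda>x. \<Prod>k. f k x) sequentially" for x
    proof (intro exI[of _ 1] conjI)
      have "cball x 1 \<subseteq> cball 0 (norm x + 1)"
        by (auto simp: dist_norm) (smt (verit) norm_minus_commute norm_triangle_ineq2)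
      then show "uniform_limit (cball x 1) (\<lambda>n x. \<Prod>k<n. f k x) (\<lambda>x. \<Prod>k. f k x) sequentially"
        by (rule uniform_limit_on_subset[OF ul])
    qed auto
  qed auto
qed

text \<open>Needed one level up: the factors of a double product are themselves infinite products,
  and this bounds their distance from 1. Finite products are compared with the product of
  \<open>1 + norm (f k - 1)\<close>, hence with an exponential.\<close>

lemma norm_prodinf_minus_1_le:
  fixes f :: "nat \<Rightarrow> complex"
  assumes "summable (\<lambda>n. norm (f n - 1))"
  shows "norm ((\<Prod>n. f n) - 1) \<le> exp (\<Sum>n. norm (f n - 1)) - 1"
proof -
  have "convergent_prod f"
    using assms by (intro abs_convergent_prod_imp_convergent_prod summable_imp_abs_convergent_prod)
  then have "(\<lambda>n. \<Prod>k<n. f k) \<longlonglongrightarrow> (\<Prod>k. f k)"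
    using convergent_prod_has_prod by (intro has_prod_imp_tendsto') auto
  then have lim: "(\<lambda>n. norm ((\<Prod>k<n. f k) - 1)) \<longlonglongrightarrow> norm ((\<Prod>k. f k) - 1)"
    by (intro tendsto_intros)
  show ?thesis
  proof (rule LIMSEQ_le_const2[OF lim], intro exI allI impI)
    fix n
    have "norm ((\<Prod>k<n. f k) - 1) \<le> (\<Prod>k<n. 1 + norm (f k - 1)) - 1"
      using norm_prod_minus1_le_prod_minus1[of "\<lambda>k. f k - 1" "{..<n}"] by simp
    also have "\<dots> \<le> exp (\<Sum>k<n. norm (f k - 1)) - 1"
      using prod_le_exp_sum[of "{..<n}" "\<lambda>k. norm (f k - 1)"] by simp
    also have "\<dots> \<le> exp (\<Sum>n. norm (f n - 1)) - 1"
      using sum_le_suminf[OF assms, of "{..<n}"] by simp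
    finally show "norm ((\<Prod>k<n. f k) - 1) \<le> exp (\<Sum>n. norm (f n - 1)) - 1" .
  qed
qed

section \<open>Single infinite products\<close>

context
  fixes a :: complex
  assumes a: "norm a < 1"
begin

private lemma qpoch1_bound:
  "norm x \<le> R \<Longrightarrow> norm ((1 - x * a ^ n) - 1) \<le> R * norm a ^ n"
  by (simp add: norm_mult norm_power mult_right_mono)

private lemma qpoch1_summable: "summable (\<lambda>n. R * norm a ^ n)"
  using a by (intro summable_mult summable_geometric) auto

lemma convergent_qpoch1: "convergent_prod (\<lambda>n. 1 - x * a ^ n)"
  by (rule convergent_prod_of_bound[where f = "\<lambda>n x. 1 - x * a ^ n" and M = "\<lambda>R n. R * norm a ^ n"])
     (intro holomorphic_intros qpoch1_bound qpoch1_summable; assumption)+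

lemma uniform_limit_qpoch1:
  "uniform_limit (cball 0 R) (\<lambda>n x. \<Prod>k<n. 1 - x * a ^ k) (\<lambda>x. qpoch1 x a) sequentially"
  unfolding qpoch1_def
  by (rule uniform_limit_prod_of_bound[where f = "\<lambda>n x. 1 - x * a ^ n" and M = "\<lambda>R n. R * norm a ^ n"])
     (intro holomorphic_intros qpoch1_bound qpoch1_summable; assumption)+

lemma holomorphic_qpoch1_UNIV: "(\<lambda>x. qpoch1 x a) holomorphic_on UNIV"
  unfolding qpoch1_def
  by (rule holomorphic_prodinf_of_bound[where f = "\<lambda>n x. 1 - x * a ^ n" and M = "\<lambda>R n. R * norm a ^ n"])
     (intro holomorphic_intros qpoch1_bound qpoch1_summable; assumption)+

lemma holomorphic_on_qpoch1 [holomorphic_intros]: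
  assumes "g holomorphic_on A" shows "(\<lambda>x. qpoch1 (g x) a) holomorphic_on A"
  using holomorphic_on_compose_gen[OF assms holomorphic_qpoch1_UNIV] by (auto simp: o_def)

lemma qpoch1_rec: "qpoch1 x a = (1 - x) * qpoch1 (x * a) a"
proof -
  have "(\<lambda>n. 1 - x * a ^ n) has_prod ((\<Prod>k<1. 1 - x * a ^ k) * (\<Prod>k. 1 - x * a ^ (k + 1)))"
    using convergent_qpoch1 by (rule has_prod_ignore_initial_segment')
  then have "qpoch1 x a = (\<Prod>k<1. 1 - x * a ^ k) * (\<Prod>k. 1 - x * a ^ (k + 1))"
    unfolding qpoch1_def by (metis has_prod_unique)
  then show ?thesis by (simp add: qpoch1_def mult_ac)
qed

lemma qpoch1_eq_0_iff: "qpoch1 x a = 0 \<longleftrightarrow> (\<exists>n. x * a ^ n = 1)"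
proof -
  have "(\<lambda>n. 1 - x * a ^ n) has_prod qpoch1 x a"
    unfolding qpoch1_def using convergent_qpoch1 by (rule convergent_prod_has_prod)
  from has_prod_eq_0_iff[OF this] show ?thesis by (auto simp: image_iff)
qed

text \<open>The source of the Lambert series in the final formula. Locally uniform convergence of
  the partial products permits termwise logarithmic differentiation away from the zeros.\<close>

lemma logderiv_qpoch1:
  assumes "qpoch1 x a \<noteq> 0"
  shows "(\<lambda>k. - (a ^ k) / (1 - x * a ^ k)) sums (deriv (\<lambda>x. qpoch1 x a) x / qpoch1 x a)"
proof -
  have "(\<lambda>k. deriv (\<lambda>x. 1 - x * a ^ k) x / (1 - x * a ^ k)) sums
      (deriv (\<lambda>x. qpoch1 x a) x / qpoch1 x a)"
    by (rule logderiv_prodinf_complex_uniform_limit[where A = "ball 0 (norm x + 1)"])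
       (auto intro!: holomorphic_intros assms
          uniform_limit_on_subset[OF uniform_limit_qpoch1[of "norm x + 1"]])
  moreover have "deriv (\<lambda>x. 1 - x * a ^ k) x = - (a ^ k)" for k
    by (rule DERIV_imp_deriv) (auto intro!: derivative_eq_intros)
  ultimately show ?thesis by simp
qed

lemma norm_qpoch1_minus_1_le: "norm (qpoch1 x a - 1) \<le> exp (norm x / (1 - norm a)) - 1"
proof -
  have s: "(\<lambda>n. norm x * norm a ^ n) sums (norm x * (1 / (1 - norm a)))"
    using a by (intro sums_mult geometric_sums) auto
  have eq: "norm (1 - x * a ^ n - 1) = norm x * norm a ^ n" for n
    by (simp add: norm_mult norm_power)
  show ?thesis
    using norm_prodinf_minus_1_le[of "\<lambda>n. 1 - x * a ^ n"] s
    unfolding qpoch1_def eq by (simp add: sums_iff)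
qed

end

text \<open>Makes the exponential bound of \<open>norm_qpoch1_minus_1_le\<close> linear in the
  argument, so that it decays geometrically along \<open>x * a ^ n\<close> and can serve as a
  majorant for the double product.\<close>

lemma exp_minus_1_le: "0 \<le> t \<Longrightarrow> exp t - 1 \<le> t * exp (t::real)"
proof -
  assume t: "0 \<le> t"
  have "1 - t \<le> exp (- t)" using exp_ge_add_one_self[of "-t"] by simp
  then have "(1 - t) * exp t \<le> exp (- t) * exp t" by (intro mult_right_mono) auto
  then show ?thesis by (simp add: algebra_simps flip: exp_add)
qed

section \<open>Double infinite products\<close>

context
  fixes a b :: complex
  assumes a: "norm a < 1" and b: "norm b < 1"
begin

lemma qpoch2_eq_prodinf: "qpoch2 x a b = (\<Prod>m. qpoch1 (x * a ^ m) b)"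
  by (simp add: qpoch2_def qpoch1_def)

private definition M where
  "M R n = (R / (1 - norm b) * exp (R / (1 - norm b))) * norm a ^ n"

private lemma qpoch2_bound:
  assumes "norm x \<le> R"
  shows "norm (qpoch1 (x * a ^ n) b - 1) \<le> M R n"
proof -
  have R: "0 \<le> R" using assms norm_ge_zero order_trans by blast
  have b': "1 - norm b > 0" using b by simp
  define t where "t = norm (x * a ^ n) / (1 - norm b)"
  have t0: "0 \<le> t" using b' by (simp add: t_def)
  have t1: "t \<le> R / (1 - norm b) * norm a ^ n"
    unfolding t_def using b' assms by (auto simp: norm_mult norm_power intro!: divide_right_mono mult_right_mono)
  have "norm a ^ n \<le> 1" using a by (intro power_le_one) auto
  then have "R / (1 - norm b) * norm a ^ n \<le> R / (1 - norm b) * 1"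
    using R b' by (intro mult_left_mono) auto
  with t1 have t2: "t \<le> R / (1 - norm b)" by simp
  have "norm (qpoch1 (x * a ^ n) b - 1) \<le> exp t - 1"
    unfolding t_def by (rule norm_qpoch1_minus_1_le[OF b])
  also have "\<dots> \<le> t * exp t" by (rule exp_minus_1_le[OF t0])
  also have "\<dots> \<le> (R / (1 - norm b) * norm a ^ n) * exp (R / (1 - norm b))"
    using t0 t1 t2 by (intro mult_mono) auto
  finally show ?thesis by (simp add: M_def mult_ac)
qed

private lemma qpoch2_summable: "summable (M R)"
  unfolding M_def using a by (intro summable_mult summable_geometric) auto

lemma convergent_qpoch2: "convergent_prod (\<lambda>n. qpoch1 (x * a ^ n) b)"
  by (rule convergent_prod_of_bound[where f = "\<lambda>n x. qpoch1 (x * a ^ n) b" and M = M])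
     (intro holomorphic_intros b qpoch2_bound qpoch2_summable; assumption)+

lemma holomorphic_qpoch2_UNIV: "(\<lambda>x. qpoch2 x a b) holomorphic_on UNIV"
  unfolding qpoch2_eq_prodinf
  by (rule holomorphic_prodinf_of_bound[where f = "\<lambda>n x. qpoch1 (x * a ^ n) b" and M = M])
     (intro holomorphic_intros b qpoch2_bound qpoch2_summable; assumption)+

lemma holomorphic_on_qpoch2 [holomorphic_intros]:
  assumes "g holomorphic_on A" shows "(\<lambda>x. qpoch2 (g x) a b) holomorphic_on A"
  using holomorphic_on_compose_gen[OF assms holomorphic_qpoch2_UNIV] by (auto simp: o_def)

lemma qpoch2_rec_left: "qpoch2 x a b = qpoch1 x b * qpoch2 (x * a) a b"
proof -
  have "(\<lambda>n. qpoch1 (x * a ^ n) b) has_prod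
      ((\<Prod>k<1. qpoch1 (x * a ^ k) b) * (\<Prod>k. qpoch1 (x * a ^ (k + 1)) b))"
    using convergent_qpoch2 by (rule has_prod_ignore_initial_segment')
  then have "qpoch2 x a b = (\<Prod>k<1. qpoch1 (x * a ^ k) b) * (\<Prod>k. qpoch1 (x * a ^ (k + 1)) b)"
    unfolding qpoch2_eq_prodinf by (metis has_prod_unique)
  then show ?thesis by (simp add: qpoch2_eq_prodinf mult_ac)
qed

text \<open>Here the first factor of every inner product is split off, instead of the whole first
  inner product; the factors collected in this way form a single product in the other nome.\<close>

lemma qpoch2_rec_right: "qpoch2 x a b = qpoch1 x a * qpoch2 (x * b) a b"
proof -
  have "qpoch2 x a b = (\<Prod>m. (1 - x * a ^ m) * qpoch1 (x * b * a ^ m) b)"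
    unfolding qpoch2_eq_prodinf using qpoch1_rec[OF b, of "x * a ^ _"] by (simp add: mult_ac)
  also have "\<dots> = (\<Prod>m. 1 - x * a ^ m) * (\<Prod>m. qpoch1 (x * b * a ^ m) b)"
    by (rule prodinf_mult[symmetric]) (rule convergent_qpoch1[OF a] convergent_qpoch2)+
  finally show ?thesis by (simp add: qpoch2_eq_prodinf qpoch1_def)
qed

lemma qpoch2_eq_0_iff: "qpoch2 x a b = 0 \<longleftrightarrow> (\<exists>m n. x * a ^ m * b ^ n = 1)"
proof -
  have "(\<lambda>n. qpoch1 (x * a ^ n) b) has_prod qpoch2 x a b"
    unfolding qpoch2_eq_prodinf using convergent_qpoch2 by (rule convergent_prod_has_prod)
  from has_prod_eq_0_iff[OF this] show ?thesis
    by (auto simp: image_iff qpoch1_eq_0_iff[OF b] eq_commute[of 0])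
qed

end

section \<open>The multiplicative theta function\<close>

context
  fixes a :: complex
  assumes a: "norm a < 1" and a0: "a \<noteq> 0"
begin

lemma Theta_shift:
  assumes "x \<noteq> 0" shows "Theta a (a * x) = - Theta a x / x"
proof -
  have 1: "qpoch1 x a = (1 - x) * qpoch1 (a * x) a"
    using qpoch1_rec[OF a, of x] by (simp add: mult.commute)
  have 2: "qpoch1 (1 / x) a = (1 - 1 / x) * qpoch1 (a / x) a"
    using qpoch1_rec[OF a, of "1 / x"] by simp
  have 3: "a / (a * x) = 1 / x" using a0 by simp
  show ?thesis unfolding Theta_def 3 1 2 using assms by (simp add: field_simps)
qed

lemma Theta_inverse:
  assumes "x \<noteq> 0" shows "Theta a (1 / x) = - Theta a x / x"
proof -
  have "Theta a (1 / x) = Theta a (a * x)"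
    using a0 by (simp add: Theta_def mult_ac)
  then show ?thesis using Theta_shift[OF assms] by simp
qed

text \<open>The factor \<open>qpoch1 x a\<close> vanishes at the powers of \<open>a\<close> with
  exponent at most 0, the factor \<open>qpoch1 (a / x) a\<close> at those with positive exponent.
  The third factor is a nonzero constant because \<open>a\<close> has norm below 1.\<close>

lemma Theta_eq_0_iff:
  assumes "x \<noteq> 0" shows "Theta a x = 0 \<longleftrightarrow> (\<exists>n::int. x = a powi n)"
proof
  have nz: "qpoch1 a a \<noteq> 0"
  proof
    assume "qpoch1 a a = 0"
    then obtain n where "a * a ^ n = 1" using qpoch1_eq_0_iff[OF a] by blast
    then have "norm a ^ Suc n = 1" by (metis norm_one norm_power power_Suc)
    moreover have "norm a ^ Suc n < 1" using a a0 by (intro power_Suc_less_one) auto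
    ultimately show False by simp
  qed
  {
    assume "Theta a x = 0"
    then consider n where "x * a ^ n = 1" | n where "a / x * a ^ n = 1"
      using nz qpoch1_eq_0_iff[OF a] by (auto simp: Theta_def)
    then show "\<exists>n::int. x = a powi n"
    proof cases
      case (1 n)
      then have "a ^ n \<noteq> 0" "x * a ^ n = 1" using a0 by auto
      then have "x = a powi (- int n)" by (simp add: power_int_minus field_simps)
      then show ?thesis by blast
    next
      case (2 n)
      then have "a ^ Suc n = x" using assms by (simp add: field_simps)
      then have "x = a powi (int (Suc n))" by (simp only: power_int_of_nat)
      then show ?thesis by blast
    qed
  }
  {
    assume "\<exists>n::int. x = a powi n"
    then obtain n :: int where n: "x = a powi n" by blast
    show "Theta a x = 0"
    proof (cases "n \<le> 0")
      case True
      then have "x * a ^ nat (- n) = 1"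
        using n a0 by (simp add: power_int_def field_simps)
      then show ?thesis using qpoch1_eq_0_iff[OF a] by (auto simp: Theta_def)
    next
      case False
      then obtain k where k: "n = int (Suc k)" by (metis not_le zero_less_imp_eq_int gr0_implies_Suc)
      then have "x = a ^ Suc k" using n by (simp only: power_int_of_nat)
      then have "a / x * a ^ k = 1" using a0 by (simp add: field_simps)
      then show ?thesis using qpoch1_eq_0_iff[OF a] by (auto simp: Theta_def)
    qed
  }
qed

lemma holomorphic_on_Theta [holomorphic_intros]:
  assumes "g holomorphic_on A" "\<And>x. x \<in> A \<Longrightarrow> g x \<noteq> 0"
  shows "(\<lambda>x. Theta a (g x)) holomorphic_on A"
  unfolding Theta_def using assms by (intro holomorphic_intros a) auto

end

section \<open>Entire quasi-periodic functions\<close>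

lemma holomorphic_on_entire_compose:
  assumes "f holomorphic_on UNIV" "g holomorphic_on A"
  shows "(\<lambda>z. f (g z)) holomorphic_on A"
  using holomorphic_on_compose_gen[OF assms(2,1)] by (auto simp: o_def)

lemma eventually_nonzero_at_simple_zero:
  fixes g :: "complex \<Rightarrow> complex"
  assumes "g holomorphic_on UNIV" "g z = 0" "deriv g z \<noteq> 0"
  shows "eventually (\<lambda>w. g w \<noteq> 0) (at z)"
proof -
  have "(g has_field_derivative deriv g z) (at z)"
    using assms(1) by (simp add: holomorphic_derivI)
  then have "((\<lambda>w. (g w - g z) / (w - z)) \<longlongrightarrow> deriv g z) (at z)"
    by (simp add: has_field_derivative_iff)
  then have "eventually (\<lambda>w. (g w - g z) / (w - z) \<noteq> 0) (at z)"
    using assms(3) by (rule tendsto_imp_eventually_ne)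
  then show ?thesis by eventually_elim (use assms(2) in auto)
qed

lemma entire_quotient:
  fixes f g :: "complex \<Rightarrow> complex"
  assumes f: "f holomorphic_on UNIV" and g: "g holomorphic_on UNIV"
    and van: "\<And>z. g z = 0 \<Longrightarrow> f z = 0" and simple: "\<And>z. g z = 0 \<Longrightarrow> deriv g z \<noteq> 0"
  obtains h where "h holomorphic_on UNIV" "\<And>z. f z = h z * g z"
proof
  \<comment> \<open>Because the zeros of \<open>g\<close> are simple, the quotient of derivatives is
    the limit of \<open>f / g\<close> at such a zero. With this value \<open>h\<close> is continuous
    there, and the isolated singularity is removable.\<close>
  define h where "h z = (if g z = 0 then deriv f z / deriv g z else f z / g z)" for z
  show "f z = h z * g z" for z using van by (auto simp: h_def)
  show "h holomorphic_on UNIV"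
  proof -
    have "\<exists>S. open S \<and> z \<in> S \<and> h holomorphic_on S" for z
    proof (cases "g z = 0")
      case False
      have op: "open {w. g w \<noteq> 0}"
        using g by (intro open_Collect_neq holomorphic_on_imp_continuous_on continuous_intros)
      have "h holomorphic_on {w. g w \<noteq> 0}"
        by (rule holomorphic_transform[where f = "\<lambda>z. f z / g z"])
           (auto simp: h_def intro!: holomorphic_on_divide holomorphic_on_subset[OF f]
              holomorphic_on_subset[OF g])
      then show ?thesis using op False by blast
    next
      case True
      from eventually_nonzero_at_simple_zero[OF g True simple[OF True]]
      obtain S where S: "open S" "z \<in> S" "\<And>w. w \<in> S \<Longrightarrow> w \<noteq> z \<Longrightarrow> g w \<noteq> 0"
        by (auto simp: eventually_at_topological)
      have "h holomorphic_on S"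
      proof (rule no_isolated_singularity'[where K = "{z}"])
        show "h holomorphic_on S - {z}"
          by (rule holomorphic_transform[where f = "\<lambda>z. f z / g z"])
             (use S in \<open>auto simp: h_def intro!: holomorphic_on_divide holomorphic_on_subset[OF f]
                holomorphic_on_subset[OF g]\<close>)
        fix w assume "w \<in> {z}"
        then have [simp]: "w = z" by simp
        have df: "((\<lambda>w. (f w - f z) / (w - z)) \<longlongrightarrow> deriv f z) (at z)"
          using holomorphic_derivI[OF f, of z] by (simp add: has_field_derivative_iff)
        have dg: "((\<lambda>w. (g w - g z) / (w - z)) \<longlongrightarrow> deriv g z) (at z)"
          using holomorphic_derivI[OF g, of z] by (simp add: has_field_derivative_iff)
        have "((\<lambda>w. ((f w - f z) / (w - z)) / ((g w - g z) / (w - z))) \<longlongrightarrow> h z) (at z)"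
          unfolding h_def using tendsto_divide[OF df dg simple[OF True]] True by simp
        then have "(h \<longlongrightarrow> h z) (at z)"
        proof (rule Lim_transform_eventually)
          show "\<forall>\<^sub>F w in at z. (f w - f z) / (w - z) / ((g w - g z) / (w - z)) = h w"
            using S True van[OF True] by (auto simp: eventually_at_topological h_def intro!: exI[of _ S])
        qed
        then show "(h \<longlongrightarrow> h w) (at w within S)"
          using tendsto_within_subset by fastforce
      qed (use S in auto)
      then show ?thesis using S by blast
    qed
    then show ?thesis
      unfolding holomorphic_on_def
      by (metis UNIV_I at_within_open field_differentiable_at_within)
  qed
qed

text \<open>Simple zeros are isolated, so \<open>u\<close> and \<open>v\<close> agree on a punctured
  neighbourhood of each zero of \<open>g\<close>, and continuity gives equality at the zero
  itself.\<close>

lemma entire_cancel: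
  fixes u v g :: "complex \<Rightarrow> complex"
  assumes u: "u holomorphic_on UNIV" and v: "v holomorphic_on UNIV" and g: "g holomorphic_on UNIV"
    and simple: "\<And>z. g z = 0 \<Longrightarrow> deriv g z \<noteq> 0"
    and eq: "\<And>z. u z * g z = v z * g z"
  shows "u z = v z"
proof (cases "g z = 0")
  case False
  then show ?thesis using eq[of z] by simp
next
  case True
  from eventually_nonzero_at_simple_zero[OF g True simple[OF True]]
  have ev: "eventually (\<lambda>w. u w = v w) (at z)"
    by eventually_elim (use eq in auto)
  have "(u \<longlongrightarrow> u z) (at z)" "(v \<longlongrightarrow> v z) (at z)"
    using u v by (meson UNIV_I continuous_on_def holomorphic_on_imp_continuous_on open_UNIV at_within_open)+
  then show ?thesis
    using tendsto_cong[OF ev] tendsto_unique[OF at_neq_bot] by blast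
qed

text \<open>The multiplier of \<open>f\<close> is given as a product whose second factor is the
  multiplier of \<open>g\<close>, so the first factor is what the quotient inherits. Where
  \<open>g\<close> vanishes, \<open>entire_cancel\<close> supplies the conclusion.\<close>

lemma entire_quotient_quasiperiodic:
  fixes f g a b A B :: "complex \<Rightarrow> complex"
  assumes f: "f holomorphic_on UNIV" and g: "g holomorphic_on UNIV"
    and van: "\<And>z. g z = 0 \<Longrightarrow> f z = 0" and simple: "\<And>z. g z = 0 \<Longrightarrow> deriv g z \<noteq> 0"
    and a: "a holomorphic_on UNIV" and b: "b holomorphic_on UNIV"
    and f1: "\<And>z. f (z + w1) = a z * A z * f z" and g1: "\<And>z. g (z + w1) = A z * g z" and A: "\<And>z. A z \<noteq> 0"
    and f2: "\<And>z. f (z + w2) = b z * B z * f z" and g2: "\<And>z. g (z + w2) = B z * g z" and B: "\<And>z. B z \<noteq> 0"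
  obtains h where "h holomorphic_on UNIV" "\<And>z. f z = h z * g z"
    "\<And>z. h (z + w1) = a z * h z" "\<And>z. h (z + w2) = b z * h z"
proof -
  obtain h where h: "h holomorphic_on UNIV" "\<And>z. f z = h z * g z"
    using entire_quotient[OF f g van simple] by metis
  have quasi: "h (z + w) = c z * h z"
    if c: "c holomorphic_on UNIV" and fw: "\<And>z. f (z + w) = c z * E z * f z" and gw: "\<And>z. g (z + w) = E z * g z" and E: "\<And>z. E z \<noteq> 0"
    for w z and c E :: "complex \<Rightarrow> complex"
  proof (rule entire_cancel[where u = "\<lambda>z. h (z + w)" and v = "\<lambda>z. c z * h z" and g = g])
    show "h (z + w) * g z = c z * h z * g z" for z
    proof -
      have "E z * (h (z + w) * g z) = E z * (c z * h z * g z)"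
        using fw[of z] h(2)[of "z + w"] gw[of z] h(2)[of z] by (simp add: mult_ac)
      then show ?thesis using E[of z] by simp
    qed
  qed (use simple in \<open>auto intro!: g c holomorphic_intros h(1) holomorphic_on_entire_compose[OF h(1)]\<close>)
  show thesis
    by (rule that[OF h quasi[OF a f1 g1 A] quasi[OF b f2 g2 B]])
qed

lemma norm_add_int_period:
  fixes h :: "complex \<Rightarrow> complex" and k :: int
  assumes "\<And>z. norm (h (z + w)) = norm (h z)"
  shows "norm (h (z + of_int k * w)) = norm (h z)"
proof (induction k arbitrary: z rule: int_induct[where k = 0])
  case (step1 i)
  have "norm (h (z + of_int (i + 1) * w)) = norm (h ((z + of_int i * w) + w))"
    by (simp add: algebra_simps)
  then show ?case using assms step1 by simp
next
  case (step2 i)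
  have "norm (h (z + of_int (i - 1) * w)) = norm (h ((z + of_int (i - 1) * w) + w))"
    using assms by simp
  also have "(z + of_int (i - 1) * w) + w = z + of_int i * w"
    by (simp add: algebra_simps)
  finally show ?case using step2 by simp
qed auto

text \<open>Multipliers of norm 1 make \<open>norm (h z)\<close> doubly periodic, hence bounded by
  its values on a disc that contains a period parallelogram; then Liouville's theorem
  applies.\<close>

lemma entire_unimodular_quasiperiodic_constant:
  fixes h :: "complex \<Rightarrow> complex"
  assumes h: "h holomorphic_on UNIV" and \<tau>: "Im \<tau> > 0"
    and 1: "\<And>z. h (z + 1) = a * h z" "norm a = 1"
    and 2: "\<And>z. h (z + \<tau>) = b * h z" "norm b = 1"
  shows "h z = h 0"
proof -
  have "compact (h ` cball 0 (1 + norm \<tau>))"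
    by (intro compact_continuous_image compact_cball
      holomorphic_on_imp_continuous_on[OF holomorphic_on_subset[OF h subset_UNIV]])
  then have "bounded (h ` cball 0 (1 + norm \<tau>))" by (rule compact_imp_bounded)
  then obtain B where "\<forall>x\<in>h ` cball 0 (1 + norm \<tau>). norm x \<le> B"
    unfolding bounded_iff by (rule exE)
  then have B: "norm (h z) \<le> B" if "z \<in> cball 0 (1 + norm \<tau>)" for z
    using that by simp
  have "norm (h z) \<le> B" for z
  proof -
    \<comment> \<open>Imaginary parts determine the multiple of \<tau> to subtract. Only then is the
      real part reduced by an integer, which leaves the imaginary part alone.\<close>
    define m where "m = \<lfloor>Im z / Im \<tau>\<rfloor>"
    define w where "w = z - of_int m * \<tau>"
    define k where "k = \<lfloor>Re w\<rfloor>"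
    define w' where "w' = w - of_int k"
    define t where "t = Im z / Im \<tau> - of_int m"
    have t: "0 \<le> t" "t \<le> 1" unfolding t_def m_def by linarith+
    have "Im w' = t * Im \<tau>" using \<tau> by (simp add: w'_def w_def t_def field_simps)
    then have im: "\<bar>Im w'\<bar> \<le> norm \<tau>"
      using t \<tau> abs_Im_le_cmod[of \<tau>] by (smt (verit) mult_left_le_one_le mult_nonneg_nonneg)
    have re: "\<bar>Re w'\<bar> \<le> 1" unfolding w'_def k_def by simp linarith
    have "norm w' \<le> 1 + norm \<tau>"
      using cmod_le[of w'] im re by linarith
    then have "norm (h w') \<le> B" using B by simp
    moreover have "norm (h w) = norm (h w')"
      using norm_add_int_period[of h 1 w' k] 1 by (simp add: w'_def norm_mult)
    moreover have "norm (h z) = norm (h w)"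
      using norm_add_int_period[of h \<tau> w m] 2 by (simp add: w_def norm_mult)
    ultimately show ?thesis by simp
  qed
  then have "bounded (range h)" by (auto simp: bounded_iff)
  from Liouville_theorem[OF h this] show ?thesis
    unfolding constant_on_def by (metis UNIV_I)
qed

lemma entire_quasiperiodic_eq_0:
  fixes h :: "complex \<Rightarrow> complex"
  assumes h: "h holomorphic_on UNIV" and \<tau>: "Im \<tau> > 0"
    and 1: "\<And>z. h (z + 1) = a * h z" "norm a = 1"
    and 2: "\<And>z. h (z + \<tau>) = b * h z" "norm b = 1"
    and nontrivial: "a \<noteq> 1 \<or> b \<noteq> 1"
  shows "h z = 0"
proof -
  have c: "h z = h 0" for z
    by (rule entire_unimodular_quasiperiodic_constant[where h = h and \<tau> = \<tau> and a = a and b = b]) fact+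
  from 1(1)[of 0] 2(1)[of 0] have "h 0 = a * h 0" "h 0 = b * h 0"
    using c[of 1] c[of \<tau>] by simp_all
  then have "h 0 = 0" using nontrivial by auto
  then show ?thesis using c by simp
qed

text \<open>Two real conditions, one for each period, determine a complex \<mu> for which
  multiplication by \<open>exp (\<mu> * z)\<close> makes both multipliers unimodular; the corrected
  function is constant.\<close>

lemma entire_quasiperiodic_exponential:
  fixes h :: "complex \<Rightarrow> complex"
  assumes h: "h holomorphic_on UNIV" and \<tau>: "Im \<tau> > 0"
    and 1: "\<And>z. h (z + 1) = a * h z" "a \<noteq> 0"
    and 2: "\<And>z. h (z + \<tau>) = b * h z" "b \<noteq> 0"
  obtains C \<mu> where "\<And>z. h z = C * exp (\<mu> * z)"
proof -
  \<comment> \<open>The real part of \<mu> is fixed by the period 1; the imaginary part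
    \<open>y\<close> then solves \<open>Re (\<mu> * \<tau>) = - ln (norm b)\<close>.\<close>
  define x where "x = - ln (norm a)"
  define y where "y = (x * Re \<tau> + ln (norm b)) / Im \<tau>"
  define \<mu> where "\<mu> = Complex x y"
  define k where "k z = h z * exp (\<mu> * z)" for z
  have na: "norm (a * exp \<mu>) = 1"
    using 1(2) by (simp add: norm_mult norm_exp_eq_Re \<mu>_def x_def exp_minus)
  have "Re (\<mu> * \<tau>) = - ln (norm b)" using \<tau> by (simp add: \<mu>_def y_def)
  then have nb: "norm (b * exp (\<mu> * \<tau>)) = 1"
    using 2(2) by (simp add: norm_mult norm_exp_eq_Re exp_minus)
  have "k z = k 0" for z
  proof (rule entire_unimodular_quasiperiodic_constant[OF _ \<tau>, where a = "a * exp \<mu>" and b = "b * exp (\<mu> * \<tau>)"])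
    show "k holomorphic_on UNIV" unfolding k_def by (intro holomorphic_intros h)
    show "k (z + 1) = a * exp \<mu> * k z" for z
      using 1(1) by (simp add: k_def ring_distribs exp_add)
    show "k (z + \<tau>) = b * exp (\<mu> * \<tau>) * k z" for z
      using 2(1) by (simp add: k_def ring_distribs exp_add)
  qed (use na nb in auto)
  then have "h z = k 0 * exp (- \<mu> * z)" for z
    unfolding k_def by (metis (no_types, lifting) exp_minus_inverse mult.assoc mult.right_neutral mult_minus_left)
  then show thesis by (rule that)
qed

section \<open>The Jacobi theta function\<close>

lemma summable_exp_neg_abs_int: "(\<lambda>m::int. exp (- \<bar>of_int m :: real\<bar>)) summable_on UNIV"
proof -
  have geo: "(\<lambda>n::nat. exp (- real n)) summable_on UNIV"
  proof (rule norm_summable_imp_summable_on)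
    have "summable (\<lambda>n. exp (-1::real) ^ n)" by (intro summable_geometric) auto
    then show "summable (\<lambda>n. norm (exp (- real n)))"
      by (simp flip: exp_of_nat_mult)
  qed
  have pos: "(\<lambda>m::int. exp (- \<bar>of_int m :: real\<bar>)) summable_on (range int)"
    by (subst summable_on_reindex) (use geo in \<open>auto simp: o_def\<close>)
  have neg: "(\<lambda>m::int. exp (- \<bar>of_int m :: real\<bar>)) summable_on (range (\<lambda>n. - int n))"
    by (subst summable_on_reindex) (use geo in \<open>auto simp: o_def inj_on_def\<close>)
  have un: "(UNIV :: int set) = range int \<union> range (\<lambda>n. - int n)"
    by (auto simp: image_iff) (metis int_cases2)
  show ?thesis unfolding un
    by (rule summable_on_union[OF pos neg])
qed

context
  fixes \<tau> :: complex
  assumes \<tau>: "Im \<tau> > 0"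
begin

definition theta :: "complex \<Rightarrow> complex" where
  "theta \<xi> = jtheta (1/2) (1/2) \<xi> \<tau>"

private definition th_term :: "int \<Rightarrow> complex \<Rightarrow> complex" where
  "th_term m \<xi> = exp (\<i> * pi * (of_int m + 1/2)\<^sup>2 * \<tau> + 2 * \<i> * pi * (of_int m + 1/2) * (\<xi> + 1/2))"

private lemma theta_eq: "theta \<xi> = (\<Sum>\<^sub>\<infinity>m. th_term m \<xi>)"
  by (simp add: theta_def jtheta_def th_term_def)

text \<open>Obtained by completing the square: one extra \<open>\<bar>s\<bar>\<close> is added to
  the linear term and absorbed by the Gaussian at the cost of the quadratic constant, which leaves
  the summable decay \<open>exp (- \<bar>s\<bar>)\<close>. The summand 1 pays for replacing
  \<open>s = m + 1/2\<close> by \<open>m\<close>.\<close>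

private definition th_bound :: "real \<Rightarrow> int \<Rightarrow> real" where
  "th_bound R m = exp ((2 * pi * R + 1)\<^sup>2 / (4 * pi * Im \<tau>) + 1) * exp (- \<bar>of_int m\<bar>)"

private lemma norm_th_term_le:
  assumes "\<bar>Im \<xi>\<bar> \<le> R"
  shows "norm (th_term m \<xi>) \<le> th_bound R m"
proof -
  define s where "s = real_of_int m + 1/2"
  have s': "of_int m + 1/2 = complex_of_real s" by (simp add: s_def)
  have R: "0 \<le> R" using assms by linarith
  have "Re (\<i> * pi * (of_int m + 1/2)\<^sup>2 * \<tau> + 2 * \<i> * pi * (of_int m + 1/2) * (\<xi> + 1/2))
      = - pi * s\<^sup>2 * Im \<tau> - 2 * pi * s * Im \<xi>"
    unfolding s' by (simp add: power2_eq_square)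
  also have "\<dots> \<le> - pi * s\<^sup>2 * Im \<tau> + 2 * pi * R * \<bar>s\<bar>"
  proof -
    have "- (s * Im \<xi>) \<le> \<bar>s\<bar> * R"
      using mult_mono[OF order_refl assms, of "\<bar>s\<bar>"] abs_mult[of s "Im \<xi>"] by linarith
    then have "pi * (- (s * Im \<xi>)) \<le> pi * (\<bar>s\<bar> * R)" by (intro mult_left_mono) auto
    then show ?thesis by (simp add: algebra_simps)
  qed
  also have "\<dots> \<le> (2 * pi * R + 1)\<^sup>2 / (4 * pi * Im \<tau>) - \<bar>s\<bar>"
  proof -
    define A where "A = pi * Im \<tau>"
    define c where "c = 2 * pi * R + 1"
    have A: "A > 0" using \<tau> by (simp add: A_def)
    have "0 \<le> (2 * A * \<bar>s\<bar> - c)\<^sup>2" by simp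
    then have "4 * A * (c * \<bar>s\<bar> - A * s\<^sup>2) \<le> c\<^sup>2"
      by (simp add: power2_eq_square algebra_simps flip: abs_mult)
    then have "c * \<bar>s\<bar> - A * s\<^sup>2 \<le> c\<^sup>2 / (4 * A)"
      using A by (simp add: field_simps)
    then show ?thesis by (simp add: A_def c_def algebra_simps)
  qed
  also have "\<dots> \<le> (2 * pi * R + 1)\<^sup>2 / (4 * pi * Im \<tau>) + 1 - \<bar>of_int m\<bar>"
    unfolding s_def by linarith
  finally show ?thesis
    unfolding th_term_def th_bound_def norm_exp_eq_Re mult_exp_exp by simp
qed

private lemma th_bound_summable: "th_bound R summable_on UNIV"
  unfolding th_bound_def[abs_def] by (intro summable_on_cmult_right summable_exp_neg_abs_int)

private lemma th_term_summable: "(\<lambda>m. norm (th_term m \<xi>)) summable_on UNIV"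
  by (rule Infinite_Sum.abs_summable_on_comparison_test'[OF th_bound_summable[of "\<bar>Im \<xi>\<bar>"] norm_th_term_le]) simp

lemma holomorphic_theta_UNIV: "theta holomorphic_on UNIV"
proof -
  have "theta holomorphic_on ball 0 R" for R
  proof (rule holomorphic_uniform_limit)
    show "uniform_limit (cball 0 R) (\<lambda>X \<xi>. \<Sum>m\<in>X. th_term m \<xi>) theta (finite_subsets_at_top UNIV)"
      unfolding theta_eq[abs_def]
    proof (rule Weierstrass_m_test_general[OF _ th_bound_summable[of R]])
      fix m :: int and \<xi> :: complex assume "\<xi> \<in> cball 0 R"
      then have "\<bar>Im \<xi>\<bar> \<le> R" using abs_Im_le_cmod[of \<xi>] by simp
      then show "norm (th_term m \<xi>) \<le> th_bound R m" by (rule norm_th_term_le)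
    qed
    have "(\<lambda>\<xi>. \<Sum>m\<in>X. th_term m \<xi>) holomorphic_on A" for X A
      unfolding th_term_def by (intro holomorphic_intros)
    then show "\<forall>\<^sub>F X in finite_subsets_at_top UNIV.
        continuous_on (cball 0 R) (\<lambda>\<xi>. \<Sum>m\<in>X. th_term m \<xi>) \<and>
        (\<lambda>\<xi>. \<Sum>m\<in>X. th_term m \<xi>) holomorphic_on ball 0 R"
      by (intro always_eventually) (auto intro!: holomorphic_on_imp_continuous_on)
  qed auto
  then have "theta field_differentiable at z" for z
    by (rule holomorphic_on_imp_differentiable_at[of _ "ball 0 (norm z + 1)"]) auto
  then show ?thesis by (simp add: holomorphic_on_def field_differentiable_at_within)
qed

lemma holomorphic_on_theta [holomorphic_intros]:
  assumes "g holomorphic_on A" shows "(\<lambda>x. theta (g x)) holomorphic_on A"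
  using holomorphic_on_compose_gen[OF assms holomorphic_theta_UNIV] by (auto simp: o_def)

lemma theta_add_1: "theta (\<xi> + 1) = - theta \<xi>"
proof -
  have "th_term m (\<xi> + 1) = (-1) * th_term m \<xi>" for m
  proof -
    have "th_term m (\<xi> + 1) = th_term m \<xi> * exp (2 * pi * of_int m * \<i> + pi * \<i>)"
      unfolding th_term_def mult_exp_exp
      by (rule arg_cong[where f = exp]) (simp add: field_simps)
    also have "exp (2 * pi * of_int m * \<i> + pi * \<i>) = -1"
      unfolding exp_add using exp_integer_2pi[of "of_int m"] by (simp add: mult_ac)
    finally show ?thesis by simp
  qed
  then show ?thesis unfolding theta_eq by (simp add: infsum_uminus)
qed

lemma theta_add_tau: "theta (\<xi> + \<tau>) = - exp (- \<i> * pi * \<tau> - 2 * \<i> * pi * \<xi>) * theta \<xi>"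
proof -
  have e: "th_term m (\<xi> + \<tau>) = - exp (- \<i> * pi * \<tau> - 2 * \<i> * pi * \<xi>) * th_term (m + 1) \<xi>" for m
  proof -
    have "- exp (- \<i> * pi * \<tau> - 2 * \<i> * pi * \<xi>) =
        exp (- \<i> * pi) * exp (- \<i> * pi * \<tau> - 2 * \<i> * pi * \<xi>)"
      by (simp add: exp_minus mult.commute)
    then show ?thesis
      unfolding th_term_def mult_exp_exp
      by (simp only: mult_exp_exp) (rule arg_cong[where f = exp], simp add: power2_eq_square field_simps)
  qed
  have "theta (\<xi> + \<tau>) = - exp (- \<i> * pi * \<tau> - 2 * \<i> * pi * \<xi>) * (\<Sum>\<^sub>\<infinity>m. th_term (m + 1) \<xi>)"
    unfolding theta_eq e by (rule infsum_cmult_right')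
  also have "(\<Sum>\<^sub>\<infinity>m. th_term (m + 1) \<xi>) = theta \<xi>"
    unfolding theta_eq
    by (rule infsum_reindex_bij_betw) (rule bij_betw_byWitness[where f' = "\<lambda>m. m - 1"], auto)
  finally show ?thesis .
qed

text \<open>On the indices, reflecting the half-integers \<open>m + 1/2\<close> is the map from
  \<open>m\<close> to \<open>- 1 - m\<close>. The sign comes from the second characteristic 1/2,
  which contributes an odd multiple of \<open>\<i> * pi\<close> to each exponent.\<close>

lemma theta_minus: "theta (- \<xi>) = - theta \<xi>"
proof -
  have e: "th_term (- 1 - m) (- \<xi>) = - th_term m \<xi>" for m
  proof -
    have "th_term (- 1 - m) (- \<xi>) = th_term m \<xi> * exp (- (2 * pi * of_int m * \<i> + pi * \<i>))"
      unfolding th_term_def mult_exp_exp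
      by (rule arg_cong[where f = exp]) (simp add: power2_eq_square field_simps)
    also have "exp (- (2 * pi * of_int m * \<i> + pi * \<i>)) = -1"
      unfolding exp_minus exp_add using exp_integer_2pi[of "of_int m"] by (simp add: mult_ac)
    finally show ?thesis by simp
  qed
  have "theta (- \<xi>) = (\<Sum>\<^sub>\<infinity>m. th_term (- 1 - m) (- \<xi>))"
    unfolding theta_eq
    by (rule infsum_reindex_bij_betw[symmetric]) (rule bij_betw_byWitness[where f' = "\<lambda>m. - 1 - m"], auto)
  then show ?thesis unfolding e theta_eq by (simp add: infsum_uminus)
qed

text \<open>A change of characteristics is a translation of the argument by
  \<open>b + a * \<tau>\<close> up to an exponential, so that every theta series of the problem
  reduces to the single function \<open>theta\<close>.\<close>

lemma jtheta_eq_theta: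
  "jtheta (1/2 + a) (1/2 + b) \<xi> \<tau> =
     exp (\<i> * pi * a\<^sup>2 * \<tau> + 2 * \<i> * pi * a * (\<xi> + 1/2 + b)) * theta (\<xi> + b + a * \<tau>)"
proof -
  have "exp (\<i> * pi * (of_int m + (1/2 + a))\<^sup>2 * \<tau> + 2 * \<i> * pi * (of_int m + (1/2 + a)) * (\<xi> + (1/2 + b)))
     = exp (\<i> * pi * a\<^sup>2 * \<tau> + 2 * \<i> * pi * a * (\<xi> + 1/2 + b)) * th_term m (\<xi> + b + a * \<tau>)" for m
    unfolding th_term_def mult_exp_exp
    by (rule arg_cong[where f = exp]) (simp add: power2_eq_square field_simps)
  then show ?thesis
    unfolding jtheta_def theta_eq by (simp add: infsum_cmult_right')
qed

text \<open>Averaging over the points \<open>j / M\<close> isolates the Fourier coefficients with index divisible by \<open>M\<close>.\<close>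

lemma theta_not_identically_0: "\<exists>\<xi>. theta \<xi> \<noteq> 0"
proof (rule ccontr)
  assume "\<not> (\<exists>\<xi>. theta \<xi> \<noteq> 0)"
  then have z: "theta \<xi> = 0" for \<xi> by blast
  define c where "c m = th_term m 0" for m
  have c0: "norm (c 0) > 0" by (simp add: c_def th_term_def)
  have ab: "(\<lambda>m. norm (c m)) summable_on UNIV" unfolding c_def[abs_def] by (rule th_term_summable)
  define nc where "nc m = norm (c m)" for m
  have nc: "nc summable_on UNIV" using ab by (simp add: nc_def[abs_def])
  \<comment> \<open>Taking out \<open>exp (\<i> * pi * \<xi>)\<close> turns the half-integer
    frequencies into integers, to which averaging over roots of unity applies.\<close>
  have split: "th_term m \<xi> = exp (\<i> * pi * \<xi>) * (c m * exp (2 * \<i> * pi * of_int m * \<xi>))" for m \<xi>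
    unfolding c_def th_term_def mult_exp_exp
    by (rule arg_cong[where f = exp]) (simp add: field_simps)
  have hs: "((\<lambda>m. c m * exp (2 * \<i> * pi * of_int m * \<xi>)) has_sum 0) UNIV" for \<xi>
  proof -
    have "((\<lambda>m. th_term m \<xi>) has_sum 0) UNIV"
      using z[of \<xi>] abs_summable_summable[OF th_term_summable[of \<xi>]]
      by (simp add: theta_eq has_sum_iff)
    then have "((\<lambda>m. exp (- (\<i> * pi * \<xi>)) * th_term m \<xi>) has_sum exp (- (\<i> * pi * \<xi>)) * 0) UNIV"
      by (rule has_sum_cmult_right)
    moreover have "exp (- (\<i> * pi * \<xi>)) * th_term m \<xi> = c m * exp (2 * \<i> * pi * of_int m * \<xi>)" for m
      unfolding split by (simp add: exp_minus field_simps)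
    ultimately show ?thesis by simp
  qed
  have avg: "((\<lambda>m. \<Sum>j<k. c m * exp (2 * \<i> * pi * of_int m * (of_nat j / of_nat M))) has_sum 0) UNIV"
    for k M :: nat
  proof (induction k)
    case (Suc k)
    from has_sum_add[OF Suc hs[of "of_nat k / of_nat M"]] show ?case by simp
  qed simp
  have root_sum: "(\<Sum>j<M. exp (2 * \<i> * pi * of_int m * (of_nat j / of_nat M))) =
      (if int M dvd m then of_nat M else 0 :: complex)" if M: "M > 0" for m and M :: nat
  proof -
    define w where "w = exp (2 * \<i> * pi * of_int m / of_nat M :: complex)"
    have pw: "exp (2 * \<i> * pi * of_int m * (of_nat j / of_nat M)) = w ^ j" for j
      unfolding w_def exp_of_nat_mult[symmetric] by (rule arg_cong[where f = exp]) simp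
    have wM: "w ^ M = 1"
      unfolding w_def exp_of_nat_mult[symmetric] using M exp_integer_2pi[of "of_int m"]
      by (simp add: mult_ac)
    have "w = 1 \<longleftrightarrow> int M dvd m"
    proof
      assume "w = 1"
      then obtain n where "2 * pi * of_int m / of_nat M = of_int (2 * n) * pi"
        unfolding w_def exp_eq_1 by auto
      then have "real_of_int m = of_int n * of_nat M"
        using M by (simp add: field_simps)
      then have "m = n * int M" by (metis of_int_eq_iff of_int_mult of_int_of_nat_eq)
      then show "int M dvd m" by simp
    next
      assume "int M dvd m"
      then obtain n where "m = int M * n" by blast
      then show "w = 1"
        unfolding w_def using M exp_integer_2pi[of "of_int n"] by (simp add: mult_ac)
    qed
    then show ?thesis unfolding pw using wM
      by (auto simp: sum_gp_strict)
  qed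
  \<comment> \<open>Outside \<open>F\<close> the absolute values of the coefficients add up to less
    than that of \<open>c 0\<close>, so they cannot cancel it.\<close>
  obtain F where F: "finite F" "0 \<in> F" "(\<Sum>\<^sub>\<infinity>m\<in>UNIV - F. nc m) < norm (c 0)"
  proof -
    have "(nc has_sum infsum nc UNIV) UNIV" using nc by simp
    then have "eventually (\<lambda>F. dist (sum nc F) (infsum nc UNIV) < norm (c 0)) (finite_subsets_at_top UNIV)"
      unfolding has_sum_def using c0 by (rule tendstoD)
    then obtain F where F: "finite F" "\<And>F'. finite F' \<Longrightarrow> F \<subseteq> F' \<Longrightarrow> dist (sum nc F') (infsum nc UNIV) < norm (c 0)"
      unfolding eventually_finite_subsets_at_top by auto
    let ?F = "insert 0 F"
    have "dist (sum nc ?F) (infsum nc UNIV) < norm (c 0)" using F by auto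
    moreover have "(\<Sum>\<^sub>\<infinity>m\<in>UNIV - ?F. nc m) = infsum nc UNIV - sum nc ?F"
      using F(1) by (subst infsum_Diff[OF nc]) auto
    ultimately show ?thesis using that[of ?F] F(1) by (auto simp: dist_norm)
  qed
  \<comment> \<open>Larger than the absolute value of every index in \<open>F\<close>; averaging
    with this \<open>M\<close> leaves of \<open>F\<close> only the index 0.\<close>
  define M where "M = nat (Max (abs ` F)) + 1"
  have M: "M > 0" by (simp add: M_def)
  have notdvd: "\<not> int M dvd m" if "m \<in> F" "m \<noteq> 0" for m
  proof
    assume "int M dvd m"
    then have "int M \<le> \<bar>m\<bar>" using that(2) dvd_imp_le_int[of m "int M"] by simp
    moreover have "\<bar>m\<bar> \<le> Max (abs ` F)" using that F(1) by (intro Max_ge) auto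
    ultimately show False unfolding M_def by linarith
  qed
  define g where "g m = c m * (if int M dvd m then 1 else 0)" for m
  have "((\<lambda>m. of_nat M * g m) has_sum 0) UNIV"
  proof -
    have "(\<Sum>j<M. c m * exp (2 * \<i> * pi * of_int m * (of_nat j / of_nat M))) = of_nat M * g m" for m
      using root_sum[OF M, of m] by (simp add: g_def flip: sum_distrib_left)
    then show ?thesis using avg[where k = M and M = M] by simp
  qed
  from has_sum_cmult_right[OF this, of "1 / of_nat M"] have "(g has_sum 0) UNIV"
    using M by simp
  from has_sum_Diff[OF this has_sum_finite[of "F"]]
  have "(g has_sum (0 - sum g F)) (UNIV - F)" using F(1) by simp
  moreover have "sum g F = c 0"
  proof -
    have "sum g F = sum g {0}"
      using F notdvd by (intro sum.mono_neutral_right) (auto simp: g_def)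
    then show ?thesis by (simp add: g_def)
  qed
  ultimately have g: "(g has_sum (- c 0)) (UNIV - F)" by simp
  have "(nc has_sum (\<Sum>\<^sub>\<infinity>m\<in>UNIV - F. nc m)) (UNIV - F)"
    by (intro has_sum_infsum summable_on_subset_banach[OF nc]) auto
  from norm_infsum_le[OF g this] have "norm (- c 0) \<le> (\<Sum>\<^sub>\<infinity>m\<in>UNIV - F. nc m)"
    by (auto simp: g_def nc_def)
  with F(3) show False by simp
qed

text \<open>Stated for an arbitrary function with the two multipliers of theta, because it is
  applied both to the series and to the product.\<close>

lemma theta_lattice_shift:
  fixes f :: "complex \<Rightarrow> complex" and k m :: int
  assumes 1: "\<And>\<xi>. f (\<xi> + 1) = - f \<xi>"
    and 2: "\<And>\<xi>. f (\<xi> + \<tau>) = - exp (- \<i> * pi * \<tau> - 2 * \<i> * pi * \<xi>) * f \<xi>"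
  shows "f (\<xi> + of_int k + of_int m * \<tau>) =
    exp (\<i> * pi * (of_int k + of_int m) - \<i> * pi * (of_int m)\<^sup>2 * \<tau> - 2 * \<i> * pi * of_int m * \<xi>) * f \<xi>"
proof -
  have e: "exp (\<i> * pi) = -1" "exp (- (\<i> * pi)) = -1"
    by (simp_all add: exp_minus mult.commute)
  have k: "f (\<xi> + of_int k) = exp (\<i> * pi * of_int k) * f \<xi>" for \<xi>
  proof (induction k arbitrary: \<xi> rule: int_induct[where k = 0])
    case (step1 i)
    have "f (\<xi> + of_int (i + 1)) = - f (\<xi> + of_int i)"
      using 1[of "\<xi> + of_int i"] by (simp add: algebra_simps)
    then show ?case using step1 e by (simp add: ring_distribs exp_add)
  next
    case (step2 i)
    have "f (\<xi> + of_int (i - 1)) = - f (\<xi> + of_int i)"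
      using 1[of "\<xi> + of_int (i - 1)"] by (simp add: algebra_simps)
    then show ?case using step2 e by (simp add: ring_distribs exp_diff exp_minus)
  qed auto
  define E where "E m \<xi> = exp (\<i> * pi * of_int m - \<i> * pi * (of_int m)\<^sup>2 * \<tau> - 2 * \<i> * pi * of_int m * \<xi>)"
    for m :: int and \<xi>
  have E: "E (m + 1) \<xi> = - exp (- \<i> * pi * \<tau> - 2 * \<i> * pi * (\<xi> + of_int m * \<tau>)) * E m \<xi>" for m \<xi>
  proof -
    have "E (m + 1) \<xi> = exp (\<i> * pi) * (exp (- \<i> * pi * \<tau> - 2 * \<i> * pi * (\<xi> + of_int m * \<tau>)) * E m \<xi>)"
      unfolding E_def mult_exp_exp
      by (rule arg_cong[where f = exp]) (simp add: field_simps power2_eq_square)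
    then show ?thesis using e by simp
  qed
  have m: "f (\<xi> + of_int m * \<tau>) = E m \<xi> * f \<xi>" for \<xi>
  proof (induction m arbitrary: \<xi> rule: int_induct[where k = 0])
    case base show ?case by (simp add: E_def)
  next
    case (step1 i)
    have "f (\<xi> + of_int (i + 1) * \<tau>) = - exp (- \<i> * pi * \<tau> - 2 * \<i> * pi * (\<xi> + of_int i * \<tau>)) * f (\<xi> + of_int i * \<tau>)"
      using 2[of "\<xi> + of_int i * \<tau>"] by (simp add: algebra_simps)
    then show ?case using step1 E[of i \<xi>] by simp
  next
    case (step2 i)
    have "f (\<xi> + of_int i * \<tau>) = - exp (- \<i> * pi * \<tau> - 2 * \<i> * pi * (\<xi> + of_int (i - 1) * \<tau>)) * f (\<xi> + of_int (i - 1) * \<tau>)"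
      using 2[of "\<xi> + of_int (i - 1) * \<tau>"] by (simp add: algebra_simps)
    moreover have "E i \<xi> = - exp (- \<i> * pi * \<tau> - 2 * \<i> * pi * (\<xi> + of_int (i - 1) * \<tau>)) * E (i - 1) \<xi>"
      using E[of "i - 1" \<xi>] by simp
    ultimately show ?case using step2(2)[of \<xi>] by simp
  qed
  have "f (\<xi> + of_int k + of_int m * \<tau>) = f (\<xi> + of_int m * \<tau> + of_int k)"
    by (simp add: algebra_simps)
  also have "\<dots> = exp (\<i> * pi * of_int k) * (E m \<xi> * f \<xi>)" by (simp only: k m)
  also have "\<dots> = (exp (\<i> * pi * of_int k) * E m \<xi>) * f \<xi>" by simp
  also have "exp (\<i> * pi * of_int k) * E m \<xi> =
      exp (\<i> * pi * (of_int k + of_int m) - \<i> * pi * (of_int m)\<^sup>2 * \<tau> - 2 * \<i> * pi * of_int m * \<xi>)"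
    unfolding E_def mult_exp_exp by (rule arg_cong[where f = exp]) (simp add: field_simps)
  finally show ?thesis .
qed

section \<open>The product form of the theta function\<close>

private definition nome :: complex where "nome = exp (2 * \<i> * pi * \<tau>)"

text \<open>The product side of Jacobi's triple product, up to a constant; the exponential in front
  gives it the multipliers of the theta series.\<close>

private definition prodth :: "complex \<Rightarrow> complex" where
  "prodth \<xi> = exp (- \<i> * pi * \<xi>) * Theta nome (exp (2 * \<i> * pi * \<xi>))"

private lemma nome: "norm nome < 1" "nome \<noteq> 0"
  using \<tau> by (auto simp: nome_def norm_exp_eq_Re)

private lemma holomorphic_prodth: "prodth holomorphic_on UNIV"
  unfolding prodth_def[abs_def] by (intro holomorphic_intros nome) auto

private lemma prodth_add_1: "prodth (\<xi> + 1) = - prodth \<xi>"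
proof -
  have "exp (2 * \<i> * pi * (\<xi> + 1)) = exp (2 * \<i> * pi * \<xi>)"
    using exp_integer_2pi[of 1] by (simp add: ring_distribs exp_add mult_ac)
  moreover have "exp (- \<i> * pi * (\<xi> + 1)) = - exp (- \<i> * pi * \<xi>)"
    by (simp add: ring_distribs exp_add exp_diff exp_minus mult.commute)
  ultimately show ?thesis by (simp only: prodth_def) simp
qed

private lemma prodth_add_tau:
  "prodth (\<xi> + \<tau>) = - exp (- \<i> * pi * \<tau> - 2 * \<i> * pi * \<xi>) * prodth \<xi>"
proof -
  have "exp (2 * \<i> * pi * (\<xi> + \<tau>)) = nome * exp (2 * \<i> * pi * \<xi>)"
    by (simp add: nome_def ring_distribs exp_add mult_ac)
  then have "prodth (\<xi> + \<tau>) = - (exp (- \<i> * pi * (\<xi> + \<tau>)) / exp (2 * \<i> * pi * \<xi>)) * Theta nome (exp (2 * \<i> * pi * \<xi>))"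
    using Theta_shift[OF nome, of "exp (2 * \<i> * pi * \<xi>)"] by (simp add: prodth_def)
  also have "exp (- \<i> * pi * (\<xi> + \<tau>)) / exp (2 * \<i> * pi * \<xi>) =
      exp (- \<i> * pi * \<tau> - 2 * \<i> * pi * \<xi>) * exp (- \<i> * pi * \<xi>)"
    unfolding exp_diff[symmetric] mult_exp_exp by (rule arg_cong[where f = exp]) (simp add: algebra_simps)
  finally show ?thesis by (simp add: prodth_def)
qed

private lemma prodth_eq_0_iff: "prodth \<xi> = 0 \<longleftrightarrow> (\<exists>k m :: int. \<xi> = of_int k + of_int m * \<tau>)"
proof -
  have "prodth \<xi> = 0 \<longleftrightarrow> (\<exists>m::int. exp (2 * \<i> * pi * \<xi>) = nome powi m)"
    using Theta_eq_0_iff[OF nome, of "exp (2 * \<i> * pi * \<xi>)"] by (simp add: prodth_def)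
  also have "(\<lambda>m. nome powi m) = (\<lambda>m. exp (of_int m * (2 * \<i> * pi * \<tau>)))"
    by (simp add: nome_def exp_power_int)
  also have "(\<exists>m::int. exp (2 * \<i> * pi * \<xi>) = exp (of_int m * (2 * \<i> * pi * \<tau>))) \<longleftrightarrow>
     (\<exists>k m :: int. \<xi> = of_int k + of_int m * \<tau>)"
  proof -
    have "exp (2 * \<i> * pi * \<xi>) = exp (of_int m * (2 * \<i> * pi * \<tau>)) \<longleftrightarrow>
        (\<exists>k::int. \<xi> = of_int k + of_int m * \<tau>)" for m :: int
    proof -
      have "2 * \<i> * pi * \<xi> = of_int m * (2 * \<i> * pi * \<tau>) + of_int (2 * k) * pi * \<i> \<longleftrightarrow>
          \<xi> = of_int k + of_int m * \<tau>" for k :: int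
      proof -
        have "of_int m * (2 * \<i> * pi * \<tau>) + of_int (2 * k) * pi * \<i> = 2 * \<i> * pi * (of_int k + of_int m * \<tau>)"
          by (simp add: algebra_simps)
        then show ?thesis by (metis (no_types, opaque_lifting) mult_cancel_left complex_i_not_zero
            mult_eq_0_iff of_real_eq_0_iff pi_neq_zero zero_neq_numeral)
      qed
      then show ?thesis unfolding exp_eq by blast
    qed
    then show ?thesis by blast
  qed
  finally show ?thesis by simp
qed

private lemma deriv_prodth_0: "deriv prodth 0 \<noteq> 0"
proof -
  \<comment> \<open>\<open>G\<close> is the product without its only factor that vanishes at 0, so
    \<open>G 0\<close> is the derivative of \<open>prodth\<close> at 0 up to a nonzero
    constant.\<close>
  define G where "G \<xi> = exp (- \<i> * pi * \<xi>) * (qpoch1 (exp (2 * \<i> * pi * \<xi>) * nome) nome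
      * qpoch1 (nome / exp (2 * \<i> * pi * \<xi>)) nome * qpoch1 nome nome)" for \<xi>
  have G: "G holomorphic_on UNIV"
    unfolding G_def by (intro holomorphic_intros nome) auto
  have "prodth = (\<lambda>\<xi>. (1 - exp (2 * \<i> * pi * \<xi>)) * G \<xi>)"
    unfolding prodth_def[abs_def] Theta_def G_def using qpoch1_rec[OF nome(1), of "exp (2 * \<i> * pi * _)"]
    by (auto simp: mult_ac)
  moreover have "((\<lambda>\<xi>. (1 - exp (2 * \<i> * pi * \<xi>)) * G \<xi>) has_field_derivative - 2 * \<i> * pi * G 0) (at 0)"
    using holomorphic_derivI[OF G open_UNIV, of 0]
    by (auto intro!: derivative_eq_intros)
  moreover have "G 0 \<noteq> 0"
  proof -
    have "qpoch1 nome nome \<noteq> 0"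
    proof
      assume "qpoch1 nome nome = 0"
      then obtain n where "nome * nome ^ n = 1" using qpoch1_eq_0_iff[OF nome(1)] by blast
      then have "norm nome ^ Suc n = 1" by (metis norm_one norm_power power_Suc)
      moreover have "norm nome ^ Suc n < 1" using nome by (intro power_Suc_less_one) auto
      ultimately show False by simp
    qed
    then show ?thesis by (simp add: G_def)
  qed
  ultimately show ?thesis by (auto dest: DERIV_imp_deriv)
qed

text \<open>Simplicity of the zero at 0 is carried to every lattice point: the translation
  multiplies by the nonvanishing \<open>e\<close>, and since \<open>prodth 0 = 0\<close> the
  derivative of \<open>e\<close> does not enter.\<close>

private lemma deriv_prodth_nonzero: "prodth \<xi> = 0 \<Longrightarrow> deriv prodth \<xi> \<noteq> 0"
proof -
  assume "prodth \<xi> = 0"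
  then obtain k m :: int where km: "\<xi> = of_int k + of_int m * \<tau>" using prodth_eq_0_iff by blast
  define e where "e z = exp (\<i> * pi * (of_int k + of_int m) - \<i> * pi * (of_int m)\<^sup>2 * \<tau> - 2 * \<i> * pi * of_int m * z)" for z
  have e: "prodth (z + \<xi>) = e z * prodth z" for z
    using theta_lattice_shift[OF prodth_add_1 prodth_add_tau, of z k m] by (simp add: km e_def add.assoc)
  have 0: "prodth 0 = 0" unfolding prodth_eq_0_iff by (intro exI[of _ 0]) simp
  have "((\<lambda>z. prodth (z + \<xi>)) has_field_derivative deriv prodth \<xi>) (at 0)"
    using DERIV_shift[of prodth _ 0 \<xi>] holomorphic_derivI[OF holomorphic_prodth open_UNIV, of \<xi> UNIV]
    by simp
  moreover have "((\<lambda>z. e z * prodth z) has_field_derivative e 0 * deriv prodth 0) (at 0)"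
    using holomorphic_derivI[OF holomorphic_prodth open_UNIV, of 0] 0 unfolding e_def
    by (auto intro!: derivative_eq_intros)
  ultimately have "deriv prodth \<xi> = e 0 * deriv prodth 0"
    unfolding e by (rule DERIV_unique)
  then show ?thesis using deriv_prodth_0 by (simp add: e_def)
qed

private lemma theta_0: "theta 0 = 0" using theta_minus[of 0] by simp

text \<open>Jacobi's triple product up to its constant. Series and product have the same
  multipliers, and the series vanishes at the simple zeros of the product, so the quotient is entire
  and doubly periodic. That \<open>C\<close> is nonzero rests on
  \<open>theta_not_identically_0\<close>. Through this identity the exact location and the
  simplicity of the zeros pass to the series.\<close>

lemma theta_eq_Theta:
  "\<exists>C. C \<noteq> 0 \<and> (\<forall>\<xi>. theta \<xi> = C * (exp (- \<i> * pi * \<xi>) * Theta (exp (2 * \<i> * pi * \<tau>)) (exp (2 * \<i> * pi * \<xi>))))"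
proof -
  have van: "theta \<xi> = 0" if "prodth \<xi> = 0" for \<xi>
  proof -
    from that obtain k m :: int where km: "\<xi> = of_int k + of_int m * \<tau>" using prodth_eq_0_iff by blast
    show ?thesis using theta_lattice_shift[OF theta_add_1 theta_add_tau, of 0 k m] theta_0 by (simp add: km)
  qed
  obtain h where h: "h holomorphic_on UNIV" "\<And>z. theta z = h z * prodth z"
    "\<And>z. h (z + 1) = 1 * h z" "\<And>z. h (z + \<tau>) = 1 * h z"
  proof (rule entire_quotient_quasiperiodic[OF holomorphic_theta_UNIV holomorphic_prodth van deriv_prodth_nonzero,
      where ?w1.0 = 1 and ?w2.0 = \<tau> and a = "\<lambda>_. 1" and b = "\<lambda>_. 1" and A = "\<lambda>_. -1"
        and B = "\<lambda>\<xi>. - exp (- \<i> * pi * \<tau> - 2 * \<i> * pi * \<xi>)"])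
  qed (simp_all add: theta_add_1 theta_add_tau prodth_add_1 prodth_add_tau)
  have "h z = h 0" for z
    by (rule entire_unimodular_quasiperiodic_constant[where h = h and \<tau> = \<tau> and a = 1 and b = 1,
          OF h(1) \<tau> h(3) norm_one h(4) norm_one])
  then have eq: "theta \<xi> = h 0 * prodth \<xi>" for \<xi> using h(2) by metis
  moreover have "h 0 \<noteq> 0" using theta_not_identically_0 eq by auto
  ultimately show ?thesis by (intro exI[of _ "h 0"]) (simp add: prodth_def nome_def)
qed

private lemma theta_eq_prodth: obtains C where "C \<noteq> 0" "theta = (\<lambda>\<xi>. C * prodth \<xi>)"
proof -
  obtain C where "C \<noteq> 0" "\<forall>\<xi>. theta \<xi> = C * prodth \<xi>"
    using theta_eq_Theta by (auto simp: prodth_def nome_def)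
  then show thesis by (intro that[of C]) auto
qed

lemma theta_eq_0_iff: "theta \<xi> = 0 \<longleftrightarrow> (\<exists>k m :: int. \<xi> = of_int k + of_int m * \<tau>)"
  by (rule theta_eq_prodth) (simp add: prodth_eq_0_iff)

lemma deriv_theta_nonzero: "theta \<xi> = 0 \<Longrightarrow> deriv theta \<xi> \<noteq> 0"
proof (rule theta_eq_prodth)
  fix C assume C: "C \<noteq> 0" "theta = (\<lambda>\<xi>. C * prodth \<xi>)" and "theta \<xi> = 0"
  then have "deriv prodth \<xi> \<noteq> 0" by (intro deriv_prodth_nonzero) simp
  moreover have "deriv theta \<xi> = C * deriv prodth \<xi>"
    unfolding C(2) using holomorphic_prodth
    by (intro deriv_cmult) (simp add: holomorphic_on_def)
  ultimately show "deriv theta \<xi> \<noteq> 0" using C by simp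
qed

end

section \<open>Degree-two theta functions\<close>

context
  fixes \<tau> :: complex
  assumes \<tau> [simp]: "Im \<tau> > 0"
begin

lemmas theta_holo [holomorphic_intros] = holomorphic_on_theta[OF \<tau>]

lemma theta_zero [simp]: "theta \<tau> 0 = 0"
  using theta_minus[OF \<tau>, of 0] by simp

lemma DERIV_theta: "(theta \<tau> has_field_derivative deriv (theta \<tau>) x) (at x)"
  by (rule holomorphic_derivI[OF holomorphic_theta_UNIV[OF \<tau>] open_UNIV]) simp

lemma DERIV_theta_chain [derivative_intros]:
  assumes "(g has_field_derivative g') (at x within S)"
  shows "((\<lambda>x. theta \<tau> (g x)) has_field_derivative deriv (theta \<tau>) (g x) * g') (at x within S)"
  by (rule DERIV_chain2[OF DERIV_theta assms])

lemma deriv_theta_0: "deriv (theta \<tau>) 0 \<noteq> 0"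
  by (rule deriv_theta_nonzero[OF \<tau>]) simp

lemma zeros_lattice_invariant:
  fixes f A B :: "complex \<Rightarrow> complex" and k m :: int
  assumes f1: "\<And>z. f (z + 1) = A z * f z" "\<And>z. A z \<noteq> 0"
    and f2: "\<And>z. f (z + \<tau>) = B z * f z" "\<And>z. B z \<noteq> 0"
    and s: "f s = 0"
  shows "f (s + of_int k + of_int m * \<tau>) = 0"
proof -
  have step: "f (z + of_int k * w) = 0"
    if z: "f z = 0" and fw: "\<And>z. f (z + w) = 0 \<longleftrightarrow> f z = 0" for z w and k :: int
  proof (induction k rule: int_induct[where k = 0])
    case (step1 i)
    then show ?case using fw[of "z + of_int i * w"] by (simp add: algebra_simps)
  next
    case (step2 i)
    then show ?case using fw[of "z + of_int (i - 1) * w"] by (simp add: algebra_simps)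
  qed (use z in auto)
  have "f (s + of_int k * 1) = 0" by (rule step[OF s]) (simp add: f1)
  then show ?thesis by (intro step) (simp_all add: f2)
qed

text \<open>The multipliers are those of \<open>theta \<tau> z * theta \<tau> (z - s)\<close> up to
  the constants \<open>a\<close> and \<open>b\<close>. Dividing by one theta factor and then by the
  other uses up the two known zeros; the remaining entire function has unimodular constant
  multipliers, so it is constant, and it is 0 unless both multipliers are 1.\<close>

lemma degree_two_theta:
  fixes f :: "complex \<Rightarrow> complex"
  assumes f: "f holomorphic_on UNIV"
    and f1: "\<And>z. f (z + 1) = a * f z" "norm a = 1"
    and f2: "\<And>z. f (z + \<tau>) = b * exp (- 2 * \<i> * pi * \<tau> - 4 * \<i> * pi * z + 2 * \<i> * pi * s) * f z" "norm b = 1"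
    and f0: "f 0 = 0"
    and fs: "(theta \<tau> s \<noteq> 0 \<and> f s = 0) \<or> (s = 0 \<and> deriv f 0 = 0)"
  obtains C where "\<And>z. f z = C * (theta \<tau> z * theta \<tau> (z - s))" "a \<noteq> 1 \<or> b \<noteq> 1 \<Longrightarrow> C = 0"
proof -
  have a0: "a \<noteq> 0" and b0: "b \<noteq> 0" using f1(2) f2(2) by auto
  have van: "f z = 0" if "theta \<tau> z = 0" for z
  proof -
    from that obtain k m :: int where "z = of_int k + of_int m * \<tau>" using theta_eq_0_iff[OF \<tau>] by blast
    then show ?thesis
      using zeros_lattice_invariant[where f = f and s = 0 and k = k and m = m
        and A = "\<lambda>_. a" and B = "\<lambda>z. b * exp (- 2 * \<i> * pi * \<tau> - 4 * \<i> * pi * z + 2 * \<i> * pi * s)"]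
        f1 f2 a0 b0 f0 by simp
  qed
  obtain h where h: "h holomorphic_on UNIV" "\<And>z. f z = h z * theta \<tau> z"
    "\<And>z. h (z + 1) = - a * h z"
    "\<And>z. h (z + \<tau>) = - b * exp (- \<i> * pi * \<tau> - 2 * \<i> * pi * (z - s)) * h z"
  proof (rule entire_quotient_quasiperiodic[OF f holomorphic_theta_UNIV[OF \<tau>] van deriv_theta_nonzero[OF \<tau>],
      where ?w1.0 = 1 and ?w2.0 = \<tau> and a = "\<lambda>_. - a" and A = "\<lambda>_. -1"
      and b = "\<lambda>z. - b * exp (- \<i> * pi * \<tau> - 2 * \<i> * pi * (z - s))"
      and B = "\<lambda>\<xi>. - exp (- \<i> * pi * \<tau> - 2 * \<i> * pi * \<xi>)"])
    fix z
    have "exp (- 2 * \<i> * pi * \<tau> - 4 * \<i> * pi * z + 2 * \<i> * pi * s) =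
        exp (- \<i> * pi * \<tau> - 2 * \<i> * pi * (z - s)) * exp (- \<i> * pi * \<tau> - 2 * \<i> * pi * z)"
      unfolding mult_exp_exp by (rule arg_cong[where f = exp]) (simp add: algebra_simps)
    then show "f (z + \<tau>) = - b * exp (- \<i> * pi * \<tau> - 2 * \<i> * pi * (z - s)) *
         - exp (- \<i> * pi * \<tau> - 2 * \<i> * pi * z) * f z"
      using f2(1)[of z] by simp
  qed (auto simp: theta_add_1[OF \<tau>] theta_add_tau[OF \<tau>] f1 intro!: holomorphic_intros)
  \<comment> \<open>When \<open>s = 0\<close> the two zeros merge into a double zero at the origin,
    which is expressed through the derivative.\<close>
  have hs: "h s = 0"
    using fs
  proof
    assume "theta \<tau> s \<noteq> 0 \<and> f s = 0" then show ?thesis using h(2)[of s] by auto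
  next
    assume s: "s = 0 \<and> deriv f 0 = 0"
    have "(f has_field_derivative (deriv h 0 * theta \<tau> 0 + deriv (theta \<tau>) 0 * h 0)) (at 0)"
      unfolding h(2) using holomorphic_derivI[OF h(1) open_UNIV, of 0] DERIV_theta
      by (intro DERIV_mult) auto
    then have "deriv (theta \<tau>) 0 * h 0 = 0" using s DERIV_imp_deriv by fastforce
    then show ?thesis using deriv_theta_0 s by simp
  qed
  have dtheta: "deriv (\<lambda>z. theta \<tau> (z - s)) z = deriv (theta \<tau>) (z - s)" for z
    by (rule DERIV_imp_deriv) (auto intro!: derivative_eq_intros)
  have van2: "h z = 0" if "theta \<tau> (z - s) = 0" for z
  proof -
    from that obtain k m :: int where "z - s = of_int k + of_int m * \<tau>" using theta_eq_0_iff[OF \<tau>] by blast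
    then have "z = s + of_int k + of_int m * \<tau>" by (simp add: algebra_simps)
    then show ?thesis
      using zeros_lattice_invariant[where f = h and s = s and k = k and m = m
        and A = "\<lambda>_. - a" and B = "\<lambda>z. - b * exp (- \<i> * pi * \<tau> - 2 * \<i> * pi * (z - s))"]
        h a0 b0 hs by simp
  qed
  obtain k where k: "k holomorphic_on UNIV" "\<And>z. h z = k z * theta \<tau> (z - s)"
    "\<And>z. k (z + 1) = a * k z" "\<And>z. k (z + \<tau>) = b * k z"
  proof (rule entire_quotient_quasiperiodic[OF h(1) _ van2,
      where ?w1.0 = 1 and ?w2.0 = \<tau> and a = "\<lambda>_. a" and A = "\<lambda>_. -1"
      and b = "\<lambda>z. b" and B = "\<lambda>z. - exp (- \<i> * pi * \<tau> - 2 * \<i> * pi * (z - s))"])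
    show "theta \<tau> (z + 1 - s) = -1 * theta \<tau> (z - s)" for z
      using theta_add_1[OF \<tau>, of "z - s"] by (simp add: algebra_simps)
    show "theta \<tau> (z + \<tau> - s) = - exp (- \<i> * pi * \<tau> - 2 * \<i> * pi * (z - s)) * theta \<tau> (z - s)" for z
      using theta_add_tau[OF \<tau>, of "z - s"] by (simp add: algebra_simps)
    show "deriv (\<lambda>z. theta \<tau> (z - s)) z \<noteq> 0" if "theta \<tau> (z - s) = 0" for z
      unfolding dtheta by (rule deriv_theta_nonzero[OF \<tau> that])
  qed (auto simp: h intro!: holomorphic_intros)
  have kc: "k z = k 0" for z
    by (rule entire_unimodular_quasiperiodic_constant[where h = k and \<tau> = \<tau> and a = a and b = b]) fact+
  show thesis
  proof (rule that[of "k 0"])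
    show "f z = k 0 * (theta \<tau> z * theta \<tau> (z - s))" for z
      using h(2)[of z] k(2)[of z] kc[of z] by simp
    assume "a \<noteq> 1 \<or> b \<noteq> 1"
    then show "k 0 = 0"
      using entire_quasiperiodic_eq_0[where h = k and \<tau> = \<tau> and a = a and b = b]
        k f1(2) f2(2) \<tau> by blast
  qed
qed

end

section \<open>The weights of the R-matrix\<close>

definition chi :: "'n::nontriv mod_ring \<Rightarrow> complex" where
  "chi a = exp (2 * \<i> * pi * of_int (to_int_mod_ring a) / of_nat CARD('n))"

lemma exp_2pi_int_cong:
  assumes "N > 0" "k mod int N = l mod int N"
  shows "exp (2 * \<i> * pi * of_int k / of_nat N) = exp (2 * \<i> * pi * of_int l / of_nat N)"
proof -
  obtain d where "k = l + int N * d" using assms(2) by (metis mod_eqE mult.commute diff_add_cancel add.commute mod_eq_dvd_iff dvdE)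
  then have "2 * \<i> * pi * of_int k / of_nat N = 2 * \<i> * pi * of_int l / of_nat N + 2 * of_int d * pi * \<i>"
    using assms(1) by (simp add: field_simps)
  then show ?thesis using exp_integer_2pi[of "of_int d"] by (simp add: exp_add mult_ac)
qed

lemma CARD_nontriv_pos [simp]: "0 < CARD('n::nontriv)"
  using nontriv[where ?'a = 'n] by simp

lemma to_int_mod_ring_mod [simp]:
  "to_int_mod_ring (a :: 'n::nontriv mod_ring) mod int CARD('n) = to_int_mod_ring a"
  by (transfer) simp

lemma to_int_mod_ring_add:
  "to_int_mod_ring (a + b :: 'n::nontriv mod_ring) = (to_int_mod_ring a + to_int_mod_ring b) mod int CARD('n)"
  by transfer simp

lemma chi_0 [simp]: "chi (0 :: 'n::nontriv mod_ring) = 1" by (simp add: chi_def)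

lemma chi_nonzero [simp]: "chi a \<noteq> 0" by (simp add: chi_def)

lemma norm_chi [simp]: "norm (chi a) = 1"
  unfolding chi_def norm_exp_eq_Re by simp

lemma chi_add: "chi (a + b :: 'n::nontriv mod_ring) = chi a * chi b"
proof -
  have "chi (a + b) = exp (2 * \<i> * pi * of_int (to_int_mod_ring a + to_int_mod_ring b) / of_nat CARD('n))"
    unfolding chi_def by (rule exp_2pi_int_cong) (simp_all add: to_int_mod_ring_add)
  then show ?thesis by (simp add: chi_def ring_distribs add_divide_distrib exp_add)
qed

lemma chi_minus: "chi (- a :: 'n::nontriv mod_ring) = inverse (chi a)"
  using chi_add[of a "- a"] by (simp add: field_simps)

lemma chi_diff: "chi (a - b :: 'n::nontriv mod_ring) = chi a / chi b"
  using chi_add[of a "- b"] by (simp add: chi_minus field_simps)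

lemma chi_eq_1_iff: "chi (a :: 'n::nontriv mod_ring) = 1 \<longleftrightarrow> a = 0"
proof
  assume "chi a = 1"
  then obtain n :: int where "2 * pi * of_int (to_int_mod_ring a) / of_nat CARD('n) = of_int (2 * n) * pi"
    unfolding chi_def exp_eq_1 by auto
  then have "real_of_int (to_int_mod_ring a) = of_int (n * int CARD('n))"
    by (simp add: field_simps)
  then have "to_int_mod_ring a = n * int CARD('n)" by (simp only: of_int_eq_iff)
  then have "to_int_mod_ring a = 0" by (metis mod_mult_self2_is_0 to_int_mod_ring_mod)
  then show "a = 0" by transfer simp
qed simp

text \<open>Translating the summation index by 1 multiplies the sum by \<open>chi a\<close>, which
  differs from 1 unless \<open>a = 0\<close>.\<close>

lemma sum_chi_mult:
  "(\<Sum>b\<in>UNIV. chi (a * b)) = (if a = 0 then of_nat CARD('n) else 0)" for a :: "'n::nontriv mod_ring"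
proof (cases "a = 0")
  case False
  have "(\<Sum>b\<in>UNIV. chi (a * b)) = (\<Sum>b\<in>UNIV. chi (a * (b + 1)))"
    by (rule sum.reindex_bij_betw[symmetric]) (rule bij_betw_byWitness[where f' = "\<lambda>b. b - 1"], auto)
  also have "\<dots> = chi a * (\<Sum>b\<in>UNIV. chi (a * b))"
    by (simp add: ring_distribs chi_add sum_distrib_left mult.commute)
  finally have "(1 - chi a) * (\<Sum>b\<in>UNIV. chi (a * b)) = 0" by (simp add: algebra_simps)
  then show ?thesis using False chi_eq_1_iff[of a] by auto
qed simp

text \<open>The exponent is the symplectic form that governs commutators of the Heisenberg matrices.
  It is nondegenerate: the sum splits into two character sums, at least one of which runs over a
  nontrivial character.\<close>

lemma sum_chi_pairing:
  fixes g :: "'n::nontriv mod_ring \<times> 'n mod_ring"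
  assumes "g \<noteq> 0"
  shows "(\<Sum>a\<in>UNIV. chi (fst a * snd g - fst g * snd a)) = 0"
proof -
  have "(\<Sum>a\<in>UNIV. chi (fst a * snd g - fst g * snd a)) =
      (\<Sum>a\<in>UNIV \<times> UNIV. case a of (a1, a2) \<Rightarrow> chi (snd g * a1) * chi (- fst g * a2))"
    unfolding UNIV_Times_UNIV by (intro sum.cong) (auto simp: chi_diff chi_minus field_simps)
  also have "\<dots> = (\<Sum>a1\<in>UNIV. chi (snd g * a1)) * (\<Sum>a2\<in>UNIV. chi (- fst g * a2))"
    by (simp add: sum_product sum.cartesian_product del: mult_minus_left)
  also have "\<dots> = 0" using assms unfolding sum_chi_mult by (auto simp: prod_eq_iff)
  finally show ?thesis .
qed

lemma sum_shift:
  fixes f :: "'a::{finite, ab_group_add} \<Rightarrow> 'b::comm_monoid_add"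
  shows "(\<Sum>\<alpha>\<in>UNIV. f (\<alpha> + \<gamma>)) = (\<Sum>\<alpha>\<in>UNIV. f \<alpha>)"
  by (rule sum.reindex_bij_betw) (rule bij_betw_byWitness[where f' = "\<lambda>\<alpha>. \<alpha> - \<gamma>"], auto)

text \<open>The N-torsion point of the torus with periods 1 and \<tau> that belongs to \<alpha>,
  represented with both coordinates in the interval from 0 inclusive to 1 exclusive.\<close>

definition twist :: "complex \<Rightarrow> 'n::nontriv mod_ring \<times> 'n mod_ring \<Rightarrow> complex" where
  "twist \<tau> \<alpha> = (of_int (to_int_mod_ring (fst \<alpha>)) * \<tau> + of_int (to_int_mod_ring (snd \<alpha>))) / of_nat CARD('n)"

text \<open>For \<open>\<eta> = \<zeta> / N\<close> this is \<open>N * Wfun\<close>, the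
  characteristics having become a translation by a torsion point. Whenever the denominator is
  nonzero, the value at \<open>x = 0\<close> is 1.\<close>

definition weight ::
  "complex \<Rightarrow> complex \<Rightarrow> 'n::nontriv mod_ring \<times> 'n mod_ring \<Rightarrow> complex \<Rightarrow> complex" where
  "weight \<tau> \<eta> \<alpha> x = exp (2 * \<i> * pi * of_int (to_int_mod_ring (fst \<alpha>)) * x / of_nat CARD('n))
     * (theta \<tau> (x + \<eta> + twist \<tau> \<alpha>) / theta \<tau> (\<eta> + twist \<tau> \<alpha>))"

section \<open>Zeros and multipliers of the weights\<close>

context
  fixes \<tau> :: complex
  assumes \<tau> [simp]: "Im \<tau> > 0"
begin

lemma theta_lattice:
  fixes k m :: int
  shows "theta \<tau> (y + of_int k + of_int m * \<tau>) =
    exp (\<i> * pi * (of_int k + of_int m) - \<i> * pi * (of_int m)\<^sup>2 * \<tau> - 2 * \<i> * pi * of_int m * y) * theta \<tau> y"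
  by (rule theta_lattice_shift[OF \<tau> theta_add_1[OF \<tau>] theta_add_tau[OF \<tau>]])

text \<open>\<open>N * \<eta>\<close> is a period exactly when \<eta> is an N-torsion point modulo
  periods. The single condition \<open>theta \<tau> (N * \<eta>) \<noteq> 0\<close> therefore guards
  the denominators of all weights at once.\<close>

lemma theta_mult_eq_0_iff:
  "theta \<tau> (of_nat CARD('n) * \<eta>) = 0 \<longleftrightarrow>
     (\<exists>\<alpha> :: 'n::nontriv mod_ring \<times> 'n mod_ring. theta \<tau> (\<eta> + twist \<tau> \<alpha>) = 0)"
proof
  assume "theta \<tau> (of_nat CARD('n) * \<eta>) = 0"
  then obtain k m :: int where km: "of_nat CARD('n) * \<eta> = of_int k + of_int m * \<tau>"
    using theta_eq_0_iff[OF \<tau>] by blast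
  \<comment> \<open>The residues carry minus signs because the torsion point has to cancel \<eta>
    modulo periods.\<close>
  define \<alpha> where "\<alpha> = (of_int_mod_ring (- m) :: 'n mod_ring, of_int_mod_ring (- k) :: 'n mod_ring)"
  have rep: "\<exists>d. to_int_mod_ring (of_int_mod_ring (- m) :: 'n mod_ring) = - m + d * int CARD('n)" for m
    by transfer (metis mult.commute minus_mult_div_eq_mod diff_conv_add_uminus mult_minus_left)
  obtain d e where de: "to_int_mod_ring (fst \<alpha>) = - m + d * int CARD('n)"
    "to_int_mod_ring (snd \<alpha>) = - k + e * int CARD('n)"
    using rep[of m] rep[of k] by (auto simp: \<alpha>_def)
  have "\<eta> = (of_int k + of_int m * \<tau>) / of_nat CARD('n)"
    using km by (simp add: field_simps)
  then have "\<eta> + twist \<tau> \<alpha> = of_int e + of_int d * \<tau>"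
    unfolding twist_def de by (simp add: field_simps)
  then have "theta \<tau> (\<eta> + twist \<tau> \<alpha>) = 0" using theta_eq_0_iff[OF \<tau>] by blast
  then show "\<exists>\<alpha> :: 'n mod_ring \<times> 'n mod_ring. theta \<tau> (\<eta> + twist \<tau> \<alpha>) = 0" by blast
next
  assume "\<exists>\<alpha> :: 'n mod_ring \<times> 'n mod_ring. theta \<tau> (\<eta> + twist \<tau> \<alpha>) = 0"
  then obtain \<alpha> :: "'n mod_ring \<times> 'n mod_ring" and k m :: int
    where "\<eta> + twist \<tau> \<alpha> = of_int k + of_int m * \<tau>"
    using theta_eq_0_iff[OF \<tau>] by blast
  then have "of_nat CARD('n) * \<eta> = of_int (int CARD('n) * k - to_int_mod_ring (snd \<alpha>)) +
      of_int (int CARD('n) * m - to_int_mod_ring (fst \<alpha>)) * \<tau>"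
    by (simp add: twist_def field_simps)
  then show "theta \<tau> (of_nat CARD('n) * \<eta>) = 0" using theta_eq_0_iff[OF \<tau>] by blast
qed

lemma theta_twist_nonzero:
  fixes \<alpha> :: "'n::nontriv mod_ring \<times> 'n mod_ring"
  shows "theta \<tau> (of_nat CARD('n) * \<eta>) \<noteq> 0 \<Longrightarrow> theta \<tau> (\<eta> + twist \<tau> \<alpha>) \<noteq> 0"
  using theta_mult_eq_0_iff by blast

text \<open>The weight depends on \<alpha> only modulo N: a change of representatives moves both
  theta arguments by the same period, and the exponential prefactor absorbs the quotient of the two
  resulting multipliers.\<close>

lemma weight_cong:
  fixes \<alpha> :: "'n::nontriv mod_ring \<times> 'n mod_ring" and k l :: int
  assumes "k mod int CARD('n) = to_int_mod_ring (fst \<alpha>)" "l mod int CARD('n) = to_int_mod_ring (snd \<alpha>)"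
  shows "exp (2 * \<i> * pi * of_int k * x / of_nat CARD('n))
     * (theta \<tau> (x + \<eta> + (of_int k * \<tau> + of_int l) / of_nat CARD('n))
       / theta \<tau> (\<eta> + (of_int k * \<tau> + of_int l) / of_nat CARD('n))) = weight \<tau> \<eta> \<alpha> x"
proof -
  define d where "d = k div int CARD('n)"
  define e where "e = l div int CARD('n)"
  have k: "k = to_int_mod_ring (fst \<alpha>) + d * int CARD('n)" and l: "l = to_int_mod_ring (snd \<alpha>) + e * int CARD('n)"
    unfolding d_def e_def assms[symmetric] by simp_all
  have tw: "(of_int k * \<tau> + of_int l) / of_nat CARD('n) = twist \<tau> \<alpha> + of_int e + of_int d * \<tau>"
    unfolding k l by (simp add: twist_def field_simps)
  define E where "E y = exp (\<i> * pi * (of_int e + of_int d) - \<i> * pi * (of_int d)\<^sup>2 * \<tau> - 2 * \<i> * pi * of_int d * y)" for y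
  have th: "theta \<tau> (y + (of_int k * \<tau> + of_int l) / of_nat CARD('n)) = E (y + twist \<tau> \<alpha>) * theta \<tau> (y + twist \<tau> \<alpha>)" for y
    unfolding tw E_def theta_lattice[symmetric] by (simp add: algebra_simps)
  have "exp (2 * \<i> * pi * of_int k * x / of_nat CARD('n)) * E (x + \<eta> + twist \<tau> \<alpha>)
      = exp (2 * \<i> * pi * of_int (to_int_mod_ring (fst \<alpha>)) * x / of_nat CARD('n)) * E (\<eta> + twist \<tau> \<alpha>)"
    unfolding E_def mult_exp_exp k by (rule arg_cong[where f = exp]) (simp add: field_simps)
  moreover have "E (\<eta> + twist \<tau> \<alpha>) \<noteq> 0" by (simp add: E_def)
  ultimately have "exp (2 * \<i> * pi * of_int k * x / of_nat CARD('n)) * (E (x + \<eta> + twist \<tau> \<alpha>) / E (\<eta> + twist \<tau> \<alpha>))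
      = exp (2 * \<i> * pi * of_int (to_int_mod_ring (fst \<alpha>)) * x / of_nat CARD('n))"
    by (simp add: field_simps)
  then show ?thesis unfolding th weight_def by (metis (no_types, lifting) mult.assoc times_divide_times_eq)
qed

lemma weight_add_1: "weight \<tau> \<eta> \<alpha> (x + 1) = - chi (fst \<alpha>) * weight \<tau> \<eta> \<alpha> x"
proof -
  have "theta \<tau> (x + 1 + \<eta> + twist \<tau> \<alpha>) = - theta \<tau> (x + \<eta> + twist \<tau> \<alpha>)"
    using theta_add_1[OF \<tau>, of "x + \<eta> + twist \<tau> \<alpha>"] by (simp add: add_ac)
  then show ?thesis
    by (simp add: weight_def chi_def ring_distribs add_divide_distrib exp_add)
qed

lemma weight_add_tau:
  "weight \<tau> \<eta> \<alpha> (x + \<tau>) = - exp (- \<i> * pi * \<tau> - 2 * \<i> * pi * (x + \<eta>)) * inverse (chi (snd \<alpha>)) * weight \<tau> \<eta> \<alpha> x"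
proof -
  let ?c = "\<lambda>x. exp (2 * \<i> * pi * of_int (to_int_mod_ring (fst \<alpha>)) * x / of_nat CARD('a))"
  have 1: "theta \<tau> (x + \<tau> + \<eta> + twist \<tau> \<alpha>) =
      - exp (- \<i> * pi * \<tau> - 2 * \<i> * pi * (x + \<eta> + twist \<tau> \<alpha>)) * theta \<tau> (x + \<eta> + twist \<tau> \<alpha>)"
    using theta_add_tau[OF \<tau>, of "x + \<eta> + twist \<tau> \<alpha>"] by (simp add: add_ac)
  \<comment> \<open>The part of the torsion point proportional to \<tau> cancels against the
    prefactor; only its second coordinate survives, as a root of unity.\<close>
  have 2: "?c (x + \<tau>) * exp (- \<i> * pi * \<tau> - 2 * \<i> * pi * (x + \<eta> + twist \<tau> \<alpha>)) =
      exp (- \<i> * pi * \<tau> - 2 * \<i> * pi * (x + \<eta>)) * inverse (chi (snd \<alpha>)) * ?c x"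
    unfolding chi_def exp_minus[symmetric] mult_exp_exp
    by (rule arg_cong[where f = exp]) (simp add: twist_def field_simps)
  have "weight \<tau> \<eta> \<alpha> (x + \<tau>) = - (?c (x + \<tau>) * exp (- \<i> * pi * \<tau> - 2 * \<i> * pi * (x + \<eta> + twist \<tau> \<alpha>)))
      * (theta \<tau> (x + \<eta> + twist \<tau> \<alpha>) / theta \<tau> (\<eta> + twist \<tau> \<alpha>))"
    unfolding weight_def 1 by simp
  then show ?thesis unfolding 2 by (simp add: weight_def)
qed

lemma weight_minus_add_1: "weight \<tau> \<eta> \<alpha> (- (x + 1)) = - inverse (chi (fst \<alpha>)) * weight \<tau> \<eta> \<alpha> (- x)"
  using weight_add_1[of \<eta> \<alpha> "- (x + 1)"] by (simp add: field_simps)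

lemma weight_minus_add_tau:
  "weight \<tau> \<eta> \<alpha> (- (x + \<tau>)) = - exp (- \<i> * pi * \<tau> - 2 * \<i> * pi * (x - \<eta>)) * chi (snd \<alpha>) * weight \<tau> \<eta> \<alpha> (- x)"
proof -
  have "exp (- \<i> * pi * \<tau> - 2 * \<i> * pi * (x - \<eta>)) * exp (- \<i> * pi * \<tau> - 2 * \<i> * pi * (- (x + \<tau>) + \<eta>)) = exp 0"
    unfolding mult_exp_exp by (rule arg_cong[where f = exp]) (simp add: algebra_simps)
  then have E: "exp (- \<i> * pi * \<tau> - 2 * \<i> * pi * (x - \<eta>)) * exp (- \<i> * pi * \<tau> - 2 * \<i> * pi * (- (x + \<tau>) + \<eta>)) = 1"
    by simp
  have aux: "w' = - a * c * w" if "w = - b * inverse c * w'" "a * b = 1" "c \<noteq> 0" for a b c w w' :: complex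
  proof -
    have "- a * c * w = (a * b) * (c * inverse c) * w'" unfolding that(1) by (simp add: mult_ac)
    then show ?thesis using that by simp
  qed
  show ?thesis
    by (rule aux[OF _ E chi_nonzero]) (use weight_add_tau[of \<eta> \<alpha> "- (x + \<tau>)"] in simp)
qed

lemma weight_0 [simp]: "theta \<tau> (\<eta> + twist \<tau> \<alpha>) \<noteq> 0 \<Longrightarrow> weight \<tau> \<eta> \<alpha> 0 = 1"
  by (simp add: weight_def)

lemma holomorphic_weight_UNIV: "weight \<tau> \<eta> \<alpha> holomorphic_on UNIV"
  unfolding weight_def[abs_def]
  \<comment> \<open>Division by zero yields 0, so for an exceptional \<eta> the weight vanishes
    identically and is still entire.\<close>
  by (cases "theta \<tau> (\<eta> + twist \<tau> \<alpha>) = 0") (auto intro!: holomorphic_intros \<tau>)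

lemma holomorphic_on_weight:
  "g holomorphic_on A \<Longrightarrow> (\<lambda>x. weight \<tau> \<eta> \<alpha> (g x)) holomorphic_on A"
  by (rule holomorphic_on_entire_compose[OF holomorphic_weight_UNIV])

lemma DERIV_weight:
  assumes "(g has_field_derivative g') (at x)"
  shows "((\<lambda>x. weight \<tau> \<eta> \<alpha> (g x)) has_field_derivative deriv (weight \<tau> \<eta> \<alpha>) (g x) * g') (at x)"
  by (rule DERIV_chain2[OF holomorphic_derivI[OF holomorphic_weight_UNIV open_UNIV UNIV_I] assms])

text \<open>The sums over \<open>\<alpha>\<close> in the unitarity and crossing relations have the same multipliers up to the phase
  and the shift \<open>s\<close> of the spectral parameter.\<close>

lemma weight_product_add_1:
  "weight \<tau> \<eta> \<alpha> (x + 1 - s) * weight \<tau> \<eta> (\<alpha> - \<gamma>) (- (x + 1)) =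
     chi (fst \<gamma>) * (weight \<tau> \<eta> \<alpha> (x - s) * weight \<tau> \<eta> (\<alpha> - \<gamma>) (- x))"
  using weight_add_1[of \<eta> \<alpha> "x - s"] weight_minus_add_1[of \<eta> "\<alpha> - \<gamma>" x]
  by (simp add: chi_diff algebra_simps)

lemma weight_product_add_tau:
  "weight \<tau> \<eta> \<alpha> (x + \<tau> - s) * weight \<tau> \<eta> (\<alpha> - \<gamma>) (- (x + \<tau>)) =
     inverse (chi (snd \<gamma>)) * exp (- 2 * \<i> * pi * \<tau> - 4 * \<i> * pi * x + 2 * \<i> * pi * s)
       * (weight \<tau> \<eta> \<alpha> (x - s) * weight \<tau> \<eta> (\<alpha> - \<gamma>) (- x))"
proof -
  have "exp (- 2 * \<i> * pi * \<tau> - 4 * \<i> * pi * x + 2 * \<i> * pi * s) =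
      exp (- \<i> * pi * \<tau> - 2 * \<i> * pi * (x - s + \<eta>)) * exp (- \<i> * pi * \<tau> - 2 * \<i> * pi * (x - \<eta>))"
    unfolding mult_exp_exp by (rule arg_cong[where f = exp]) (simp add: algebra_simps)
  moreover have "x + \<tau> - s = (x - s) + \<tau>" by simp
  ultimately show ?thesis
    using weight_add_tau[of \<eta> \<alpha> "x - s"] weight_minus_add_tau[of \<eta> "\<alpha> - \<gamma>" x]
    by (simp only: chi_diff snd_diff) (simp add: field_simps)
qed

text \<open>As a function of \<open>x\<close> the sum has a double zero at 0. Its value there is a
  character sum over the nondegenerate pairing, and its derivative cancels after the reindexing from
  \<alpha> to \<open>\<alpha> + \<gamma>\<close>, which preserves the phases. Since \<gamma> is
  nonzero, one of the two constant multipliers is nontrivial, and \<open>degree_two_theta\<close>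
  leaves only the zero function.\<close>

lemma unitarity_sum_offdiag:
  fixes \<gamma> :: "'n::nontriv mod_ring \<times> 'n mod_ring"
  assumes nz: "theta \<tau> (of_nat CARD('n) * \<eta>) \<noteq> 0" and \<gamma>: "\<gamma> \<noteq> 0"
  shows "(\<Sum>\<alpha>\<in>UNIV. chi (fst \<alpha> * snd \<gamma> - fst \<gamma> * snd \<alpha>) * (weight \<tau> \<eta> \<alpha> x * weight \<tau> \<eta> (\<alpha> - \<gamma>) (- x))) = 0"
proof -
  define c where "c \<alpha> = chi (fst \<alpha> * snd \<gamma> - fst \<gamma> * snd \<alpha>)" for \<alpha>
  define f where "f x = (\<Sum>\<alpha>\<in>UNIV. c \<alpha> * (weight \<tau> \<eta> \<alpha> x * weight \<tau> \<eta> (\<alpha> - \<gamma>) (- x)))" for x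
  define w' where "w' \<alpha> = deriv (weight \<tau> \<eta> \<alpha>) 0" for \<alpha> :: "'n mod_ring \<times> 'n mod_ring"
  have w0: "weight \<tau> \<eta> \<alpha> 0 = 1" for \<alpha> :: "'n mod_ring \<times> 'n mod_ring"
    using theta_twist_nonzero[OF nz] by (rule weight_0)
  have "(f has_field_derivative (\<Sum>\<alpha>\<in>UNIV. c \<alpha> * (w' \<alpha> - w' (\<alpha> - \<gamma>)))) (at 0)"
    unfolding f_def w'_def
    by (auto intro!: derivative_eq_intros DERIV_weight simp: w0 mult.commute)
  also have "(\<Sum>\<alpha>\<in>UNIV. c \<alpha> * (w' \<alpha> - w' (\<alpha> - \<gamma>))) = 0"
  proof -
    have c: "c (\<alpha> + \<gamma>) = c \<alpha>" for \<alpha> by (simp add: c_def algebra_simps)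
    have "(\<Sum>\<alpha>\<in>UNIV. c \<alpha> * w' (\<alpha> - \<gamma>)) = (\<Sum>\<alpha>\<in>UNIV. c \<alpha> * w' \<alpha>)"
      using sum_shift[of "\<lambda>\<alpha>. c \<alpha> * w' (\<alpha> - \<gamma>)" \<gamma>] by (simp add: c)
    then show ?thesis by (simp add: right_diff_distrib sum_subtractf)
  qed
  finally have d0: "deriv f 0 = 0" by (rule DERIV_imp_deriv)
  have f0: "f 0 = 0" using sum_chi_pairing[OF \<gamma>] by (simp add: f_def c_def w0)
  obtain C where "\<And>z. f z = C * (theta \<tau> z * theta \<tau> (z - 0))"
    "chi (fst \<gamma>) \<noteq> 1 \<or> inverse (chi (snd \<gamma>)) \<noteq> 1 \<Longrightarrow> C = 0"
  proof (rule degree_two_theta[OF \<tau>, where f = f and s = 0 and a = "chi (fst \<gamma>)" and b = "inverse (chi (snd \<gamma>))"])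
    show "f holomorphic_on UNIV" unfolding f_def
      by (intro holomorphic_intros holomorphic_on_weight)
    show "f (z + 1) = chi (fst \<gamma>) * f z" for z
      using weight_product_add_1[where s = 0 and x = z and \<gamma> = \<gamma>]
      by (simp add: f_def sum_distrib_left mult_ac)
    show "f (z + \<tau>) = inverse (chi (snd \<gamma>)) *
        exp (- 2 * \<i> * pi * \<tau> - 4 * \<i> * pi * z + 2 * \<i> * pi * 0) * f z" for z
      using weight_product_add_tau[where s = 0 and x = z and \<gamma> = \<gamma>]
      unfolding f_def sum_distrib_left by (intro sum.cong) (simp_all add: mult_ac)
  qed (use f0 d0 in \<open>auto simp: norm_inverse\<close>)
  moreover have "chi (fst \<gamma>) \<noteq> 1 \<or> inverse (chi (snd \<gamma>)) \<noteq> 1"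
    using \<gamma> by (auto simp: chi_eq_1_iff prod_eq_iff)
  ultimately show ?thesis by (simp add: f_def c_def)
qed

section \<open>Logarithmic derivatives of theta and the diagonal unitarity sum\<close>

definition log_deriv_theta :: "complex \<Rightarrow> complex" where
  "log_deriv_theta u = deriv (theta \<tau>) u / theta \<tau> u"

text \<open>The second derivative of the logarithm of theta, which is minus the Weierstrass function
  of the lattice up to an additive constant.\<close>

definition log_deriv2_theta :: "complex \<Rightarrow> complex" where
  "log_deriv2_theta u = (deriv (deriv (theta \<tau>)) u * theta \<tau> u - (deriv (theta \<tau>) u)\<^sup>2) / (theta \<tau> u)\<^sup>2"

lemma DERIV_deriv_theta_chain:
  assumes "(g has_field_derivative g') (at x within S)"
  shows "((\<lambda>x. deriv (theta \<tau>) (g x)) has_field_derivative deriv (deriv (theta \<tau>)) (g x) * g') (at x within S)"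
  by (rule DERIV_chain2[OF holomorphic_derivI[OF holomorphic_deriv[OF holomorphic_theta_UNIV[OF \<tau>] open_UNIV] open_UNIV UNIV_I] assms])

lemma DERIV_log_deriv_theta:
  assumes "theta \<tau> u \<noteq> 0"
  shows "(log_deriv_theta has_field_derivative log_deriv2_theta u) (at u)"
  unfolding log_deriv_theta_def[abs_def] log_deriv2_theta_def using assms
  by (auto intro!: derivative_eq_intros DERIV_deriv_theta_chain DERIV_theta_chain[OF \<tau>] simp: power2_eq_square)

lemma DERIV_log_deriv_theta_chain:
  assumes "theta \<tau> (g x) \<noteq> 0" "(g has_field_derivative g') (at x)"
  shows "((\<lambda>x. log_deriv_theta (g x)) has_field_derivative log_deriv2_theta (g x) * g') (at x)"
  using DERIV_chain2[where f = log_deriv_theta and g = g, OF DERIV_log_deriv_theta[OF assms(1)] assms(2)] .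

text \<open>The product on the left vanishes exactly when \<open>N * \<eta>\<close> is a period.
  Dividing by \<open>theta \<tau> (N * \<eta>)\<close>, whose zeros are simple, leaves an entire
  function with constant multipliers, hence an exponential. The values of \<open>C\<close> and \<mu>
  may stay open, as both disappear after two logarithmic differentiations.\<close>

lemma prod_theta_twist:
  "\<exists>C \<mu>. \<forall>\<eta>. (\<Prod>\<alpha>\<in>(UNIV :: ('n::nontriv mod_ring \<times> 'n mod_ring) set). theta \<tau> (\<eta> + twist \<tau> \<alpha>)) =
     C * exp (\<mu> * \<eta>) * theta \<tau> (of_nat CARD('n) * \<eta>)"
proof -
  let ?U = "UNIV :: ('n mod_ring \<times> 'n mod_ring) set"
  let ?N = "of_nat CARD('n) :: complex"
  define f where "f \<eta> = (\<Prod>\<alpha>\<in>?U. theta \<tau> (\<eta> + twist \<tau> \<alpha>))" for \<eta>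
  define t where "t = (\<Sum>\<alpha>\<in>?U. twist \<tau> \<alpha>)"
  have card: "of_nat (card ?U) = ?N\<^sup>2"
    unfolding UNIV_Times_UNIV[symmetric] card_cartesian_product by (simp add: power2_eq_square)
  have dg: "deriv (\<lambda>z. theta \<tau> (?N * z)) z = ?N * deriv (theta \<tau>) (?N * z)" for z
    by (rule DERIV_imp_deriv) (auto intro!: derivative_eq_intros DERIV_theta_chain[OF \<tau>])
  obtain h where h: "h holomorphic_on UNIV" "\<And>z. f z = h z * theta \<tau> (?N * z)"
    "\<And>z. h (z + 1) = ((-1) ^ card ?U / exp (\<i> * pi * ?N)) * h z"
    "\<And>z. h (z + \<tau>) = ((-1) ^ card ?U * exp (- 2 * \<i> * pi * t) / exp (\<i> * pi * ?N)) * h z"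
  proof (rule entire_quotient_quasiperiodic[where f = f and g = "\<lambda>z. theta \<tau> (?N * z)" and ?w1.0 = 1 and ?w2.0 = \<tau>
      and a = "\<lambda>_. (-1) ^ card ?U / exp (\<i> * pi * ?N)"
      and A = "\<lambda>_. exp (\<i> * pi * ?N)"
      and b = "\<lambda>_. (-1) ^ card ?U * exp (- 2 * \<i> * pi * t) / exp (\<i> * pi * ?N)"
      and B = "\<lambda>z. exp (\<i> * pi * ?N - \<i> * pi * ?N\<^sup>2 * \<tau> - 2 * \<i> * pi * ?N * (?N * z))"])
    show "f holomorphic_on UNIV" unfolding f_def by (intro holomorphic_intros \<tau>)
    show "f z = 0" if "theta \<tau> (?N * z) = 0" for z
      using that unfolding f_def theta_mult_eq_0_iff by auto
    show "deriv (\<lambda>z. theta \<tau> (?N * z)) z \<noteq> 0" if "theta \<tau> (?N * z) = 0" for z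
      unfolding dg using deriv_theta_nonzero[OF \<tau> that] by simp
    show "f (z + 1) = (-1) ^ card ?U / exp (\<i> * pi * ?N) * exp (\<i> * pi * ?N) * f z" for z
    proof -
      have "theta \<tau> (z + 1 + twist \<tau> \<alpha>) = - 1 * theta \<tau> (z + twist \<tau> \<alpha>)" for \<alpha> :: "'n mod_ring \<times> 'n mod_ring"
        using theta_add_1[OF \<tau>, of "z + twist \<tau> \<alpha>"] by (simp add: add_ac)
      then have "f (z + 1) = (\<Prod>\<alpha>\<in>?U. - 1) * f z" unfolding f_def by (simp only: prod.distrib)
      then show ?thesis by simp
    qed
    show "theta \<tau> (?N * (z + 1)) = exp (\<i> * pi * ?N) * theta \<tau> (?N * z)" for z
      using theta_lattice[of "?N * z" "int CARD('n)" 0] by (simp add: ring_distribs)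
    show "theta \<tau> (?N * (z + \<tau>)) = exp (\<i> * pi * ?N - \<i> * pi * ?N\<^sup>2 * \<tau> - 2 * \<i> * pi * ?N * (?N * z)) * theta \<tau> (?N * z)" for z
      using theta_lattice[of "?N * z" 0 "int CARD('n)"] by (simp add: ring_distribs)
    show "f (z + \<tau>) = (-1) ^ card ?U * exp (- 2 * \<i> * pi * t) / exp (\<i> * pi * ?N) *
        exp (\<i> * pi * ?N - \<i> * pi * ?N\<^sup>2 * \<tau> - 2 * \<i> * pi * ?N * (?N * z)) * f z" for z
    proof -
      have "theta \<tau> (z + \<tau> + twist \<tau> \<alpha>) = - 1 * exp (- \<i> * pi * \<tau> - 2 * \<i> * pi * (z + twist \<tau> \<alpha>)) * theta \<tau> (z + twist \<tau> \<alpha>)"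
        for \<alpha> :: "'n mod_ring \<times> 'n mod_ring"
        using theta_add_tau[OF \<tau>, of "z + twist \<tau> \<alpha>"] by (simp add: add_ac)
      then have "f (z + \<tau>) = (\<Prod>\<alpha>\<in>?U. - 1) * (\<Prod>\<alpha>\<in>?U. exp (- \<i> * pi * \<tau> - 2 * \<i> * pi * (z + twist \<tau> \<alpha>))) * f z"
        unfolding f_def by (simp only: prod.distrib)
      also have "(\<Prod>\<alpha>\<in>?U. exp (- \<i> * pi * \<tau> - 2 * \<i> * pi * (z + twist \<tau> \<alpha>))) =
          exp (\<Sum>\<alpha>\<in>?U. - \<i> * pi * \<tau> - 2 * \<i> * pi * (z + twist \<tau> \<alpha>))"
        by (simp add: exp_sum)
      also have "(\<Sum>\<alpha>\<in>?U. - \<i> * pi * \<tau> - 2 * \<i> * pi * (z + twist \<tau> \<alpha>)) =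
          ?N\<^sup>2 * (- \<i> * pi * \<tau> - 2 * \<i> * pi * z) - 2 * \<i> * pi * t"
        by (simp add: ring_distribs sum_subtractf sum.distrib t_def sum_distrib_left card[symmetric])
      also have "exp \<dots> = exp (- 2 * \<i> * pi * t) / exp (\<i> * pi * ?N) *
          exp (\<i> * pi * ?N - \<i> * pi * ?N\<^sup>2 * \<tau> - 2 * \<i> * pi * ?N * (?N * z))"
        unfolding exp_diff[symmetric] mult_exp_exp
        by (rule arg_cong[where f = exp]) (simp add: algebra_simps power2_eq_square)
      finally show ?thesis by simp
    qed
  qed (auto intro!: holomorphic_intros \<tau>)
  obtain C \<mu> where "\<And>z. h z = C * exp (\<mu> * z)"
    by (rule entire_quasiperiodic_exponential[OF h(1) \<tau> h(3) _ h(4)]) auto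
  then show ?thesis using h(2) unfolding f_def by metis
qed

text \<open>The distribution relation over the torsion points. Differentiating
  \<open>prod_theta_twist\<close> logarithmically eliminates \<open>C\<close> at the first step and
  \<mu> at the second.\<close>

lemma sum_log_deriv2_theta:
  assumes nz: "theta \<tau> (of_nat CARD('n) * \<eta>) \<noteq> 0"
  shows "(\<Sum>\<alpha>\<in>(UNIV :: ('n::nontriv mod_ring \<times> 'n mod_ring) set). log_deriv2_theta (\<eta> + twist \<tau> \<alpha>)) =
    (of_nat CARD('n))\<^sup>2 * log_deriv2_theta (of_nat CARD('n) * \<eta>)"
proof -
  let ?U = "UNIV :: ('n mod_ring \<times> 'n mod_ring) set"
  let ?N = "of_nat CARD('n) :: complex"
  obtain C \<mu> where C: "\<And>\<eta>. (\<Prod>\<alpha>\<in>?U. theta \<tau> (\<eta> + twist \<tau> \<alpha>)) = C * exp (\<mu> * \<eta>) * theta \<tau> (?N * \<eta>)"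
    using prod_theta_twist by blast
  have first: "(\<Sum>\<alpha>\<in>?U. log_deriv_theta (\<eta> + twist \<tau> \<alpha>)) = \<mu> + ?N * log_deriv_theta (?N * \<eta>)"
    if nz: "theta \<tau> (?N * \<eta>) \<noteq> 0" for \<eta>
  proof -
    let ?P = "\<Prod>\<alpha>\<in>?U. theta \<tau> (\<eta> + twist \<tau> \<alpha>)"
    have P: "?P \<noteq> 0" using theta_twist_nonzero[OF nz] by simp
    have "((\<lambda>\<eta>. \<Prod>\<alpha>\<in>?U. theta \<tau> (\<eta> + twist \<tau> \<alpha>)) has_field_derivative
        ?P * (\<Sum>\<alpha>\<in>?U. log_deriv_theta (\<eta> + twist \<tau> \<alpha>))) (at \<eta>)"
      unfolding log_deriv_theta_def
      by (rule has_field_derivative_prod')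
         (use theta_twist_nonzero[OF nz] in \<open>auto intro!: derivative_eq_intros DERIV_theta_chain[OF \<tau>]\<close>)
    moreover have "((\<lambda>\<eta>. C * exp (\<mu> * \<eta>) * theta \<tau> (?N * \<eta>)) has_field_derivative
        ?P * (\<mu> + ?N * log_deriv_theta (?N * \<eta>))) (at \<eta>)"
      unfolding C log_deriv_theta_def using nz
      by (auto intro!: derivative_eq_intros DERIV_theta_chain[OF \<tau>] simp: field_simps)
    ultimately have "?P * (\<Sum>\<alpha>\<in>?U. log_deriv_theta (\<eta> + twist \<tau> \<alpha>)) = ?P * (\<mu> + ?N * log_deriv_theta (?N * \<eta>))"
      unfolding C by (rule DERIV_unique)
    then show ?thesis using P by simp
  qed
  \<comment> \<open>To be differentiated again, the first-order identity must hold on a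
    neighbourhood of \<eta> and not only at the point.\<close>
  define S where "S = {\<eta>. theta \<tau> (?N * \<eta>) \<noteq> 0}"
  have S: "open S" unfolding S_def
    by (intro open_Collect_neq holomorphic_on_imp_continuous_on holomorphic_intros \<tau>)
  have "((\<lambda>\<eta>. \<Sum>\<alpha>\<in>?U. log_deriv_theta (\<eta> + twist \<tau> \<alpha>)) has_field_derivative
      (\<Sum>\<alpha>\<in>?U. log_deriv2_theta (\<eta> + twist \<tau> \<alpha>))) (at \<eta>)"
    using theta_twist_nonzero[OF nz]
    by (auto intro!: derivative_eq_intros DERIV_log_deriv_theta_chain)
  moreover have "((\<lambda>\<eta>. \<mu> + ?N * log_deriv_theta (?N * \<eta>)) has_field_derivative
      ?N\<^sup>2 * log_deriv2_theta (?N * \<eta>)) (at \<eta>)"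
    using nz by (auto intro!: derivative_eq_intros DERIV_log_deriv_theta_chain simp: power2_eq_square)
  then have "((\<lambda>\<eta>. \<Sum>\<alpha>\<in>?U. log_deriv_theta (\<eta> + twist \<tau> \<alpha>)) has_field_derivative
      ?N\<^sup>2 * log_deriv2_theta (?N * \<eta>)) (at \<eta>)"
    by (rule has_field_derivative_transform_within_open[OF _ S]) (use nz first in \<open>auto simp: S_def\<close>)
  ultimately show ?thesis by (rule DERIV_unique)
qed

text \<open>Every summand is an instance of \<open>k u x\<close>, which is even in \<open>x\<close>,
  with value 1 and second derivative \<open>2 * log_deriv2_theta u\<close> at 0. The difference
  \<open>f\<close> of the two sides thus has a double zero at 0 and degree-two multipliers, so it is
  a multiple of the square of theta. By \<open>sum_log_deriv2_theta\<close> its second derivative at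
  0 vanishes, which kills the multiple.\<close>

lemma unitarity_sum_diag:
  assumes nz: "theta \<tau> (of_nat CARD('n) * \<eta>) \<noteq> 0"
  shows "(\<Sum>\<alpha>\<in>(UNIV :: ('n::nontriv mod_ring \<times> 'n mod_ring) set). weight \<tau> \<eta> \<alpha> x * weight \<tau> \<eta> \<alpha> (- x)) =
    (of_nat CARD('n))\<^sup>2 * (theta \<tau> (of_nat CARD('n) * \<eta> + x) * theta \<tau> (of_nat CARD('n) * \<eta> - x)
      / (theta \<tau> (of_nat CARD('n) * \<eta>))\<^sup>2)"
proof -
  let ?U = "UNIV :: ('n mod_ring \<times> 'n mod_ring) set"
  let ?N = "of_nat CARD('n) :: complex"
  define k where "k u x = theta \<tau> (u + x) * theta \<tau> (u - x) / (theta \<tau> u)\<^sup>2" for u x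
  define k' where "k' u x = (deriv (theta \<tau>) (u + x) * theta \<tau> (u - x) - theta \<tau> (u + x) * deriv (theta \<tau>) (u - x)) / (theta \<tau> u)\<^sup>2" for u x
  have dk: "(k u has_field_derivative k' u x) (at x)" for u x
  proof -
    have "((\<lambda>x. theta \<tau> (u + x) * theta \<tau> (u - x)) has_field_derivative
        (deriv (theta \<tau>) (u + x) * theta \<tau> (u - x) - theta \<tau> (u + x) * deriv (theta \<tau>) (u - x))) (at x)"
      by (auto intro!: derivative_eq_intros DERIV_theta_chain[OF \<tau>] simp: algebra_simps)
    then show ?thesis unfolding k_def[abs_def] k'_def by (rule DERIV_cdivide)
  qed
  have dk': "(k' u has_field_derivative 2 * log_deriv2_theta u) (at 0)" for u
  proof -
    have "((\<lambda>x. deriv (theta \<tau>) (u + x) * theta \<tau> (u - x) - theta \<tau> (u + x) * deriv (theta \<tau>) (u - x))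
        has_field_derivative 2 * (deriv (deriv (theta \<tau>)) u * theta \<tau> u - (deriv (theta \<tau>) u)\<^sup>2)) (at 0)"
      by (auto intro!: derivative_eq_intros DERIV_theta_chain[OF \<tau>] DERIV_deriv_theta_chain
        simp: algebra_simps power2_eq_square)
    from DERIV_cdivide[OF this, of "(theta \<tau> u)\<^sup>2"] show ?thesis
      unfolding k'_def[abs_def] log_deriv2_theta_def by simp
  qed
  have card: "of_nat (card ?U) = ?N\<^sup>2"
    unfolding UNIV_Times_UNIV[symmetric] card_cartesian_product by (simp add: power2_eq_square)
  have ww: "weight \<tau> \<eta> \<alpha> x * weight \<tau> \<eta> \<alpha> (- x) = k (\<eta> + twist \<tau> \<alpha>) x" for x and \<alpha> :: "'n mod_ring \<times> 'n mod_ring"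
  proof -
    have 1: "x + \<eta> + twist \<tau> \<alpha> = \<eta> + twist \<tau> \<alpha> + x" "- x + \<eta> + twist \<tau> \<alpha> = \<eta> + twist \<tau> \<alpha> - x"
      by simp_all
    have "weight \<tau> \<eta> \<alpha> x * weight \<tau> \<eta> \<alpha> (- x) = (exp (2 * \<i> * pi * of_int (to_int_mod_ring (fst \<alpha>)) * x / ?N) *
        exp (2 * \<i> * pi * of_int (to_int_mod_ring (fst \<alpha>)) * (- x) / ?N)) * k (\<eta> + twist \<tau> \<alpha>) x"
      unfolding weight_def k_def 1 by (simp add: power2_eq_square del: mult_minus_right)
    also have "\<dots> = k (\<eta> + twist \<tau> \<alpha>) x" unfolding mult_exp_exp by simp
    finally show ?thesis .
  qed
  define f where "f x = (\<Sum>\<alpha>\<in>?U. k (\<eta> + twist \<tau> \<alpha>) x) - ?N\<^sup>2 * k (?N * \<eta>) x" for x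
  define f' where "f' x = (\<Sum>\<alpha>\<in>?U. k' (\<eta> + twist \<tau> \<alpha>) x) - ?N\<^sup>2 * k' (?N * \<eta>) x" for x
  have df: "(f has_field_derivative f' x) (at x)" for x
    unfolding f_def[abs_def] f'_def
    by (intro DERIV_diff DERIV_sum DERIV_cmult dk)
  have df': "(f' has_field_derivative 0) (at 0)"
  proof -
    have "(f' has_field_derivative (\<Sum>\<alpha>\<in>?U. 2 * log_deriv2_theta (\<eta> + twist \<tau> \<alpha>)) - ?N\<^sup>2 * (2 * log_deriv2_theta (?N * \<eta>))) (at 0)"
      unfolding f'_def[abs_def] by (intro DERIV_diff DERIV_sum DERIV_cmult dk')
    then show ?thesis using sum_log_deriv2_theta[OF nz] by (simp flip: sum_distrib_left)
  qed
  have theta_sub_tau: "theta \<tau> (v - (x + \<tau>)) = - exp (- \<i> * pi * \<tau> - 2 * \<i> * pi * (x - v)) * theta \<tau> (v - x)" for v x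
    using theta_add_tau[OF \<tau>, of "x - v"] theta_minus[OF \<tau>, of "x + \<tau> - v"] theta_minus[OF \<tau>, of "x - v"]
    by (simp add: algebra_simps)
  have theta_sub_1: "theta \<tau> (v - (x + 1)) = - theta \<tau> (v - x)" for v x
    using theta_add_1[OF \<tau>, of "x - v"] theta_minus[OF \<tau>, of "x + 1 - v"] theta_minus[OF \<tau>, of "x - v"]
    by (simp add: algebra_simps)
  have k1: "k v (x + 1) = k v x" for v x
    using theta_add_1[OF \<tau>, of "v + x"] by (simp only: k_def theta_sub_1) (simp add: add.assoc)
  have k2: "k v (x + \<tau>) = exp (- 2 * \<i> * pi * \<tau> - 4 * \<i> * pi * x) * k v x" for v x
  proof -
    have "exp (- 2 * \<i> * pi * \<tau> - 4 * \<i> * pi * x) = exp (- \<i> * pi * \<tau> - 2 * \<i> * pi * (v + x)) * exp (- \<i> * pi * \<tau> - 2 * \<i> * pi * (x - v))"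
      unfolding mult_exp_exp by (rule arg_cong[where f = exp]) (simp add: algebra_simps)
    moreover have "theta \<tau> (v + (x + \<tau>)) = - exp (- \<i> * pi * \<tau> - 2 * \<i> * pi * (v + x)) * theta \<tau> (v + x)"
      using theta_add_tau[OF \<tau>, of "v + x"] by (simp add: add.assoc)
    ultimately show ?thesis unfolding k_def theta_sub_tau by simp
  qed
  obtain C where C: "\<And>z. f z = C * (theta \<tau> z * theta \<tau> (z - 0))"
  proof (rule degree_two_theta[OF \<tau>, where f = f and s = 0 and a = 1 and b = 1])
    show "f holomorphic_on UNIV" using df
      by (auto simp: holomorphic_on_def field_differentiable_def intro: has_field_derivative_at_within)
    show "f (z + 1) = 1 * f z" for z unfolding f_def k1 by simp
    show "f (z + \<tau>) = 1 * exp (- 2 * \<i> * pi * \<tau> - 4 * \<i> * pi * z + 2 * \<i> * pi * 0) * f z" for z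
      unfolding f_def k2 sum_distrib_left[symmetric] by (simp add: right_diff_distrib mult_ac)
    show "f 0 = 0" using nz theta_twist_nonzero[OF nz]
      by (simp add: f_def k_def power2_eq_square[symmetric] card)
    have "deriv f 0 = 0" using DERIV_imp_deriv[OF df[of 0]] by (simp add: f'_def k'_def mult.commute)
    then show "theta \<tau> 0 \<noteq> 0 \<and> f 0 = 0 \<or> 0 = (0::complex) \<and> deriv f 0 = 0" by simp
  qed auto
  \<comment> \<open>The two expressions for the derivative of \<open>f\<close> are equated as
    functions, so that one further differentiation at 0 isolates \<open>C\<close>.\<close>
  have "(f has_field_derivative C * (2 * deriv (theta \<tau>) x * theta \<tau> x)) (at x)" for x
    unfolding C by (auto intro!: derivative_eq_intros DERIV_theta_chain[OF \<tau>])
  from DERIV_unique[OF df this] have "f' = (\<lambda>x. C * (2 * deriv (theta \<tau>) x * theta \<tau> x))" by blast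
  then have "(f' has_field_derivative C * (2 * (deriv (theta \<tau>) 0)\<^sup>2)) (at 0)"
    using theta_zero[OF \<tau>]
    by (auto intro!: derivative_eq_intros DERIV_theta_chain[OF \<tau>] DERIV_deriv_theta_chain simp: power2_eq_square)
  from DERIV_unique[OF df' this] have "C = 0" using deriv_theta_0[OF \<tau>] by simp
  then have "f x = 0" using C by simp
  then show ?thesis unfolding ww by (simp add: f_def k_def)
qed

end

section \<open>The sum of all weights and the crossing sum\<close>

context
  fixes \<tau> :: complex
  assumes \<tau> [simp]: "Im \<tau> > 0"
begin

text \<open>Here and in \<open>weight_eta_shift_tau\<close>, moving \<eta> by a torsion point
  permutes the indices \<alpha>, in the \<tau>-direction up to a factor common to all of them. Hence
  the sum over all \<alpha> is quasi-periodic in \<open>N * \<eta>\<close>.\<close>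

lemma weight_eta_shift_1:
  fixes \<alpha> :: "'n::nontriv mod_ring \<times> 'n mod_ring"
  shows "weight \<tau> (\<eta> + 1 / of_nat CARD('n)) \<alpha> x = weight \<tau> \<eta> (\<alpha> + (0, 1)) x"
proof -
  have "weight \<tau> \<eta> (\<alpha> + (0, 1)) x =
      exp (2 * \<i> * pi * of_int (to_int_mod_ring (fst \<alpha>)) * x / of_nat CARD('n))
     * (theta \<tau> (x + \<eta> + (of_int (to_int_mod_ring (fst \<alpha>)) * \<tau> + of_int (to_int_mod_ring (snd \<alpha>) + 1)) / of_nat CARD('n))
       / theta \<tau> (\<eta> + (of_int (to_int_mod_ring (fst \<alpha>)) * \<tau> + of_int (to_int_mod_ring (snd \<alpha>) + 1)) / of_nat CARD('n)))"
    by (rule weight_cong[OF \<tau>, symmetric]) (simp_all add: to_int_mod_ring_add)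
  also have "\<dots> = weight \<tau> (\<eta> + 1 / of_nat CARD('n)) \<alpha> x"
    unfolding weight_def twist_def by (simp add: add_divide_distrib add_ac)
  finally show ?thesis by simp
qed

lemma weight_eta_shift_tau:
  fixes \<alpha> :: "'n::nontriv mod_ring \<times> 'n mod_ring"
  shows "weight \<tau> (\<eta> + \<tau> / of_nat CARD('n)) \<alpha> x =
    exp (- 2 * \<i> * pi * x / of_nat CARD('n)) * weight \<tau> \<eta> (\<alpha> + (1, 0)) x"
proof -
  have "weight \<tau> \<eta> (\<alpha> + (1, 0)) x =
      exp (2 * \<i> * pi * of_int (to_int_mod_ring (fst \<alpha>) + 1) * x / of_nat CARD('n))
     * (theta \<tau> (x + \<eta> + (of_int (to_int_mod_ring (fst \<alpha>) + 1) * \<tau> + of_int (to_int_mod_ring (snd \<alpha>))) / of_nat CARD('n))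
       / theta \<tau> (\<eta> + (of_int (to_int_mod_ring (fst \<alpha>) + 1) * \<tau> + of_int (to_int_mod_ring (snd \<alpha>))) / of_nat CARD('n)))"
    by (rule weight_cong[OF \<tau>, symmetric]) (simp_all add: to_int_mod_ring_add)
  moreover have "exp (2 * \<i> * pi * of_int (to_int_mod_ring (fst \<alpha>)) * x / of_nat CARD('n)) =
      exp (- 2 * \<i> * pi * x / of_nat CARD('n)) * exp (2 * \<i> * pi * of_int (to_int_mod_ring (fst \<alpha>) + 1) * x / of_nat CARD('n))"
    unfolding mult_exp_exp by (rule arg_cong[where f = exp]) (simp add: field_simps)
  moreover have "\<eta> + (of_int (to_int_mod_ring (fst \<alpha>) + 1) * \<tau> + of_int (to_int_mod_ring (snd \<alpha>))) / of_nat CARD('n)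
      = \<eta> + \<tau> / of_nat CARD('n) + twist \<tau> \<alpha>"
    by (simp add: twist_def field_simps)
  ultimately show ?thesis
    unfolding weight_def by (simp add: add.assoc)
qed

lemma exp_2pi_i_eq_1_iff: "exp (2 * \<i> * pi * z) = 1 \<longleftrightarrow> (\<exists>k::int. z = of_int k)"
proof -
  have "2 * \<i> * pi * z = 0 + of_int (2 * k) * pi * \<i> \<longleftrightarrow> z = of_int k" for k :: int
    by auto
  then show ?thesis using exp_eq[of "2 * \<i> * pi * z" 0] by simp
qed

text \<open>The variable of the proof is \<open>v = N * \<eta>\<close>, because the terms have
  different multipliers in \<open>x\<close> but are permuted by translations of \<open>v\<close>.
  Multiplied by \<open>theta \<tau> v\<close>, the sum becomes the entire function \<open>S\<close>,
  with the multipliers of \<open>theta \<tau> (v + x / N)\<close>. The difference \<open>f\<close>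
  of \<open>S\<close> and a multiple of that function vanishes at 0, hence on the lattice, and
  dividing by theta leaves an exponential with incompatible multipliers, that is, 0.\<close>

lemma weight_sum:
  assumes x: "theta \<tau> (x / of_nat CARD('n)) \<noteq> 0" and nz: "theta \<tau> (of_nat CARD('n) * \<eta>) \<noteq> 0"
  shows "(\<Sum>\<alpha>\<in>(UNIV :: ('n::nontriv mod_ring \<times> 'n mod_ring) set). weight \<tau> \<eta> \<alpha> x) =
    of_nat CARD('n) * theta \<tau> x * theta \<tau> (x / of_nat CARD('n) + of_nat CARD('n) * \<eta>)
      / (theta \<tau> (x / of_nat CARD('n)) * theta \<tau> (of_nat CARD('n) * \<eta>))"
proof -
  let ?U = "UNIV :: ('n mod_ring \<times> 'n mod_ring) set"
  let ?N = "of_nat CARD('n) :: complex"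
  have dg: "deriv (\<lambda>v. theta \<tau> (v / ?N + t)) z = deriv (theta \<tau>) (z / ?N + t) / ?N" for t z
    by (rule DERIV_imp_deriv) (auto intro!: derivative_eq_intros DERIV_theta_chain[OF \<tau>])
  have "\<exists>q. q holomorphic_on UNIV \<and> (\<forall>v. theta \<tau> v = q v * theta \<tau> (v / ?N + twist \<tau> \<alpha>))" for \<alpha> :: "'n mod_ring \<times> 'n mod_ring"
  proof (rule entire_quotient[where f = "theta \<tau>" and g = "\<lambda>v. theta \<tau> (v / ?N + twist \<tau> \<alpha>)"])
    show "theta \<tau> z = 0" if "theta \<tau> (z / ?N + twist \<tau> \<alpha>) = 0" for z
      using theta_twist_nonzero[OF \<tau>, of "z / ?N" \<alpha>] that by auto
    show "deriv (\<lambda>v. theta \<tau> (v / ?N + twist \<tau> \<alpha>)) z \<noteq> 0" if "theta \<tau> (z / ?N + twist \<tau> \<alpha>) = 0" for z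
      unfolding dg using deriv_theta_nonzero[OF \<tau> that] by simp
    show "theta \<tau> holomorphic_on UNIV" by (rule holomorphic_theta_UNIV[OF \<tau>])
    show "(\<lambda>v. theta \<tau> (v / ?N + twist \<tau> \<alpha>)) holomorphic_on UNIV"
      by (intro holomorphic_intros \<tau>) auto
  qed blast
  then obtain q :: "'n mod_ring \<times> 'n mod_ring \<Rightarrow> complex \<Rightarrow> complex" where
    "\<forall>\<alpha>. q \<alpha> holomorphic_on UNIV \<and> (\<forall>v. theta \<tau> v = q \<alpha> v * theta \<tau> (v / ?N + twist \<tau> \<alpha>))"
    by metis
  then have q: "\<And>\<alpha>. q \<alpha> holomorphic_on UNIV"
    "\<And>\<alpha> v. theta \<tau> v = q \<alpha> v * theta \<tau> (v / ?N + twist \<tau> \<alpha>)"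
    by blast+
  define e where "e \<alpha> = exp (2 * \<i> * pi * of_int (to_int_mod_ring (fst \<alpha>)) * x / ?N)" for \<alpha> :: "'n mod_ring \<times> 'n mod_ring"
  define S where "S v = (\<Sum>\<alpha>\<in>?U. e \<alpha> * theta \<tau> (x + v / ?N + twist \<tau> \<alpha>) * q \<alpha> v)" for v
  have S_eq: "S v = theta \<tau> v * (\<Sum>\<alpha>\<in>?U. weight \<tau> (v / ?N) \<alpha> x)" if "theta \<tau> v \<noteq> 0" for v
    unfolding S_def sum_distrib_left
  proof (intro sum.cong refl)
    fix \<alpha> :: "'n mod_ring \<times> 'n mod_ring"
    have "theta \<tau> (v / ?N + twist \<tau> \<alpha>) \<noteq> 0"
      using theta_twist_nonzero[OF \<tau>, where ?'n = 'n and \<eta> = "v / ?N"] that by simp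
    then show "e \<alpha> * theta \<tau> (x + v / ?N + twist \<tau> \<alpha>) * q \<alpha> v = theta \<tau> v * weight \<tau> (v / ?N) \<alpha> x"
      using q(2)[of v \<alpha>] by (simp add: weight_def e_def)
  qed
  have S_holo: "S holomorphic_on UNIV"
    unfolding S_def by (intro holomorphic_intros \<tau> q) auto
  have theta_holo: "theta \<tau> holomorphic_on UNIV" by (rule holomorphic_theta_UNIV[OF \<tau>])
  have S_1: "S (v + 1) = - S v" for v
  proof (rule entire_cancel[where u = "\<lambda>v. S (v + 1)" and v = "\<lambda>v. - S v" and g = "theta \<tau>"])
    show "S (v + 1) * theta \<tau> v = - S v * theta \<tau> v" for v
    proof (cases "theta \<tau> v = 0")
      case False
      then have "S (v + 1) = - theta \<tau> v * (\<Sum>\<alpha>\<in>?U. weight \<tau> (v / ?N) (\<alpha> + (0, 1)) x)"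
        using S_eq[of "v + 1"] theta_add_1[OF \<tau>, of v]
        by (simp add: add_divide_distrib weight_eta_shift_1)
      then show ?thesis using S_eq[OF False] sum_shift[of "\<lambda>\<alpha> :: 'n mod_ring \<times> 'n mod_ring. weight \<tau> (v / ?N) \<alpha> x" "(0, 1)"] by simp
    qed simp
    show "(\<lambda>v. S (v + 1)) holomorphic_on UNIV"
      by (rule holomorphic_on_entire_compose[OF S_holo]) (intro holomorphic_intros)
    show "(\<lambda>v. - S v) holomorphic_on UNIV" by (intro holomorphic_intros S_holo)
  qed (fact theta_holo deriv_theta_nonzero[OF \<tau>])+
  define B where "B v = - exp (- \<i> * pi * \<tau> - 2 * \<i> * pi * v)" for v
  have S_tau: "S (v + \<tau>) = B v * exp (- 2 * \<i> * pi * x / ?N) * S v" for v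
  proof (rule entire_cancel[where u = "\<lambda>v. S (v + \<tau>)" and v = "\<lambda>v. B v * exp (- 2 * \<i> * pi * x / ?N) * S v" and g = "theta \<tau>"])
    show "S (v + \<tau>) * theta \<tau> v = B v * exp (- 2 * \<i> * pi * x / ?N) * S v * theta \<tau> v" for v
    proof (cases "theta \<tau> v = 0")
      case False
      have t: "theta \<tau> (v + \<tau>) = B v * theta \<tau> v" using theta_add_tau[OF \<tau>, of v] by (simp add: B_def)
      then have "theta \<tau> (v + \<tau>) \<noteq> 0" using False by (simp add: B_def)
      then have "S (v + \<tau>) = B v * theta \<tau> v * (exp (- 2 * \<i> * pi * x / ?N) * (\<Sum>\<alpha>\<in>?U. weight \<tau> (v / ?N) (\<alpha> + (1, 0)) x))"
        using S_eq[of "v + \<tau>"] t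
        by (simp add: add_divide_distrib weight_eta_shift_tau sum_distrib_left)
      then show ?thesis using S_eq[OF False] sum_shift[of "\<lambda>\<alpha> :: 'n mod_ring \<times> 'n mod_ring. weight \<tau> (v / ?N) \<alpha> x" "(1, 0)"] by simp
    qed simp
    show "(\<lambda>v. S (v + \<tau>)) holomorphic_on UNIV"
      by (rule holomorphic_on_entire_compose[OF S_holo]) (intro holomorphic_intros)
    show "(\<lambda>v. B v * exp (- 2 * \<i> * pi * x / ?N) * S v) holomorphic_on UNIV"
      unfolding B_def by (intro holomorphic_intros S_holo) auto
  qed (fact theta_holo deriv_theta_nonzero[OF \<tau>])+
  define K where "K = ?N * theta \<tau> x / theta \<tau> (x / ?N)"
  define f where "f v = S v - K * theta \<tau> (v + x / ?N)" for v
  have f_1: "f (v + 1) = - 1 * f v" for v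
    using S_1[of v] theta_add_1[OF \<tau>, of "v + x / ?N"] by (simp add: f_def algebra_simps)
  have f_tau: "f (v + \<tau>) = exp (- 2 * \<i> * pi * x / ?N) * B v * f v" for v
  proof -
    have "B (v + x / ?N) = B v * exp (- 2 * \<i> * pi * x / ?N)"
      unfolding B_def minus_mult_left[symmetric] mult_exp_exp
      by (rule arg_cong[where f = "\<lambda>x. - exp x"]) (simp add: algebra_simps)
    moreover have "theta \<tau> (v + \<tau> + x / ?N) = B (v + x / ?N) * theta \<tau> (v + x / ?N)"
      using theta_add_tau[OF \<tau>, of "v + x / ?N"] by (simp add: B_def add_ac)
    ultimately show ?thesis using S_tau[of v] by (simp add: f_def algebra_simps)
  qed
  have f_0: "f 0 = 0"
  proof -
    have tw0: "twist \<tau> (0 :: 'n mod_ring \<times> 'n mod_ring) = 0" by (simp add: twist_def)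
    \<comment> \<open>For the index 0 the quotient of theta values is 0/0 at \<open>v = 0\<close>;
      comparing derivatives gives N. Every other \<open>q \<alpha>\<close> vanishes there, because
      its denominator is theta at a nonzero torsion point.\<close>
    have q0: "q 0 0 = ?N"
    proof -
      have "((\<lambda>v. q 0 v * theta \<tau> (v / ?N + twist \<tau> (0 :: 'n mod_ring \<times> 'n mod_ring))) has_field_derivative q 0 0 * (deriv (theta \<tau>) 0 / ?N)) (at 0)"
        using holomorphic_derivI[OF q(1)[of 0] open_UNIV, of 0] unfolding tw0
        by (auto intro!: derivative_eq_intros DERIV_theta_chain[OF \<tau>] simp: theta_zero[OF \<tau>])
      from DERIV_unique[OF this[folded q(2)] DERIV_theta[OF \<tau>]]
      show ?thesis using deriv_theta_0[OF \<tau>] by (simp add: field_simps)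
    qed
    have q\<alpha>: "q \<alpha> 0 = 0" if "\<alpha> \<noteq> 0" for \<alpha>
    proof -
      have "theta \<tau> (twist \<tau> \<alpha>) \<noteq> 0"
      proof
        assume "theta \<tau> (twist \<tau> \<alpha>) = 0"
        then obtain k m :: int where "twist \<tau> \<alpha> = of_int k + of_int m * \<tau>"
          using theta_eq_0_iff[OF \<tau>] by blast
        then have eq: "of_int (to_int_mod_ring (fst \<alpha>)) * \<tau> + of_int (to_int_mod_ring (snd \<alpha>)) =
            of_int (int CARD('n) * k) + of_int (int CARD('n) * m) * \<tau>"
          by (simp add: twist_def field_simps)
        from arg_cong[OF eq, of Im] have "real_of_int (to_int_mod_ring (fst \<alpha>)) * Im \<tau> = real_of_int (int CARD('n) * m) * Im \<tau>"
          by simp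
        then have "real_of_int (to_int_mod_ring (fst \<alpha>)) = real_of_int (int CARD('n) * m)"
          using \<tau> by (metis less_irrefl mult_right_cancel)
        then have 1: "to_int_mod_ring (fst \<alpha>) = int CARD('n) * m" by (simp only: of_int_eq_iff)
        with eq have "complex_of_int (to_int_mod_ring (snd \<alpha>)) = of_int (int CARD('n) * k)" by simp
        then have 2: "to_int_mod_ring (snd \<alpha>) = int CARD('n) * k" by (simp only: of_int_eq_iff)
        have "to_int_mod_ring a = 0 \<Longrightarrow> a = 0" for a :: "'n mod_ring" by transfer simp
        moreover have "to_int_mod_ring (fst \<alpha>) = 0" "to_int_mod_ring (snd \<alpha>) = 0"
          using to_int_mod_ring_mod[of "fst \<alpha>"] to_int_mod_ring_mod[of "snd \<alpha>"] unfolding 1 2 by auto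
        ultimately show False using that by (auto simp: prod_eq_iff)
      qed
      then show ?thesis using q(2)[of 0 \<alpha>] theta_zero[OF \<tau>] by simp
    qed
    have "S 0 = (\<Sum>\<alpha>\<in>{0}. e \<alpha> * theta \<tau> (x + 0 / ?N + twist \<tau> \<alpha>) * q \<alpha> 0)"
      unfolding S_def by (rule sum.mono_neutral_right) (auto simp: q\<alpha>)
    then have "S 0 = theta \<tau> x * ?N" by (simp add: q0 tw0 e_def)
    then show ?thesis using x by (simp add: f_def K_def)
  qed
  have B0: "B v \<noteq> 0" for v by (simp add: B_def)
  have van: "f v = 0" if "theta \<tau> v = 0" for v
  proof -
    from that obtain k m :: int where "v = of_int k + of_int m * \<tau>" using theta_eq_0_iff[OF \<tau>] by blast
    then show ?thesis
      using zeros_lattice_invariant[OF \<tau>, where f = f and s = 0 and k = k and m = m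
        and A = "\<lambda>_. - 1" and B = "\<lambda>v. exp (- 2 * \<i> * pi * x / ?N) * B v"] f_1 f_tau f_0 B0 by simp
  qed
  obtain h where h: "h holomorphic_on UNIV" "\<And>v. f v = h v * theta \<tau> v" "\<And>v. h (v + 1) = 1 * h v"
    "\<And>v. h (v + \<tau>) = exp (- 2 * \<i> * pi * x / ?N) * h v"
  proof (rule entire_quotient_quasiperiodic[where f = f and g = "theta \<tau>" and ?w1.0 = 1 and ?w2.0 = \<tau>
      and a = "\<lambda>_. 1" and A = "\<lambda>_. - 1" and b = "\<lambda>_. exp (- 2 * \<i> * pi * x / ?N)" and B = B])
    show "f holomorphic_on UNIV" unfolding f_def by (intro holomorphic_intros S_holo \<tau>)
    show "f (z + 1) = 1 * - 1 * f z" for z using f_1 by simp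
    show "theta \<tau> (z + \<tau>) = B z * theta \<tau> z" for z
      using theta_add_tau[OF \<tau>, of z] by (simp add: B_def)
  qed (use theta_holo van deriv_theta_nonzero[OF \<tau>] theta_add_1[OF \<tau>] f_tau B0 in auto)
  obtain C \<mu> where C: "\<And>z. h z = C * exp (\<mu> * z)"
    by (rule entire_quasiperiodic_exponential[where h = h and \<tau> = \<tau> and a = 1 and b = "exp (- 2 * \<i> * pi * x / ?N)",
          OF h(1) \<tau> h(3) one_neq_zero h(4) exp_not_eq_zero]) (rule that)
  \<comment> \<open>A nonzero exponential with the multipliers of \<open>h\<close> would force
    \<open>x / N\<close> to be a period, which is excluded by
    \<open>theta \<tau> (x / N) \<noteq> 0\<close>.\<close>
  have "C = 0"
  proof (rule ccontr)
    assume "C \<noteq> 0"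
    then have "exp \<mu> = 1" "exp (\<mu> * \<tau>) = exp (- 2 * \<i> * pi * x / ?N)"
      using h(3)[of 0] h(4)[of 0] by (simp_all add: C)
    then obtain k :: int where k: "\<mu> = 2 * \<i> * pi * of_int k"
      using exp_2pi_i_eq_1_iff[of "\<mu> / (2 * \<i> * pi)"] by (auto simp: field_simps)
    have "exp (2 * \<i> * pi * (of_int k * \<tau> + x / ?N)) = exp (\<mu> * \<tau>) / exp (- 2 * \<i> * pi * x / ?N)"
      unfolding exp_diff[symmetric] k by (rule arg_cong[where f = exp]) (simp add: algebra_simps)
    also have "\<dots> = 1" using \<open>exp (\<mu> * \<tau>) = _\<close> by simp
    finally obtain l :: int where "of_int k * \<tau> + x / ?N = of_int l" using exp_2pi_i_eq_1_iff by blast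
    then have "x / ?N = of_int l + of_int (- k) * \<tau>" by (simp add: algebra_simps)
    then show False using x theta_eq_0_iff[OF \<tau>] by blast
  qed
  then have "f (?N * \<eta>) = 0" using h(2) C by simp
  then have "theta \<tau> (?N * \<eta>) * (\<Sum>\<alpha>\<in>?U. weight \<tau> \<eta> \<alpha> x) = K * theta \<tau> (?N * \<eta> + x / ?N)"
    using S_eq[OF nz] by (simp add: f_def)
  then have "(\<Sum>\<alpha>\<in>?U. weight \<tau> \<eta> \<alpha> x) = K * theta \<tau> (?N * \<eta> + x / ?N) / theta \<tau> (?N * \<eta>)"
    using nz by (simp add: field_simps)
  then show ?thesis by (simp add: K_def add.commute mult_ac)
qed

text \<open>At \<open>x = 0\<close> one of the two weights in each summand is 1, and the sum becomes
  the sum of all weights at \<open>- s\<close> with \<open>s = N * (N * \<eta>)\<close>; by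
  \<open>weight_sum\<close> it contains the factor \<open>theta \<tau> 0\<close> and vanishes. After
  reindexing the same happens at \<open>x = s\<close>. So \<open>degree_two_theta\<close> applies: a
  nontrivial multiplier settles nonzero \<gamma>, and for \<open>\<gamma> = 0\<close> the constant
  is read off from the derivative at 0.\<close>

private lemma crossing_sum_generic:
  fixes \<gamma> :: "'n::nontriv mod_ring \<times> 'n mod_ring"
  defines "N \<equiv> of_nat CARD('n)"
  assumes nz: "theta \<tau> (N * \<eta>) \<noteq> 0" and nzz: "theta \<tau> (N * (N * \<eta>)) \<noteq> 0"
  shows "(\<Sum>\<alpha>\<in>UNIV. weight \<tau> \<eta> \<alpha> (x - N * (N * \<eta>)) * weight \<tau> \<eta> (\<alpha> - \<gamma>) (- x)) =
    (if \<gamma> = 0 then - N\<^sup>2 * theta \<tau> x * theta \<tau> (x - N * (N * \<eta>)) / (theta \<tau> (N * \<eta>))\<^sup>2 else 0)"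
proof -
  let ?U = "UNIV :: ('n mod_ring \<times> 'n mod_ring) set"
  define s where "s = N * (N * \<eta>)"
  have N0: "N \<noteq> 0" by (simp add: N_def)
  have twnz: "theta \<tau> (\<eta> + twist \<tau> \<alpha>) \<noteq> 0" for \<alpha> :: "'n mod_ring \<times> 'n mod_ring"
    by (rule theta_twist_nonzero[OF \<tau> nz[unfolded N_def]])
  have w0: "weight \<tau> \<eta> \<alpha> 0 = 1" for \<alpha> :: "'n mod_ring \<times> 'n mod_ring"
    by (rule weight_0[OF \<tau> twnz])
  have sN: "- s / N = - (N * \<eta>)" using N0 by (simp add: s_def)
  have nzm: "theta \<tau> (- s / N) \<noteq> 0" unfolding sN using nz by (simp add: theta_minus[OF \<tau>])
  have W: "(\<Sum>\<alpha>\<in>?U. weight \<tau> \<eta>' \<alpha> (- s)) =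
      N * theta \<tau> (- s) * theta \<tau> (- s / N + N * \<eta>') / (theta \<tau> (- s / N) * theta \<tau> (N * \<eta>'))"
    if "theta \<tau> (N * \<eta>') \<noteq> 0" for \<eta>'
    using weight_sum[of "- s" \<eta>', where ?'n = 'n] nzm that by (simp add: N_def)
  have W0: "(\<Sum>\<alpha>\<in>?U. weight \<tau> \<eta> \<alpha> (- s)) = 0"
    unfolding W[OF nz] sN by (simp add: theta_zero[OF \<tau>])
  define f where "f x = (\<Sum>\<alpha>\<in>?U. weight \<tau> \<eta> \<alpha> (x - s) * weight \<tau> \<eta> (\<alpha> - \<gamma>) (- x))" for x
  define w' where "w' \<alpha> y = deriv (weight \<tau> \<eta> \<alpha>) y" for \<alpha> :: "'n mod_ring \<times> 'n mod_ring" and y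
  obtain C where C: "\<And>z. f z = C * (theta \<tau> z * theta \<tau> (z - s))"
    "chi (fst \<gamma>) \<noteq> 1 \<or> inverse (chi (snd \<gamma>)) \<noteq> 1 \<Longrightarrow> C = 0"
  proof (rule degree_two_theta[OF \<tau>, where f = f and s = s and a = "chi (fst \<gamma>)" and b = "inverse (chi (snd \<gamma>))"])
    show "f holomorphic_on UNIV" unfolding f_def
      by (intro holomorphic_intros holomorphic_on_weight[OF \<tau>])
    show "f (z + 1) = chi (fst \<gamma>) * f z" for z
      using weight_product_add_1[OF \<tau>, where s = s and x = z and \<gamma> = \<gamma>]
      unfolding f_def sum_distrib_left by (intro sum.cong) simp_all
    show "f (z + \<tau>) = inverse (chi (snd \<gamma>)) *
        exp (- 2 * \<i> * pi * \<tau> - 4 * \<i> * pi * z + 2 * \<i> * pi * s) * f z" for z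
      using weight_product_add_tau[OF \<tau>, where s = s and x = z and \<gamma> = \<gamma>]
      unfolding f_def sum_distrib_left by (intro sum.cong) simp_all
    show "f 0 = 0" using W0 by (simp add: f_def w0)
    have "f s = (\<Sum>\<alpha>\<in>?U. weight \<tau> \<eta> (\<alpha> - \<gamma>) (- s))" by (simp add: f_def w0)
    also have "\<dots> = 0"
      using sum_shift[of "\<lambda>\<alpha>. weight \<tau> \<eta> (\<alpha> - \<gamma>) (- s)" \<gamma>] W0 by simp
    finally show "theta \<tau> s \<noteq> 0 \<and> f s = 0 \<or> s = 0 \<and> deriv f 0 = 0" using nzz by (simp add: s_def)
  qed (auto simp: norm_inverse)
  have C_eq: "C = - N\<^sup>2 / (theta \<tau> (N * \<eta>))\<^sup>2" if \<gamma>: "\<gamma> = 0"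
  proof -
    have "(f has_field_derivative (\<Sum>\<alpha>\<in>?U. w' \<alpha> (- s) - weight \<tau> \<eta> \<alpha> (- s) * w' \<alpha> 0)) (at 0)"
      unfolding f_def w'_def
      by (auto intro!: derivative_eq_intros DERIV_weight[OF \<tau>] simp: w0 \<gamma> mult.commute)
    moreover have "(f has_field_derivative C * (deriv (theta \<tau>) 0 * theta \<tau> (- s))) (at 0)"
      unfolding C(1) by (auto intro!: derivative_eq_intros DERIV_theta_chain[OF \<tau>] simp: theta_zero[OF \<tau>])
    ultimately have 1: "C * (deriv (theta \<tau>) 0 * theta \<tau> (- s)) = (\<Sum>\<alpha>\<in>?U. w' \<alpha> (- s) - weight \<tau> \<eta> \<alpha> (- s) * w' \<alpha> 0)"
      by (rule DERIV_unique[symmetric])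
    \<comment> \<open>The summands of the derivative at \<open>x = 0\<close> are recognized as
      \<eta>-derivatives of the weights at the fixed point \<open>- s\<close>. The theta quotient is
      differentiated in its common translation \<open>u\<close>, and the contributions of the
      exponential prefactor cancel.\<close>
    have deta: "((\<lambda>\<eta>'. weight \<tau> \<eta>' \<alpha> (- s)) has_field_derivative
        (w' \<alpha> (- s) - weight \<tau> \<eta> \<alpha> (- s) * w' \<alpha> 0)) (at \<eta>)" for \<alpha> :: "'n mod_ring \<times> 'n mod_ring"
    proof -
      define u where "u = \<eta> + twist \<tau> \<alpha>"
      define a where "a = 2 * \<i> * pi * of_int (to_int_mod_ring (fst \<alpha>)) / N"
      have u: "theta \<tau> u \<noteq> 0" using twnz by (simp add: u_def)
      have wt: "weight \<tau> \<eta>' \<alpha> y = exp (a * y) * (theta \<tau> (y + \<eta>' + twist \<tau> \<alpha>) / theta \<tau> (\<eta>' + twist \<tau> \<alpha>))" for \<eta>' y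
        by (simp add: weight_def a_def N_def)
      have w\<eta>: "weight \<tau> \<eta> \<alpha> y = exp (a * y) * (theta \<tau> (y + u) / theta \<tau> u)" for y
        by (simp add: wt u_def add.assoc)
      have "((\<lambda>y. exp (a * y) * (theta \<tau> (y + u) / theta \<tau> u)) has_field_derivative
          a * exp (a * y) * (theta \<tau> (y + u) / theta \<tau> u) + exp (a * y) * (deriv (theta \<tau>) (y + u) / theta \<tau> u)) (at y)" for y
        using u by (auto intro!: derivative_eq_intros DERIV_theta_chain[OF \<tau>] simp: field_simps)
      then have w'_eq: "w' \<alpha> y = a * exp (a * y) * (theta \<tau> (y + u) / theta \<tau> u) + exp (a * y) * (deriv (theta \<tau>) (y + u) / theta \<tau> u)" for y
        unfolding w'_def w\<eta>[abs_def] by (rule DERIV_imp_deriv)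
      have "((\<lambda>\<eta>'. theta \<tau> (- s + \<eta>' + twist \<tau> \<alpha>) / theta \<tau> (\<eta>' + twist \<tau> \<alpha>)) has_field_derivative
          (deriv (theta \<tau>) (- s + \<eta> + twist \<tau> \<alpha>) * theta \<tau> (\<eta> + twist \<tau> \<alpha>)
            - theta \<tau> (- s + \<eta> + twist \<tau> \<alpha>) * deriv (theta \<tau>) (\<eta> + twist \<tau> \<alpha>))
          / (theta \<tau> (\<eta> + twist \<tau> \<alpha>) * theta \<tau> (\<eta> + twist \<tau> \<alpha>))) (at \<eta>)"
        using twnz[of \<alpha>] by (auto intro!: derivative_eq_intros DERIV_theta_chain[OF \<tau>])
      from DERIV_cmult[OF this, of "exp (a * (- s))"]
      have "((\<lambda>\<eta>'. weight \<tau> \<eta>' \<alpha> (- s)) has_field_derivative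
          exp (a * (- s)) * ((deriv (theta \<tau>) (- s + u) * theta \<tau> u - theta \<tau> (- s + u) * deriv (theta \<tau>) u) / (theta \<tau> u * theta \<tau> u))) (at \<eta>)"
        unfolding wt u_def add.assoc by simp
      also have "exp (a * (- s)) * ((deriv (theta \<tau>) (- s + u) * theta \<tau> u - theta \<tau> (- s + u) * deriv (theta \<tau>) u) / (theta \<tau> u * theta \<tau> u))
          = w' \<alpha> (- s) - weight \<tau> \<eta> \<alpha> (- s) * w' \<alpha> 0"
      proof -
        have "E * ((T' * d - T * d') / (d * d)) =
            (a * E * (T / d) + E * (T' / d)) - E * (T / d) * (a * 1 * (d / d) + 1 * (d' / d))"
          if "d \<noteq> 0" for E T T' d d' :: complex
          using that by (simp add: field_simps)
        from this[OF u] show ?thesis unfolding w'_eq w\<eta> by simp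
      qed
      finally show ?thesis .
    qed
    have "((\<lambda>\<eta>'. \<Sum>\<alpha>\<in>?U. weight \<tau> \<eta>' \<alpha> (- s)) has_field_derivative
        (\<Sum>\<alpha>\<in>?U. w' \<alpha> (- s) - weight \<tau> \<eta> \<alpha> (- s) * w' \<alpha> 0)) (at \<eta>)"
      by (intro DERIV_sum deta)
    \<comment> \<open>Here \<open>s\<close> stays fixed while \<open>\<eta>'\<close> varies. The
      closed form vanishes at \<eta>, so only the derivative of its vanishing theta factor
      contributes.\<close>
    moreover have "((\<lambda>\<eta>'. \<Sum>\<alpha>\<in>?U. weight \<tau> \<eta>' \<alpha> (- s)) has_field_derivative
        - N\<^sup>2 * theta \<tau> (- s) * deriv (theta \<tau>) 0 / (theta \<tau> (N * \<eta>))\<^sup>2) (at \<eta>)"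
    proof (rule has_field_derivative_transform_within_open)
      show "((\<lambda>\<eta>'. N * theta \<tau> (- s) / theta \<tau> (- s / N) * (theta \<tau> (- s / N + N * \<eta>') / theta \<tau> (N * \<eta>')))
          has_field_derivative - N\<^sup>2 * theta \<tau> (- s) * deriv (theta \<tau>) 0 / (theta \<tau> (N * \<eta>))\<^sup>2) (at \<eta>)"
        unfolding sN using nz
        by (auto intro!: derivative_eq_intros DERIV_theta_chain[OF \<tau>]
              simp: theta_zero[OF \<tau>] theta_minus[OF \<tau>] power2_eq_square)
      show "open {\<eta>'. theta \<tau> (N * \<eta>') \<noteq> 0}"
        by (intro open_Collect_neq holomorphic_on_imp_continuous_on holomorphic_intros \<tau>)
    qed (use nz W in auto)
    ultimately have "(\<Sum>\<alpha>\<in>?U. w' \<alpha> (- s) - weight \<tau> \<eta> \<alpha> (- s) * w' \<alpha> 0) =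
        - N\<^sup>2 * theta \<tau> (- s) * deriv (theta \<tau>) 0 / (theta \<tau> (N * \<eta>))\<^sup>2"
      by (rule DERIV_unique)
    then have "C * (deriv (theta \<tau>) 0 * theta \<tau> (- s)) =
        (- N\<^sup>2 / (theta \<tau> (N * \<eta>))\<^sup>2) * (deriv (theta \<tau>) 0 * theta \<tau> (- s))"
      using 1 by (simp add: mult_ac)
    then show ?thesis
      using deriv_theta_0[OF \<tau>] nzz by (simp only: mult_cancel_right) (simp add: s_def theta_minus[OF \<tau>])
  qed
  show ?thesis
  proof (cases "\<gamma> = 0")
    case True
    then show ?thesis using C(1)[of x] C_eq by (simp add: f_def s_def)
  next
    case False
    then have "C = 0" using C(2) by (auto simp: chi_eq_1_iff prod_eq_iff)
    then show ?thesis using C(1)[of x] False by (simp add: f_def s_def)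
  qed
qed

text \<open>The points where \<open>N\<^sup>2 \<eta>\<close> lies in the period lattice are reached by continuity.\<close>

lemma crossing_sum:
  fixes \<gamma> :: "'n::nontriv mod_ring \<times> 'n mod_ring"
  defines "N \<equiv> of_nat CARD('n)"
  assumes nz: "theta \<tau> (N * \<eta>) \<noteq> 0"
  shows "(\<Sum>\<alpha>\<in>UNIV. weight \<tau> \<eta> \<alpha> (x - N * (N * \<eta>)) * weight \<tau> \<eta> (\<alpha> - \<gamma>) (- x)) =
    (if \<gamma> = 0 then - N\<^sup>2 * theta \<tau> x * theta \<tau> (x - N * (N * \<eta>)) / (theta \<tau> (N * \<eta>))\<^sup>2 else 0)"
proof (cases "theta \<tau> (N * (N * \<eta>)) = 0")
  case False
  then show ?thesis using crossing_sum_generic[of \<eta> x \<gamma>] nz by (simp add: N_def)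
next
  case True
  have N0: "N \<noteq> 0" by (simp add: N_def)
  define S where "S = {t. theta \<tau> (N * t) \<noteq> 0}"
  have S: "open S" unfolding S_def
    by (intro open_Collect_neq holomorphic_on_imp_continuous_on holomorphic_intros \<tau>)
  have nzS: "theta \<tau> (t + twist \<tau> \<alpha>) \<noteq> 0" if "t \<in> S" for t and \<alpha> :: "'n mod_ring \<times> 'n mod_ring"
    using that theta_twist_nonzero[OF \<tau>, of t \<alpha>] by (simp add: S_def N_def)
  define F where "F t = (\<Sum>\<alpha>\<in>UNIV. weight \<tau> t \<alpha> (x - N * (N * t)) * weight \<tau> t (\<alpha> - \<gamma>) (- x))
     - (if \<gamma> = 0 then - N\<^sup>2 * theta \<tau> x * theta \<tau> (x - N * (N * t)) / (theta \<tau> (N * t))\<^sup>2 else 0)" for t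
  have hif: "(\<lambda>t. if \<gamma> = 0 then - N\<^sup>2 * theta \<tau> x * theta \<tau> (x - N * (N * t)) / (theta \<tau> (N * t))\<^sup>2 else 0) holomorphic_on S"
    by (cases "\<gamma> = 0") (auto simp: S_def intro!: holomorphic_intros \<tau>)
  have hw: "(\<lambda>t. weight \<tau> t \<alpha> (g t)) holomorphic_on S" if g: "g holomorphic_on S"
    for g and \<alpha> :: "'n mod_ring \<times> 'n mod_ring"
    unfolding weight_def
    by (intro holomorphic_on_mult holomorphic_on_divide holomorphic_on_exp' holomorphic_on_theta[OF \<tau>]
          holomorphic_on_add holomorphic_on_const holomorphic_on_ident g nzS) auto
  have "(\<lambda>t. \<Sum>\<alpha>\<in>UNIV. weight \<tau> t \<alpha> (x - N * (N * t)) * weight \<tau> t (\<alpha> - \<gamma>) (- x)) holomorphic_on S"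
    by (intro holomorphic_on_sum holomorphic_on_mult hw) (intro holomorphic_intros)+
  then have "F holomorphic_on S"
    unfolding F_def[abs_def] using hif by (rule holomorphic_on_diff)
  then have "isCont F \<eta>"
    using continuous_on_eq_continuous_at[OF S, of F] holomorphic_on_imp_continuous_on[of F S] nz
    by (auto simp: S_def)
  then have lim: "(F \<longlongrightarrow> F \<eta>) (at \<eta>)" by (simp add: isCont_def)
  have dg: "deriv (\<lambda>t. theta \<tau> (N * (N * t))) \<eta> = N * N * deriv (theta \<tau>) (N * (N * \<eta>))"
    by (rule DERIV_imp_deriv) (auto intro!: derivative_eq_intros DERIV_theta_chain[OF \<tau>])
  \<comment> \<open>The excluded value of \<open>t\<close> is a simple zero of an entire function,
    hence isolated.\<close>
  have "eventually (\<lambda>t. theta \<tau> (N * (N * t)) \<noteq> 0) (at \<eta>)"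
    by (rule eventually_nonzero_at_simple_zero)
       (use True deriv_theta_nonzero[OF \<tau> True] N0 in \<open>auto simp: dg intro!: holomorphic_intros \<tau>\<close>)
  moreover have "eventually (\<lambda>t. t \<in> S) (at \<eta>)"
    by (rule eventually_at_in_open'[OF S]) (use nz in \<open>simp add: S_def\<close>)
  ultimately have "eventually (\<lambda>t. F t = 0) (at \<eta>)"
  proof eventually_elim
    case (elim t)
    then show ?case using crossing_sum_generic[of t x \<gamma>] by (simp add: F_def S_def N_def)
  qed
  then have "(F \<longlongrightarrow> 0) (at \<eta>)" by (rule tendsto_eventually)
  with lim have "F \<eta> = 0" using tendsto_unique at_neq_bot by blast
  then show ?thesis by (simp add: F_def)
qed

end

no_notation fps_nth (infixl "$" 75)

section \<open>Matrix algebra\<close>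

lemma mat_eqI: "(\<And>i j. A $ i $ j = B $ i $ j) \<Longrightarrow> A = B"
  by (simp add: vec_eq_iff)

lemma matrix_mult_nth: "(A ** B) $ i $ j = (\<Sum>k\<in>UNIV. A $ i $ k * B $ k $ j)"
  by (simp add: matrix_matrix_mult_def)

lemma tensor_nth [simp]: "tensor A B $ i $ j = A $ fst i $ fst j * B $ snd i $ snd j"
  by (simp add: tensor_def)

lemma flip_nth [simp]: "flip A $ i $ j = A $ prod.swap i $ prod.swap j"
  by (simp add: flip_def)

lemma transp2_nth [simp]: "transp2 A $ i $ j = A $ (fst i, snd j) $ (fst j, snd i)"
  by (simp add: transp2_def)

lemma mat_nth: "mat c $ i $ j = (if i = j then c else 0)"
  by (simp add: mat_def)

lemma sum_UNIV_prod: "(\<Sum>k\<in>UNIV. f k) = (\<Sum>a\<in>UNIV. \<Sum>b\<in>UNIV. f (a, b))"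
  by (simp add: UNIV_Times_UNIV[symmetric] sum.cartesian_product del: UNIV_Times_UNIV)

lemma matrix_inv_eqI:
  assumes "A ** B = mat 1" "B ** A = mat 1"
  shows "matrix_inv A = B"
  unfolding matrix_inv_def
proof (rule some_equality)
  fix C assume "A ** C = mat 1 \<and> C ** A = mat 1"
  then have "C = (B ** A) ** C" "B ** (A ** C) = B" using assms by simp_all
  then show "C = B" by (simp add: matrix_mul_assoc)
qed (use assms in simp)

lemma matrix_inv_of_invertible:
  assumes "invertible A"
  shows "A ** matrix_inv A = mat 1" "matrix_inv A ** A = mat 1"
  using someI_ex[OF assms[unfolded invertible_def]] unfolding matrix_inv_def by auto

lemma smult_matrix_mult:
  fixes A :: "('a::comm_semiring_1, 'm::finite) vec ^ 'l" and B :: "'a ^ 'k ^ 'm"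
  shows smult_matrix_mult_left: "map_matrix ((*) c) A ** B = map_matrix ((*) c) (A ** B)"
    and smult_matrix_mult_right: "A ** map_matrix ((*) c) B = map_matrix ((*) c) (A ** B)"
  by (rule mat_eqI; simp add: matrix_mult_nth sum_distrib_left mult_ac)+

lemma smult_smult_matrix: "map_matrix ((*) (c::'a::comm_semiring_1)) (map_matrix ((*) d) A) = map_matrix ((*) (c * d)) A"
  by (rule mat_eqI) (simp add: mult.assoc)

lemma smult_1_matrix [simp]: "map_matrix ((*) (1::'a::comm_semiring_1)) A = A"
  by (rule mat_eqI) simp

lemma smult_sum_matrix:
  "map_matrix ((*) (c::'a::comm_semiring_1)) (\<Sum>x\<in>S. A x) = (\<Sum>x\<in>S. map_matrix ((*) c) (A x))"
  by (rule mat_eqI) (simp add: sum_component sum_distrib_left)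

lemma sum_matrix_mult_left: "(\<Sum>x\<in>S. A x) ** B = (\<Sum>x\<in>S. A x ** B)"
  by (rule mat_eqI) (simp add: matrix_mult_nth sum_component sum_distrib_right sum.swap[of _ _ S])

lemma sum_matrix_mult_right: "B ** (\<Sum>x\<in>S. A x) = (\<Sum>x\<in>S. B ** A x)"
  by (rule mat_eqI) (simp add: matrix_mult_nth sum_component sum_distrib_left sum.swap[of _ _ S])

text \<open>The entries of \<open>B\<close> and \<open>C\<close> have to change places, whence the
  commutative entries. Over the operator algebra the embeddings \<open>emb1\<close> and
  \<open>emb2\<close> are multiplied slot by slot instead.\<close>

lemma tensor_mult:
  fixes A B C D :: "('a::comm_semiring_1, 'n::finite) zmat"
  shows "tensor A B ** tensor C D = tensor (A ** C) (B ** D)"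
  by (rule mat_eqI) (simp add: matrix_mult_nth sum_UNIV_prod sum_product mult_ac)

lemma tensor_mat_1 [simp]: "tensor (mat 1) (mat 1) = mat 1"
  by (rule mat_eqI) (auto simp: mat_nth prod_eq_iff)

lemma flip_mult: "flip (A ** B) = flip A ** flip B"
proof (rule mat_eqI)
  fix i j
  have "(\<Sum>k\<in>UNIV. A $ prod.swap i $ k * B $ k $ prod.swap j) =
      (\<Sum>k\<in>UNIV. A $ prod.swap i $ prod.swap k * B $ prod.swap k $ prod.swap j)"
    by (rule sum.reindex_bij_betw[symmetric]) (rule bij_swap)
  then show "flip (A ** B) $ i $ j = (flip A ** flip B) $ i $ j" by (simp add: matrix_mult_nth)
qed

lemma flip_tensor: "flip (tensor A B) = tensor B (A :: ('a::comm_semiring_1, 'n::finite) zmat)"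
  by (rule mat_eqI) (simp add: mult.commute)

lemma flip_flip [simp]: "flip (flip A) = A"
  by (rule mat_eqI) simp

lemma flip_mat [simp]: "flip (mat c) = mat c"
  by (rule mat_eqI) (auto simp: mat_nth)

lemma flip_smult: "flip (map_matrix ((*) c) A) = map_matrix ((*) c) (flip A)"
  by (rule mat_eqI) simp

lemma flip_sum: "flip (\<Sum>x\<in>S. A x) = (\<Sum>x\<in>S. flip (A x))"
  by (rule mat_eqI) (simp add: sum_component)

lemma transp2_tensor: "transp2 (tensor A B) = tensor A (transpose B)"
  by (rule mat_eqI) (simp add: transpose_def)

lemma transp2_mat [simp]: "transp2 (mat c) = mat c"
  by (rule mat_eqI) (auto simp: mat_nth prod_eq_iff)

lemma transp2_smult: "transp2 (map_matrix ((*) c) A) = map_matrix ((*) c) (transp2 A)"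
  by (rule mat_eqI) simp

lemma transp2_sum: "transp2 (\<Sum>x\<in>S. A x) = (\<Sum>x\<in>S. transp2 (A x))"
  by (rule mat_eqI) (simp add: sum_component)

section \<open>The Heisenberg group matrices\<close>

lemma of_int_to_int_mod_ring: "of_int (to_int_mod_ring (a :: 'n::nontriv mod_ring)) = a"
  by (simp add: of_int_of_int_mod_ring)

lemma int_zrep: "int (zrep a) = to_int_mod_ring (a :: 'n::nontriv mod_ring)"
proof -
  have "0 \<le> to_int_mod_ring a" by transfer simp
  then show ?thesis by (simp add: zrep_def)
qed

lemma of_nat_zrep [simp]: "of_nat (zrep a) = (a :: 'n::nontriv mod_ring)"
  using of_int_to_int_mod_ring[of a] unfolding int_zrep[symmetric] by simp

lemma chi_eq_omega: "chi (a :: 'n::nontriv mod_ring) = omega CARD('n) ^ zrep a"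
proof -
  have "omega CARD('n) ^ zrep a = exp (of_nat (zrep a) * (2 * \<i> * pi / of_nat CARD('n)))"
    unfolding omega_def exp_of_nat_mult ..
  also have "of_nat (zrep a) = complex_of_int (to_int_mod_ring a)"
    by (simp flip: int_zrep)
  finally show ?thesis by (simp add: chi_def mult_ac)
qed

lemma matpow_0: "matpow A 0 = mat 1" and matpow_Suc: "matpow A (Suc k) = A ** matpow A k"
  by (simp_all add: matpow_def)

lemma matpow_gmat_nth: "matpow gmat k $ i $ j = (if i = j then chi (of_nat k * i) else 0)"
proof (induction k arbitrary: i j)
  case (Suc k)
  have "matpow gmat (Suc k) $ i $ j = (\<Sum>l\<in>UNIV. if i = l then chi i * matpow gmat k $ l $ j else 0)"
    unfolding matpow_Suc matrix_mult_nth by (intro sum.cong) (auto simp: gmat_def chi_eq_omega)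
  then show ?case using Suc by (auto simp: ring_distribs chi_add)
qed (simp add: matpow_0 mat_nth)

lemma matpow_hmat_nth: "matpow hmat k $ i $ j = (if i + of_nat k = j then 1 else 0)"
proof (induction k arbitrary: i j)
  case (Suc k)
  have "matpow hmat (Suc k) $ i $ j = (\<Sum>l\<in>UNIV. if i + 1 = l then matpow hmat k $ l $ j else 0)"
    unfolding matpow_Suc matrix_mult_nth by (intro sum.cong) (auto simp: hmat_def)
  then show ?case using Suc by (auto simp: algebra_simps)
qed (simp add: matpow_0 mat_nth)

lemma Imat_nth: "Imat \<alpha> $ i $ j = (if j = i + fst \<alpha> then chi (i * snd \<alpha>) else 0)"
proof -
  have "Imat \<alpha> $ i $ j = (\<Sum>l\<in>UNIV. if i = l then chi (i * snd \<alpha>) * (if l + fst \<alpha> = j then 1 else 0) else 0)"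
    unfolding Imat_def matrix_mult_nth by (intro sum.cong) (auto simp: matpow_gmat_nth matpow_hmat_nth mult.commute)
  then show ?thesis by auto
qed

text \<open>The inverse of \<open>Imat \<alpha>\<close> written out entrywise, so that each sum in a
  product with it has at most one nonzero term.\<close>

definition Iinv :: "'n::nontriv mod_ring \<times> 'n mod_ring \<Rightarrow> (complex, 'n) zmat" where
  "Iinv \<alpha> = (\<chi> i j. if i = j + fst \<alpha> then chi (- j * snd \<alpha>) else 0)"

lemma Iinv_nth: "Iinv \<alpha> $ i $ j = (if i = j + fst \<alpha> then chi (- j * snd \<alpha>) else 0)"
  by (simp add: Iinv_def)

lemma Imat_Iinv_nth: "(Imat \<alpha> ** Iinv \<beta>) $ i $ j = (if i + fst \<alpha> = j + fst \<beta> then chi (i * snd \<alpha> - j * snd \<beta>) else 0)"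
proof -
  have "(Imat \<alpha> ** Iinv \<beta>) $ i $ j =
      (\<Sum>l\<in>UNIV. if i + fst \<alpha> = l then chi (i * snd \<alpha>) * (if l = j + fst \<beta> then chi (- j * snd \<beta>) else 0) else 0)"
    unfolding matrix_mult_nth by (intro sum.cong) (auto simp: Imat_nth Iinv_nth)
  then show ?thesis by (auto simp: chi_diff chi_minus field_simps)
qed

lemma Iinv_Imat_nth:
  "(Iinv \<alpha> ** Imat \<beta>) $ i $ j = (if i + fst \<beta> = j + fst \<alpha> then chi ((i - fst \<alpha>) * (snd \<beta> - snd \<alpha>)) else 0)"
proof -
  have "(Iinv \<alpha> ** Imat \<beta>) $ i $ j =
      (\<Sum>l\<in>UNIV. if i - fst \<alpha> = l then chi (- l * snd \<alpha>) * (if j = l + fst \<beta> then chi (l * snd \<beta>) else 0) else 0)"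
    unfolding matrix_mult_nth by (intro sum.cong) (auto simp: Imat_nth Iinv_nth algebra_simps)
  also have "\<dots> = (if j = i - fst \<alpha> + fst \<beta> then chi (- (i - fst \<alpha>) * snd \<alpha>) * chi ((i - fst \<alpha>) * snd \<beta>) else 0)"
    by auto
  also have "chi (- (i - fst \<alpha>) * snd \<alpha>) * chi ((i - fst \<alpha>) * snd \<beta>) = chi ((i - fst \<alpha>) * (snd \<beta> - snd \<alpha>))"
    unfolding chi_add[symmetric] by (rule arg_cong[where f = chi]) (simp add: algebra_simps)
  finally show ?thesis by (auto simp: algebra_simps)
qed

lemma matrix_inv_Imat: "matrix_inv (Imat \<alpha>) = Iinv \<alpha>"
  by (rule matrix_inv_eqI; rule mat_eqI) (auto simp: Imat_Iinv_nth Iinv_Imat_nth mat_nth)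

definition Jmat :: "'n::nontriv mod_ring \<times> 'n mod_ring \<Rightarrow> (complex, 'n) zmat2" where
  "Jmat \<alpha> = tensor (Imat \<alpha>) (Iinv \<alpha>)"

lemma Jmat_0 [simp]: "Jmat 0 = mat 1"
  by (rule mat_eqI) (auto simp: Jmat_def Imat_nth Iinv_nth mat_nth prod_eq_iff)

text \<open>Multiplication in the Heisenberg group adds labels up to a phase. The phases of the two
  tensor factors combine to the symplectic form, which is how the characters get into the unitarity
  sums.\<close>

lemma Jmat_mult_flip:
  "Jmat \<alpha> ** flip (Jmat \<beta>) = map_matrix ((*) (chi (fst \<beta> * snd \<alpha> - fst \<alpha> * snd \<beta>))) (Jmat (\<alpha> - \<beta>))"
proof (rule mat_eqI)
  fix i j :: "'a mod_ring \<times> 'a mod_ring"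
  have "chi (fst i * snd \<alpha> - fst j * snd \<beta>) * chi ((snd i - fst \<alpha>) * (snd \<beta> - snd \<alpha>)) =
      chi (fst \<beta> * snd \<alpha> - fst \<alpha> * snd \<beta>) * (chi (fst i * snd (\<alpha> - \<beta>)) * chi (- snd j * snd (\<alpha> - \<beta>)))"
    if "fst j = fst i + fst (\<alpha> - \<beta>)" "snd i = snd j + fst (\<alpha> - \<beta>)"
    unfolding chi_add[symmetric] that by (rule arg_cong[where f = chi]) (simp add: algebra_simps)
  moreover have "fst i + fst \<alpha> = fst j + fst \<beta> \<longleftrightarrow> fst j = fst i + fst (\<alpha> - \<beta>)"
    "snd i + fst \<beta> = snd j + fst \<alpha> \<longleftrightarrow> snd i = snd j + fst (\<alpha> - \<beta>)"
    by (auto simp: algebra_simps)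
  ultimately show "(Jmat \<alpha> ** flip (Jmat \<beta>)) $ i $ j =
      map_matrix ((*) (chi (fst \<beta> * snd \<alpha> - fst \<alpha> * snd \<beta>))) (Jmat (\<alpha> - \<beta>)) $ i $ j"
    unfolding Jmat_def flip_tensor tensor_mult
    by (simp only: tensor_nth nth_map_matrix Imat_Iinv_nth Iinv_Imat_nth Imat_nth Iinv_nth) simp
qed

text \<open>The partial transposition reverses the order of multiplication in the second factor, and
  now the phases of the two factors cancel. This is why the crossing sum carries no
  characters.\<close>

lemma transp2_flip_Jmat_mult: "transp2 (flip (Jmat \<beta>)) ** transp2 (Jmat \<alpha>) = transp2 (Jmat (\<alpha> - \<beta>))"
proof -
  have "transp2 (flip (Jmat \<beta>)) ** transp2 (Jmat \<alpha>) = transp2 (tensor (Iinv \<beta> ** Imat \<alpha>) (Iinv \<alpha> ** Imat \<beta>))"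
    unfolding Jmat_def flip_tensor transp2_tensor tensor_mult matrix_transpose_mul ..
  also have "tensor (Iinv \<beta> ** Imat \<alpha>) (Iinv \<alpha> ** Imat \<beta>) = Jmat (\<alpha> - \<beta>)"
  proof (rule mat_eqI)
    fix i j :: "'a mod_ring \<times> 'a mod_ring"
    have "chi ((fst i - fst \<beta>) * (snd \<alpha> - snd \<beta>)) * chi ((snd i - fst \<alpha>) * (snd \<beta> - snd \<alpha>)) =
        chi (fst i * snd (\<alpha> - \<beta>)) * chi (- snd j * snd (\<alpha> - \<beta>))"
      if "fst j = fst i + fst (\<alpha> - \<beta>)" "snd i = snd j + fst (\<alpha> - \<beta>)"
      unfolding chi_add[symmetric] that by (rule arg_cong[where f = chi]) (simp add: algebra_simps)
    moreover have "fst i + fst \<alpha> = fst j + fst \<beta> \<longleftrightarrow> fst j = fst i + fst (\<alpha> - \<beta>)"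
      "snd i + fst \<beta> = snd j + fst \<alpha> \<longleftrightarrow> snd i = snd j + fst (\<alpha> - \<beta>)"
      by (auto simp: algebra_simps)
    ultimately show "tensor (Iinv \<beta> ** Imat \<alpha>) (Iinv \<alpha> ** Imat \<beta>) $ i $ j = Jmat (\<alpha> - \<beta>) $ i $ j"
      unfolding Jmat_def by (simp only: tensor_nth Iinv_Imat_nth Imat_nth Iinv_nth) simp
  qed
  finally show ?thesis .
qed

lemma hg_nth: "(hmat ** gmat) $ i $ j = (if j = i + 1 then chi j else 0)"
proof -
  have "(hmat ** gmat) $ i $ j = (\<Sum>l\<in>UNIV. if i + 1 = l then (if l = j then chi j else 0) else 0)"
    unfolding matrix_mult_nth by (intro sum.cong) (auto simp: hmat_def gmat_def chi_eq_omega)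
  then show ?thesis by auto
qed

text \<open>The phase is the \<alpha>-dependent part of the multiplier of the weight of \<alpha>
  under a shift by \<open>\<tau> + 1\<close>; this coincidence singles out \<open>h g\<close> among
  the Heisenberg matrices.\<close>

lemma Imat_hg:
  "Imat \<alpha> ** (hmat ** gmat) = map_matrix ((*) (chi (fst \<alpha> - snd \<alpha>))) ((hmat ** gmat) ** Imat \<alpha>)"
proof (rule mat_eqI)
  fix i j :: "'a mod_ring"
  have "(Imat \<alpha> ** (hmat ** gmat)) $ i $ j =
      (\<Sum>l\<in>UNIV. if i + fst \<alpha> = l then chi (i * snd \<alpha>) * (if j = l + 1 then chi j else 0) else 0)"
    unfolding matrix_mult_nth[of "Imat \<alpha>"] by (intro sum.cong) (auto simp: Imat_nth hg_nth)
  also have "\<dots> = (if j = i + fst \<alpha> + 1 then chi (i * snd \<alpha>) * chi j else 0)" by auto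
  finally have 1: "(Imat \<alpha> ** (hmat ** gmat)) $ i $ j = (if j = i + fst \<alpha> + 1 then chi (i * snd \<alpha>) * chi j else 0)" .
  have "((hmat ** gmat) ** Imat \<alpha>) $ i $ j =
      (\<Sum>l\<in>UNIV. if i + 1 = l then chi l * (if j = l + fst \<alpha> then chi (l * snd \<alpha>) else 0) else 0)"
    unfolding matrix_mult_nth[of "hmat ** gmat"] by (intro sum.cong) (auto simp: Imat_nth hg_nth)
  also have "\<dots> = (if j = i + fst \<alpha> + 1 then chi (i + 1) * chi ((i + 1) * snd \<alpha>) else 0)"
    by (auto simp: add_ac)
  finally have 2: "((hmat ** gmat) ** Imat \<alpha>) $ i $ j = (if j = i + fst \<alpha> + 1 then chi (i + 1) * chi ((i + 1) * snd \<alpha>) else 0)" .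
  have "chi (i * snd \<alpha>) * chi j = chi (fst \<alpha> - snd \<alpha>) * (chi (i + 1) * chi ((i + 1) * snd \<alpha>))"
    if "j = i + fst \<alpha> + 1"
    unfolding chi_add[symmetric] that by (rule arg_cong[where f = chi]) (simp add: algebra_simps)
  then show "(Imat \<alpha> ** (hmat ** gmat)) $ i $ j = map_matrix ((*) (chi (fst \<alpha> - snd \<alpha>))) ((hmat ** gmat) ** Imat \<alpha>) $ i $ j"
    by (simp add: 1 2)
qed

lemma Imat_Iinv: "Imat \<alpha> ** Iinv \<alpha> = mat 1" and Iinv_Imat: "Iinv \<alpha> ** Imat \<alpha> = mat 1"
  by (rule mat_eqI; auto simp: Imat_Iinv_nth Iinv_Imat_nth mat_nth)+

lemma Iinv_hg:
  "Iinv \<alpha> ** (hmat ** gmat) = map_matrix ((*) (chi (snd \<alpha> - fst \<alpha>))) ((hmat ** gmat) ** Iinv \<alpha>)"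
proof -
  define K where "K = hmat ** (gmat :: (complex, 'a) zmat)"
  have "K ** Iinv \<alpha> = Iinv \<alpha> ** (Imat \<alpha> ** K) ** Iinv \<alpha>"
    by (simp add: matrix_mul_assoc Iinv_Imat)
  also have "\<dots> = map_matrix ((*) (chi (fst \<alpha> - snd \<alpha>))) (Iinv \<alpha> ** K ** (Imat \<alpha> ** Iinv \<alpha>))"
    by (simp only: Imat_hg[of \<alpha>, folded K_def] smult_matrix_mult matrix_mul_assoc)
  finally have "K ** Iinv \<alpha> = map_matrix ((*) (chi (fst \<alpha> - snd \<alpha>))) (Iinv \<alpha> ** K)"
    by (simp add: Imat_Iinv)
  moreover have "chi (snd \<alpha> - fst \<alpha>) * chi (fst \<alpha> - snd \<alpha>) = 1"
    by (simp flip: chi_add)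
  ultimately show ?thesis by (simp add: smult_smult_matrix K_def)
qed

section \<open>The sum over the Heisenberg group\<close>

text \<open>Terms with the same difference \<open>\<gamma> = \<alpha> - \<beta>\<close> are
  collected; the coefficient of \<open>M \<gamma>\<close> is then exactly one of the sums over
  weights evaluated above.\<close>

lemma sum_pairs_diff:
  fixes M :: "'i::{finite, ab_group_add} \<Rightarrow> ('a::comm_ring_1, 'm::finite) vec ^ 'k"
  assumes "\<And>\<gamma>. (\<Sum>\<alpha>\<in>UNIV. f \<alpha> (\<alpha> - \<gamma>)) = (if \<gamma> = 0 then K else 0)"
  shows "(\<Sum>\<alpha>\<in>UNIV. \<Sum>\<beta>\<in>UNIV. map_matrix ((*) (f \<alpha> \<beta>)) (M (\<alpha> - \<beta>))) = map_matrix ((*) K) (M 0)"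
proof (rule mat_eqI)
  fix i j
  have "(\<Sum>\<alpha>\<in>UNIV. \<Sum>\<beta>\<in>UNIV. f \<alpha> \<beta> * M (\<alpha> - \<beta>) $ i $ j) =
      (\<Sum>\<alpha>\<in>UNIV. \<Sum>\<gamma>\<in>UNIV. f \<alpha> (\<alpha> - \<gamma>) * M \<gamma> $ i $ j)"
  proof (rule sum.cong)
    fix \<alpha> :: 'i
    show "(\<Sum>\<beta>\<in>UNIV. f \<alpha> \<beta> * M (\<alpha> - \<beta>) $ i $ j) = (\<Sum>\<gamma>\<in>UNIV. f \<alpha> (\<alpha> - \<gamma>) * M \<gamma> $ i $ j)"
      by (rule sum.reindex_bij_witness[where i = "\<lambda>\<gamma>. \<alpha> - \<gamma>" and j = "\<lambda>\<beta>. \<alpha> - \<beta>"]) auto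
  qed simp
  also have "\<dots> = (\<Sum>\<gamma>\<in>UNIV. (\<Sum>\<alpha>\<in>UNIV. f \<alpha> (\<alpha> - \<gamma>)) * M \<gamma> $ i $ j)"
    unfolding sum_distrib_right by (rule sum.swap)
  also have "\<dots> = (\<Sum>\<gamma>\<in>UNIV. if \<gamma> = 0 then K * M \<gamma> $ i $ j else 0)"
    unfolding assms by (intro sum.cong) auto
  finally show "(\<Sum>\<alpha>\<in>UNIV. \<Sum>\<beta>\<in>UNIV. map_matrix ((*) (f \<alpha> \<beta>)) (M (\<alpha> - \<beta>))) $ i $ j = map_matrix ((*) K) (M 0) $ i $ j"
    by (simp add: sum_component)
qed

text \<open>The part of the R-matrix to which the theta identities apply: the scalar factor and the
  conjugation by \<open>G\<close> are left out.\<close>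

definition Rcore :: "complex \<Rightarrow> complex \<Rightarrow> complex \<Rightarrow> (complex, 'n::nontriv) zmat2" where
  "Rcore \<zeta> \<tau> \<xi> = (\<Sum>\<alpha>\<in>UNIV. map_matrix ((*) (weight \<tau> (\<zeta> / of_nat CARD('n)) \<alpha> \<xi>)) (Jmat \<alpha>))"

lemma Rcore_unitarity:
  fixes \<zeta> \<tau> \<xi> :: complex
  assumes \<tau>: "Im \<tau> > 0" and nz: "theta \<tau> \<zeta> \<noteq> 0"
  shows "Rcore \<zeta> \<tau> \<xi> ** flip (Rcore \<zeta> \<tau> (- \<xi>)) =
    (mat ((of_nat CARD('n))\<^sup>2 * (theta \<tau> (\<zeta> + \<xi>) * theta \<tau> (\<zeta> - \<xi>) / (theta \<tau> \<zeta>)\<^sup>2)) :: (complex, 'n::nontriv) zmat2)"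
proof -
  define \<eta> where "\<eta> = \<zeta> / of_nat CARD('n)"
  have N\<eta>: "of_nat CARD('n) * \<eta> = \<zeta>" by (simp add: \<eta>_def)
  have nz': "theta \<tau> (of_nat CARD('n) * \<eta>) \<noteq> 0" using nz by (simp add: N\<eta>)
  define c where "c \<alpha> \<beta> = chi (fst \<beta> * snd \<alpha> - fst \<alpha> * snd \<beta>)" for \<alpha> \<beta> :: "'n mod_ring \<times> 'n mod_ring"
  define K where "K = (of_nat CARD('n))\<^sup>2 * (theta \<tau> (\<zeta> + \<xi>) * theta \<tau> (\<zeta> - \<xi>) / (theta \<tau> \<zeta>)\<^sup>2)"
  have "Rcore \<zeta> \<tau> \<xi> ** flip (Rcore \<zeta> \<tau> (- \<xi>)) =
      (\<Sum>\<alpha>\<in>UNIV. \<Sum>\<beta>\<in>UNIV. map_matrix ((*) (weight \<tau> \<eta> \<alpha> \<xi> * weight \<tau> \<eta> \<beta> (- \<xi>) * c \<alpha> \<beta>)) (Jmat (\<alpha> - \<beta>) :: (complex, 'n) zmat2))"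
    unfolding Rcore_def flip_sum sum_matrix_mult_left sum_matrix_mult_right flip_smult smult_matrix_mult
      smult_smult_matrix smult_sum_matrix Jmat_mult_flip \<eta>_def[symmetric] c_def
    by (subst sum.swap) (simp add: mult_ac)
  also have "\<dots> = map_matrix ((*) K) (Jmat 0)"
  proof (rule sum_pairs_diff)
    fix \<gamma> :: "'n mod_ring \<times> 'n mod_ring"
    have c: "c \<alpha> (\<alpha> - \<gamma>) = chi (fst \<alpha> * snd \<gamma> - fst \<gamma> * snd \<alpha>)" for \<alpha>
      unfolding c_def by (rule arg_cong[where f = chi]) (simp add: algebra_simps)
    show "(\<Sum>\<alpha>\<in>UNIV. weight \<tau> \<eta> \<alpha> \<xi> * weight \<tau> \<eta> (\<alpha> - \<gamma>) (- \<xi>) * c \<alpha> (\<alpha> - \<gamma>)) = (if \<gamma> = 0 then K else 0)"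
    proof (cases "\<gamma> = 0")
      case True
      then show ?thesis
        using unitarity_sum_diag[OF \<tau> nz', of \<xi>] unfolding c N\<eta> by (simp add: K_def)
    next
      case False
      then show ?thesis
        using unitarity_sum_offdiag[OF \<tau> nz' False, of \<xi>] unfolding c by (simp add: mult_ac)
    qed
  qed
  also have "\<dots> = mat K" by (rule mat_eqI) (simp add: mat_nth)
  finally show ?thesis by (simp add: K_def)
qed

lemma Rcore_crossing:
  fixes \<zeta> \<tau> \<xi> :: complex
  assumes \<tau>: "Im \<tau> > 0" and nz: "theta \<tau> \<zeta> \<noteq> 0"
  shows "transp2 (flip (Rcore \<zeta> \<tau> (- x))) ** transp2 (Rcore \<zeta> \<tau> (x - of_nat CARD('n) * \<zeta>)) =
    (mat (- (of_nat CARD('n))\<^sup>2 * theta \<tau> x * theta \<tau> (x - of_nat CARD('n) * \<zeta>) / (theta \<tau> \<zeta>)\<^sup>2) :: (complex, 'n::nontriv) zmat2)"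
proof -
  define \<eta> where "\<eta> = \<zeta> / of_nat CARD('n)"
  have N\<eta>: "of_nat CARD('n) * \<eta> = \<zeta>" by (simp add: \<eta>_def)
  have nz': "theta \<tau> (of_nat CARD('n) * \<eta>) \<noteq> 0" using nz by (simp add: N\<eta>)
  let ?y = "x - of_nat CARD('n) * \<zeta>"
  define K where "K = - (of_nat CARD('n))\<^sup>2 * theta \<tau> x * theta \<tau> ?y / (theta \<tau> \<zeta>)\<^sup>2"
  have "transp2 (flip (Rcore \<zeta> \<tau> (- x))) ** transp2 (Rcore \<zeta> \<tau> ?y) =
      (\<Sum>\<alpha>\<in>UNIV. \<Sum>\<beta>\<in>UNIV. map_matrix ((*) (weight \<tau> \<eta> \<alpha> ?y * weight \<tau> \<eta> \<beta> (- x))) (transp2 (Jmat (\<alpha> - \<beta>) :: (complex, 'n) zmat2)))"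
    unfolding Rcore_def flip_sum transp2_sum sum_matrix_mult_left sum_matrix_mult_right flip_smult transp2_smult smult_matrix_mult
      smult_smult_matrix smult_sum_matrix transp2_flip_Jmat_mult \<eta>_def[symmetric]
    by (simp add: mult_ac)
  also have "\<dots> = map_matrix ((*) K) (transp2 (Jmat 0))"
  proof (rule sum_pairs_diff)
    fix \<gamma> :: "'n mod_ring \<times> 'n mod_ring"
    show "(\<Sum>\<alpha>\<in>UNIV. weight \<tau> \<eta> \<alpha> ?y * weight \<tau> \<eta> (\<alpha> - \<gamma>) (- x)) = (if \<gamma> = 0 then K else 0)"
      using crossing_sum[OF \<tau> nz', of x \<gamma>] unfolding N\<eta> K_def .
  qed
  also have "\<dots> = mat K" by (rule mat_eqI) (auto simp: mat_nth prod_eq_iff)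
  finally show ?thesis by (simp add: K_def)
qed

section \<open>The normalization factors in additive notation\<close>

definition e2pi :: "complex \<Rightarrow> complex" where
  "e2pi x = exp (2 * \<i> * pi * x)"

lemma e2pi_add: "e2pi (x + y) = e2pi x * e2pi y"
  by (simp add: e2pi_def ring_distribs exp_add)

lemma e2pi_minus: "e2pi (- x) = inverse (e2pi x)"
  by (simp add: e2pi_def exp_minus)

lemma e2pi_diff: "e2pi (x - y) = e2pi x / e2pi y"
  by (simp add: e2pi_def ring_distribs exp_diff)

lemma e2pi_nonzero [simp]: "e2pi x \<noteq> 0"
  by (simp add: e2pi_def)

lemma e2pi_power: "e2pi x ^ n = e2pi (of_nat n * x)"
  unfolding e2pi_def exp_of_nat_mult[symmetric] by (rule arg_cong[where f = exp]) simp

lemma e2pi_1: "e2pi 1 = 1"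
  using exp_integer_2pi[of 1] by (simp add: e2pi_def mult_ac)

lemma e2pi_eq_1_iff: "e2pi x = 1 \<longleftrightarrow> (\<exists>k::int. x = of_int k)"
  unfolding e2pi_def by (rule exp_2pi_i_eq_1_iff[of \<i>]) simp

lemma norm_e2pi_less_1: "Im x > 0 \<Longrightarrow> norm (e2pi x) < 1"
  by (simp add: e2pi_def norm_exp_eq_Re)

lemma holomorphic_on_e2pi [holomorphic_intros]:
  "g holomorphic_on A \<Longrightarrow> (\<lambda>x. e2pi (g x)) holomorphic_on A"
  unfolding e2pi_def by (intro holomorphic_intros)

definition Theta_add :: "complex \<Rightarrow> complex \<Rightarrow> complex" where
  "Theta_add t x = Theta (e2pi t) (e2pi x)"

definition qp :: "complex \<Rightarrow> complex \<Rightarrow> complex" where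
  "qp t x = qpoch1 (e2pi x) (e2pi t)"

lemma Theta_add_eq_qp: "Theta_add t x = qp t x * qp t (t - x) * qp t t"
  by (simp add: Theta_add_def Theta_def qp_def e2pi_diff)

lemma Theta_add_shift: "Im t > 0 \<Longrightarrow> Theta_add t (x + t) = - Theta_add t x / e2pi x"
  unfolding Theta_add_def e2pi_add
  using Theta_shift[OF norm_e2pi_less_1, of t "e2pi x"] by (simp add: mult.commute)

lemma Theta_add_minus: "Im t > 0 \<Longrightarrow> Theta_add t (- x) = - Theta_add t x / e2pi x"
  unfolding Theta_add_def e2pi_minus inverse_eq_divide
  by (rule Theta_inverse[OF norm_e2pi_less_1]) auto

lemma theta_eq_Theta_add:
  assumes "Im \<tau> > 0"
  shows "\<exists>C. C \<noteq> 0 \<and> (\<forall>x. Theta_add \<tau> x = C * (exp (\<i> * pi * x) * theta \<tau> x))"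
proof -
  obtain C where C: "C \<noteq> 0" "\<And>x. theta \<tau> x = C * (exp (- \<i> * pi * x) * Theta_add \<tau> x)"
    using theta_eq_Theta[OF assms] unfolding Theta_add_def e2pi_def by blast
  have "Theta_add \<tau> x = inverse C * (exp (\<i> * pi * x) * theta \<tau> x)" for x
    using C(1) unfolding C(2) by (simp add: exp_minus field_simps)
  then show ?thesis using C(1) by (intro exI[of _ "inverse C"]) auto
qed

lemma generic_arg_shift:
  assumes "generic_arg \<zeta> \<tau> \<xi>"
  shows "generic_arg \<zeta> \<tau> (\<xi> + of_int a + of_int b * \<zeta> + of_int c * \<tau>)"
  unfolding generic_arg_def
proof (intro allI notI)
  fix k l m :: int
  assume "\<xi> + of_int a + of_int b * \<zeta> + of_int c * \<tau> = of_int k + of_int l * \<zeta> + of_int m * \<tau>"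
  then have "\<xi> = of_int (k - a) + of_int (l - b) * \<zeta> + of_int (m - c) * \<tau>"
    by (simp add: algebra_simps)
  then show False using assms unfolding generic_arg_def by blast
qed

lemma generic_arg_minus:
  assumes "generic_arg \<zeta> \<tau> \<xi>" shows "generic_arg \<zeta> \<tau> (- \<xi>)"
  unfolding generic_arg_def
proof (intro allI notI)
  fix k l m :: int
  assume "- \<xi> = of_int k + of_int l * \<zeta> + of_int m * \<tau>"
  then have "\<xi> = of_int (- k) + of_int (- l) * \<zeta> + of_int (- m) * \<tau>"
    by (simp add: algebra_simps minus_equation_iff[of \<xi>])
  then show False using assms unfolding generic_arg_def by blast
qed

lemma generic_arg_tau_shift:
  assumes "generic_arg \<zeta> \<tau> \<xi>" shows "generic_arg \<zeta> (\<tau> + of_nat n * \<zeta>) \<xi>"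
  unfolding generic_arg_def
proof (intro allI notI)
  fix k l m :: int
  assume "\<xi> = of_int k + of_int l * \<zeta> + of_int m * (\<tau> + of_nat n * \<zeta>)"
  then have "\<xi> = of_int k + of_int (l + m * int n) * \<zeta> + of_int m * \<tau>"
    by (simp add: algebra_simps)
  then show False using assms unfolding generic_arg_def by blast
qed

section \<open>Double products in additive notation and the scalar factor of the R-matrix\<close>

context
  fixes \<zeta> \<tau> :: complex and N :: nat
  assumes \<zeta>: "Im \<zeta> > 0" and \<tau>: "Im \<tau> > 0" and N: "N > 0"
begin

definition kp :: "complex \<Rightarrow> complex" where
  "kp x = qpoch2 (e2pi x) (e2pi \<tau>) (e2pi (of_nat N * \<zeta>))"

private lemma norms: "norm (e2pi \<tau>) < 1" "norm (e2pi (of_nat N * \<zeta>)) < 1"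
  using \<zeta> \<tau> N by (auto intro!: norm_e2pi_less_1)

text \<open>A step by \<tau> leaves a single product in the nome of period
  \<open>N * \<zeta>\<close>, and a step by \<open>N * \<zeta>\<close>, in \<open>kp_zeta\<close>,
  one in the nome of period \<tau>. The former drives the quasi-periodicity of the scalar factor,
  the latter its crossing.\<close>

lemma kp_tau: "kp x = qp (of_nat N * \<zeta>) x * kp (x + \<tau>)"
  unfolding kp_def qp_def e2pi_add by (rule qpoch2_rec_left[OF norms])

lemma kp_zeta: "kp x = qp \<tau> x * kp (x + of_nat N * \<zeta>)"
  unfolding kp_def qp_def e2pi_add by (rule qpoch2_rec_right[OF norms])

lemma kp_nonzero:
  assumes "generic_arg \<zeta> \<tau> x" shows "kp x \<noteq> 0"
proof
  assume "kp x = 0"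
  then obtain m n where "e2pi x * e2pi \<tau> ^ m * e2pi (of_nat N * \<zeta>) ^ n = 1"
    unfolding kp_def qpoch2_eq_0_iff[OF norms] by blast
  then have "e2pi (x + of_nat m * \<tau> + of_nat n * (of_nat N * \<zeta>)) = 1"
    by (simp add: e2pi_power e2pi_add)
  then obtain k :: int where "x + of_nat m * \<tau> + of_nat n * (of_nat N * \<zeta>) = of_int k"
    using e2pi_eq_1_iff by blast
  then have "x = of_int k + of_int (- int (n * N)) * \<zeta> + of_int (- int m) * \<tau>"
    by (simp add: algebra_simps eq_diff_eq)
  then show False using assms unfolding generic_arg_def by blast
qed

lemma holomorphic_on_kp [holomorphic_intros]:
  "g holomorphic_on A \<Longrightarrow> (\<lambda>x. kp (g x)) holomorphic_on A"
  unfolding kp_def by (intro holomorphic_on_qpoch2[OF norms] holomorphic_intros)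

lemma inv_kappa_eq_kp:
  "inv_kappa N \<zeta> \<tau> \<xi> =
     (kp (of_nat N * \<zeta> - \<xi>) * kp (\<zeta> + \<xi>) * kp (\<tau> - \<xi>) * kp (\<tau> + (of_nat N - 1) * \<zeta> + \<xi>))
     / (kp (of_nat N * \<zeta> + \<xi>) * kp (\<zeta> - \<xi>) * kp (\<tau> + \<xi>) * kp (\<tau> + (of_nat N - 1) * \<zeta> - \<xi>))"
proof -
  have q: "exp (\<i> * pi * \<zeta>) ^ (2 * k) = e2pi (of_nat k * \<zeta>)" for k
    unfolding e2pi_def exp_of_nat_mult[symmetric] by (rule arg_cong[where f = exp]) simp
  have Q: "exp (\<i> * pi * \<zeta>) ^ (2 * N) = e2pi (of_nat N * \<zeta>)" by (rule q)
  have q2: "(exp (\<i> * pi * \<zeta>))\<^sup>2 = e2pi \<zeta>" using q[of 1] by simp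
  have "2 * N - 2 = 2 * (N - 1)" by simp
  then have qN: "exp (\<i> * pi * \<zeta>) ^ (2 * N - 2) = e2pi ((of_nat N - 1) * \<zeta>)"
    using q[of "N - 1"] N by (simp add: of_nat_diff)
  show ?thesis
    unfolding inv_kappa_def Let_def Q q2 qN kp_def e2pi_def[symmetric] e2pi_add e2pi_diff ..
qed

text \<open>Open in \<open>\<xi>\<close>, in contrast to \<open>generic_arg\<close>: the values of the spectral parameter near which
  the R-matrix is holomorphic and invertible.\<close>

definition reg :: "complex \<Rightarrow> bool" where
  "reg \<xi> \<longleftrightarrow> (\<forall>s\<in>{\<xi>, - \<xi>}. kp (of_nat N * \<zeta> + s) \<noteq> 0 \<and> kp (\<zeta> + s) \<noteq> 0 \<and> kp (\<tau> + s) \<noteq> 0 \<and>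
     kp (\<tau> + (of_nat N - 1) * \<zeta> + s) \<noteq> 0 \<and> theta \<tau> (\<zeta> + s) \<noteq> 0)"

lemma reg_iff:
  "reg \<xi> \<longleftrightarrow> kp (of_nat N * \<zeta> + \<xi>) \<noteq> 0 \<and> kp (of_nat N * \<zeta> - \<xi>) \<noteq> 0 \<and> kp (\<zeta> + \<xi>) \<noteq> 0 \<and> kp (\<zeta> - \<xi>) \<noteq> 0 \<and>
     kp (\<tau> + \<xi>) \<noteq> 0 \<and> kp (\<tau> - \<xi>) \<noteq> 0 \<and> kp (\<tau> + (of_nat N - 1) * \<zeta> + \<xi>) \<noteq> 0 \<and>
     kp (\<tau> + (of_nat N - 1) * \<zeta> - \<xi>) \<noteq> 0 \<and> theta \<tau> (\<zeta> + \<xi>) \<noteq> 0 \<and> theta \<tau> (\<zeta> - \<xi>) \<noteq> 0"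
  by (auto simp: reg_def)

lemma reg_minus [simp]: "reg (- \<xi>) = reg \<xi>"
  by (auto simp: reg_def)

lemma reg_generic:
  assumes "generic_arg \<zeta> \<tau> \<xi>" shows "reg \<xi>"
  unfolding reg_def
proof
  fix s assume "s \<in> {\<xi>, - \<xi>}"
  then have s: "generic_arg \<zeta> \<tau> s" using assms generic_arg_minus by auto
  have gen: "generic_arg \<zeta> \<tau> (of_int c * \<tau> + of_int b * \<zeta> + s)" for b c :: int
    using generic_arg_shift[OF s, of 0 b c] by (simp add: algebra_simps)
  have "theta \<tau> (\<zeta> + s) \<noteq> 0"
  proof
    assume "theta \<tau> (\<zeta> + s) = 0"
    then obtain k m :: int where "\<zeta> + s = of_int k + of_int m * \<tau>" using theta_eq_0_iff[OF \<tau>] by blast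
    then have "s = of_int k + of_int (- 1) * \<zeta> + of_int m * \<tau>" by (simp add: algebra_simps)
    then show False using s unfolding generic_arg_def by blast
  qed
  moreover have "kp (of_nat N * \<zeta> + s) \<noteq> 0" using kp_nonzero[OF gen[of 0 "int N"]] by simp
  moreover have "kp (\<zeta> + s) \<noteq> 0" using kp_nonzero[OF gen[of 0 1]] by simp
  moreover have "kp (\<tau> + s) \<noteq> 0" using kp_nonzero[OF gen[of 1 0]] by simp
  moreover have "kp (\<tau> + (of_nat N - 1) * \<zeta> + s) \<noteq> 0" using kp_nonzero[OF gen[of 1 "int N - 1"]] by simp
  ultimately show "kp (of_nat N * \<zeta> + s) \<noteq> 0 \<and> kp (\<zeta> + s) \<noteq> 0 \<and> kp (\<tau> + s) \<noteq> 0 \<and>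
     kp (\<tau> + (of_nat N - 1) * \<zeta> + s) \<noteq> 0 \<and> theta \<tau> (\<zeta> + s) \<noteq> 0" by blast
qed

lemma open_reg: "open {\<xi>. reg \<xi>}"
proof -
  have op: "open {\<xi>. f (a + s * \<xi>) \<noteq> 0}" if "f holomorphic_on UNIV" for f a s
  proof -
    have "(\<lambda>\<xi>. f (a + s * \<xi>)) holomorphic_on UNIV"
      by (rule holomorphic_on_entire_compose[OF that]) (intro holomorphic_intros)
    then show ?thesis
      by (intro open_Collect_neq holomorphic_on_imp_continuous_on holomorphic_on_const)
  qed
  have kp: "kp holomorphic_on UNIV" using holomorphic_on_kp[of "\<lambda>x. x" UNIV] by (auto intro: holomorphic_intros)
  note k = op[OF kp, of _ 1] op[OF kp, of _ "-1"]
    op[OF holomorphic_theta_UNIV[OF \<tau>], of _ 1] op[OF holomorphic_theta_UNIV[OF \<tau>], of _ "-1"]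
  show ?thesis
    unfolding reg_def using k by (simp add: Collect_conj_eq) (intro open_Int; simp)
qed

lemma inv_kappa_minus: "inv_kappa N \<zeta> \<tau> (- \<xi>) = inverse (inv_kappa N \<zeta> \<tau> \<xi>)"
  by (simp add: inv_kappa_eq_kp)

lemma inv_kappa_nonzero: "reg \<xi> \<Longrightarrow> inv_kappa N \<zeta> \<tau> \<xi> \<noteq> 0"
  by (simp add: inv_kappa_eq_kp reg_def)

lemma holomorphic_inv_kappa: "inv_kappa N \<zeta> \<tau> holomorphic_on {\<xi>. reg \<xi>}"
  unfolding inv_kappa_eq_kp[abs_def] by (intro holomorphic_intros) (auto simp: reg_def)

definition rscal :: "complex \<Rightarrow> complex" where
  "rscal \<xi> = exp (\<i> * pi * \<xi> * (2 / of_nat N - 2)) * inv_kappa N \<zeta> \<tau> \<xi> * (theta \<tau> \<zeta> / theta \<tau> (\<xi> + \<zeta>))"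

lemma holomorphic_rscal: "rscal holomorphic_on {\<xi>. reg \<xi>}"
  unfolding rscal_def[abs_def]
  by (intro holomorphic_intros holomorphic_inv_kappa holomorphic_on_theta[OF \<tau>])
     (auto simp: reg_def add.commute)

lemma rscal_nonzero: "theta \<tau> \<zeta> \<noteq> 0 \<Longrightarrow> reg \<xi> \<Longrightarrow> rscal \<xi> \<noteq> 0"
  using inv_kappa_nonzero by (auto simp: rscal_def reg_def add.commute)

lemma rscal_unitarity:
  assumes "reg \<xi>" "theta \<tau> \<zeta> \<noteq> 0"
  shows "rscal \<xi> * rscal (- \<xi>) * (theta \<tau> (\<zeta> + \<xi>) * theta \<tau> (\<zeta> - \<xi>) / (theta \<tau> \<zeta>)\<^sup>2) = 1"
proof -
  have e: "exp (\<i> * pi * \<xi> * (2 / of_nat N - 2)) * exp (\<i> * pi * (- \<xi>) * (2 / of_nat N - 2)) = 1"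
    unfolding mult_exp_exp by simp
  have t: "theta \<tau> (\<zeta> + \<xi>) \<noteq> 0" "theta \<tau> (\<zeta> - \<xi>) \<noteq> 0" using assms(1) by (auto simp: reg_def)
  have "rscal \<xi> * rscal (- \<xi>) * (theta \<tau> (\<zeta> + \<xi>) * theta \<tau> (\<zeta> - \<xi>) / (theta \<tau> \<zeta>)\<^sup>2) =
      (exp (\<i> * pi * \<xi> * (2 / of_nat N - 2)) * exp (\<i> * pi * (- \<xi>) * (2 / of_nat N - 2))) *
      (inv_kappa N \<zeta> \<tau> \<xi> * inv_kappa N \<zeta> \<tau> (- \<xi>)) *
      ((theta \<tau> \<zeta> / theta \<tau> (\<zeta> + \<xi>)) * (theta \<tau> \<zeta> / theta \<tau> (\<zeta> - \<xi>)) * (theta \<tau> (\<zeta> + \<xi>) * theta \<tau> (\<zeta> - \<xi>) / (theta \<tau> \<zeta>)\<^sup>2))"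
    by (simp add: rscal_def add.commute)
  also have "\<dots> = 1"
    unfolding e inv_kappa_minus using inv_kappa_nonzero[OF assms(1)] t assms(2)
    by (simp add: power2_eq_square)
  finally show ?thesis .
qed

text \<open>Each numerator of one fraction is matched with a denominator of the other; in the
  applications the arguments in such a pair differ by exactly one period of
  \<open>kp\<close>.\<close>

private lemma ratio_rearrange:
  fixes a :: complex
  shows "(a * b * c * d) / (e * f * g * h) * ((a' * b' * c' * d') / (e' * f' * g' * h')) =
    (a / e') * (b / f') * (c / g') * (d / h') * ((a' / e) * (b' / f) * (c' / g) * (d' / h))"
  by (simp add: mult_ac)

text \<open>The arguments paired by \<open>ratio_rearrange\<close> differ by
  \<open>N * \<zeta>\<close>, so all double products collapse through \<open>kp_zeta\<close> to
  eight single products, which assemble into the four theta values.\<close>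

lemma inv_kappa_crossing:
  assumes r1: "reg \<xi>" and r2: "reg (- \<xi> - of_nat N * \<zeta>)"
  shows "inv_kappa N \<zeta> \<tau> \<xi> * inv_kappa N \<zeta> \<tau> (- \<xi> - of_nat N * \<zeta>) =
    (Theta_add \<tau> (\<zeta> + \<xi>) * Theta_add \<tau> (- (of_nat N - 1) * \<zeta> - \<xi>)) / (Theta_add \<tau> (- \<xi>) * Theta_add \<tau> (of_nat N * \<zeta> + \<xi>))"
proof -
  let ?n = "of_nat N :: complex"
  let ?x = "- \<xi> - ?n * \<zeta>"
  have k1: "kp a / kp b = inverse (qp \<tau> b)" if "a = b + ?n * \<zeta>" "kp a \<noteq> 0" for a b
    using kp_zeta[of b] that by (simp add: field_simps)
  have k2: "kp a / kp b = qp \<tau> a" if "b = a + ?n * \<zeta>" "kp b \<noteq> 0" for a b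
    using kp_zeta[of a] that by (simp add: field_simps)
  have nz: "kp (?n * \<zeta> - \<xi>) \<noteq> 0" "kp (\<zeta> - ?x) \<noteq> 0" "kp (\<tau> - \<xi>) \<noteq> 0" "kp (\<tau> + (?n - 1) * \<zeta> - ?x) \<noteq> 0"
    "kp (?n * \<zeta> - ?x) \<noteq> 0" "kp (\<zeta> - \<xi>) \<noteq> 0" "kp (\<tau> - ?x) \<noteq> 0" "kp (\<tau> + (?n - 1) * \<zeta> - \<xi>) \<noteq> 0"
    "kp (?n * \<zeta> + \<xi>) \<noteq> 0" "kp (\<tau> + \<xi>) \<noteq> 0"
    using r1 r2 unfolding reg_iff by blast+
  have "inv_kappa N \<zeta> \<tau> \<xi> * inv_kappa N \<zeta> \<tau> ?x =
     (kp (?n * \<zeta> - \<xi>) / kp (?n * \<zeta> + ?x)) * (kp (\<zeta> + \<xi>) / kp (\<zeta> - ?x)) * (kp (\<tau> - \<xi>) / kp (\<tau> + ?x))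
       * (kp (\<tau> + (?n - 1) * \<zeta> + \<xi>) / kp (\<tau> + (?n - 1) * \<zeta> - ?x)) *
     ((kp (?n * \<zeta> - ?x) / kp (?n * \<zeta> + \<xi>)) * (kp (\<zeta> + ?x) / kp (\<zeta> - \<xi>)) * (kp (\<tau> - ?x) / kp (\<tau> + \<xi>))
       * (kp (\<tau> + (?n - 1) * \<zeta> + ?x) / kp (\<tau> + (?n - 1) * \<zeta> - \<xi>)))"
    unfolding inv_kappa_eq_kp by (rule ratio_rearrange)
  also have "kp (?n * \<zeta> - \<xi>) / kp (?n * \<zeta> + ?x) = inverse (qp \<tau> (?n * \<zeta> + ?x))"
    by (rule k1) (use nz in \<open>simp_all add: algebra_simps\<close>)
  also have "kp (\<zeta> + \<xi>) / kp (\<zeta> - ?x) = qp \<tau> (\<zeta> + \<xi>)"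
    by (rule k2) (use nz in \<open>simp_all add: algebra_simps\<close>)
  also have "kp (\<tau> - \<xi>) / kp (\<tau> + ?x) = inverse (qp \<tau> (\<tau> + ?x))"
    by (rule k1) (use nz in \<open>simp_all add: algebra_simps\<close>)
  also have "kp (\<tau> + (?n - 1) * \<zeta> + \<xi>) / kp (\<tau> + (?n - 1) * \<zeta> - ?x) = qp \<tau> (\<tau> + (?n - 1) * \<zeta> + \<xi>)"
    by (rule k2) (use nz in \<open>simp_all add: algebra_simps\<close>)
  also have "kp (?n * \<zeta> - ?x) / kp (?n * \<zeta> + \<xi>) = inverse (qp \<tau> (?n * \<zeta> + \<xi>))"
    by (rule k1) (use nz in \<open>simp_all add: algebra_simps\<close>)
  also have "kp (\<zeta> + ?x) / kp (\<zeta> - \<xi>) = qp \<tau> (\<zeta> + ?x)"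
    by (rule k2) (use nz in \<open>simp_all add: algebra_simps\<close>)
  also have "kp (\<tau> - ?x) / kp (\<tau> + \<xi>) = inverse (qp \<tau> (\<tau> + \<xi>))"
    by (rule k1) (use nz in \<open>simp_all add: algebra_simps\<close>)
  also have "kp (\<tau> + (?n - 1) * \<zeta> + ?x) / kp (\<tau> + (?n - 1) * \<zeta> - \<xi>) = qp \<tau> (\<tau> + (?n - 1) * \<zeta> + ?x)"
    by (rule k2) (use nz in \<open>simp_all add: algebra_simps\<close>)
  finally have 1: "inv_kappa N \<zeta> \<tau> \<xi> * inv_kappa N \<zeta> \<tau> ?x =
     inverse (qp \<tau> (?n * \<zeta> + ?x)) * qp \<tau> (\<zeta> + \<xi>) * inverse (qp \<tau> (\<tau> + ?x)) * qp \<tau> (\<tau> + (?n - 1) * \<zeta> + \<xi>) *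
     (inverse (qp \<tau> (?n * \<zeta> + \<xi>)) * qp \<tau> (\<zeta> + ?x) * inverse (qp \<tau> (\<tau> + \<xi>)) * qp \<tau> (\<tau> + (?n - 1) * \<zeta> + ?x))" .
  have q0: "qp \<tau> \<tau> \<noteq> 0"
  proof
    assume "qp \<tau> \<tau> = 0"
    then obtain n where "e2pi \<tau> ^ Suc n = 1" unfolding qp_def qpoch1_eq_0_iff[OF norms(1)] by auto
    then have "norm (e2pi \<tau>) ^ Suc n = 1" by (metis norm_one norm_power)
    moreover have "norm (e2pi \<tau>) ^ Suc n < 1" using norms(1) by (intro power_Suc_less_one) auto
    ultimately show False by simp
  qed
  \<comment> \<open>The arguments are rewritten so that they occur in pairs \<open>y\<close> and
    \<open>\<tau> - y\<close>, each pair making up one \<open>Theta_add\<close>.\<close>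
  have arg: "?n * \<zeta> + ?x = - \<xi>" "\<tau> + ?x = \<tau> - (?n * \<zeta> + \<xi>)" "\<tau> + (?n - 1) * \<zeta> + \<xi> = \<tau> - (- (?n - 1) * \<zeta> - \<xi>)"
    "\<zeta> + ?x = - (?n - 1) * \<zeta> - \<xi>" "\<tau> + \<xi> = \<tau> - (- \<xi>)" "\<tau> + (?n - 1) * \<zeta> + ?x = \<tau> - (\<zeta> + \<xi>)"
    by (simp_all add: algebra_simps)
  show ?thesis
    unfolding 1 arg Theta_add_eq_qp using q0 by (simp add: divide_inverse mult_ac) (simp add: field_simps)
qed

text \<open>The theta values from \<open>inv_kappa_crossing\<close> cancel those in the denominators
  of \<open>rscal\<close> and in the crossing constant. The passage from \<open>Theta_add\<close> to
  \<open>theta\<close> leaves exponentials, and the exponent \<open>2 / N - 2\<close> in the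
  definition of the R-matrix is the one that cancels them.\<close>

lemma rscal_crossing:
  assumes r1: "reg \<xi>" and r2: "reg (- \<xi> - of_nat N * \<zeta>)" and nz: "theta \<tau> \<zeta> \<noteq> 0"
  shows "rscal \<xi> * rscal (- \<xi> - of_nat N * \<zeta>) *
    (- (theta \<tau> \<xi> * theta \<tau> (\<xi> + of_nat N * \<zeta>)) / (theta \<tau> \<zeta>)\<^sup>2) = 1"
proof -
  let ?n = "of_nat N :: complex"
  let ?x = "- \<xi> - ?n * \<zeta>"
  obtain C where C: "C \<noteq> 0" "\<And>x. Theta_add \<tau> x = C * (exp (\<i> * pi * x) * theta \<tau> x)"
    using theta_eq_Theta_add[OF \<tau>] by blast
  have kk: "inv_kappa N \<zeta> \<tau> \<xi> * inv_kappa N \<zeta> \<tau> ?x =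
      (Theta_add \<tau> (\<zeta> + \<xi>) * Theta_add \<tau> (- (?n - 1) * \<zeta> - \<xi>)) / (Theta_add \<tau> (- \<xi>) * Theta_add \<tau> (?n * \<zeta> + \<xi>))"
    by (rule inv_kappa_crossing[OF r1 r2])
  moreover have "inv_kappa N \<zeta> \<tau> \<xi> * inv_kappa N \<zeta> \<tau> ?x \<noteq> 0"
    using inv_kappa_nonzero r1 r2 by simp
  ultimately have t: "theta \<tau> (\<zeta> + \<xi>) \<noteq> 0" "theta \<tau> (- (?n - 1) * \<zeta> - \<xi>) \<noteq> 0" "theta \<tau> \<xi> \<noteq> 0" "theta \<tau> (?n * \<zeta> + \<xi>) \<noteq> 0"
    using theta_minus[OF \<tau>, of \<xi>] by (auto simp: C)
  have x: "?x + \<zeta> = - (?n - 1) * \<zeta> - \<xi>" by (simp add: algebra_simps)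
  define E where "E x = exp (\<i> * pi * x)" for x
  have EE: "(exp (\<i> * pi * \<xi> * (2 / ?n - 2)) * exp (\<i> * pi * ?x * (2 / ?n - 2))) * (E (\<zeta> + \<xi>) * E (- (?n - 1) * \<zeta> - \<xi>)) / (E (- \<xi>) * E (?n * \<zeta> + \<xi>)) = 1"
  proof -
    have "(exp (\<i> * pi * \<xi> * (2 / ?n - 2)) * exp (\<i> * pi * ?x * (2 / ?n - 2))) * (E (\<zeta> + \<xi>) * E (- (?n - 1) * \<zeta> - \<xi>)) / (E (- \<xi>) * E (?n * \<zeta> + \<xi>)) = exp 0"
      unfolding E_def mult_exp_exp exp_diff[symmetric] using N
      by (intro arg_cong[where f = exp]) (simp add: field_simps)
    then show ?thesis by simp
  qed
  have "rscal \<xi> * rscal ?x * (- (theta \<tau> \<xi> * theta \<tau> (\<xi> + ?n * \<zeta>)) / (theta \<tau> \<zeta>)\<^sup>2) =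
      (exp (\<i> * pi * \<xi> * (2 / ?n - 2)) * exp (\<i> * pi * ?x * (2 / ?n - 2))) *
      (inv_kappa N \<zeta> \<tau> \<xi> * inv_kappa N \<zeta> \<tau> ?x) *
      ((theta \<tau> \<zeta> / theta \<tau> (\<zeta> + \<xi>)) * (theta \<tau> \<zeta> / theta \<tau> (- (?n - 1) * \<zeta> - \<xi>)) * (- (theta \<tau> \<xi> * theta \<tau> (?n * \<zeta> + \<xi>)) / (theta \<tau> \<zeta>)\<^sup>2))"
    unfolding rscal_def x by (simp add: add.commute)
  also have "\<dots> = ((exp (\<i> * pi * \<xi> * (2 / ?n - 2)) * exp (\<i> * pi * ?x * (2 / ?n - 2))) * (E (\<zeta> + \<xi>) * E (- (?n - 1) * \<zeta> - \<xi>)) / (E (- \<xi>) * E (?n * \<zeta> + \<xi>))) *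
      ((theta \<tau> (\<zeta> + \<xi>) * theta \<tau> (- (?n - 1) * \<zeta> - \<xi>)) / (- theta \<tau> \<xi> * theta \<tau> (?n * \<zeta> + \<xi>)) *
      ((theta \<tau> \<zeta> / theta \<tau> (\<zeta> + \<xi>)) * (theta \<tau> \<zeta> / theta \<tau> (- (?n - 1) * \<zeta> - \<xi>)) * (- (theta \<tau> \<xi> * theta \<tau> (?n * \<zeta> + \<xi>)) / (theta \<tau> \<zeta>)\<^sup>2)))"
    unfolding kk C E_def[symmetric] theta_minus[OF \<tau>, of \<xi>] using C(1) by (simp add: mult_ac)
  also have "\<dots> = 1"
    unfolding EE using t nz by (simp add: power2_eq_square)
  finally show ?thesis .
qed

text \<open>Since \<open>inv_kappa\<close> at \<open>- \<xi>\<close> is the inverse of its value at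
  \<xi>, the quotient is a product of two values, and the pairing of arguments used for crossing
  works again, now with difference \<tau>. What remains are theta products in the nome of period
  \<open>N * \<zeta>\<close>.\<close>

lemma inv_kappa_tau:
  assumes r1: "reg \<xi>" and r2: "reg (\<xi> + \<tau>)"
  shows "inv_kappa N \<zeta> \<tau> (\<xi> + \<tau>) / inv_kappa N \<zeta> \<tau> \<xi> =
    (Theta_add (of_nat N * \<zeta>) (\<tau> + \<xi>) * Theta_add (of_nat N * \<zeta>) (- \<xi>)) /
    (Theta_add (of_nat N * \<zeta>) (\<zeta> + \<xi>) * Theta_add (of_nat N * \<zeta>) (\<zeta> - \<xi> - \<tau>))"
proof -
  let ?n = "of_nat N :: complex"
  let ?x = "\<xi> + \<tau>"
  let ?q = "qp (?n * \<zeta>)"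
  have k1: "kp a / kp b = inverse (?q b)" if "a = b + \<tau>" "kp a \<noteq> 0" for a b
    using kp_tau[of b] that by (simp add: field_simps)
  have k2: "kp a / kp b = ?q a" if "b = a + \<tau>" "kp b \<noteq> 0" for a b
    using kp_tau[of a] that by (simp add: field_simps)
  have nz: "kp (?n * \<zeta> - \<xi>) \<noteq> 0" "kp (\<zeta> + ?x) \<noteq> 0" "kp (\<tau> - \<xi>) \<noteq> 0" "kp (\<tau> + (?n - 1) * \<zeta> + ?x) \<noteq> 0"
    "kp (?n * \<zeta> + ?x) \<noteq> 0" "kp (\<zeta> - \<xi>) \<noteq> 0" "kp (\<tau> + ?x) \<noteq> 0" "kp (\<tau> + (?n - 1) * \<zeta> - \<xi>) \<noteq> 0"
    using r1 r2 unfolding reg_iff by blast+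
  have "inv_kappa N \<zeta> \<tau> ?x / inv_kappa N \<zeta> \<tau> \<xi> = inv_kappa N \<zeta> \<tau> ?x * inv_kappa N \<zeta> \<tau> (- \<xi>)"
    by (simp add: inv_kappa_minus divide_inverse)
  also have "\<dots> =
     (kp (?n * \<zeta> - ?x) / kp (?n * \<zeta> + - \<xi>)) * (kp (\<zeta> + ?x) / kp (\<zeta> - - \<xi>)) * (kp (\<tau> - ?x) / kp (\<tau> + - \<xi>))
       * (kp (\<tau> + (?n - 1) * \<zeta> + ?x) / kp (\<tau> + (?n - 1) * \<zeta> - - \<xi>)) *
     ((kp (?n * \<zeta> - - \<xi>) / kp (?n * \<zeta> + ?x)) * (kp (\<zeta> + - \<xi>) / kp (\<zeta> - ?x)) * (kp (\<tau> - - \<xi>) / kp (\<tau> + ?x))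
       * (kp (\<tau> + (?n - 1) * \<zeta> + - \<xi>) / kp (\<tau> + (?n - 1) * \<zeta> - ?x)))"
    unfolding inv_kappa_eq_kp by (rule ratio_rearrange)
  also have "kp (?n * \<zeta> - ?x) / kp (?n * \<zeta> + - \<xi>) = ?q (?n * \<zeta> - ?x)"
    by (rule k2) (use nz in \<open>simp_all add: algebra_simps\<close>)
  also have "kp (\<zeta> + ?x) / kp (\<zeta> - - \<xi>) = inverse (?q (\<zeta> - - \<xi>))"
    by (rule k1) (use nz in \<open>simp_all add: algebra_simps\<close>)
  also have "kp (\<tau> - ?x) / kp (\<tau> + - \<xi>) = ?q (\<tau> - ?x)"
    by (rule k2) (use nz in \<open>simp_all add: algebra_simps\<close>)
  also have "kp (\<tau> + (?n - 1) * \<zeta> + ?x) / kp (\<tau> + (?n - 1) * \<zeta> - - \<xi>) = inverse (?q (\<tau> + (?n - 1) * \<zeta> - - \<xi>))"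
    by (rule k1) (use nz in \<open>simp_all add: algebra_simps\<close>)
  also have "kp (?n * \<zeta> - - \<xi>) / kp (?n * \<zeta> + ?x) = ?q (?n * \<zeta> - - \<xi>)"
    by (rule k2) (use nz in \<open>simp_all add: algebra_simps\<close>)
  also have "kp (\<zeta> + - \<xi>) / kp (\<zeta> - ?x) = inverse (?q (\<zeta> - ?x))"
    by (rule k1) (use nz in \<open>simp_all add: algebra_simps\<close>)
  also have "kp (\<tau> - - \<xi>) / kp (\<tau> + ?x) = ?q (\<tau> - - \<xi>)"
    by (rule k2) (use nz in \<open>simp_all add: algebra_simps\<close>)
  also have "kp (\<tau> + (?n - 1) * \<zeta> + - \<xi>) / kp (\<tau> + (?n - 1) * \<zeta> - ?x) = inverse (?q (\<tau> + (?n - 1) * \<zeta> - ?x))"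
    by (rule k1) (use nz in \<open>simp_all add: algebra_simps\<close>)
  finally have 1: "inv_kappa N \<zeta> \<tau> ?x / inv_kappa N \<zeta> \<tau> \<xi> =
     ?q (?n * \<zeta> - ?x) * inverse (?q (\<zeta> - - \<xi>)) * ?q (\<tau> - ?x) * inverse (?q (\<tau> + (?n - 1) * \<zeta> - - \<xi>)) *
     (?q (?n * \<zeta> - - \<xi>) * inverse (?q (\<zeta> - ?x)) * ?q (\<tau> - - \<xi>) * inverse (?q (\<tau> + (?n - 1) * \<zeta> - ?x)))" .
  have q0: "?q (?n * \<zeta>) \<noteq> 0"
  proof
    let ?Q = "e2pi (?n * \<zeta>)"
    assume "?q (?n * \<zeta>) = 0"
    then obtain n where "?Q ^ Suc n = 1" unfolding qp_def qpoch1_eq_0_iff[OF norms(2)] by auto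
    then have "norm ?Q ^ Suc n = 1" by (metis norm_one norm_power)
    moreover have "norm ?Q ^ Suc n < 1" using norms(2) by (intro power_Suc_less_one) auto
    ultimately show False by simp
  qed
  have arg: "?n * \<zeta> - ?x = ?n * \<zeta> - (\<tau> + \<xi>)" "\<zeta> - - \<xi> = \<zeta> + \<xi>" "\<tau> - ?x = - \<xi>"
    "\<tau> + (?n - 1) * \<zeta> - - \<xi> = ?n * \<zeta> - (\<zeta> - \<xi> - \<tau>)" "\<zeta> - ?x = \<zeta> - \<xi> - \<tau>" "\<tau> - - \<xi> = \<tau> + \<xi>"
    "\<tau> + (?n - 1) * \<zeta> - ?x = ?n * \<zeta> - (\<zeta> + \<xi>)"
    by (simp_all add: algebra_simps)
  show ?thesis
    unfolding 1 arg Theta_add_eq_qp using q0 by (simp add: divide_inverse mult_ac) (simp add: field_simps)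
qed

text \<open>The factor that the R-matrix acquires under \<open>\<xi> \<mapsto> \<xi> + \<tau> + 1\<close>, up to conjugation by \<open>g\<^sup>1\<^sup>/\<^sup>2 h g\<^sup>1\<^sup>/\<^sup>2\<close>.\<close>

definition rho :: "complex \<Rightarrow> complex" where
  "rho \<xi> = rscal (\<xi> + \<tau> + 1) / rscal \<xi> * exp (- \<i> * pi * \<tau> - 2 * \<i> * pi * (\<xi> + \<zeta> / of_nat N))"

lemma tauN_eq_Theta_add:
  "tauN N \<zeta> \<xi> = exp (\<i> * pi * \<xi> * (2 / of_nat N - 2)) *
     (Theta_add (of_nat N * \<zeta>) (\<zeta> / 2 + \<xi>) / Theta_add (of_nat N * \<zeta>) (\<zeta> / 2 - \<xi>))"
proof -
  have Q: "e2pi (\<zeta> / 2) ^ (2 * N) = e2pi (of_nat N * \<zeta>)"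
    by (simp add: e2pi_power)
  have q: "exp (\<i> * pi * \<zeta>) = e2pi (\<zeta> / 2)" by (simp add: e2pi_def mult_ac)
  show ?thesis
    unfolding tauN_def Let_def q Q e2pi_def[of \<xi>, symmetric] Theta_add_def e2pi_add e2pi_diff ..
qed

lemma Theta_add_zeta_nonzero:
  assumes "generic_arg \<zeta> \<tau> \<xi>"
  shows "Theta_add (of_nat N * \<zeta>) \<xi> \<noteq> 0"
proof
  have im: "Im (of_nat N * \<zeta>) > 0" using \<zeta> N by simp
  assume "Theta_add (of_nat N * \<zeta>) \<xi> = 0"
  then obtain n :: int where "e2pi \<xi> = e2pi (of_nat N * \<zeta>) powi n"
    unfolding Theta_add_def using Theta_eq_0_iff[OF norms(2)] by auto
  also have "\<dots> = e2pi (of_int n * (of_nat N * \<zeta>))"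
    unfolding e2pi_def exp_power_int by (simp add: mult_ac)
  finally have "e2pi (\<xi> - of_int n * (of_nat N * \<zeta>)) = 1" by (simp add: e2pi_diff)
  then obtain k :: int where "\<xi> - of_int n * (of_nat N * \<zeta>) = of_int k" using e2pi_eq_1_iff by blast
  then have "\<xi> = of_int k + of_int (n * int N) * \<zeta> + of_int 0 * \<tau>" by (simp add: algebra_simps)
  then show False using assms unfolding generic_arg_def by blast
qed

text \<open>The shift gives each theta factor an exponential multiplier, and the quotient of the two
  is compensated by the change of the fractional power
  \<open>exp (\<i> * pi * \<xi> * (2 / N - 2))\<close>.\<close>

lemma tauN_period: "tauN N \<zeta> (\<xi> + of_nat N * \<zeta>) = tauN N \<zeta> \<xi>"
proof -
  let ?t = "of_nat N * \<zeta>"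
  have im: "Im ?t > 0" using \<zeta> N by simp
  have 1: "Theta_add ?t (\<zeta> / 2 + (\<xi> + ?t)) = - Theta_add ?t (\<zeta> / 2 + \<xi>) / e2pi (\<zeta> / 2 + \<xi>)"
    using Theta_add_shift[OF im, of "\<zeta> / 2 + \<xi>"] by (simp add: add.assoc)
  have 2: "Theta_add ?t (\<zeta> / 2 - (\<xi> + ?t)) = - Theta_add ?t (\<zeta> / 2 - \<xi>) * e2pi (\<zeta> / 2 - \<xi> - ?t)"
    using Theta_add_shift[OF im, of "\<zeta> / 2 - \<xi> - ?t"] by (simp add: field_simps)
  have "exp (\<i> * pi * (\<xi> + ?t) * (2 / of_nat N - 2)) / (e2pi (\<zeta> / 2 + \<xi>) * e2pi (\<zeta> / 2 - \<xi> - ?t)) =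
      exp (\<i> * pi * \<xi> * (2 / of_nat N - 2))"
    unfolding e2pi_def mult_exp_exp exp_diff[symmetric] using N
    by (intro arg_cong[where f = exp]) (simp add: field_simps)
  then have e: "exp (\<i> * pi * (\<xi> + ?t) * (2 / of_nat N - 2)) * (inverse (e2pi (\<zeta> / 2 + \<xi>)) * inverse (e2pi (\<zeta> / 2 - \<xi> - ?t))) =
      exp (\<i> * pi * \<xi> * (2 / of_nat N - 2))"
    by (simp only: divide_inverse inverse_mult_distrib)
  have aux: "E * (- A / a / (- B * b)) = E * (inverse a * inverse b) * (A / B)" for E A a B b :: complex
    by (simp add: divide_inverse mult_ac)
  show ?thesis
    unfolding tauN_eq_Theta_add 1 2 e[symmetric] by (rule aux)
qed

text \<open>The four theta values of \<open>inv_kappa_tau\<close> are precisely those in the two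
  \<open>tauN\<close> factors, and all exponentials cancel. Consequently \<open>rho\<close> depends
  on \<tau> only through an argument of \<open>tauN\<close>, which allows a comparison of the two
  elliptic nomes.\<close>

lemma rho_tauN:
  assumes g: "generic_arg \<zeta> \<tau> \<xi>" and nz: "theta \<tau> \<zeta> \<noteq> 0"
  shows "rho \<xi> * (tauN N \<zeta> (\<zeta> / 2 + \<xi>) * tauN N \<zeta> (\<zeta> / 2 - \<xi> - \<tau> - 1)) = 1"
proof -
  let ?n = "of_nat N :: complex"
  let ?T = "Theta_add (?n * \<zeta>)"
  have gs: "generic_arg \<zeta> \<tau> (\<xi> + of_int a + of_int b * \<zeta> + of_int c * \<tau>)" for a b c
    by (rule generic_arg_shift[OF g])
  have r: "reg \<xi>" "reg (\<xi> + \<tau>)" "reg (\<xi> + \<tau> + 1)"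
    using reg_generic[OF gs[of 0 0 0]] reg_generic[OF gs[of 0 0 1]] reg_generic[OF gs[of 1 0 1]] by (simp_all add: add_ac)
  have nzT: "?T (\<xi> + of_int a + of_int b * \<zeta> + of_int c * \<tau>) \<noteq> 0" for a b c
    by (rule Theta_add_zeta_nonzero[OF gs])
  \<comment> \<open>Adding 1 is invisible to all infinite products. It affects the fractional power
    and the sign of theta, and that sign cancels the one from the shift by \<tau>.\<close>
  have per: "?T (x + 1) = ?T x" "?T (x - 1) = ?T x" for x
    by (simp_all add: Theta_add_def e2pi_add e2pi_diff e2pi_1)
  have kper: "kp (x + 1) = kp x" "kp (x - 1) = kp x" for x
    by (simp_all add: kp_def e2pi_add e2pi_diff e2pi_1)
  have k1: "inv_kappa N \<zeta> \<tau> (x + 1) = inv_kappa N \<zeta> \<tau> x" for x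
    unfolding inv_kappa_eq_kp add.assoc[symmetric] diff_diff_eq[symmetric] kper ..
  define kr where "kr = inv_kappa N \<zeta> \<tau> (\<xi> + \<tau>) / inv_kappa N \<zeta> \<tau> \<xi>"
  have kr: "kr = (?T (\<tau> + \<xi>) * ?T (- \<xi>)) / (?T (\<zeta> + \<xi>) * ?T (\<zeta> - \<xi> - \<tau>))"
    unfolding kr_def by (rule inv_kappa_tau[OF r(1,2)])
  have th: "theta \<tau> (\<xi> + \<tau> + 1 + \<zeta>) = exp (- \<i> * pi * \<tau> - 2 * \<i> * pi * (\<xi> + \<zeta>)) * theta \<tau> (\<xi> + \<zeta>)"
    using theta_add_1[OF \<tau>, of "\<xi> + \<zeta> + \<tau>"] theta_add_tau[OF \<tau>, of "\<xi> + \<zeta>"] by (simp add: add_ac)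
  have thnz: "theta \<tau> (\<xi> + \<zeta>) \<noteq> 0" using r(1) by (simp add: reg_iff add.commute)
  have rr: "rscal (\<xi> + \<tau> + 1) / rscal \<xi> = exp (\<i> * pi * (\<xi> + \<tau> + 1) * (2 / ?n - 2)) / exp (\<i> * pi * \<xi> * (2 / ?n - 2)) * kr /
      exp (- \<i> * pi * \<tau> - 2 * \<i> * pi * (\<xi> + \<zeta>))"
    unfolding rscal_def k1 th kr_def using nz thnz by (simp add: field_simps)
  have E: "exp (\<i> * pi * (\<xi> + \<tau> + 1) * (2 / ?n - 2)) / exp (\<i> * pi * \<xi> * (2 / ?n - 2)) /
      exp (- \<i> * pi * \<tau> - 2 * \<i> * pi * (\<xi> + \<zeta>)) * exp (- \<i> * pi * \<tau> - 2 * \<i> * pi * (\<xi> + \<zeta> / ?n)) *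
      (exp (\<i> * pi * (\<zeta> / 2 + \<xi>) * (2 / ?n - 2)) * exp (\<i> * pi * (\<zeta> / 2 - \<xi> - \<tau> - 1) * (2 / ?n - 2))) = 1"
  proof -
    have "exp (\<i> * pi * (\<xi> + \<tau> + 1) * (2 / ?n - 2)) / exp (\<i> * pi * \<xi> * (2 / ?n - 2)) /
      exp (- \<i> * pi * \<tau> - 2 * \<i> * pi * (\<xi> + \<zeta>)) * exp (- \<i> * pi * \<tau> - 2 * \<i> * pi * (\<xi> + \<zeta> / ?n)) *
      (exp (\<i> * pi * (\<zeta> / 2 + \<xi>) * (2 / ?n - 2)) * exp (\<i> * pi * (\<zeta> / 2 - \<xi> - \<tau> - 1) * (2 / ?n - 2))) = exp 0"
      unfolding exp_diff[symmetric] mult_exp_exp using N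
      by (intro arg_cong[where f = exp]) (simp add: field_simps)
    then show ?thesis by simp
  qed
  have arg: "\<zeta> / 2 + (\<zeta> / 2 + \<xi>) = \<zeta> + \<xi>" "\<zeta> / 2 - (\<zeta> / 2 + \<xi>) = - \<xi>"
    "\<zeta> / 2 + (\<zeta> / 2 - \<xi> - \<tau> - 1) = \<zeta> - \<xi> - \<tau> - 1" "\<zeta> / 2 - (\<zeta> / 2 - \<xi> - \<tau> - 1) = \<tau> + \<xi> + 1"
    by (simp_all add: algebra_simps flip: add_divide_distrib)
  have Tnz: "?T (\<tau> + \<xi>) \<noteq> 0" "?T (- \<xi>) \<noteq> 0" "?T (\<zeta> + \<xi>) \<noteq> 0" "?T (\<zeta> - \<xi> - \<tau>) \<noteq> 0"
  proof -
    have im: "Im (?n * \<zeta>) > 0" using \<zeta> N by simp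
    show "?T (\<tau> + \<xi>) \<noteq> 0" using nzT[of 0 0 1] by (simp add: add.commute)
    show "?T (\<zeta> + \<xi>) \<noteq> 0" using nzT[of 0 1 0] by (simp add: add.commute)
    show "?T (- \<xi>) \<noteq> 0" using nzT[of 0 0 0] by (simp add: Theta_add_minus[OF im])
    have *: "\<xi> + of_int 0 + of_int (- 1) * \<zeta> + of_int 1 * \<tau> = \<xi> + \<tau> - \<zeta>" by simp
    have "?T (\<xi> + \<tau> - \<zeta>) \<noteq> 0" using nzT[of 0 "-1" 1] unfolding * .
    then have "?T (- (\<xi> + \<tau> - \<zeta>)) \<noteq> 0" unfolding Theta_add_minus[OF im] by simp
    moreover have "- (\<xi> + \<tau> - \<zeta>) = \<zeta> - \<xi> - \<tau>" by simp
    ultimately show "?T (\<zeta> - \<xi> - \<tau>) \<noteq> 0" by (simp only: not_False_eq_True)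
  qed
  have aux: "a / b * k / c * e * (E1 * (A / B) * (E2 * (C / D))) = a / b / c * e * (E1 * E2) * (k * (A / B * (C / D)))"
    for a b c e k E1 E2 A B C D :: complex
    by (simp add: divide_inverse mult_ac)
  have "rho \<xi> * (tauN N \<zeta> (\<zeta> / 2 + \<xi>) * tauN N \<zeta> (\<zeta> / 2 - \<xi> - \<tau> - 1)) =
     (exp (\<i> * pi * (\<xi> + \<tau> + 1) * (2 / ?n - 2)) / exp (\<i> * pi * \<xi> * (2 / ?n - 2)) /
      exp (- \<i> * pi * \<tau> - 2 * \<i> * pi * (\<xi> + \<zeta>)) * exp (- \<i> * pi * \<tau> - 2 * \<i> * pi * (\<xi> + \<zeta> / ?n)) *
      (exp (\<i> * pi * (\<zeta> / 2 + \<xi>) * (2 / ?n - 2)) * exp (\<i> * pi * (\<zeta> / 2 - \<xi> - \<tau> - 1) * (2 / ?n - 2)))) *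
     (kr * ((?T (\<zeta> + \<xi>) / ?T (- \<xi>)) * (?T (\<zeta> - \<xi> - \<tau>) / ?T (\<tau> + \<xi>))))"
    unfolding rho_def rr tauN_eq_Theta_add arg per by (rule aux)
  also have "\<dots> = 1" unfolding E kr using Tnz by simp
  finally show ?thesis .
qed

end

section \<open>Properties of the R-matrix\<close>

context
  fixes \<zeta> \<tau> :: complex
  assumes \<zeta>: "Im \<zeta> > 0" and \<tau>: "Im \<tau> > 0"
begin

lemma Wfun_eq_weight: "Wfun (\<alpha> :: 'n::nontriv mod_ring \<times> 'n mod_ring) \<xi> \<zeta> \<tau> =
    weight \<tau> (\<zeta> / of_nat CARD('n)) \<alpha> \<xi> / of_nat CARD('n)"
proof -
  define a where "a = real (zrep (fst \<alpha>)) / real CARD('n)"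
  define b where "b = real (zrep (snd \<alpha>)) / real CARD('n)"
  define \<eta> where "\<eta> = \<zeta> / of_nat CARD('n)"
  have z: "complex_of_real (real (zrep i)) = of_int (to_int_mod_ring i)" for i :: "'n mod_ring"
    unfolding int_zrep[symmetric] by simp
  have a: "complex_of_real a = of_int (to_int_mod_ring (fst \<alpha>)) / of_nat CARD('n)"
    unfolding a_def of_real_divide z by simp
  have b: "complex_of_real b = of_int (to_int_mod_ring (snd \<alpha>)) / of_nat CARD('n)"
    unfolding b_def of_real_divide z by simp
  have tw: "b + a * \<tau> = twist \<tau> \<alpha>" by (simp add: a b twist_def add_divide_distrib)
  have E: "exp (\<i> * pi * (complex_of_real a)\<^sup>2 * \<tau> + 2 * \<i> * pi * a * (\<xi> + \<eta> + 1/2 + b)) =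
      exp (2 * \<i> * pi * of_int (to_int_mod_ring (fst \<alpha>)) * \<xi> / of_nat CARD('n)) *
      exp (\<i> * pi * (complex_of_real a)\<^sup>2 * \<tau> + 2 * \<i> * pi * a * (\<eta> + 1/2 + b))"
    unfolding mult_exp_exp by (rule arg_cong[where f = exp]) (simp add: a field_simps)
  have "Wfun \<alpha> \<xi> \<zeta> \<tau> = 1 / of_nat CARD('n) * (jtheta (1/2 + a) (1/2 + b) (\<xi> + \<eta>) \<tau> / jtheta (1/2 + a) (1/2 + b) \<eta> \<tau>)"
    by (simp add: Wfun_def Let_def a_def b_def \<eta>_def)
  also have "\<dots> = weight \<tau> \<eta> \<alpha> \<xi> / of_nat CARD('n)"
    unfolding jtheta_eq_theta[OF \<tau>] E weight_def add.assoc[of _ "complex_of_real b"] tw by simp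
  finally show ?thesis by (simp add: \<eta>_def)
qed

lemma Rtilde_eq:
  "(Rtilde \<zeta> \<tau> \<xi> :: (complex, 'n::nontriv) zmat2) =
     map_matrix ((*) (rscal \<zeta> \<tau> CARD('n) \<xi> / of_nat CARD('n))) (Rcore \<zeta> \<tau> \<xi>)"
proof -
  have "(Rtilde \<zeta> \<tau> \<xi> :: (complex, 'n) zmat2) = map_matrix ((*) (rscal \<zeta> \<tau> CARD('n) \<xi>))
     (\<Sum>\<alpha>\<in>UNIV. map_matrix ((*) (weight \<tau> (\<zeta> / of_nat CARD('n)) \<alpha> \<xi> / of_nat CARD('n))) (Jmat \<alpha>))"
    unfolding Rtilde_def Wfun_eq_weight matrix_inv_Imat Jmat_def rscal_def[OF \<zeta> \<tau> CARD_nontriv_pos] theta_def[OF \<tau>, symmetric] by (simp add: mult_ac)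
  also have "\<dots> = map_matrix ((*) (rscal \<zeta> \<tau> CARD('n) \<xi> / of_nat CARD('n))) (Rcore \<zeta> \<tau> \<xi>)"
    unfolding Rcore_def smult_sum_matrix smult_smult_matrix by simp
  finally show ?thesis .
qed

end

definition diag_mat :: "('a::zero, 'n::finite) zmat \<Rightarrow> bool" where
  "diag_mat A \<longleftrightarrow> (\<forall>i j. i \<noteq> j \<longrightarrow> A $ i $ j = 0)"

lemma tensor_diag_mult_nth:
  fixes A B :: "('a::comm_semiring_1, 'n::finite) zmat"
  assumes "diag_mat A" "diag_mat B"
  shows "(tensor A B ** X) $ i $ j = A $ fst i $ fst i * B $ snd i $ snd i * X $ i $ j"
    and "(X ** tensor A B) $ i $ j = X $ i $ j * (A $ fst j $ fst j * B $ snd j $ snd j)"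
proof -
  have d: "A $ k $ l = (if k = l then A $ k $ k else 0)" "B $ k $ l = (if k = l then B $ k $ k else 0)" for k l
    using assms by (auto simp: diag_mat_def)
  have t: "tensor A B $ k $ l = (if k = l then A $ fst k $ fst k * B $ snd k $ snd k else 0)" for k l
    using d(1)[of "fst k" "fst l"] d(2)[of "snd k" "snd l"] by (auto simp: prod_eq_iff)
  show "(tensor A B ** X) $ i $ j = A $ fst i $ fst i * B $ snd i $ snd i * X $ i $ j"
    unfolding matrix_mult_nth t by (simp add: mult_delta_left mult_delta_right)
  show "(X ** tensor A B) $ i $ j = X $ i $ j * (A $ fst j $ fst j * B $ snd j $ snd j)"
    unfolding matrix_mult_nth t by (simp add: mult_delta_left mult_delta_right)
qed

lemma mat_mult_smult:
  fixes A :: "('a::comm_semiring_1, 'm::finite) vec ^ 'm"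
  shows "A ** mat c = map_matrix ((*) c) A" and "mat c ** A = map_matrix ((*) c) A"
  by (rule mat_eqI; simp add: matrix_mult_nth mat_nth mult_delta_left mult_delta_right mult.commute)+

lemma smult_mat: "map_matrix ((*) c) (mat d) = mat (c * d :: 'a::comm_semiring_1)"
  by (rule mat_eqI) (simp add: mat_nth)

context
  fixes G :: "(complex, 'n::nontriv) zmat"
  assumes G: "diag_sqrt_g G"
begin

abbreviation (input) "Gi \<equiv> matrix_inv G"

lemma diag_G: "diag_mat G" using G by (simp add: diag_sqrt_g_def diag_mat_def)

lemma G_mult_G: "G ** G = gmat" using G by (simp add: diag_sqrt_g_def)

lemma G_diag_nonzero: "G $ i $ i \<noteq> 0"
proof
  assume 0: "G $ i $ i = 0"
  have "G $ i $ k * G $ k $ i = 0" for k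
    using diag_G 0 by (cases "k = i") (auto simp: diag_mat_def)
  then have "(G ** G) $ i $ i = 0" unfolding matrix_mult_nth by (simp only: sum.neutral_const)
  then show False unfolding G_mult_G by (simp add: gmat_def omega_def)
qed

lemma G_inverse:
  defines "H \<equiv> (\<chi> i j. if i = j then inverse (G $ i $ i) else 0)"
  shows "G ** H = mat 1" "H ** G = mat 1"
proof -
  define \<gamma> where "\<gamma> i = G $ i $ i" for i
  have \<gamma>: "\<gamma> i \<noteq> 0" for i by (simp add: \<gamma>_def G_diag_nonzero)
  have G_nth: "G $ k $ l = (if k = l then \<gamma> k else 0)" for k l
    using diag_G by (auto simp: diag_mat_def \<gamma>_def)
  have H_nth: "H $ k $ l = (if k = l then inverse (\<gamma> k) else 0)" for k l
    by (simp add: H_def \<gamma>_def)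
  show "G ** H = mat 1" "H ** G = mat 1"
    by (rule mat_eqI; simp add: matrix_mult_nth mat_nth G_nth H_nth \<gamma> mult_delta_left)+
qed

lemma matrix_inv_G: "matrix_inv G = (\<chi> i j. if i = j then inverse (G $ i $ i) else 0)"
  by (rule matrix_inv_eqI[OF G_inverse])

lemma diag_Gi: "diag_mat (matrix_inv G)" by (simp add: diag_mat_def matrix_inv_G)

lemma G_Gi: "G ** matrix_inv G = mat 1" "matrix_inv G ** G = mat 1"
  unfolding matrix_inv_G by (rule G_inverse)+

text \<open>Partial transposition exchanges left and right multiplication in the second tensor
  factor. For diagonal \<open>G\<close> this trades \<open>G\<close> for its inverse in that slot,
  in such a way that the inner matrices still cancel in the crossing product.\<close>

lemma transp2_conj_G:
  "transp2 (tensor G G ** X ** tensor (matrix_inv G) (matrix_inv G)) =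
     tensor G (matrix_inv G) ** transp2 X ** tensor (matrix_inv G) G"
proof (rule mat_eqI)
  fix i j :: "'n mod_ring \<times> 'n mod_ring"
  show "transp2 (tensor G G ** X ** tensor (matrix_inv G) (matrix_inv G)) $ i $ j =
     (tensor G (matrix_inv G) ** transp2 X ** tensor (matrix_inv G) G) $ i $ j"
    unfolding transp2_nth tensor_diag_mult_nth(1)[OF diag_G diag_G] tensor_diag_mult_nth(2)[OF diag_Gi diag_Gi]
      tensor_diag_mult_nth(1)[OF diag_G diag_Gi] tensor_diag_mult_nth(2)[OF diag_Gi diag_G]
    by (simp only: fst_conv snd_conv transp2_nth mult_ac)
qed

lemma conj_G_mult:
  "(tensor G G ** X ** tensor Gi Gi) ** (tensor G G ** Y ** tensor Gi Gi) = tensor G G ** (X ** Y) ** tensor Gi Gi"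
proof -
  have i: "tensor Gi Gi ** tensor G G = mat 1" by (simp add: tensor_mult G_Gi)
  have "(tensor G G ** X ** tensor Gi Gi) ** (tensor G G ** Y ** tensor Gi Gi) =
      tensor G G ** X ** (tensor Gi Gi ** tensor G G) ** Y ** tensor Gi Gi"
    by (simp only: matrix_mul_assoc)
  then show ?thesis unfolding i by (simp add: matrix_mul_assoc)
qed

lemma conj_G_mat: "tensor G G ** mat c ** tensor Gi Gi = mat c"
  by (simp add: mat_mult_smult smult_matrix_mult tensor_mult G_Gi smult_mat)

section \<open>Unitarity, crossing and quasi-periodicity of the full R-matrix\<close>

context
  fixes \<zeta> \<tau> :: complex
  assumes \<zeta>: "Im \<zeta> > 0" and \<tau>: "Im \<tau> > 0" and nz: "theta \<tau> \<zeta> \<noteq> 0"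
begin

lemma Rmat_eq:
  "Rmat G \<zeta> \<tau> \<xi> = map_matrix ((*) (rscal \<zeta> \<tau> CARD('n) \<xi> / of_nat CARD('n))) (tensor G G ** Rcore \<zeta> \<tau> \<xi> ** tensor Gi Gi)"
  unfolding Rmat_def Rtilde_eq[OF \<zeta> \<tau>] smult_matrix_mult ..

lemma flip_Rmat_eq:
  "flip (Rmat G \<zeta> \<tau> \<xi>) = map_matrix ((*) (rscal \<zeta> \<tau> CARD('n) \<xi> / of_nat CARD('n))) (tensor G G ** flip (Rcore \<zeta> \<tau> \<xi>) ** tensor Gi Gi)"
  unfolding Rmat_eq flip_smult flip_mult flip_tensor ..

lemma Rmat_unitarity:
  assumes r: "reg \<zeta> \<tau> CARD('n) \<xi>"
  shows "Rmat G \<zeta> \<tau> \<xi> ** flip (Rmat G \<zeta> \<tau> (- \<xi>)) = mat 1"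
proof -
  have "Rmat G \<zeta> \<tau> \<xi> ** flip (Rmat G \<zeta> \<tau> (- \<xi>)) =
      mat (rscal \<zeta> \<tau> CARD('n) \<xi> * rscal \<zeta> \<tau> CARD('n) (- \<xi>) * (theta \<tau> (\<zeta> + \<xi>) * theta \<tau> (\<zeta> - \<xi>) / (theta \<tau> \<zeta>)\<^sup>2))"
    unfolding flip_Rmat_eq unfolding Rmat_eq smult_matrix_mult conj_G_mult Rcore_unitarity[OF \<tau> nz] conj_G_mat
      smult_smult_matrix smult_mat by (rule arg_cong[where f = mat]) (simp add: power2_eq_square)
  also have "\<dots> = mat 1"
    by (subst rscal_unitarity[OF \<zeta> \<tau> CARD_nontriv_pos r nz]) (rule refl)
  finally show ?thesis .
qed

lemma flip_Rmat_unitarity: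
  assumes r: "reg \<zeta> \<tau> CARD('n) \<xi>"
  shows "flip (Rmat G \<zeta> \<tau> \<xi>) ** Rmat G \<zeta> \<tau> (- \<xi>) = mat 1"
  using arg_cong[OF Rmat_unitarity[OF r], of flip] by (simp add: flip_mult)

lemma matrix_inv_Rmat:
  assumes r: "reg \<zeta> \<tau> CARD('n) \<xi>"
  shows "matrix_inv (Rmat G \<zeta> \<tau> \<xi>) = flip (Rmat G \<zeta> \<tau> (- \<xi>))"
proof (rule matrix_inv_eqI)
  have r': "reg \<zeta> \<tau> CARD('n) (- \<xi>)" using r by (simp add: reg_minus[OF \<zeta> \<tau> CARD_nontriv_pos])
  show "flip (Rmat G \<zeta> \<tau> (- \<xi>)) ** Rmat G \<zeta> \<tau> \<xi> = mat 1"
    using flip_Rmat_unitarity[OF r'] by simp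
qed (rule Rmat_unitarity[OF r])

lemma matrix_inv_flip_Rmat:
  assumes r: "reg \<zeta> \<tau> CARD('n) \<xi>"
  shows "matrix_inv (flip (Rmat G \<zeta> \<tau> \<xi>)) = Rmat G \<zeta> \<tau> (- \<xi>)"
proof (rule matrix_inv_eqI)
  have r': "reg \<zeta> \<tau> CARD('n) (- \<xi>)" using r by (simp add: reg_minus[OF \<zeta> \<tau> CARD_nontriv_pos])
  show "Rmat G \<zeta> \<tau> (- \<xi>) ** flip (Rmat G \<zeta> \<tau> \<xi>) = mat 1"
    using Rmat_unitarity[OF r'] by simp
qed (rule flip_Rmat_unitarity[OF r])

lemma Rmat_crossing:
  assumes r: "reg \<zeta> \<tau> CARD('n) \<xi>" and r': "reg \<zeta> \<tau> CARD('n) (- \<xi> - of_nat CARD('n) * \<zeta>)"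
  shows "transp2 (flip (Rmat G \<zeta> \<tau> \<xi>)) ** transp2 (Rmat G \<zeta> \<tau> (- \<xi> - of_nat CARD('n) * \<zeta>)) = mat 1"
proof -
  let ?x = "- \<xi> - of_nat CARD('n) * \<zeta>"
  let ?A = "transp2 (flip (Rcore \<zeta> \<tau> \<xi>)) :: (complex, 'n) zmat2"
  let ?B = "transp2 (Rcore \<zeta> \<tau> ?x) :: (complex, 'n) zmat2"
  define c where "c = - (of_nat CARD('n))\<^sup>2 * theta \<tau> (- \<xi>) * theta \<tau> ?x / (theta \<tau> \<zeta>)\<^sup>2"
  have AB: "?A ** ?B = mat c"
    using Rcore_crossing[OF \<tau> nz, of "- \<xi>", where ?'n = 'n] by (simp add: c_def)
  have i: "tensor Gi G ** tensor G Gi = mat 1" "tensor G Gi ** tensor Gi G = mat 1"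
    by (simp_all add: tensor_mult G_Gi)
  have "(tensor G Gi ** ?A ** tensor Gi G) ** (tensor G Gi ** ?B ** tensor Gi G) =
      tensor G Gi ** ?A ** (tensor Gi G ** tensor G Gi) ** ?B ** tensor Gi G"
    by (simp only: matrix_mul_assoc)
  also have "\<dots> = tensor G Gi ** (?A ** ?B) ** tensor Gi G"
    unfolding i by (simp add: matrix_mul_assoc)
  also have "\<dots> = mat c"
    unfolding AB by (simp add: mat_mult_smult smult_matrix_mult i smult_mat)
  finally have ABG: "(tensor G Gi ** ?A ** tensor Gi G) ** (tensor G Gi ** ?B ** tensor Gi G) = mat c" .
  have "transp2 (flip (Rmat G \<zeta> \<tau> \<xi>)) ** transp2 (Rmat G \<zeta> \<tau> ?x) =
      mat (rscal \<zeta> \<tau> CARD('n) \<xi> / of_nat CARD('n) * (rscal \<zeta> \<tau> CARD('n) ?x / of_nat CARD('n) * c))"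
    unfolding flip_Rmat_eq unfolding Rmat_eq transp2_smult smult_matrix_mult transp2_conj_G ABG smult_smult_matrix smult_mat
    by (simp add: mult_ac)
  also have "rscal \<zeta> \<tau> CARD('n) \<xi> / of_nat CARD('n) * (rscal \<zeta> \<tau> CARD('n) ?x / of_nat CARD('n) * c) = 1"
  proof -
    have x: "theta \<tau> (- \<xi> - of_nat CARD('n) * \<zeta>) = - theta \<tau> (\<xi> + of_nat CARD('n) * \<zeta>)"
      using theta_minus[OF \<tau>, of "\<xi> + of_nat CARD('n) * \<zeta>"] by simp
    have aux: "r / n * (r' / n * (- n\<^sup>2 * - t * - t' / z)) = r * r' * (- (t * t') / z)" if "n \<noteq> 0" for r r' n t t' z :: complex
      using that by (simp add: power2_eq_square)
    show ?thesis
      unfolding c_def x theta_minus[OF \<tau>]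
      by (subst aux) (simp_all add: rscal_crossing[OF \<zeta> \<tau> CARD_nontriv_pos r r' nz, simplified])
  qed
  finally show ?thesis .
qed

text \<open>Under the shift by \<open>\<tau> + 1\<close> the weight of \<alpha> acquires the phase
  \<open>chi (fst \<alpha> - snd \<alpha>)\<close> besides the common factor \<open>e\<close>.
  Moving \<open>h g\<close> past \<open>Jmat \<alpha>\<close> in either slot absorbs exactly this
  phase.\<close>

lemma Rcore_hg:
  fixes \<xi> :: complex
  defines "e \<equiv> exp (- \<i> * pi * \<tau> - 2 * \<i> * pi * (\<xi> + \<zeta> / of_nat CARD('n)))"
  shows "tensor (hmat ** gmat) (mat 1) ** Rcore \<zeta> \<tau> (\<xi> + \<tau> + 1) =
      map_matrix ((*) e) (Rcore \<zeta> \<tau> \<xi> ** tensor (hmat ** gmat :: (complex, 'n) zmat) (mat 1))"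
    and "Rcore \<zeta> \<tau> (\<xi> + \<tau> + 1) ** tensor (mat 1) (hmat ** gmat) =
      map_matrix ((*) e) (tensor (mat 1) (hmat ** gmat :: (complex, 'n) zmat) ** Rcore \<zeta> \<tau> \<xi>)"
proof -
  let ?h = "hmat ** gmat :: (complex, 'n) zmat"
  let ?\<eta> = "\<zeta> / of_nat CARD('n)"
  have w: "weight \<tau> ?\<eta> \<alpha> (\<xi> + \<tau> + 1) = e * (chi (fst \<alpha> - snd \<alpha>) * weight \<tau> ?\<eta> \<alpha> \<xi>)" for \<alpha> :: "'n mod_ring \<times> 'n mod_ring"
    using weight_add_1[OF \<tau>, of ?\<eta> \<alpha> "\<xi> + \<tau>"] weight_add_tau[OF \<tau>, of ?\<eta> \<alpha> \<xi>]
    by (simp add: e_def chi_diff field_simps)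
  have J1: "Jmat \<alpha> ** tensor ?h (mat 1) = map_matrix ((*) (chi (fst \<alpha> - snd \<alpha>))) (tensor ?h (mat 1) ** Jmat \<alpha>)" for \<alpha> :: "'n mod_ring \<times> 'n mod_ring"
    unfolding Jmat_def tensor_mult Imat_hg by (rule mat_eqI) simp
  have J2: "tensor (mat 1) ?h ** Jmat \<alpha> = map_matrix ((*) (chi (fst \<alpha> - snd \<alpha>))) (Jmat \<alpha> ** tensor (mat 1) ?h)" for \<alpha> :: "'n mod_ring \<times> 'n mod_ring"
  proof -
    have "chi (fst \<alpha> - snd \<alpha>) * chi (snd \<alpha> - fst \<alpha>) = 1" by (simp flip: chi_add)
    moreover have "chi (snd \<alpha> - fst \<alpha>) * chi (fst \<alpha> - snd \<alpha>) = 1" by (simp flip: chi_add)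
    ultimately show ?thesis unfolding Jmat_def tensor_mult Iinv_hg
      by (intro mat_eqI) (simp add: mult.left_commute[of "chi (fst \<alpha> - snd \<alpha>)"])
  qed
  show "tensor ?h (mat 1) ** Rcore \<zeta> \<tau> (\<xi> + \<tau> + 1) = map_matrix ((*) e) (Rcore \<zeta> \<tau> \<xi> ** tensor ?h (mat 1))"
    unfolding Rcore_def sum_matrix_mult_left sum_matrix_mult_right smult_matrix_mult smult_sum_matrix J1 smult_smult_matrix w
    by (simp add: mult_ac)
  show "Rcore \<zeta> \<tau> (\<xi> + \<tau> + 1) ** tensor (mat 1) ?h = map_matrix ((*) e) (tensor (mat 1) ?h ** Rcore \<zeta> \<tau> \<xi>)"
    unfolding Rcore_def sum_matrix_mult_left sum_matrix_mult_right smult_matrix_mult smult_sum_matrix J2 smult_smult_matrix w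
    by (simp add: mult_ac)
qed

lemma Rmat_quasiperiodic:
  assumes r: "reg \<zeta> \<tau> CARD('n) \<xi>"
  defines "K \<equiv> G ** hmat ** G"
  shows "tensor K (mat 1) ** Rmat G \<zeta> \<tau> (\<xi> + \<tau> + 1) = map_matrix ((*) (rho \<zeta> \<tau> CARD('n) \<xi>)) (Rmat G \<zeta> \<tau> \<xi> ** tensor K (mat 1))"
    and "Rmat G \<zeta> \<tau> (\<xi> + \<tau> + 1) ** tensor (mat 1) K = map_matrix ((*) (rho \<zeta> \<tau> CARD('n) \<xi>)) (tensor (mat 1) K ** Rmat G \<zeta> \<tau> \<xi>)"
proof -
  let ?h = "hmat ** gmat :: (complex, 'n) zmat"
  define e where "e = exp (- \<i> * pi * \<tau> - 2 * \<i> * pi * (\<xi> + \<zeta> / of_nat CARD('n)))"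
  \<comment> \<open>Conjugation by \<open>G\<close> turns \<open>h g\<close> into \<open>K\<close>;
    these two identities let \<open>K\<close> pass the outer factors of \<open>Rmat\<close> and act
    as \<open>h g\<close> on \<open>Rcore\<close>.\<close>
  have K1: "K ** G = G ** ?h" "Gi ** K = ?h ** Gi"
  proof -
    show "K ** G = G ** ?h" by (simp add: K_def matrix_mul_assoc[symmetric] G_mult_G)
    have "Gi ** K = (Gi ** G) ** hmat ** G" by (simp only: K_def matrix_mul_assoc)
    moreover have "?h ** Gi = hmat ** G ** (G ** Gi)"
      by (simp only: G_mult_G[symmetric] matrix_mul_assoc)
    ultimately show "Gi ** K = ?h ** Gi" by (simp add: G_Gi)
  qed
  have t1: "tensor K (mat 1) ** tensor G G = tensor G G ** tensor ?h (mat 1)"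
    "tensor Gi Gi ** tensor K (mat 1) = tensor ?h (mat 1) ** tensor Gi Gi"
    "tensor (mat 1) K ** tensor G G = tensor G G ** tensor (mat 1) ?h"
    "tensor Gi Gi ** tensor (mat 1) K = tensor (mat 1) ?h ** tensor Gi Gi"
    unfolding tensor_mult K1 by simp_all
  have r0: "rscal \<zeta> \<tau> CARD('n) \<xi> \<noteq> 0" by (rule rscal_nonzero[OF \<zeta> \<tau> CARD_nontriv_pos nz r])
  have s: "rscal \<zeta> \<tau> CARD('n) (\<xi> + \<tau> + 1) / of_nat CARD('n) * e = rho \<zeta> \<tau> CARD('n) \<xi> * (rscal \<zeta> \<tau> CARD('n) \<xi> / of_nat CARD('n))"
    using r0 by (simp add: rho_def[OF \<zeta> \<tau> CARD_nontriv_pos] e_def)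
  have "tensor K (mat 1) ** (tensor G G ** Rcore \<zeta> \<tau> (\<xi> + \<tau> + 1) ** tensor Gi Gi) =
      tensor G G ** (tensor ?h (mat 1) ** Rcore \<zeta> \<tau> (\<xi> + \<tau> + 1)) ** tensor Gi Gi"
    by (simp only: matrix_mul_assoc t1)
  also have "\<dots> = map_matrix ((*) e) (tensor G G ** Rcore \<zeta> \<tau> \<xi> ** (tensor ?h (mat 1) ** tensor Gi Gi))"
    unfolding Rcore_hg(1) e_def[symmetric] smult_matrix_mult by (simp only: matrix_mul_assoc)
  also have "\<dots> = map_matrix ((*) e) (tensor G G ** Rcore \<zeta> \<tau> \<xi> ** tensor Gi Gi ** tensor K (mat 1))"
    by (simp only: t1(2)[symmetric] matrix_mul_assoc)
  finally show "tensor K (mat 1) ** Rmat G \<zeta> \<tau> (\<xi> + \<tau> + 1) = map_matrix ((*) (rho \<zeta> \<tau> CARD('n) \<xi>)) (Rmat G \<zeta> \<tau> \<xi> ** tensor K (mat 1))"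
    unfolding Rmat_eq smult_matrix_mult smult_smult_matrix s[symmetric] by (simp only: smult_smult_matrix)
  have "(tensor G G ** Rcore \<zeta> \<tau> (\<xi> + \<tau> + 1) ** tensor Gi Gi) ** tensor (mat 1) K =
      tensor G G ** Rcore \<zeta> \<tau> (\<xi> + \<tau> + 1) ** (tensor Gi Gi ** tensor (mat 1) K)"
    by (simp only: matrix_mul_assoc)
  also have "\<dots> = tensor G G ** (Rcore \<zeta> \<tau> (\<xi> + \<tau> + 1) ** tensor (mat 1) ?h) ** tensor Gi Gi"
    unfolding t1(4) by (simp only: matrix_mul_assoc)
  also have "\<dots> = map_matrix ((*) e) ((tensor G G ** tensor (mat 1) ?h) ** Rcore \<zeta> \<tau> \<xi> ** tensor Gi Gi)"
    unfolding Rcore_hg(2) e_def[symmetric] smult_matrix_mult by (simp only: matrix_mul_assoc)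
  also have "\<dots> = map_matrix ((*) e) (tensor (mat 1) K ** (tensor G G ** Rcore \<zeta> \<tau> \<xi> ** tensor Gi Gi))"
    by (simp only: t1(3)[symmetric] matrix_mul_assoc)
  finally show "Rmat G \<zeta> \<tau> (\<xi> + \<tau> + 1) ** tensor (mat 1) K = map_matrix ((*) (rho \<zeta> \<tau> CARD('n) \<xi>)) (tensor (mat 1) K ** Rmat G \<zeta> \<tau> \<xi>)"
    unfolding Rmat_eq smult_matrix_mult smult_smult_matrix s[symmetric] by (simp only: smult_smult_matrix)
qed

lemma holomorphic_Rmat_nth: "(\<lambda>\<xi>. Rmat G \<zeta> \<tau> \<xi> $ i $ j) holomorphic_on {\<xi>. reg \<zeta> \<tau> CARD('n) \<xi>}"
proof -
  have "Rmat G \<zeta> \<tau> \<xi> $ i $ j = rscal \<zeta> \<tau> CARD('n) \<xi> / of_nat CARD('n) *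
     (\<Sum>\<alpha>\<in>UNIV. weight \<tau> (\<zeta> / of_nat CARD('n)) \<alpha> \<xi> * (tensor G G ** Jmat \<alpha> ** tensor Gi Gi) $ i $ j)" for \<xi>
    unfolding Rmat_eq Rcore_def sum_matrix_mult_left sum_matrix_mult_right smult_matrix_mult
    by (simp add: sum_component)
  moreover have "(\<lambda>\<xi>. rscal \<zeta> \<tau> CARD('n) \<xi>) holomorphic_on {\<xi>. reg \<zeta> \<tau> CARD('n) \<xi>}"
    using holomorphic_rscal[OF \<zeta> \<tau> CARD_nontriv_pos] .
  ultimately show ?thesis
    by (simp only:) (intro holomorphic_on_mult holomorphic_on_divide holomorphic_on_const holomorphic_on_sum
        holomorphic_on_weight[OF \<tau>] holomorphic_on_ident; simp)
qed

end

end

section \<open>Matrices over a noncommutative algebra\<close>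

definition emb1 :: "('a::semiring_1, 'n::finite) zmat \<Rightarrow> ('a, 'n) zmat2" where
  "emb1 A = tensor A (mat 1)"

definition emb2 :: "('a::semiring_1, 'n::finite) zmat \<Rightarrow> ('a, 'n) zmat2" where
  "emb2 A = tensor (mat 1) A"

lemma emb1_mult_nth: "(emb1 P ** X) $ i $ j = (\<Sum>a\<in>UNIV. P $ fst i $ a * X $ (a, snd i) $ j)"
proof -
  have "(emb1 P ** X) $ i $ j = (\<Sum>a\<in>UNIV. \<Sum>b\<in>UNIV. if snd i = b then P $ fst i $ a * X $ (a, b) $ j else 0)"
    unfolding matrix_mult_nth sum_UNIV_prod by (intro sum.cong) (auto simp: emb1_def mat_nth)
  then show ?thesis by simp
qed

lemma emb2_mult_nth: "(emb2 P ** X) $ i $ j = (\<Sum>a\<in>UNIV. P $ snd i $ a * X $ (fst i, a) $ j)"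
proof -
  have "(emb2 P ** X) $ i $ j = (\<Sum>b\<in>UNIV. \<Sum>a\<in>UNIV. if fst i = b then P $ snd i $ a * X $ (b, a) $ j else 0)"
    unfolding matrix_mult_nth sum_UNIV_prod by (intro sum.cong) (auto simp: emb2_def mat_nth)
  also have "\<dots> = (\<Sum>b\<in>UNIV. if fst i = b then (\<Sum>a\<in>UNIV. P $ snd i $ a * X $ (b, a) $ j) else 0)"
    by (intro sum.cong) auto
  finally show ?thesis by simp
qed

lemma mult_emb1_nth: "(X ** emb1 P) $ i $ j = (\<Sum>a\<in>UNIV. X $ i $ (a, snd j) * P $ a $ fst j)"
proof -
  have "(X ** emb1 P) $ i $ j = (\<Sum>a\<in>UNIV. \<Sum>b\<in>UNIV. if b = snd j then X $ i $ (a, b) * P $ a $ fst j else 0)"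
    unfolding matrix_mult_nth sum_UNIV_prod by (intro sum.cong) (auto simp: emb1_def mat_nth)
  then show ?thesis by simp
qed

lemma mult_emb2_nth: "(X ** emb2 P) $ i $ j = (\<Sum>a\<in>UNIV. X $ i $ (fst j, a) * P $ a $ snd j)"
proof -
  have "(X ** emb2 P) $ i $ j = (\<Sum>b\<in>UNIV. \<Sum>a\<in>UNIV. if b = fst j then X $ i $ (b, a) * P $ a $ snd j else 0)"
    unfolding matrix_mult_nth sum_UNIV_prod by (intro sum.cong) (auto simp: emb2_def mat_nth)
  also have "\<dots> = (\<Sum>b\<in>UNIV. if b = fst j then (\<Sum>a\<in>UNIV. X $ i $ (b, a) * P $ a $ snd j) else 0)"
    by (intro sum.cong) auto
  finally show ?thesis by simp
qed

lemma emb1_mult: "emb1 A ** emb1 B = emb1 (A ** B)"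
  by (rule mat_eqI) (simp add: emb1_mult_nth, simp add: emb1_def matrix_mult_nth sum_distrib_right mult.assoc)

lemma emb2_mult: "emb2 A ** emb2 B = emb2 (A ** B)"
proof (rule mat_eqI)
  fix i j :: "'b mod_ring \<times> 'b mod_ring"
  have "P * (mat 1 $ fst i $ fst j * Q) = mat 1 $ fst i $ fst j * (P * Q)" for P Q :: 'a
    by (simp add: mat_nth)
  then show "(emb2 A ** emb2 B) $ i $ j = emb2 (A ** B) $ i $ j"
    by (simp add: emb2_mult_nth) (simp add: emb2_def matrix_mult_nth sum_distrib_left)
qed

lemma emb_mat_1 [simp]: "emb1 (mat 1) = mat 1" "emb2 (mat 1) = mat 1"
  by (rule mat_eqI; auto simp: emb1_def emb2_def mat_nth prod_eq_iff)+

lemma trace_nth: "trace A = (\<Sum>i\<in>UNIV. A $ i $ i)"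
  by (simp add: trace_def)

lemma sum_reorder:
  fixes F :: "'p::finite \<Rightarrow> 'q::finite \<Rightarrow> 'r::finite \<Rightarrow> 's::finite \<Rightarrow> 't::finite \<Rightarrow> 'm::comm_monoid_add"
  shows "(\<Sum>p\<in>UNIV. \<Sum>q\<in>UNIV. \<Sum>r\<in>UNIV. \<Sum>s\<in>UNIV. \<Sum>t\<in>UNIV. F p q r s t) =
     (\<Sum>t\<in>UNIV. \<Sum>s\<in>UNIV. \<Sum>r\<in>UNIV. \<Sum>q\<in>UNIV. \<Sum>p\<in>UNIV. F p q r s t)"
proof -
  have "(\<Sum>x\<in>UNIV. case x of (p, q, r, s, t) \<Rightarrow> F p q r s t) = (\<Sum>x\<in>UNIV. case x of (t, s, r, q, p) \<Rightarrow> F p q r s t)"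
    by (rule sum.reindex_bij_witness[where i = "\<lambda>(t, s, r, q, p). (p, q, r, s, t)" and j = "\<lambda>(p, q, r, s, t). (t, s, r, q, p)"]) auto
  then show ?thesis by (simp add: sum_UNIV_prod)
qed

context
  fixes sc :: "complex \<Rightarrow> 'a::ring_1"
  assumes sc: "complex_algebra sc"
begin

lemma sc_add: "sc (a + b) = sc a + sc b" and sc_mult: "sc (a * b) = sc a * sc b"
  and sc_1: "sc 1 = 1" and sc_central: "sc a * x = x * sc a"
  using sc unfolding complex_algebra_def by blast+

lemma sc_0: "sc 0 = 0" using sc_add[of 0 0] by simp

lemma sc_sum: "sc (\<Sum>x\<in>S. f x) = (\<Sum>x\<in>S. sc (f x))"
  by (induction S rule: infinite_finite_induct) (simp_all add: sc_0 sc_add)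

abbreviation (input) "hat \<equiv> map_matrix sc"

lemma map_matrix_sc_mult: "hat (A ** B) = hat A ** hat B"
  by (rule mat_eqI) (simp add: matrix_mult_nth sc_sum sc_mult)

lemma map_matrix_sc_mat_1: "hat (mat 1) = mat 1"
  by (rule mat_eqI) (simp add: mat_nth sc_0 sc_1)

lemma map_matrix_sc_smult: "hat (map_matrix ((*) c) A) = map_matrix ((*) (sc c)) (hat A)"
  by (rule mat_eqI) (simp add: sc_mult)

lemma sc_smult_mult:
  "map_matrix ((*) (sc c)) A ** B = map_matrix ((*) (sc c)) (A ** B)"
  "A ** map_matrix ((*) (sc c)) B = map_matrix ((*) (sc c)) (A ** B)"
proof -
  show "map_matrix ((*) (sc c)) A ** B = map_matrix ((*) (sc c)) (A ** B)"
    by (rule mat_eqI) (simp add: matrix_mult_nth sum_distrib_left mult.assoc)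
  have "x * (sc c * y) = sc c * (x * y)" for x y
    by (metis sc_central mult.assoc)
  then show "A ** map_matrix ((*) (sc c)) B = map_matrix ((*) (sc c)) (A ** B)"
    by (intro mat_eqI) (simp add: matrix_mult_nth sum_distrib_left)
qed

lemma sc_smult_cancel:
  assumes "map_matrix ((*) (sc c)) A = map_matrix ((*) (sc c)) B" "c \<noteq> 0"
  shows "A = B"
proof (rule mat_eqI)
  fix i j
  have "sc c * A $ i $ j = sc c * B $ i $ j"
    using arg_cong[OF assms(1), of "\<lambda>M. M $ i $ j"] by simp
  then have "sc (inverse c) * (sc c * A $ i $ j) = sc (inverse c) * (sc c * B $ i $ j)" by simp
  then show "A $ i $ j = B $ i $ j"
    using assms(2) by (simp add: mult.assoc[symmetric] sc_mult[symmetric] sc_1)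
qed

lemma hat_emb1: "hat (tensor K (mat 1)) = emb1 (hat K)" and hat_emb2: "hat (tensor (mat 1) K) = emb2 (hat K)"
  by (rule mat_eqI; simp add: emb1_def emb2_def mat_nth sc_0 sc_1 sc_mult)+

text \<open>Holds because the entries of \<open>hat K\<close> are central; matrices with operator
  entries in the two slots do not commute in general.\<close>

lemma emb_commute:
  "emb1 (hat K) ** emb2 Y = emb2 Y ** emb1 (hat K)"
  "emb2 (hat K) ** emb1 Y = emb1 Y ** emb2 (hat K)"
proof -
  have "x * (mat 1 $ i $ k * y) = mat 1 $ i $ k * (x * y)" for x y :: 'a and i k :: "'n::finite mod_ring"
    by (simp add: mat_nth)
  show "emb1 (hat K) ** emb2 Y = emb2 Y ** emb1 (hat K)"
    by (rule mat_eqI) (simp add: emb1_mult_nth mult_emb1_nth, simp add: emb2_def mat_nth mult_delta_left mult_delta_right sc_central)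
  show "emb2 (hat K) ** emb1 Y = emb1 Y ** emb2 (hat K)"
    by (rule mat_eqI) (simp add: emb2_mult_nth mult_emb2_nth, simp add: emb1_def mat_nth mult_delta_left mult_delta_right sc_central)
qed

text \<open>The partial transposes turn the contraction of the indices of \<open>X\<close> and \<open>Z\<close> into a matrix product.\<close>

lemma trace_sandwich:
  fixes P Q :: "('a, 'n::finite) zmat"
  assumes XZ: "transp2 X ** transp2 Z = mat 1"
  shows "trace (emb1 P ** hat X ** emb2 Q ** hat Z) = trace P * trace Q"
    and "trace (hat X ** emb2 Q ** hat Z ** emb1 P) = trace Q * trace P"
proof -
  \<comment> \<open>The hypothesis on the partial transposes, read entrywise, is a contraction over
    the two inner indices.\<close>
  have contr: "(\<Sum>b\<in>UNIV. \<Sum>e\<in>UNIV. sc (X $ (a, e) $ (b, c)) * sc (Z $ (b, d) $ (f, e))) =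
      (if a = f \<and> c = d then 1 else 0)" for a c d f
  proof -
    have "(\<Sum>b\<in>UNIV. \<Sum>e\<in>UNIV. X $ (a, e) $ (b, c) * Z $ (b, d) $ (f, e)) = (transp2 X ** transp2 Z) $ (a, c) $ (f, d)"
      unfolding matrix_mult_nth sum_UNIV_prod by simp
    also have "\<dots> = (if a = f \<and> c = d then 1 else 0)" unfolding XZ by (simp add: mat_nth)
    finally show ?thesis by (simp flip: sc_mult sc_sum add: sc_0 sc_1)
  qed
  have diag: "(\<Sum>c\<in>UNIV. \<Sum>d\<in>UNIV. f c d * (if c = d then 1 else 0)) = (\<Sum>c\<in>UNIV. f c c)"
    for f :: "'n mod_ring \<Rightarrow> 'n mod_ring \<Rightarrow> 'a"
    by (simp add: mult_delta_right)
  \<comment> \<open>The central entries of \<open>X\<close> and \<open>Z\<close> can be gathered,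
    while the mutual order of the operator entries \<open>p\<close> and \<open>q\<close> is
    preserved; this order decides which product of traces appears.\<close>
  have c1: "p * sc x * q * sc z = p * q * (sc x * sc z)" for p q x z
    by (metis sc_central mult.assoc)
  have c2: "sc x * q * sc z * p = q * p * (sc x * sc z)" for p q x z
    by (metis sc_central mult.assoc)
  have "trace (emb1 P ** hat X ** emb2 Q ** hat Z) =
      (\<Sum>f\<in>UNIV. \<Sum>e\<in>UNIV. \<Sum>b\<in>UNIV. \<Sum>d\<in>UNIV. \<Sum>c\<in>UNIV. \<Sum>a\<in>UNIV.
         P $ f $ a * sc (X $ (a, e) $ (b, c)) * Q $ c $ d * sc (Z $ (b, d) $ (f, e)))"
    unfolding trace_nth sum_UNIV_prod matrix_mult_nth[of _ "hat Z"] mult_emb2_nth emb1_mult_nth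
    by (simp add: sum_distrib_right)
  also have "\<dots> = (\<Sum>f\<in>UNIV. \<Sum>a\<in>UNIV. \<Sum>c\<in>UNIV. \<Sum>d\<in>UNIV. \<Sum>b\<in>UNIV. \<Sum>e\<in>UNIV.
         P $ f $ a * sc (X $ (a, e) $ (b, c)) * Q $ c $ d * sc (Z $ (b, d) $ (f, e)))"
    by (rule sum.cong[OF refl]) (rule sum_reorder)
  also have "\<dots> = (\<Sum>f\<in>UNIV. \<Sum>a\<in>UNIV. \<Sum>c\<in>UNIV. \<Sum>d\<in>UNIV.
         P $ f $ a * Q $ c $ d * (if a = f \<and> c = d then 1 else 0))"
    unfolding c1 sum_distrib_left[symmetric] contr ..
  also have "\<dots> = (\<Sum>f\<in>UNIV. \<Sum>a\<in>UNIV. (\<Sum>c\<in>UNIV. P $ f $ a * Q $ c $ c) * (if f = a then 1 else 0))"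
  proof (intro sum.cong refl)
    fix f a
    show "(\<Sum>c\<in>UNIV. \<Sum>d\<in>UNIV. P $ f $ a * Q $ c $ d * (if a = f \<and> c = d then 1 else 0)) =
        (\<Sum>c\<in>UNIV. P $ f $ a * Q $ c $ c) * (if f = a then 1 else 0)"
      using diag[of "\<lambda>c d. P $ f $ a * Q $ c $ d"] by (cases "a = f") auto
  qed
  also have "\<dots> = trace P * trace Q"
    unfolding diag by (simp add: trace_nth sum_product)
  finally show "trace (emb1 P ** hat X ** emb2 Q ** hat Z) = trace P * trace Q" .
  have "trace (hat X ** emb2 Q ** hat Z ** emb1 P) =
      (\<Sum>a\<in>UNIV. \<Sum>e\<in>UNIV. \<Sum>f\<in>UNIV. \<Sum>b\<in>UNIV. \<Sum>d\<in>UNIV. \<Sum>c\<in>UNIV.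
         sc (X $ (a, e) $ (b, c)) * Q $ c $ d * sc (Z $ (b, d) $ (f, e)) * P $ f $ a)"
    unfolding trace_nth sum_UNIV_prod mult_emb1_nth matrix_mult_nth[of _ "hat Z"] mult_emb2_nth
    by (simp add: sum_distrib_right)
  also have "\<dots> = (\<Sum>a\<in>UNIV. \<Sum>c\<in>UNIV. \<Sum>d\<in>UNIV. \<Sum>b\<in>UNIV. \<Sum>f\<in>UNIV. \<Sum>e\<in>UNIV.
         sc (X $ (a, e) $ (b, c)) * Q $ c $ d * sc (Z $ (b, d) $ (f, e)) * P $ f $ a)"
    by (rule sum.cong[OF refl]) (rule sum_reorder)
  also have "\<dots> = (\<Sum>a\<in>UNIV. \<Sum>c\<in>UNIV. \<Sum>d\<in>UNIV. \<Sum>f\<in>UNIV. \<Sum>b\<in>UNIV. \<Sum>e\<in>UNIV.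
         sc (X $ (a, e) $ (b, c)) * Q $ c $ d * sc (Z $ (b, d) $ (f, e)) * P $ f $ a)"
    by (rule sum.cong[OF refl], rule sum.cong[OF refl], rule sum.cong[OF refl], rule sum.swap)
  also have "\<dots> = (\<Sum>a\<in>UNIV. \<Sum>c\<in>UNIV. \<Sum>d\<in>UNIV. \<Sum>f\<in>UNIV.
         Q $ c $ d * P $ f $ a * (if a = f \<and> c = d then 1 else 0))"
    unfolding c2 sum_distrib_left[symmetric] contr ..
  also have "\<dots> = (\<Sum>a\<in>UNIV. \<Sum>c\<in>UNIV. \<Sum>d\<in>UNIV. Q $ c $ d * P $ a $ a * (if c = d then 1 else 0))"
  proof (intro sum.cong refl)
    fix a c d
    show "(\<Sum>f\<in>UNIV. Q $ c $ d * P $ f $ a * (if a = f \<and> c = d then 1 else 0)) =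
        Q $ c $ d * P $ a $ a * (if c = d then 1 else 0)"
      by (cases "c = d") (simp_all add: mult_delta_right)
  qed
  also have "\<dots> = (\<Sum>a\<in>UNIV. \<Sum>c\<in>UNIV. Q $ c $ c * P $ a $ a)"
    unfolding diag ..
  also have "\<dots> = trace Q * trace P"
    by (subst sum.swap) (simp add: trace_nth sum_product)
  finally show "trace (hat X ** emb2 Q ** hat Z ** emb1 P) = trace Q * trace P" .
qed

end

text \<open>With \<open>L = A B\<^sup>-\<^sup>1\<close> the conclusion reads \<open>L\<^sub>1 rp' L\<^sub>2 = r' L\<^sub>2 rm L\<^sub>1 r'\<close>; it no longer contains
  the starred R-matrix \<open>rs\<close>.\<close>

lemma reflection_relation:
  fixes r r' rs rs' rp rp' rm A1 A2 B1 B2 C1 C2 :: "('a::ring_1, 'm::finite) vec ^ 'm"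
  assumes r: "r ** r' = mat 1" "r' ** r = mat 1" and rs: "rs ** rs' = mat 1"
    and rp: "rp' ** rp = mat 1"
    and C1: "B1 ** C1 = mat 1" "C1 ** B1 = mat 1" and C2: "B2 ** C2 = mat 1" "C2 ** B2 = mat 1"
    and AA: "r ** A1 ** A2 = A2 ** A1 ** rs"
    and BB: "r ** B1 ** B2 = B2 ** B1 ** rs"
    and BA: "rp ** B1 ** A2 = A2 ** B1 ** rs"
    and AB: "rm ** A1 ** B2 = B2 ** A1 ** rs"
  shows "(A1 ** C1) ** rp' ** (A2 ** C2) = r' ** (A2 ** C2) ** rm ** (A1 ** C1) ** r'"
proof -
  \<comment> \<open>The exchange relations are first rewritten in terms of inverses. In the final
    chain \<open>2\<close> introduces \<open>rs\<close> and \<open>3\<close> removes it again;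
    \<open>rs'\<close> enters together with \<open>AA\<close> and is removed by
    \<open>1\<close>.\<close>
  have 1: "A2 ** rs' ** C1 = C1 ** rp' ** A2"
  proof -
    have "C1 ** rp' ** A2 = C1 ** rp' ** A2 ** (B1 ** (rs ** rs') ** C1)"
      by (simp add: rs C1)
    also have "\<dots> = C1 ** rp' ** (A2 ** B1 ** rs) ** rs' ** C1"
      by (simp only: matrix_mul_assoc)
    also have "\<dots> = C1 ** (rp' ** rp) ** B1 ** A2 ** rs' ** C1"
      unfolding BA[symmetric] by (simp only: matrix_mul_assoc)
    also have "\<dots> = (C1 ** B1) ** A2 ** rs' ** C1"
      by (simp add: rp)
    finally show ?thesis by (simp add: C1)
  qed
  have 2: "C2 ** rm ** A1 = A1 ** rs ** C2"
  proof -
    have "C2 ** rm ** A1 = C2 ** (rm ** A1 ** B2) ** C2"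
      by (simp add: matrix_mul_assoc[symmetric] C2)
    also have "\<dots> = (C2 ** B2) ** A1 ** rs ** C2"
      unfolding AB by (simp only: matrix_mul_assoc)
    finally show ?thesis by (simp add: C2)
  qed
  have 3: "rs ** C2 ** C1 = C1 ** C2 ** r"
  proof -
    have "C1 ** C2 ** r = C1 ** C2 ** (r ** B1 ** B2) ** C2 ** C1"
    proof -
      have "r ** B1 ** B2 ** C2 ** C1 = r ** B1 ** (B2 ** C2) ** C1" by (simp only: matrix_mul_assoc)
      also have "\<dots> = r ** (B1 ** C1)" by (simp add: C2 matrix_mul_assoc)
      finally have "r ** B1 ** B2 ** C2 ** C1 = r" by (simp add: C1)
      then have "C1 ** C2 ** r = C1 ** C2 ** (r ** B1 ** B2 ** C2 ** C1)" by simp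
      then show ?thesis by (simp only: matrix_mul_assoc)
    qed
    also have "\<dots> = C1 ** (C2 ** B2) ** B1 ** rs ** C2 ** C1"
      unfolding BB by (simp only: matrix_mul_assoc)
    also have "\<dots> = (C1 ** B1) ** rs ** C2 ** C1" by (simp add: C2)
    finally show ?thesis by (simp add: C1)
  qed
  have "r' ** (A2 ** C2) ** rm ** (A1 ** C1) ** r' = r' ** A2 ** (C2 ** rm ** A1) ** C1 ** r'"
    by (simp only: matrix_mul_assoc)
  also have "\<dots> = r' ** A2 ** A1 ** (rs ** C2 ** C1) ** r'"
    unfolding 2 by (simp only: matrix_mul_assoc)
  also have "\<dots> = r' ** A2 ** A1 ** C1 ** C2 ** (r ** r')"
    unfolding 3 by (simp only: matrix_mul_assoc)
  also have "\<dots> = r' ** (A2 ** A1 ** rs) ** rs' ** C1 ** C2"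
    using rs by (simp add: r matrix_mul_assoc[symmetric])
  also have "\<dots> = (r' ** r) ** A1 ** (A2 ** rs' ** C1) ** C2"
    unfolding AA[symmetric] by (simp only: matrix_mul_assoc)
  also have "\<dots> = (A1 ** C1) ** rp' ** (A2 ** C2)"
    unfolding 1 by (simp add: r matrix_mul_assoc)
  finally show ?thesis by simp
qed

section \<open>The derivative at the critical level\<close>

definition has_matrix_derivative ::
  "(complex \<Rightarrow> (complex, 'm::finite) vec ^ 'k::finite) \<Rightarrow> (complex, 'm) vec ^ 'k \<Rightarrow> complex \<Rightarrow> bool" where
  "has_matrix_derivative X X' c \<longleftrightarrow> (\<forall>i j. ((\<lambda>t. X t $ i $ j) has_field_derivative X' $ i $ j) (at c))"

lemma has_matrix_derivative_mult:
  assumes "has_matrix_derivative X X' c" "has_matrix_derivative Y Y' c"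
  shows "has_matrix_derivative (\<lambda>t. X t ** Y t) (X' ** Y c + X c ** Y') c"
  unfolding has_matrix_derivative_def
proof (intro allI)
  fix i j
  have "((\<lambda>t. \<Sum>k\<in>UNIV. X t $ i $ k * Y t $ k $ j) has_field_derivative
      (\<Sum>k\<in>UNIV. X' $ i $ k * Y c $ k $ j + Y' $ k $ j * X c $ i $ k)) (at c)"
    using assms unfolding has_matrix_derivative_def by (intro DERIV_sum DERIV_mult) auto
  then show "((\<lambda>t. (X t ** Y t) $ i $ j) has_field_derivative (X' ** Y c + X c ** Y') $ i $ j) (at c)"
    by (simp add: matrix_mult_nth sum.distrib mult.commute)
qed

lemma has_matrix_derivative_const: "has_matrix_derivative (\<lambda>_. A) 0 c"
  by (simp add: has_matrix_derivative_def)

lemma has_matrix_derivative_transp2: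
  "has_matrix_derivative X X' c \<Longrightarrow> has_matrix_derivative (\<lambda>t. transp2 (X t)) (transp2 X') c"
  by (simp add: has_matrix_derivative_def)

lemma has_matrix_derivative_unique:
  assumes "has_matrix_derivative X A c" "has_matrix_derivative X B c"
  shows "A = B"
  using assms unfolding has_matrix_derivative_def by (intro mat_eqI) (meson DERIV_unique)

lemma has_matrix_derivative_cong_open:
  assumes X: "has_matrix_derivative X X' c" and S: "open S" "c \<in> S" and eq: "\<And>t. t \<in> S \<Longrightarrow> X t = Y t"
  shows "has_matrix_derivative Y X' c"
  unfolding has_matrix_derivative_def
proof (intro allI)
  fix i j
  have "((\<lambda>t. X t $ i $ j) has_field_derivative X' $ i $ j) (at c)"
    using X by (simp add: has_matrix_derivative_def)
  then show "((\<lambda>t. Y t $ i $ j) has_field_derivative X' $ i $ j) (at c)"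
    by (rule has_field_derivative_transform_within_open[OF _ S]) (simp add: eq)
qed

lemma matrix_minus_mult:
  fixes A :: "(complex, 'm::finite) vec ^ 'k::finite" and B :: "(complex, 'l::finite) vec ^ 'm"
  shows "(- A) ** B = - (A ** B)"
  by (rule mat_eqI) (simp add: matrix_mult_nth sum_negf)

context
  fixes G :: "(complex, 'n::nontriv) zmat" and \<zeta> \<tau> \<xi> :: complex
  assumes G: "diag_sqrt_g G" and \<zeta>: "Im \<zeta> > 0" and \<tau>: "Im \<tau> > 0" and nz: "theta \<tau> \<zeta> \<noteq> 0"
    and gen: "generic_arg \<zeta> \<tau> \<xi>"
begin

private lemmas Rm = Rmat_unitarity[OF G \<zeta> \<tau> nz] flip_Rmat_unitarity[OF G \<zeta> \<tau> nz] Rmat_crossing[OF G \<zeta> \<tau> nz]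

text \<open>Unitarity and crossing make the first order variation of \<open>Mmat\<close> vanish: both factors move by
  opposite multiples of the derivative of \<open>R\<^sub>2\<^sub>1\<close> at \<open>\<xi>\<close>.\<close>

lemma Mmat_critical:
  defines "c0 \<equiv> - of_nat CARD('n)"
  shows "Mmat G \<zeta> \<tau> c0 \<xi> = mat 1" and "has_matrix_derivative (\<lambda>c. Mmat G \<zeta> \<tau> c \<xi>) 0 c0"
proof -
  let ?n = "of_nat CARD('n) :: complex"
  define R where "R = Rmat G \<zeta> \<tau>"
  let ?reg = "reg \<zeta> \<tau> CARD('n)"
  have reg_m: "?reg (- x) = ?reg x" for x by (rule reg_minus[OF \<zeta> \<tau> CARD_nontriv_pos])
  \<comment> \<open>A neighbourhood of the critical level on which the R-matrices in play are
    regular, so that unitarity and crossing hold as identities in \<open>c\<close> and may be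
    differentiated.\<close>
  define U where "U = {c. ?reg ((c + ?n) * \<zeta> + \<xi>)} \<inter> {c. ?reg (\<xi> - (c + ?n) * \<zeta>)} \<inter> {c. ?reg (c * \<zeta> - \<xi>)}"
  have U: "open U"
  proof -
    have op: "open {c. ?reg (f c)}" if "continuous_on UNIV f" for f
      using open_vimage[OF open_reg[OF \<zeta> \<tau> CARD_nontriv_pos] that] by (simp add: vimage_def)
    show ?thesis unfolding U_def by (intro open_Int op continuous_intros)
  qed
  have gs: "generic_arg \<zeta> \<tau> (\<xi> + of_nat k * \<zeta>)" for k
    using generic_arg_shift[OF gen, of 0 "int k" 0] by simp
  have reg\<xi>: "?reg \<xi>" by (rule reg_generic[OF \<zeta> \<tau> CARD_nontriv_pos gen])
  have c0: "c0 \<in> U"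
  proof -
    have "?reg (- (\<xi> + ?n * \<zeta>))" unfolding reg_m by (rule reg_generic[OF \<zeta> \<tau> CARD_nontriv_pos gs])
    moreover have "- (\<xi> + ?n * \<zeta>) = - ?n * \<zeta> - \<xi>" by simp
    ultimately have "?reg (- ?n * \<zeta> - \<xi>)" by (simp only:)
    then show ?thesis using reg\<xi> by (simp add: U_def c0_def)
  qed
  define R' where "R' x = (\<chi> i j. deriv (\<lambda>x. R x $ i $ j) x)" for x
  have dR: "has_matrix_derivative (\<lambda>c. R (f c)) (map_matrix ((*) f') (R' (f c))) c"
    if "?reg (f c)" "(f has_field_derivative f') (at c)" for f f' c
    unfolding has_matrix_derivative_def
  proof (intro allI)
    fix i j
    have "((\<lambda>x. R x $ i $ j) has_field_derivative R' (f c) $ i $ j) (at (f c))"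
      unfolding R'_def R_def using holomorphic_derivI[OF holomorphic_Rmat_nth[OF G \<zeta> \<tau> nz] open_reg[OF \<zeta> \<tau> CARD_nontriv_pos]] that(1)
      by simp
    from DERIV_chain2[OF this that(2)]
    show "((\<lambda>c. R (f c) $ i $ j) has_field_derivative map_matrix ((*) f') (R' (f c)) $ i $ j) (at c)"
      by (simp add: mult.commute)
  qed
  have dflip: "has_matrix_derivative (\<lambda>c. flip (X c)) (flip X') c" if "has_matrix_derivative X X' c"
    for X :: "complex \<Rightarrow> (complex, 'n) zmat2" and X' c
    using that by (simp add: has_matrix_derivative_def)
  define A where "A c = flip (R ((c + ?n) * \<zeta> + \<xi>))" for c
  \<comment> \<open>An auxiliary curve rather than a factor of \<open>Mmat\<close>: the crossing
    partner of \<open>H\<close>. It agrees with \<open>A\<close> at \<open>c0\<close> and has the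
    opposite derivative there, as \<open>c\<close> enters with the opposite sign.\<close>
  define B where "B c = flip (R (\<xi> - (c + ?n) * \<zeta>))" for c
  define F where "F c = R (- ((c + ?n) * \<zeta> + \<xi>))" for c
  define H where "H c = R (c * \<zeta> - \<xi>)" for c
  define A' where "A' = flip (map_matrix ((*) \<zeta>) (R' \<xi>))"
  define F' where "F' = map_matrix ((*) (- \<zeta>)) (R' (- \<xi>))"
  define H' where "H' = map_matrix ((*) \<zeta>) (R' (c0 * \<zeta> - \<xi>))"
  have lin: "((\<lambda>c. (c + ?n) * \<zeta> + \<xi>) has_field_derivative \<zeta>) (at c0)"
    "((\<lambda>c. \<xi> - (c + ?n) * \<zeta>) has_field_derivative - \<zeta>) (at c0)"
    "((\<lambda>c. - ((c + ?n) * \<zeta> + \<xi>)) has_field_derivative - \<zeta>) (at c0)"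
    "((\<lambda>c. c * \<zeta> - \<xi>) has_field_derivative \<zeta>) (at c0)"
    by (auto intro!: derivative_eq_intros)
  have dA: "has_matrix_derivative A A' c0"
    using dflip[OF dR[OF _ lin(1)]] reg\<xi> unfolding A_def[abs_def] A'_def by (simp add: c0_def)
  have dB: "has_matrix_derivative B (- A') c0"
  proof -
    have "has_matrix_derivative B (flip (map_matrix ((*) (- \<zeta>)) (R' \<xi>))) c0"
      using dflip[OF dR[OF _ lin(2)]] reg\<xi> unfolding B_def[abs_def] by (simp add: c0_def)
    moreover have "flip (map_matrix ((*) (- \<zeta>)) (R' \<xi>)) = - A'"
      unfolding A'_def by (rule mat_eqI) simp
    ultimately show ?thesis by simp
  qed
  have dF: "has_matrix_derivative F F' c0"
    using dR[OF _ lin(3)] reg\<xi> unfolding F_def[abs_def] F'_def by (simp add: c0_def reg_m)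
  have dH: "has_matrix_derivative H H' c0"
    using dR[OF _ lin(4)] c0 unfolding H_def[abs_def] H'_def by (simp add: U_def)
  have AF: "A c ** F c = mat 1" if "c \<in> U" for c
    unfolding A_def F_def R_def by (rule Rm(2)) (use that in \<open>simp add: U_def\<close>)
  have FA: "F c0 ** A c0 = mat 1"
  proof -
    have "R (- \<xi>) ** flip (R (- (- \<xi>))) = mat 1"
      unfolding R_def by (rule Rm(1)) (simp add: reg_m reg\<xi>)
    then show ?thesis by (simp add: A_def F_def c0_def)
  qed
  have BH: "transp2 (B c) ** transp2 (H c) = mat 1" if "c \<in> U" for c
  proof -
    have x: "- (\<xi> - (c + ?n) * \<zeta>) - ?n * \<zeta> = c * \<zeta> - \<xi>" by (simp add: algebra_simps)
    show ?thesis
      using Rm(3)[of "\<xi> - (c + ?n) * \<zeta>"] that unfolding B_def H_def R_def x by (simp add: U_def)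
  qed
  have AB: "A c0 = B c0" by (simp add: A_def B_def c0_def)
  have M: "Mmat G \<zeta> \<tau> c \<xi> = transp2 (transp2 (A c0 ** F c ** A c0) ** transp2 (H c))" if "c \<in> U" for c
  proof -
    have "matrix_inv (flip (R ((c + ?n) * \<zeta> + \<xi>))) = F c"
      unfolding F_def R_def by (rule matrix_inv_flip_Rmat[OF G \<zeta> \<tau> nz]) (use that in \<open>simp add: U_def\<close>)
    moreover have "matrix_inv (R (- \<xi>)) = A c0"
      using matrix_inv_Rmat[OF G \<zeta> \<tau> nz, of "- \<xi>"] reg\<xi> unfolding A_def R_def by (simp add: c0_def reg_m)
    moreover have "flip (R \<xi>) = A c0" by (simp add: A_def c0_def)
    ultimately show ?thesis unfolding Mmat_def R_def[symmetric] H_def by simp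
  qed
  have AFA: "A c0 ** F c0 ** A c0 = A c0" using AF[OF c0] by simp
  show "Mmat G \<zeta> \<tau> c0 \<xi> = mat 1"
    unfolding M[OF c0] AFA using BH[OF c0] unfolding AB by simp
  have "has_matrix_derivative (\<lambda>c. A c ** F c) (A' ** F c0 + A c0 ** F') c0"
    by (rule has_matrix_derivative_mult[OF dA dF])
  moreover have "has_matrix_derivative (\<lambda>c. A c ** F c) 0 c0"
    by (rule has_matrix_derivative_cong_open[OF has_matrix_derivative_const U c0]) (simp add: AF)
  ultimately have "A' ** F c0 + A c0 ** F' = 0" by (rule has_matrix_derivative_unique)
  \<comment> \<open>Differentiating \<open>A ** F = 1\<close> expresses the variation of the inverse
    through \<open>A'\<close>, so that the product of the first three factors of \<open>Mmat\<close>
    also varies by \<open>- A'\<close>.\<close>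
  then have "A c0 ** F' = - (A' ** F c0)" by (simp add: eq_neg_iff_add_eq_0 add.commute)
  then have "A c0 ** F' ** A c0 = - (A' ** (F c0 ** A c0))"
    by (simp add: matrix_minus_mult matrix_mul_assoc)
  then have AFA': "A c0 ** F' ** A c0 = - A'" by (simp add: FA)
  have "has_matrix_derivative (\<lambda>c. transp2 (B c) ** transp2 (H c)) (transp2 (- A') ** transp2 (H c0) + transp2 (B c0) ** transp2 H') c0"
    by (intro has_matrix_derivative_mult has_matrix_derivative_transp2 dB dH)
  moreover have "has_matrix_derivative (\<lambda>c. transp2 (B c) ** transp2 (H c)) 0 c0"
    by (rule has_matrix_derivative_cong_open[OF has_matrix_derivative_const U c0]) (simp add: BH)
  ultimately have BH': "transp2 (- A') ** transp2 (H c0) + transp2 (B c0) ** transp2 H' = 0"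
    by (rule has_matrix_derivative_unique)
  have "has_matrix_derivative (\<lambda>c. A c0 ** F c ** A c0) ((0 ** F c0 + A c0 ** F') ** A c0 + (A c0 ** F c0) ** 0) c0"
    by (intro has_matrix_derivative_mult has_matrix_derivative_const dF)
  then have "has_matrix_derivative (\<lambda>c. A c0 ** F c ** A c0) (- A') c0"
    by (simp add: AFA')
  \<comment> \<open>The first factor now has the same value and the same derivative as
    \<open>B\<close>, so the product rule reproduces the derivative of the constant product in
    \<open>BH\<close>.\<close>
  then have "has_matrix_derivative (\<lambda>c. transp2 (A c0 ** F c ** A c0) ** transp2 (H c))
      (transp2 (- A') ** transp2 (H c0) + transp2 (A c0 ** F c0 ** A c0) ** transp2 H') c0"
    by (intro has_matrix_derivative_mult has_matrix_derivative_transp2 dH)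
  then have "has_matrix_derivative (\<lambda>c. transp2 (A c0 ** F c ** A c0) ** transp2 (H c)) 0 c0"
    unfolding AFA unfolding AB BH' .
  from has_matrix_derivative_transp2[OF this]
  have "has_matrix_derivative (\<lambda>c. transp2 (transp2 (A c0 ** F c ** A c0) ** transp2 (H c))) 0 c0"
    by (simp add: has_matrix_derivative_def)
  then show "has_matrix_derivative (\<lambda>c. Mmat G \<zeta> \<tau> c \<xi>) 0 c0"
    by (rule has_matrix_derivative_cong_open[OF _ U c0]) (simp add: M)
qed

lemma dYmat_eq:
  assumes T: "((\<lambda>c. Tfun CARD('n) \<zeta> c \<xi>) has_field_derivative f) (at (- of_nat CARD('n)))"
  shows "dYmat G \<zeta> \<tau> \<xi> = mat f"
proof (rule mat_eqI)
  fix i j :: "'n mod_ring \<times> 'n mod_ring"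
  let ?c = "- of_nat CARD('n) :: complex"
  have "((\<lambda>c. Mmat G \<zeta> \<tau> c \<xi> $ i $ j) has_field_derivative 0) (at ?c)"
    using Mmat_critical(2)[unfolded has_matrix_derivative_def, rule_format, of i j] by simp
  from DERIV_mult[OF T this]
  have "((\<lambda>c. Ymat G \<zeta> \<tau> c \<xi> $ i $ j) has_field_derivative f * (mat 1 :: (complex, 'n) zmat2) $ i $ j) (at ?c)"
    by (simp add: Ymat_def Mmat_critical(1))
  then show "dYmat G \<zeta> \<tau> \<xi> $ i $ j = mat f $ i $ j"
    unfolding dYmat_def by (simp add: DERIV_imp_deriv mat_nth)
qed

end

section \<open>The scalar factor\<close>

definition lambert :: "complex \<Rightarrow> complex \<Rightarrow> complex" where
  "lambert Q y = (\<Sum>k. y * Q ^ k / (1 - y * Q ^ k))"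

lemma divide_one_minus_reflect:
  fixes y :: complex
  assumes "y \<noteq> 0" "y \<noteq> 1"
  shows "y / (1 - y) = - 1 - inverse y / (1 - inverse y)"
proof -
  have "inverse y / (1 - inverse y) = (inverse y * y) / ((1 - inverse y) * y)"
    by (rule mult_divide_mult_cancel_right[symmetric]) (rule assms)
  also have "\<dots> = 1 / (y - 1)" using assms by (simp add: left_diff_distrib)
  finally show ?thesis using assms by (simp add: field_simps)
qed

context
  fixes \<zeta> \<tau> :: complex and N :: nat
  assumes \<zeta>: "Im \<zeta> > 0" and \<tau>: "Im \<tau> > 0" and N: "N > 0"
begin

private lemma Q: "norm (e2pi (of_nat N * \<zeta>)) < 1" using \<zeta> N by (intro norm_e2pi_less_1) auto

private lemma qp_nonzero:
  assumes "generic_arg \<zeta> \<tau> x" shows "qp (of_nat N * \<zeta>) x \<noteq> 0"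
  using kp_nonzero[OF \<zeta> \<tau> N assms] kp_tau[OF \<zeta> \<tau> N, of x] by auto

private lemma DERIV_qp:
  assumes "qp (of_nat N * \<zeta>) x \<noteq> 0"
  shows "(qp (of_nat N * \<zeta>) has_field_derivative - (2 * \<i> * pi) * lambert (e2pi (of_nat N * \<zeta>)) (e2pi x) * qp (of_nat N * \<zeta>) x) (at x)"
    and "summable (\<lambda>k. e2pi x * e2pi (of_nat N * \<zeta>) ^ k / (1 - e2pi x * e2pi (of_nat N * \<zeta>) ^ k))"
proof -
  let ?D = "deriv (\<lambda>y. qpoch1 y (e2pi (of_nat N * \<zeta>))) (e2pi x)"
  have nz: "qpoch1 (e2pi x) (e2pi (of_nat N * \<zeta>)) \<noteq> 0" using assms by (simp add: qp_def)
  have "(\<lambda>k. - e2pi x * (- (e2pi (of_nat N * \<zeta>) ^ k) / (1 - e2pi x * e2pi (of_nat N * \<zeta>) ^ k))) sums (- e2pi x * (?D / qpoch1 (e2pi x) (e2pi (of_nat N * \<zeta>))))"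
    by (rule sums_mult) (rule logderiv_qpoch1[OF Q nz])
  then have s: "(\<lambda>k. e2pi x * e2pi (of_nat N * \<zeta>) ^ k / (1 - e2pi x * e2pi (of_nat N * \<zeta>) ^ k)) sums (- e2pi x * (?D / qpoch1 (e2pi x) (e2pi (of_nat N * \<zeta>))))"
    by simp
  then show "summable (\<lambda>k. e2pi x * e2pi (of_nat N * \<zeta>) ^ k / (1 - e2pi x * e2pi (of_nat N * \<zeta>) ^ k))" by (rule sums_summable)
  from s have l: "lambert (e2pi (of_nat N * \<zeta>)) (e2pi x) = - e2pi x * (?D / qpoch1 (e2pi x) (e2pi (of_nat N * \<zeta>)))"
    unfolding lambert_def by (simp add: sums_iff)
  have "(e2pi has_field_derivative 2 * \<i> * pi * e2pi x) (at x)"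
    unfolding e2pi_def by (auto intro!: derivative_eq_intros)
  from DERIV_chain2[OF holomorphic_derivI[OF holomorphic_qpoch1_UNIV[OF Q] open_UNIV UNIV_I] this]
  show "(qp (of_nat N * \<zeta>) has_field_derivative - (2 * \<i> * pi) * lambert (e2pi (of_nat N * \<zeta>)) (e2pi x) * qp (of_nat N * \<zeta>) x) (at x)"
    unfolding qp_def[abs_def] l using nz by (simp add: mult_ac)
qed

text \<open>The logarithmic derivative of \<open>Theta_add\<close>. The last fraction is the initial
  term of the Lambert series at \<open>e2pi (- x)\<close>, removed because the second product of
  \<open>Theta\<close> starts one power later.\<close>

definition Lth :: "complex \<Rightarrow> complex" where
  "Lth x = 2 * \<i> * pi * (lambert (e2pi (of_nat N * \<zeta>)) (e2pi (- x)) - lambert (e2pi (of_nat N * \<zeta>)) (e2pi x) - e2pi (- x) / (1 - e2pi (- x)))"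

private lemma e2pi_neq_1: "generic_arg \<zeta> \<tau> x \<Longrightarrow> e2pi x \<noteq> 1"
  using generic_arg_def[of \<zeta> \<tau> x] e2pi_eq_1_iff[of x] by (metis add.right_neutral mult_zero_left of_int_0)

private lemma e2pi_reflect:
  "generic_arg \<zeta> \<tau> x \<Longrightarrow> e2pi x / (1 - e2pi x) = - 1 - e2pi (- x) / (1 - e2pi (- x))"
  using divide_one_minus_reflect[of "e2pi x"] e2pi_neq_1[of x] by (simp add: e2pi_minus)

private lemma lambert_shift:
  assumes g: "generic_arg \<zeta> \<tau> x"
  shows "lambert (e2pi (of_nat N * \<zeta>)) (e2pi x) = e2pi x / (1 - e2pi x) + lambert (e2pi (of_nat N * \<zeta>)) (e2pi (x + (of_nat N * \<zeta>)))"
proof -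
  let ?f = "\<lambda>k. e2pi x * e2pi (of_nat N * \<zeta>) ^ k / (1 - e2pi x * e2pi (of_nat N * \<zeta>) ^ k)"
  have "summable ?f" by (rule DERIV_qp(2)[OF qp_nonzero[OF g]])
  from suminf_split_head[OF this] have "lambert (e2pi (of_nat N * \<zeta>)) (e2pi x) = ?f 0 + (\<Sum>k. ?f (Suc k))"
    by (simp add: lambert_def)
  then show ?thesis by (simp add: lambert_def e2pi_add mult.assoc)
qed

lemma DERIV_Theta_add:
  assumes g: "generic_arg \<zeta> \<tau> x"
  shows "(Theta_add (of_nat N * \<zeta>) has_field_derivative Lth x * Theta_add (of_nat N * \<zeta>) x) (at x)"
proof -
  have g': "generic_arg \<zeta> \<tau> (- x)" by (rule generic_arg_minus[OF g])
  have gt: "generic_arg \<zeta> \<tau> ((of_nat N * \<zeta>) - x)"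
    using generic_arg_shift[OF g', of 0 "int N" 0] by (simp add: add.commute)
  have "((\<lambda>x. qp (of_nat N * \<zeta>) ((of_nat N * \<zeta>) - x)) has_field_derivative - (2 * \<i> * pi) * lambert (e2pi (of_nat N * \<zeta>)) (e2pi ((of_nat N * \<zeta>) - x)) * qp (of_nat N * \<zeta>) ((of_nat N * \<zeta>) - x) * (- 1)) (at x)"
    by (rule DERIV_chain2[where g = "\<lambda>x. (of_nat N * \<zeta>) - x", OF DERIV_qp(1)[OF qp_nonzero[OF gt]]])
       (auto intro!: derivative_eq_intros)
  from DERIV_mult[OF DERIV_qp(1)[OF qp_nonzero[OF g]] this]
  have "((\<lambda>x. qp (of_nat N * \<zeta>) x * qp (of_nat N * \<zeta>) ((of_nat N * \<zeta>) - x)) has_field_derivative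
      2 * \<i> * pi * (lambert (e2pi (of_nat N * \<zeta>)) (e2pi ((of_nat N * \<zeta>) - x)) - lambert (e2pi (of_nat N * \<zeta>)) (e2pi x)) * (qp (of_nat N * \<zeta>) x * qp (of_nat N * \<zeta>) ((of_nat N * \<zeta>) - x))) (at x)"
    by (simp add: algebra_simps)
  from DERIV_cmult_right[OF this, of "qp (of_nat N * \<zeta>) (of_nat N * \<zeta>)"]
  have "(Theta_add (of_nat N * \<zeta>) has_field_derivative
      2 * \<i> * pi * (lambert (e2pi (of_nat N * \<zeta>)) (e2pi ((of_nat N * \<zeta>) - x)) - lambert (e2pi (of_nat N * \<zeta>)) (e2pi x)) * Theta_add (of_nat N * \<zeta>) x) (at x)"
    unfolding Theta_add_eq_qp[abs_def] by (simp add: mult_ac)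
  moreover have le: "lambert (e2pi (of_nat N * \<zeta>)) (e2pi ((of_nat N * \<zeta>) - x)) = lambert (e2pi (of_nat N * \<zeta>)) (e2pi (- x)) - e2pi (- x) / (1 - e2pi (- x))"
    using lambert_shift[OF g'] by (simp add: add.commute)
  ultimately show ?thesis unfolding Lth_def le by (simp only: diff_diff_eq add.commute)
qed

text \<open>The logarithmic form of \<open>Theta_add_minus\<close>: the exponential there has
  logarithmic derivative \<open>- 2 * \<i> * pi\<close>.\<close>

lemma Lth_minus:
  assumes g: "generic_arg \<zeta> \<tau> x"
  shows "Lth (- x) = 2 * \<i> * pi - Lth x"
proof -
  have e: "e2pi (- x) / (1 - e2pi (- x)) = - 1 - e2pi x / (1 - e2pi x)"
    using e2pi_reflect[OF g] by simp
  show ?thesis unfolding Lth_def minus_minus e by (simp add: algebra_simps)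
qed

lemma DERIV_tauN:
  assumes g1: "generic_arg \<zeta> \<tau> (\<zeta> / 2 + x)" and g2: "generic_arg \<zeta> \<tau> (\<zeta> / 2 - x)"
  shows "(tauN N \<zeta> has_field_derivative
    (\<i> * pi * (2 / of_nat N - 2) + Lth (\<zeta> / 2 + x) + Lth (\<zeta> / 2 - x)) * tauN N \<zeta> x) (at x)"
    and "tauN N \<zeta> x \<noteq> 0"
proof -
  define k where "k = \<i> * pi * (2 / of_nat N - 2)"
  let ?T = "Theta_add (of_nat N * \<zeta>)"
  have nz: "?T (\<zeta> / 2 + x) \<noteq> 0" "?T (\<zeta> / 2 - x) \<noteq> 0"
    by (rule Theta_add_zeta_nonzero[OF \<zeta> \<tau> N g1], rule Theta_add_zeta_nonzero[OF \<zeta> \<tau> N g2])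
  have eq: "tauN N \<zeta> = (\<lambda>x. exp (k * x) * (?T (\<zeta> / 2 + x) / ?T (\<zeta> / 2 - x)))"
    by (rule ext) (simp add: tauN_eq_Theta_add[OF \<zeta> \<tau> N] k_def mult_ac)
  show "tauN N \<zeta> x \<noteq> 0" unfolding eq using nz by simp
  have d1: "((\<lambda>x. ?T (\<zeta> / 2 + x)) has_field_derivative Lth (\<zeta> / 2 + x) * ?T (\<zeta> / 2 + x)) (at x)"
    by (rule DERIV_chain2[where g = "\<lambda>x. \<zeta> / 2 + x", OF DERIV_Theta_add[OF g1], of 1, simplified mult_1_right])
      (auto intro!: derivative_eq_intros)
  have d2: "((\<lambda>x. ?T (\<zeta> / 2 - x)) has_field_derivative - Lth (\<zeta> / 2 - x) * ?T (\<zeta> / 2 - x)) (at x)"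
    by (rule DERIV_cong[OF DERIV_chain2[where g = "\<lambda>x. \<zeta> / 2 - x", OF DERIV_Theta_add[OF g2], of "- 1"]])
      (auto intro!: derivative_eq_intros)
  have d0: "((\<lambda>x. exp (k * x)) has_field_derivative exp (k * x) * k) (at x)"
    by (auto intro!: derivative_eq_intros)
  have "(tauN N \<zeta> has_field_derivative
      exp (k * x) * k * (?T (\<zeta> / 2 + x) / ?T (\<zeta> / 2 - x)) +
      (Lth (\<zeta> / 2 + x) * ?T (\<zeta> / 2 + x) * ?T (\<zeta> / 2 - x) - ?T (\<zeta> / 2 + x) * (- Lth (\<zeta> / 2 - x) * ?T (\<zeta> / 2 - x)))
        / (?T (\<zeta> / 2 - x) * ?T (\<zeta> / 2 - x)) * exp (k * x)) (at x)"
    unfolding eq by (rule DERIV_mult[OF d0 DERIV_divide[OF d1 d2 nz(2)]])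
  then show "(tauN N \<zeta> has_field_derivative
    (\<i> * pi * (2 / of_nat N - 2) + Lth (\<zeta> / 2 + x) + Lth (\<zeta> / 2 - x)) * tauN N \<zeta> x) (at x)"
    unfolding k_def[symmetric]
  proof (rule DERIV_cong)
    have "E * k * (A / B) + (a * A * B - A * (- b * B)) / (B * B) * E = (k + a + b) * (E * (A / B))"
      if "B \<noteq> 0" for E A B a b :: complex
      using that by (simp add: field_simps)
    from this[OF nz(2)] show "exp (k * x) * k * (?T (\<zeta> / 2 + x) / ?T (\<zeta> / 2 - x)) +
      (Lth (\<zeta> / 2 + x) * ?T (\<zeta> / 2 + x) * ?T (\<zeta> / 2 - x) - ?T (\<zeta> / 2 + x) * (- Lth (\<zeta> / 2 - x) * ?T (\<zeta> / 2 - x)))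
        / (?T (\<zeta> / 2 - x) * ?T (\<zeta> / 2 - x)) * exp (k * x) = (k + Lth (\<zeta> / 2 + x) + Lth (\<zeta> / 2 - x)) * tauN N \<zeta> x"
      unfolding eq .
  qed
qed

text \<open>By \<open>tauN_period\<close>, \<open>c\<close> enters only through
  \<open>c + N\<close>, and \<open>Tfun\<close> has value 1 at the critical level. Its derivative is
  \<open>- \<zeta>\<close> times the difference of the logarithmic derivatives of
  \<open>tauN\<close> at \<open>\<zeta> / 2 + \<xi>\<close> and \<open>\<zeta> / 2 - \<xi>\<close>;
  the exponents and the constants from \<open>Lth_minus\<close> cancel in it.\<close>

lemma DERIV_Tfun:
  assumes g: "generic_arg \<zeta> \<tau> \<xi>"
  shows "((\<lambda>c. Tfun N \<zeta> c \<xi>) has_field_derivative - \<zeta> * (Lth (\<xi> + \<zeta>) + Lth (\<xi> - \<zeta>) - 2 * Lth \<xi>)) (at (- of_nat N))"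
proof -
  let ?n = "of_nat N :: complex"
  have gs: "generic_arg \<zeta> \<tau> (\<xi> + of_int b * \<zeta>)" for b using generic_arg_shift[OF g, of 0 b 0] by simp
  have gp: "generic_arg \<zeta> \<tau> (\<xi> + \<zeta>)" "generic_arg \<zeta> \<tau> (\<xi> - \<zeta>)" "generic_arg \<zeta> \<tau> (- \<xi>)" "generic_arg \<zeta> \<tau> (\<zeta> - \<xi>)"
    using gs[of 1] gs[of "-1"] generic_arg_minus[OF g] generic_arg_minus[OF gs[of "-1"]] by simp_all
  have arg: "\<zeta> / 2 + (\<zeta> / 2 + \<xi>) = \<xi> + \<zeta>" "\<zeta> / 2 - (\<zeta> / 2 + \<xi>) = - \<xi>"
    "\<zeta> / 2 + (\<zeta> / 2 - \<xi>) = \<zeta> - \<xi>" "\<zeta> / 2 - (\<zeta> / 2 - \<xi>) = \<xi>"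
    by (simp_all add: algebra_simps flip: add_divide_distrib)
  define k where "k = \<i> * pi * (2 / ?n - 2)"
  define a where "a = tauN N \<zeta> (\<zeta> / 2 + \<xi>)"
  define b where "b = tauN N \<zeta> (\<zeta> / 2 - \<xi>)"
  have d1: "(tauN N \<zeta> has_field_derivative (k + Lth (\<xi> + \<zeta>) + Lth (- \<xi>)) * a) (at (\<zeta> / 2 + \<xi>))" "a \<noteq> 0"
    using DERIV_tauN[of "\<zeta> / 2 + \<xi>"] gp unfolding arg k_def a_def by auto
  have d2: "(tauN N \<zeta> has_field_derivative (k + Lth (\<zeta> - \<xi>) + Lth \<xi>) * b) (at (\<zeta> / 2 - \<xi>))" "b \<noteq> 0"
    using DERIV_tauN[of "\<zeta> / 2 - \<xi>"] gp g unfolding arg k_def b_def by auto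
  have T: "Tfun N \<zeta> c \<xi> = b / a * (tauN N \<zeta> (\<zeta> / 2 + \<xi> - (c + ?n) * \<zeta>) / tauN N \<zeta> (\<zeta> / 2 - \<xi> - (c + ?n) * \<zeta>))" for c
  proof -
    have "(1/2 - c) * \<zeta> + \<xi> = (\<zeta> / 2 + \<xi> - (c + ?n) * \<zeta>) + ?n * \<zeta>"
      "(1/2 - c) * \<zeta> - \<xi> = (\<zeta> / 2 - \<xi> - (c + ?n) * \<zeta>) + ?n * \<zeta>" by (simp_all add: algebra_simps)
    then show ?thesis unfolding Tfun_def by (simp only: tauN_period[OF \<zeta> \<tau> N] a_def b_def) simp
  qed
  have e1: "((\<lambda>c. tauN N \<zeta> (\<zeta> / 2 + \<xi> - (c + ?n) * \<zeta>)) has_field_derivative (k + Lth (\<xi> + \<zeta>) + Lth (- \<xi>)) * a * (- \<zeta>)) (at (- ?n))"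
    by (rule DERIV_chain2[where g = "\<lambda>c. \<zeta> / 2 + \<xi> - (c + ?n) * \<zeta>"])
       (use d1 in \<open>auto intro!: derivative_eq_intros\<close>)
  have e2: "((\<lambda>c. tauN N \<zeta> (\<zeta> / 2 - \<xi> - (c + ?n) * \<zeta>)) has_field_derivative (k + Lth (\<zeta> - \<xi>) + Lth \<xi>) * b * (- \<zeta>)) (at (- ?n))"
    by (rule DERIV_chain2[where g = "\<lambda>c. \<zeta> / 2 - \<xi> - (c + ?n) * \<zeta>"])
       (use d2 in \<open>auto intro!: derivative_eq_intros\<close>)
  have v: "tauN N \<zeta> (\<zeta> / 2 + \<xi> - (- ?n + ?n) * \<zeta>) = a" "tauN N \<zeta> (\<zeta> / 2 - \<xi> - (- ?n + ?n) * \<zeta>) = b"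
    by (simp_all add: a_def b_def)
  have "tauN N \<zeta> (\<zeta> / 2 - \<xi> - (- ?n + ?n) * \<zeta>) \<noteq> 0" unfolding v by (rule d2)
  from DERIV_cmult[OF DERIV_divide[OF e1 e2 this], of "b / a"]
  show ?thesis unfolding T v
  proof (rule DERIV_cong)
    have m: "Lth (- \<xi>) = 2 * \<i> * pi - Lth \<xi>" "Lth (\<zeta> - \<xi>) = 2 * \<i> * pi - Lth (\<xi> - \<zeta>)"
      using Lth_minus[OF g] Lth_minus[OF gp(2)] by simp_all
    have "b / a * ((X * a * (- \<zeta>) * b - a * (Y * b * (- \<zeta>))) / (b * b)) = - \<zeta> * (X - Y)" for X Y
      using d1(2) d2(2) by (simp add: field_simps)
    then show "b / a * (((k + Lth (\<xi> + \<zeta>) + Lth (- \<xi>)) * a * (- \<zeta>) * b - a * ((k + Lth (\<zeta> - \<xi>) + Lth \<xi>) * b * (- \<zeta>))) / (b * b)) =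
        - \<zeta> * (Lth (\<xi> + \<zeta>) + Lth (\<xi> - \<zeta>) - 2 * Lth \<xi>)"
      by (simp add: m)
  qed
qed

private lemma f_bracket_eq:
  assumes g: "generic_arg \<zeta> \<tau> \<xi>"
  shows "f_bracket N (exp (\<i> * pi * \<zeta>)) (exp (\<i> * pi * \<xi>)) =
    2 * lambert (e2pi (of_nat N * \<zeta>)) (e2pi \<xi>) - lambert (e2pi (of_nat N * \<zeta>)) (e2pi (\<xi> + \<zeta>)) - lambert (e2pi (of_nat N * \<zeta>)) (e2pi (\<xi> - \<zeta>))
    - e2pi \<xi> / (1 - e2pi \<xi>) + 1/2 * (e2pi (\<xi> + \<zeta>) / (1 - e2pi (\<xi> + \<zeta>))) + 1/2 * (e2pi (\<xi> - \<zeta>) / (1 - e2pi (\<xi> - \<zeta>)))"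
proof -
  let ?q = "exp (\<i> * pi * \<zeta>)"
  let ?Q = "e2pi (of_nat N * \<zeta>)"
  let ?l = "\<lambda>x k. e2pi x * ?Q ^ k / (1 - e2pi x * ?Q ^ k)"
  have gs: "generic_arg \<zeta> \<tau> (\<xi> + of_int b * \<zeta>)" for b using generic_arg_shift[OF g, of 0 b 0] by simp
  have x2: "(exp (\<i> * pi * \<xi>))\<^sup>2 = e2pi \<xi>" for \<xi>
    unfolding e2pi_def exp_of_nat_mult[symmetric] power2_eq_square mult_exp_exp by (rule arg_cong[where f = exp]) simp
  have q: "?q ^ (2 * k) = e2pi (of_nat k * \<zeta>)" for k
    unfolding e2pi_def exp_of_nat_mult[symmetric] by (rule arg_cong[where f = exp]) simp
  have q1: "?q ^ (2 * N * l) = ?Q ^ l" for l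
    using q[of "N * l"] by (simp add: e2pi_power mult_ac)
  have q2: "?q ^ (2 * N * l + 2) = e2pi \<zeta> * ?Q ^ l" for l
    unfolding power_add q1 x2 by simp
  have q3: "?q powi (2 * int N * int l - 2) = e2pi (- \<zeta>) * ?Q ^ l" for l
  proof -
    have "?q powi (2 * int N * int l - 2) = ?q powi int (2 * N * l) / ?q powi 2"
      by (subst power_int_diff[symmetric]) simp_all
    also have "\<dots> = ?q ^ (2 * N * l) / ?q\<^sup>2"
      unfolding power_int_of_nat by simp
    finally have "?q powi (2 * int N * int l - 2) = ?q ^ (2 * N * l) / ?q\<^sup>2" .
    then show ?thesis unfolding q1 x2 by (simp add: e2pi_minus field_simps)
  qed
  have q4: "?q powi (- 2) = e2pi (- \<zeta>)"
    using q3[of 0] by simp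
  have s: "summable (?l \<xi>)" "summable (?l (\<xi> + \<zeta>))" "summable (?l (\<xi> - \<zeta>))"
    using DERIV_qp(2)[OF qp_nonzero[OF gs[of 0]]] DERIV_qp(2)[OF qp_nonzero[OF gs[of 1]]]
      DERIV_qp(2)[OF qp_nonzero[OF gs[of "-1"]]] by simp_all
  have "(\<lambda>l. 2 * ?l \<xi> l - ?l (\<xi> + \<zeta>) l - ?l (\<xi> - \<zeta>) l) sums
      (2 * lambert ?Q (e2pi \<xi>) - lambert ?Q (e2pi (\<xi> + \<zeta>)) - lambert ?Q (e2pi (\<xi> - \<zeta>)))"
    unfolding lambert_def by (intro sums_diff sums_mult summable_sums s)
  then have "(\<Sum>l. 2 * ?l \<xi> l - ?l (\<xi> + \<zeta>) l - ?l (\<xi> - \<zeta>) l) =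
      2 * lambert ?Q (e2pi \<xi>) - lambert ?Q (e2pi (\<xi> + \<zeta>)) - lambert ?Q (e2pi (\<xi> - \<zeta>))"
    by (simp add: sums_iff)
  moreover have "e2pi (\<xi> - \<zeta>) = e2pi \<xi> * e2pi (- \<zeta>)" by (simp add: e2pi_diff e2pi_minus divide_inverse)
  ultimately show ?thesis
    unfolding f_bracket_def x2 q1 q2 q3 q4 by (simp add: e2pi_add mult.assoc)
qed

text \<open>With \<open>E x = e2pi x / (1 - e2pi x)\<close> one has
  \<open>E x - E (- x) = - 1 - 2 * E (- x)\<close>. This turns the antisymmetrized terms outside the
  sum into the extra fractions of \<open>Lth\<close>, which explains their coefficients -1, 1/2,
  1/2; the leftover constants 1, -1/2, -1/2 add up to 0.\<close>

lemma f_poisson_eq: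
  assumes g: "generic_arg \<zeta> \<tau> \<xi>"
  shows "f_poisson N \<zeta> (exp (\<i> * pi * \<xi>)) = - \<zeta> * (Lth (\<xi> + \<zeta>) + Lth (\<xi> - \<zeta>) - 2 * Lth \<xi>)"
proof -
  have gs: "generic_arg \<zeta> \<tau> (\<xi> + of_int b * \<zeta>)" for b using generic_arg_shift[OF g, of 0 b 0] by simp
  have gp: "generic_arg \<zeta> \<tau> (\<xi> + \<zeta>)" "generic_arg \<zeta> \<tau> (\<xi> - \<zeta>)"
    using gs[of 1] gs[of "-1"] by simp_all
  have inv: "inverse (exp (\<i> * pi * \<xi>)) = exp (\<i> * pi * (- \<xi>))" by (simp add: exp_minus)
  define E where "E x = e2pi x / (1 - e2pi x)" for x
  have r: "E x = - 1 - E (- x)" if "generic_arg \<zeta> \<tau> x" for x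
    unfolding E_def by (rule e2pi_reflect[OF that])
  have m: "- \<xi> + \<zeta> = - (\<xi> - \<zeta>)" "- \<xi> - \<zeta> = - (\<xi> + \<zeta>)" by simp_all
  have "2 * \<i> * pi * (f_bracket N (exp (\<i> * pi * \<zeta>)) (exp (\<i> * pi * \<xi>)) - f_bracket N (exp (\<i> * pi * \<zeta>)) (exp (\<i> * pi * (- \<xi>)))) =
      Lth (\<xi> + \<zeta>) + Lth (\<xi> - \<zeta>) - 2 * Lth \<xi>"
    unfolding f_bracket_eq[OF g] f_bracket_eq[OF generic_arg_minus[OF g]] m Lth_def E_def[symmetric]
    by (simp add: r[OF g] r[OF gp(1)] r[OF gp(2)] algebra_simps)
  then show ?thesis unfolding f_poisson_def inv by (simp add: mult_ac)
qed

end

section \<open>Commutativity at the critical level\<close>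

text \<open>Both R-matrices commute with \<open>k1 ** k2\<close>, so conjugating the operators in
  both slots leaves the spectral parameters unchanged.\<close>

lemma exchange_conjugate_both:
  fixes k1 k1i k2 k2i e1 e2 r s :: "('a::semiring_1, 'm::finite) vec ^ 'm"
  assumes e: "r ** e1 ** e2 = e2 ** e1 ** s"
    and r: "r ** k1 ** k2 = k1 ** k2 ** r" and s: "s ** k1 ** k2 = k1 ** k2 ** s"
    and k: "k1 ** k1i = mat 1" "k1i ** k1 = mat 1" "k2 ** k2i = mat 1" "k2i ** k2 = mat 1"
    and c: "k1i ** k2 = k2 ** k1i" "k1 ** k2 = k2 ** k1" "k1 ** k2i = k2i ** k1" "k1i ** k2i = k2i ** k1i"
      "e1 ** k2 = k2 ** e1" "e1 ** k2i = k2i ** e1" "k1 ** e2 = e2 ** k1" "k1i ** e2 = e2 ** k1i"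
  shows "r ** (k1 ** e1 ** k1i) ** (k2 ** e2 ** k2i) = (k2 ** e2 ** k2i) ** (k1 ** e1 ** k1i) ** s"
proof -
  have s': "s ** k1i ** k2i = k1i ** k2i ** s"
  proof -
    have 1: "k1 ** k2 ** (k1i ** k2i) = mat 1"
    proof -
      have "k1 ** k2 ** (k1i ** k2i) = k1 ** (k2 ** k2i) ** k1i"
        unfolding c(4) by (simp only: matrix_mul_assoc)
      then show ?thesis by (simp add: k)
    qed
    have 2: "(k1i ** k2i) ** (k1 ** k2) = mat 1"
    proof -
      have "(k1i ** k2i) ** (k1 ** k2) = k1i ** (k2i ** k2) ** k1"
        unfolding c(2) by (simp only: matrix_mul_assoc)
      then show ?thesis by (simp add: k)
    qed
    have "s ** k1i ** k2i = ((k1i ** k2i) ** (k1 ** k2)) ** s ** (k1i ** k2i)"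
      unfolding 2 by (simp add: matrix_mul_assoc)
    also have "\<dots> = k1i ** k2i ** (k1 ** k2 ** s) ** (k1i ** k2i)" by (simp only: matrix_mul_assoc)
    also have "\<dots> = k1i ** k2i ** s ** (k1 ** k2 ** (k1i ** k2i))"
      unfolding s[symmetric] by (simp only: matrix_mul_assoc)
    finally show ?thesis unfolding 1 by simp
  qed
  have "r ** (k1 ** e1 ** k1i) ** (k2 ** e2 ** k2i) = r ** k1 ** e1 ** (k1i ** k2) ** e2 ** k2i"
    by (simp only: matrix_mul_assoc)
  also have "\<dots> = r ** k1 ** (e1 ** k2) ** (k1i ** e2) ** k2i"
    unfolding c(1) by (simp only: matrix_mul_assoc)
  also have "\<dots> = (r ** k1 ** k2) ** e1 ** e2 ** k1i ** k2i"
    unfolding c(5) c(8) by (simp only: matrix_mul_assoc)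
  also have "\<dots> = k1 ** k2 ** (r ** e1 ** e2) ** k1i ** k2i"
    unfolding r by (simp only: matrix_mul_assoc)
  also have "\<dots> = k1 ** k2 ** e2 ** e1 ** (s ** k1i ** k2i)"
    unfolding e by (simp only: matrix_mul_assoc)
  also have "\<dots> = (k1 ** k2) ** e2 ** e1 ** (k1i ** k2i) ** s"
    unfolding s' by (simp only: matrix_mul_assoc)
  also have "\<dots> = k2 ** (k1 ** e2) ** (e1 ** k2i) ** k1i ** s"
    unfolding c(2) c(4) by (simp only: matrix_mul_assoc)
  also have "\<dots> = k2 ** e2 ** (k1 ** k2i) ** e1 ** k1i ** s"
    unfolding c(6) c(7) by (simp only: matrix_mul_assoc)
  also have "\<dots> = (k2 ** e2 ** k2i) ** (k1 ** e1 ** k1i) ** s"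
    unfolding c(3) by (simp only: matrix_mul_assoc)
  finally show ?thesis .
qed

context
  fixes sc :: "complex \<Rightarrow> 'a::ring_1"
  assumes sc: "complex_algebra sc"
begin

text \<open>Conjugation in a single slot replaces both R-matrices by shifted ones. The scalar
  \<open>c\<close> produced on the left equals the one produced on the right and can be cancelled;
  this equality is what the applications have to provide.\<close>

lemma exchange_conjugate_left:
  fixes p q s s' k ki e a :: "('a, 'm::finite) vec ^ 'm"
  assumes e: "q ** e ** a = a ** e ** s'"
    and q: "k ** q = map_matrix ((*) (sc c)) (p ** k)" and s: "k ** s' = map_matrix ((*) (sc c)) (s ** k)"
    and k: "k ** ki = mat 1" "ki ** k = mat 1" and a: "k ** a = a ** k" "ki ** a = a ** ki" and c: "c \<noteq> 0"
  shows "p ** (k ** e ** ki) ** a = a ** (k ** e ** ki) ** s"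
proof (rule sc_smult_cancel[OF sc _ c])
  have "s' ** ki = (ki ** k) ** s' ** ki" by (simp add: k)
  also have "\<dots> = ki ** (k ** s') ** ki" by (simp only: matrix_mul_assoc)
  also have "\<dots> = map_matrix ((*) (sc c)) (ki ** s ** (k ** ki))"
    unfolding s sc_smult_mult[OF sc] by (simp only: matrix_mul_assoc)
  finally have s': "s' ** ki = map_matrix ((*) (sc c)) (ki ** s)" by (simp add: k)
  have "map_matrix ((*) (sc c)) (p ** (k ** e ** ki) ** a) = map_matrix ((*) (sc c)) (p ** k) ** e ** (ki ** a)"
    unfolding sc_smult_mult[OF sc] by (simp only: matrix_mul_assoc)
  also have "\<dots> = k ** (q ** e ** a) ** ki"
    unfolding a q[symmetric] by (simp only: matrix_mul_assoc)
  also have "\<dots> = (k ** a) ** e ** (s' ** ki)"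
    unfolding e by (simp only: matrix_mul_assoc)
  also have "\<dots> = map_matrix ((*) (sc c)) (a ** (k ** e ** ki) ** s)"
    unfolding a s' sc_smult_mult[OF sc] by (simp only: matrix_mul_assoc)
  finally show "map_matrix ((*) (sc c)) (p ** (k ** e ** ki) ** a) = map_matrix ((*) (sc c)) (a ** (k ** e ** ki) ** s)" .
qed

lemma exchange_conjugate_right:
  fixes p q s s' k ki e a :: "('a, 'm::finite) vec ^ 'm"
  assumes e: "q ** a ** e = e ** a ** s'"
    and p: "p ** k = map_matrix ((*) (sc c)) (k ** q)" and s: "s ** k = map_matrix ((*) (sc c)) (k ** s')"
    and k: "k ** ki = mat 1" "ki ** k = mat 1" and a: "k ** a = a ** k" "ki ** a = a ** ki"
  shows "p ** a ** (k ** e ** ki) = (k ** e ** ki) ** a ** s"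
proof -
  have "map_matrix ((*) (sc c)) (s' ** ki) = map_matrix ((*) (sc c)) ((ki ** k) ** s' ** ki)" by (simp add: k)
  also have "\<dots> = ki ** map_matrix ((*) (sc c)) (k ** s') ** ki"
    unfolding sc_smult_mult[OF sc] by (simp only: matrix_mul_assoc)
  also have "\<dots> = ki ** s ** (k ** ki)"
    unfolding s[symmetric] by (simp only: matrix_mul_assoc)
  finally have s': "map_matrix ((*) (sc c)) (s' ** ki) = ki ** s" by (simp add: k)
  have "p ** a ** (k ** e ** ki) = p ** (a ** k) ** e ** ki" by (simp only: matrix_mul_assoc)
  also have "\<dots> = (p ** k) ** a ** e ** ki"
    unfolding a[symmetric] by (simp only: matrix_mul_assoc)
  also have "\<dots> = map_matrix ((*) (sc c)) (k ** (q ** a ** e) ** ki)"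
    unfolding p sc_smult_mult[OF sc] by (simp only: matrix_mul_assoc)
  also have "\<dots> = k ** e ** a ** map_matrix ((*) (sc c)) (s' ** ki)"
    unfolding e sc_smult_mult[OF sc] by (simp only: matrix_mul_assoc)
  also have "\<dots> = k ** e ** (a ** ki) ** s"
    unfolding s' by (simp only: matrix_mul_assoc)
  also have "\<dots> = (k ** e ** ki) ** a ** s"
    unfolding a[symmetric] by (simp only: matrix_mul_assoc)
  finally show ?thesis .
qed

end

lemma generic_qp_theta_nonzero: "Im \<tau> > 0 \<Longrightarrow> generic_qp \<zeta> \<tau> \<Longrightarrow> theta \<tau> \<zeta> \<noteq> 0"
  by (simp add: theta_eq_0_iff generic_qp_def)

lemma hmat_invertible: "hmat ** Iinv (1, 0) = (mat 1 :: (complex, 'n::nontriv) zmat)"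
  "Iinv (1, 0) ** hmat = (mat 1 :: (complex, 'n) zmat)"
proof -
  have h: "hmat = (Imat (1, 0) :: (complex, 'n) zmat)"
    by (rule mat_eqI) (auto simp: hmat_def Imat_nth)
  show "hmat ** Iinv (1, 0) = (mat 1 :: (complex, 'n) zmat)" "Iinv (1, 0) ** hmat = (mat 1 :: (complex, 'n) zmat)"
    unfolding h by (rule Imat_Iinv Iinv_Imat)+
qed

lemma invertible_ghg:
  fixes G :: "(complex, 'n::nontriv) zmat"
  assumes G: "diag_sqrt_g G"
  shows "invertible (G ** hmat ** G)"
proof -
  let ?Gi = "matrix_inv G"
  have "(G ** hmat ** G) ** (?Gi ** Iinv (1, 0) ** ?Gi) = G ** hmat ** (G ** ?Gi) ** Iinv (1, 0) ** ?Gi"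
    by (simp only: matrix_mul_assoc)
  also have "\<dots> = G ** (hmat ** Iinv (1, 0)) ** ?Gi" by (simp add: G_Gi[OF G] matrix_mul_assoc)
  finally have 1: "(G ** hmat ** G) ** (?Gi ** Iinv (1, 0) ** ?Gi) = mat 1"
    by (simp add: hmat_invertible G_Gi[OF G])
  have "(?Gi ** Iinv (1, 0) ** ?Gi) ** (G ** hmat ** G) = ?Gi ** Iinv (1, 0) ** (?Gi ** G) ** hmat ** G"
    by (simp only: matrix_mul_assoc)
  also have "\<dots> = ?Gi ** (Iinv (1, 0) ** hmat) ** G" by (simp add: G_Gi[OF G] matrix_mul_assoc)
  finally have 2: "(?Gi ** Iinv (1, 0) ** ?Gi) ** (G ** hmat ** G) = mat 1"
    by (simp add: hmat_invertible G_Gi[OF G])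
  from 1 2 show ?thesis unfolding invertible_def by blast
qed

text \<open>All three follow by comparing instances of \<open>rho_tauN\<close>, whose
  \<open>tauN\<close> arguments agree or differ by the period \<open>N * \<zeta>\<close>. In the
  last one, the displacement of \<open>x\<close> moves one argument by a period and turns \<tau>
  into \<open>\<tau> + N * \<zeta>\<close> in the other.\<close>

lemma rho_eq_rho_tau_shift:
  assumes \<zeta>: "Im \<zeta> > 0" and \<tau>: "Im \<tau> > 0" and N: "N > 0"
    and nz: "theta \<tau> \<zeta> \<noteq> 0" "theta (\<tau> + of_nat N * \<zeta>) \<zeta> \<noteq> 0" and g: "generic_arg \<zeta> \<tau> x"
  shows "rho \<zeta> \<tau> N x \<noteq> 0" "rho \<zeta> \<tau> N x = rho \<zeta> (\<tau> + of_nat N * \<zeta>) N x"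
    "rho \<zeta> \<tau> N (x + of_nat N * \<zeta>) = rho \<zeta> (\<tau> + of_nat N * \<zeta>) N x"
proof -
  let ?n = "of_nat N :: complex"
  let ?\<tau> = "\<tau> + ?n * \<zeta>"
  let ?t = "tauN N \<zeta>"
  have \<tau>s: "Im ?\<tau> > 0" using \<zeta> \<tau> by (simp add: add_pos_nonneg)
  have g': "generic_arg \<zeta> \<tau> (x + ?n * \<zeta>)" using generic_arg_shift[OF g, of 0 "int N" 0] by simp
  have 1: "rho \<zeta> \<tau> N x * (?t (\<zeta> / 2 + x) * ?t (\<zeta> / 2 - x - \<tau> - 1)) = 1"
    by (rule rho_tauN[OF \<zeta> \<tau> N g nz(1)])
  have 2: "rho \<zeta> ?\<tau> N x * (?t (\<zeta> / 2 + x) * ?t (\<zeta> / 2 - x - ?\<tau> - 1)) = 1"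
    by (rule rho_tauN[OF \<zeta> \<tau>s N generic_arg_tau_shift[OF g] nz(2)])
  have 3: "rho \<zeta> \<tau> N (x + ?n * \<zeta>) * (?t (\<zeta> / 2 + (x + ?n * \<zeta>)) * ?t (\<zeta> / 2 - (x + ?n * \<zeta>) - \<tau> - 1)) = 1"
    by (rule rho_tauN[OF \<zeta> \<tau> N g' nz(1)])
  show "rho \<zeta> \<tau> N x \<noteq> 0" using 1 by auto
  have p: "?t (\<zeta> / 2 - x - \<tau> - 1) = ?t (\<zeta> / 2 - x - ?\<tau> - 1)"
    using tauN_period[OF \<zeta> \<tau> N, of "\<zeta> / 2 - x - ?\<tau> - 1"] by (simp add: algebra_simps)
  have p': "?t (\<zeta> / 2 + (x + ?n * \<zeta>)) = ?t (\<zeta> / 2 + x)"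
    using tauN_period[OF \<zeta> \<tau> N, of "\<zeta> / 2 + x"] by (simp add: add.assoc)
  have a: "\<zeta> / 2 - (x + ?n * \<zeta>) - \<tau> - 1 = \<zeta> / 2 - x - ?\<tau> - 1" by simp
  show "rho \<zeta> \<tau> N x = rho \<zeta> ?\<tau> N x"
    using 1 2 unfolding p by (metis mult_right_cancel mult_zero_right zero_neq_one)
  show "rho \<zeta> \<tau> N (x + ?n * \<zeta>) = rho \<zeta> ?\<tau> N x"
    using 3 2 unfolding p' a by (metis mult_right_cancel mult_zero_right zero_neq_one)
qed

section \<open>The exchange relations of the elliptic algebra at the critical level\<close>

context
  fixes sc :: "complex \<Rightarrow> 'a::{ring_1, t2_space}"
    and G :: "(complex, 'n::nontriv) zmat"
    and \<zeta> \<tau> :: complex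
    and D :: "complex set"
    and Lm :: "int \<Rightarrow> ('a, 'n) zmat"
  assumes \<zeta>: "Im \<zeta> > 0" and \<tau>: "Im \<tau> > 0"
    and gq: "generic_qp \<zeta> \<tau>" and gqs: "generic_qp \<zeta> (\<tau> + of_nat CARD('n) * \<zeta>)"
    and G: "diag_sqrt_g G"
    and gl: "elliptic_gl sc G \<zeta> \<tau> (- of_nat CARD('n)) D Lm"
begin

private abbreviation (input) "R \<equiv> Rmat G \<zeta> \<tau>"
private abbreviation (input) "Rs \<equiv> Rmat G \<zeta> (\<tau> + of_nat CARD('n) * \<zeta>)"

private lemma sc: "complex_algebra sc" using gl by (simp add: elliptic_gl_def)

private lemma \<tau>s: "Im (\<tau> + of_nat CARD('n) * \<zeta>) > 0" using \<zeta> \<tau> by (simp add: add_pos_nonneg)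

private lemmas nz = generic_qp_theta_nonzero[OF \<tau> gq]
private lemmas nzs = generic_qp_theta_nonzero[OF \<tau>s gqs]

text \<open>The factor \<open>tauN\<close> that distinguishes \<open>Rhat\<close> from
  \<open>Rmat\<close> contains only \<zeta> and the spectral parameter, so it is the same for both
  nomes and cancels.\<close>

lemma exchange_relation:
  assumes D: "a \<in> D" "b \<in> D" and g: "generic_arg \<zeta> \<tau> (a - b)"
  shows "map_matrix sc (R (a - b)) ** emb1 (Lop sc Lm a) ** emb2 (Lop sc Lm b) =
    emb2 (Lop sc Lm b) ** emb1 (Lop sc Lm a) ** map_matrix sc (Rs (a - b))"
proof -
  let ?x = "a - b"
  have \<tau>e: "\<tau> - - of_nat CARD('n) * \<zeta> = \<tau> + of_nat CARD('n) * \<zeta>" by simp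
  define c where "c = tauN CARD('n) \<zeta> (\<zeta> / 2 - ?x)"
  have c: "c \<noteq> 0"
  proof -
    have g': "generic_arg \<zeta> \<tau> (\<zeta> - ?x)"
      using generic_arg_shift[OF generic_arg_minus[OF g], of 0 1 0] by (simp add: algebra_simps)
    have e: "\<zeta> / 2 + (\<zeta> / 2 - ?x) = \<zeta> - ?x" "\<zeta> / 2 - (\<zeta> / 2 - ?x) = ?x"
      by (simp_all add: algebra_simps flip: add_divide_distrib)
    show ?thesis
      unfolding c_def by (rule DERIV_tauN(2)[OF \<zeta> \<tau> CARD_nontriv_pos]; unfold e) (rule g' g)+
  qed
  have "map_matrix sc (Rhat G \<zeta> \<tau> ?x) ** emb1 (Lop sc Lm a) ** emb2 (Lop sc Lm b) =
    emb2 (Lop sc Lm b) ** emb1 (Lop sc Lm a) ** map_matrix sc (Rhat G \<zeta> (\<tau> + of_nat CARD('n) * \<zeta>) ?x)"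
    using gl D g generic_arg_tau_shift[OF g, of "CARD('n)"]
    unfolding elliptic_gl_def \<tau>e emb1_def emb2_def by blast
  then show ?thesis
    unfolding Rhat_def c_def[symmetric] map_matrix_sc_smult[OF sc] sc_smult_mult[OF sc]
    by (rule sc_smult_cancel[OF sc _ c])
qed

private abbreviation (input) "K \<equiv> G ** hmat ** G"

private lemma hat_quasiperiodic:
  assumes t: "Im t > 0" and z: "theta t \<zeta> \<noteq> 0" and g: "generic_arg \<zeta> t x"
  shows "emb1 (map_matrix sc K) ** map_matrix sc (Rmat G \<zeta> t (x + t + 1)) =
      map_matrix ((*) (sc (rho \<zeta> t CARD('n) x))) (map_matrix sc (Rmat G \<zeta> t x) ** emb1 (map_matrix sc K))"
    and "map_matrix sc (Rmat G \<zeta> t (x + t + 1)) ** emb2 (map_matrix sc K) =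
      map_matrix ((*) (sc (rho \<zeta> t CARD('n) x))) (emb2 (map_matrix sc K) ** map_matrix sc (Rmat G \<zeta> t x))"
proof -
  have r: "reg \<zeta> t CARD('n) x" by (rule reg_generic[OF \<zeta> t CARD_nontriv_pos g])
  show "emb1 (map_matrix sc K) ** map_matrix sc (Rmat G \<zeta> t (x + t + 1)) =
      map_matrix ((*) (sc (rho \<zeta> t CARD('n) x))) (map_matrix sc (Rmat G \<zeta> t x) ** emb1 (map_matrix sc K))"
    using arg_cong[OF Rmat_quasiperiodic(1)[OF G \<zeta> t z r], of "map_matrix sc"]
    unfolding map_matrix_sc_mult[OF sc] map_matrix_sc_smult[OF sc] hat_emb1[OF sc] .
  show "map_matrix sc (Rmat G \<zeta> t (x + t + 1)) ** emb2 (map_matrix sc K) =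
      map_matrix ((*) (sc (rho \<zeta> t CARD('n) x))) (emb2 (map_matrix sc K) ** map_matrix sc (Rmat G \<zeta> t x))"
    using arg_cong[OF Rmat_quasiperiodic(2)[OF G \<zeta> t z r], of "map_matrix sc"]
    unfolding map_matrix_sc_mult[OF sc] map_matrix_sc_smult[OF sc] hat_emb2[OF sc] .
qed

text \<open>Both quasi-periodicity relations involve the same shifted R-matrix with the same scalar;
  eliminating it leaves the commutation with \<open>K\<close> in both slots.\<close>

private lemma hat_Rmat_commute:
  assumes t: "Im t > 0" and z: "theta t \<zeta> \<noteq> 0" and g: "generic_arg \<zeta> t x"
  shows "map_matrix sc (Rmat G \<zeta> t x) ** emb1 (map_matrix sc K) ** emb2 (map_matrix sc K) =
    emb1 (map_matrix sc K) ** emb2 (map_matrix sc K) ** map_matrix sc (Rmat G \<zeta> t x)"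
proof (rule sc_smult_cancel[OF sc])
  let ?k1 = "emb1 (map_matrix sc K)" and ?k2 = "emb2 (map_matrix sc K)"
  let ?S = "\<lambda>X. map_matrix ((*) (sc (rho \<zeta> t CARD('n) x))) X :: ('a, 'n) zmat2"
  have "?S (map_matrix sc (Rmat G \<zeta> t x) ** ?k1 ** ?k2) = ?S (map_matrix sc (Rmat G \<zeta> t x) ** ?k1) ** ?k2"
    unfolding sc_smult_mult[OF sc] ..
  also have "\<dots> = ?k1 ** (map_matrix sc (Rmat G \<zeta> t (x + t + 1)) ** ?k2)"
    unfolding hat_quasiperiodic(1)[OF t z g, symmetric] by (simp only: matrix_mul_assoc)
  also have "\<dots> = ?S (?k1 ** ?k2 ** map_matrix sc (Rmat G \<zeta> t x))"
    unfolding hat_quasiperiodic(2)[OF t z g] sc_smult_mult[OF sc] by (simp only: matrix_mul_assoc)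
  finally show "?S (map_matrix sc (Rmat G \<zeta> t x) ** ?k1 ** ?k2) = ?S (?k1 ** ?k2 ** map_matrix sc (Rmat G \<zeta> t x))" .
  show "rho \<zeta> t CARD('n) x \<noteq> 0" using rho_tauN[OF \<zeta> t CARD_nontriv_pos[where ?'n = 'n] g z] by auto
qed

lemma tgen_commute:
  assumes D: "u - of_nat CARD('n) * \<zeta> \<in> D" "u + \<tau> + 1 \<in> D" "v - of_nat CARD('n) * \<zeta> \<in> D" "v + \<tau> + 1 \<in> D"
    and inv: "invertible (Lminus sc G \<tau> Lm u)" "invertible (Lminus sc G \<tau> Lm v)"
    and g: "generic_arg \<zeta> \<tau> (u - v)"
  defines "t \<equiv> tgen sc G \<zeta> \<tau> (- of_nat CARD('n)) Lm"
  shows "t u * t v = t v * t u"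
proof -
  let ?n = "of_nat CARD('n) :: complex"
  define \<xi> where "\<xi> = u - v"
  let ?\<tau>s = "\<tau> + ?n * \<zeta>"
  let ?h = "map_matrix sc :: (complex, 'n) zmat2 \<Rightarrow> ('a, 'n) zmat2"
  define k where "k = map_matrix sc K"
  define ki where "ki = map_matrix sc (matrix_inv K)"
  have k: "k ** ki = mat 1" "ki ** k = mat 1"
    using matrix_inv_of_invertible[OF invertible_ghg[OF G]]
    unfolding k_def ki_def by (simp_all add: map_matrix_sc_mat_1[OF sc] flip: map_matrix_sc_mult[OF sc])
  define A where "A w = Lop sc Lm (w - ?n * \<zeta>)" for w
  define E where "E w = Lop sc Lm (w + \<tau> + 1)" for w
  define B where "B w = Lminus sc G \<tau> Lm w" for w
  define C where "C w = matrix_inv (B w)" for w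
  have B: "B w = k ** E w ** ki" for w by (simp add: B_def Lminus_def k_def ki_def E_def)
  have BC: "B w ** C w = mat 1" "C w ** B w = mat 1" if "w = u \<or> w = v" for w
    using that matrix_inv_of_invertible[OF inv(1)] matrix_inv_of_invertible[OF inv(2)] unfolding C_def B_def by auto
  \<comment> \<open>The two half shifts by \<open>c / 2\<close> in \<open>Lcal\<close> and
    \<open>Lplus\<close> add up to \<open>- N * \<zeta>\<close>.\<close>
  have Lcal: "Lcal sc G \<zeta> \<tau> (- ?n) Lm w = A w ** C w" for w
  proof -
    have "w + - ?n / 2 * \<zeta> + - ?n / 2 * \<zeta> = w - ?n * \<zeta>" by (simp add: field_simps)
    then show ?thesis by (simp only: Lcal_def Lplus_def A_def C_def B_def)
  qed
  have g\<xi>: "generic_arg \<zeta> \<tau> \<xi>" using g by (simp add: \<xi>_def)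
  have gs: "generic_arg \<zeta> \<tau> (\<xi> + of_int a + of_int b * \<zeta> + of_int c * \<tau>)" for a b c
    by (rule generic_arg_shift[OF g\<xi>])
  have gp: "generic_arg \<zeta> \<tau> (\<xi> + ?n * \<zeta>)" using gs[of 0 "int CARD('n)" 0] by simp
  have gm: "generic_arg \<zeta> \<tau> (\<xi> - ?n * \<zeta>)" using gs[of 0 "- int CARD('n)" 0] by simp
  have gx: "generic_arg \<zeta> \<tau> (\<xi> + ?n * \<zeta> + \<tau> + 1)"
    using gs[of 1 "int CARD('n)" 1] by (simp add: algebra_simps)
  have gy: "generic_arg \<zeta> \<tau> (\<xi> - ?n * \<zeta> - \<tau> - 1)"
    using gs[of "-1" "- int CARD('n)" "-1"] by (simp add: algebra_simps)
  note gen_s = generic_arg_tau_shift[of \<zeta> \<tau> _ "CARD('n)"]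
  note comm = emb_commute[OF sc]
  have kk: "emb1 k ** emb1 ki = mat 1" "emb1 ki ** emb1 k = mat 1" "emb2 k ** emb2 ki = mat 1" "emb2 ki ** emb2 k = mat 1"
    by (simp_all add: emb1_mult emb2_mult k)
  have AA: "?h (R \<xi>) ** emb1 (A u) ** emb2 (A v) = emb2 (A v) ** emb1 (A u) ** ?h (Rs \<xi>)"
    using exchange_relation[OF D(1,3)] g\<xi> by (simp add: A_def \<xi>_def)
  have BB: "?h (R \<xi>) ** emb1 (B u) ** emb2 (B v) = emb2 (B v) ** emb1 (B u) ** ?h (Rs \<xi>)"
    unfolding B emb1_mult[symmetric] emb2_mult[symmetric]
  proof (rule exchange_conjugate_both)
    show "?h (R \<xi>) ** emb1 (E u) ** emb2 (E v) = emb2 (E v) ** emb1 (E u) ** ?h (Rs \<xi>)"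
      using exchange_relation[OF D(2,4)] g\<xi> by (simp add: E_def \<xi>_def)
    show "?h (R \<xi>) ** emb1 k ** emb2 k = emb1 k ** emb2 k ** ?h (R \<xi>)"
      unfolding k_def by (rule hat_Rmat_commute[OF \<tau> nz g\<xi>])
    show "?h (Rs \<xi>) ** emb1 k ** emb2 k = emb1 k ** emb2 k ** ?h (Rs \<xi>)"
      unfolding k_def by (rule hat_Rmat_commute[OF \<tau>s nzs gen_s[OF g\<xi>]])
  qed (rule kk comm(1)[of "K", folded k_def] comm(1)[of "matrix_inv K", folded ki_def]
      comm(2)[of "K", folded k_def, symmetric] comm(2)[of "matrix_inv K", folded ki_def, symmetric])+
  have BA: "?h (R (\<xi> + ?n * \<zeta>)) ** emb1 (B u) ** emb2 (A v) = emb2 (A v) ** emb1 (B u) ** ?h (Rs \<xi>)"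
    unfolding B emb1_mult[symmetric]
  proof (rule exchange_conjugate_left[OF sc])
    have x: "u + \<tau> + 1 - (v - ?n * \<zeta>) = \<xi> + ?n * \<zeta> + \<tau> + 1" by (simp add: \<xi>_def)
    show "?h (R (\<xi> + ?n * \<zeta> + \<tau> + 1)) ** emb1 (E u) ** emb2 (A v) = emb2 (A v) ** emb1 (E u) ** ?h (Rs (\<xi> + ?n * \<zeta> + \<tau> + 1))"
      using exchange_relation[OF D(2,3)] gx unfolding x by (simp add: E_def A_def)
    show "emb1 k ** ?h (R (\<xi> + ?n * \<zeta> + \<tau> + 1)) =
        map_matrix ((*) (sc (rho \<zeta> ?\<tau>s CARD('n) \<xi>))) (?h (R (\<xi> + ?n * \<zeta>)) ** emb1 k)"
      unfolding k_def rho_eq_rho_tau_shift(3)[OF \<zeta> \<tau> CARD_nontriv_pos nz nzs g\<xi>, symmetric]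
      by (rule hat_quasiperiodic(1)[OF \<tau> nz gp])
    \<comment> \<open>The same argument has two readings: relative to \<tau> it lies over
      \<open>\<xi> + N * \<zeta>\<close>, relative to the starred parameter \<open>?\<tau>s\<close>
      over \<xi>. Hence the unstarred matrix keeps the displacement by \<open>N * \<zeta>\<close>
      and the starred one loses it.\<close>
    have x': "\<xi> + ?n * \<zeta> + \<tau> + 1 = \<xi> + ?\<tau>s + 1" by simp
    show "emb1 k ** ?h (Rs (\<xi> + ?n * \<zeta> + \<tau> + 1)) = map_matrix ((*) (sc (rho \<zeta> ?\<tau>s CARD('n) \<xi>))) (?h (Rs \<xi>) ** emb1 k)"
      unfolding k_def x' by (rule hat_quasiperiodic(1)[OF \<tau>s nzs gen_s[OF g\<xi>]])
    show "rho \<zeta> ?\<tau>s CARD('n) \<xi> \<noteq> 0"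
      using rho_eq_rho_tau_shift(1,2)[OF \<zeta> \<tau> CARD_nontriv_pos nz nzs g\<xi>] by simp
  qed (rule kk comm(1)[of "K", folded k_def] comm(1)[of "matrix_inv K", folded ki_def])+
  have AB: "?h (R (\<xi> - ?n * \<zeta>)) ** emb1 (A u) ** emb2 (B v) = emb2 (B v) ** emb1 (A u) ** ?h (Rs \<xi>)"
    unfolding B emb2_mult[symmetric]
  proof (rule exchange_conjugate_right[OF sc])
    \<comment> \<open>The spectral parameter of the unconjugated relation. A shift by
      \<open>\<tau> + 1\<close> takes it to \<open>\<xi> - N * \<zeta>\<close>, a shift by
      \<open>?\<tau>s + 1\<close> to \<xi>.\<close>
    let ?y = "\<xi> - ?n * \<zeta> - \<tau> - 1"
    have x: "u - ?n * \<zeta> - (v + \<tau> + 1) = ?y" by (simp add: \<xi>_def)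
    show "?h (R ?y) ** emb1 (A u) ** emb2 (E v) = emb2 (E v) ** emb1 (A u) ** ?h (Rs ?y)"
      using exchange_relation[OF D(1,4)] gy unfolding x by (simp add: E_def A_def)
    have y: "\<xi> - ?n * \<zeta> = ?y + \<tau> + 1" "\<xi> = ?y + ?\<tau>s + 1" by simp_all
    show "?h (R (\<xi> - ?n * \<zeta>)) ** emb2 k = map_matrix ((*) (sc (rho \<zeta> \<tau> CARD('n) ?y))) (emb2 k ** ?h (R ?y))"
      using hat_quasiperiodic(2)[OF \<tau> nz gy] unfolding k_def y(1)[symmetric] .
    show "?h (Rs \<xi>) ** emb2 k = map_matrix ((*) (sc (rho \<zeta> \<tau> CARD('n) ?y))) (emb2 k ** ?h (Rs ?y))"
      using hat_quasiperiodic(2)[OF \<tau>s nzs gen_s[OF gy]]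
      unfolding k_def y(2)[symmetric] rho_eq_rho_tau_shift(2)[OF \<zeta> \<tau> CARD_nontriv_pos nz nzs gy, symmetric] .
  qed (rule kk comm(2)[of "K", folded k_def] comm(2)[of "matrix_inv K", folded ki_def])+
  note reg = reg_generic[OF \<zeta> \<tau> CARD_nontriv_pos] and regs = reg_generic[OF \<zeta> \<tau>s CARD_nontriv_pos gen_s]
  have m: "generic_arg \<zeta> \<tau> (- \<xi>)" "generic_arg \<zeta> \<tau> (- \<xi> - ?n * \<zeta>)"
    using generic_arg_minus[OF g\<xi>] generic_arg_minus[OF gp] by simp_all
  have uni: "?h X ** ?h Y = mat 1" if "X ** Y = mat 1" for X Y
    using arg_cong[OF that, of ?h] by (simp add: map_matrix_sc_mult[OF sc] map_matrix_sc_mat_1[OF sc])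
  have "(emb1 (A u) ** emb1 (C u)) ** ?h (flip (R (- \<xi> - ?n * \<zeta>))) ** (emb2 (A v) ** emb2 (C v)) =
      ?h (flip (R (- \<xi>))) ** (emb2 (A v) ** emb2 (C v)) ** ?h (R (\<xi> - ?n * \<zeta>)) ** (emb1 (A u) ** emb1 (C u)) ** ?h (flip (R (- \<xi>)))"
  proof (rule reflection_relation[OF _ _ _ _ _ _ _ _ AA BB BA AB])
    show "?h (R \<xi>) ** ?h (flip (R (- \<xi>))) = mat 1"
      by (rule uni[OF Rmat_unitarity[OF G \<zeta> \<tau> nz reg[OF g\<xi>]]])
    show "?h (flip (R (- \<xi>))) ** ?h (R \<xi>) = mat 1"
      using uni[OF flip_Rmat_unitarity[OF G \<zeta> \<tau> nz reg[OF m(1)]]] by simp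
    show "?h (Rs \<xi>) ** ?h (flip (Rs (- \<xi>))) = mat 1"
      by (rule uni[OF Rmat_unitarity[OF G \<zeta> \<tau>s nzs regs[OF g\<xi>]]])
    show "?h (flip (R (- \<xi> - ?n * \<zeta>))) ** ?h (R (\<xi> + ?n * \<zeta>)) = mat 1"
      using uni[OF flip_Rmat_unitarity[OF G \<zeta> \<tau> nz reg[OF m(2)]]] by (simp add: add.commute)
  qed (simp_all add: emb1_mult emb2_mult BC)
  then have refl: "emb1 (A u ** C u) ** ?h (flip (R (- \<xi> - ?n * \<zeta>))) ** emb2 (A v ** C v) =
      ?h (flip (R (- \<xi>))) ** emb2 (A v ** C v) ** ?h (R (\<xi> - ?n * \<zeta>)) ** emb1 (A u ** C u) ** ?h (flip (R (- \<xi>)))"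
    unfolding emb1_mult emb2_mult .
  \<comment> \<open>Multiplying by \<open>R \<xi>\<close> on the right removes the last factor of
    the reflection relation. On each side the two scalar matrices that remain form a crossing pair,
    so that \<open>trace_sandwich\<close> evaluates both traces.\<close>
  have "emb1 (A u ** C u) ** ?h (flip (R (- \<xi> - ?n * \<zeta>))) ** emb2 (A v ** C v) ** ?h (R \<xi>) =
      ?h (flip (R (- \<xi>))) ** emb2 (A v ** C v) ** ?h (R (\<xi> - ?n * \<zeta>)) ** emb1 (A u ** C u) ** (?h (flip (R (- \<xi>))) ** ?h (R \<xi>))"
    unfolding refl by (simp only: matrix_mul_assoc)
  also have "?h (flip (R (- \<xi>))) ** ?h (R \<xi>) = mat 1"
    using uni[OF flip_Rmat_unitarity[OF G \<zeta> \<tau> nz reg[OF m(1)]]] by simp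
  finally have tr: "trace (emb1 (A u ** C u) ** ?h (flip (R (- \<xi> - ?n * \<zeta>))) ** emb2 (A v ** C v) ** ?h (R \<xi>)) =
      trace (?h (flip (R (- \<xi>))) ** emb2 (A v ** C v) ** ?h (R (\<xi> - ?n * \<zeta>)) ** emb1 (A u ** C u))"
    by simp
  have "transp2 (flip (R (- \<xi> - ?n * \<zeta>))) ** transp2 (R \<xi>) = mat 1"
    using Rmat_crossing[OF G \<zeta> \<tau> nz reg[OF m(2)]] reg[OF g\<xi>] by simp
  moreover have "transp2 (flip (R (- \<xi>))) ** transp2 (R (\<xi> - ?n * \<zeta>)) = mat 1"
    using Rmat_crossing[OF G \<zeta> \<tau> nz reg[OF m(1)]] reg[OF gm] by simp
  ultimately have "trace (A u ** C u) * trace (A v ** C v) = trace (A v ** C v) * trace (A u ** C u)"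
    using tr by (simp only: trace_sandwich[OF sc])
  then show ?thesis unfolding t_def tgen_def Lcal .
qed

end

text \<open>A scalar derivative contracts each index pair into a trace. As in the definition of the
  bracket, the factor at \<open>v\<close> stands first, so the order in the theorem still has to
  come from \<open>tgen_commute\<close>.\<close>

lemma poisson_t_scalar:
  fixes sc :: "complex \<Rightarrow> 'a::{ring_1, t2_space}" and G :: "(complex, 'n::nontriv) zmat" and Lm :: "int \<Rightarrow> ('a, 'n) zmat"
  assumes sc: "complex_algebra sc" and Y: "dYmat G \<zeta> \<tau> (v - u) = mat f"
  defines "t \<equiv> tgen sc G \<zeta> \<tau> (- of_nat CARD('n)) Lm"
  shows "poisson_t sc G \<zeta> \<tau> Lm u v = sc f * (t v * t u)"
proof -
  define P where "P = Lcal sc G \<zeta> \<tau> (- of_nat CARD('n)) Lm v"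
  define Q where "Q = Lcal sc G \<zeta> \<tau> (- of_nat CARD('n)) Lm u"
  have "poisson_t sc G \<zeta> \<tau> Lm u v = (\<Sum>i1\<in>UNIV. \<Sum>i2\<in>UNIV. \<Sum>j1\<in>UNIV. \<Sum>j2\<in>UNIV.
      sc (mat f $ (i1, i2) $ (j1, j2)) * P $ j2 $ i2 * Q $ j1 $ i1)"
    unfolding poisson_t_def Y P_def Q_def ..
  also have "\<dots> = (\<Sum>i1\<in>UNIV. \<Sum>i2\<in>UNIV. \<Sum>j1\<in>UNIV. \<Sum>j2\<in>UNIV.
      if i1 = j1 then if i2 = j2 then sc f * P $ j2 $ i2 * Q $ j1 $ i1 else 0 else 0)"
    by (intro sum.cong refl) (simp add: mat_nth sc_0[OF sc])
  also have "\<dots> = (\<Sum>i1\<in>UNIV. \<Sum>i2\<in>UNIV. \<Sum>j1\<in>UNIV. if i1 = j1 then sc f * P $ i2 $ i2 * Q $ j1 $ i1 else 0)"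
  proof (intro sum.cong refl)
    fix i1 i2 j1
    show "(\<Sum>j2\<in>UNIV. if i1 = j1 then if i2 = j2 then sc f * P $ j2 $ i2 * Q $ j1 $ i1 else 0 else 0) =
        (if i1 = j1 then sc f * P $ i2 $ i2 * Q $ j1 $ i1 else 0)"
      by (cases "i1 = j1") simp_all
  qed
  also have "\<dots> = (\<Sum>i1\<in>UNIV. \<Sum>i2\<in>UNIV. sc f * (P $ i2 $ i2 * Q $ i1 $ i1))"
    by (simp add: mult.assoc)
  also have "\<dots> = sc f * (trace P * trace Q)"
    unfolding trace_nth unfolding sum_product unfolding sum_distrib_left by (rule sum.swap)
  finally show ?thesis by (simp add: t_def tgen_def P_def Q_def)
qed

lemma dYmat_eq_f_poisson:
  fixes G :: "(complex, 'n::nontriv) zmat"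
  assumes \<zeta>: "Im \<zeta> > 0" and \<tau>: "Im \<tau> > 0" and gq: "generic_qp \<zeta> \<tau>" and G: "diag_sqrt_g G" and g: "generic_arg \<zeta> \<tau> \<xi>"
  shows "dYmat G \<zeta> \<tau> \<xi> = mat (f_poisson CARD('n) \<zeta> (exp (\<i> * pi * \<xi>)))"
proof -
  have N: "0 < CARD('n)" by simp
  show ?thesis
    unfolding f_poisson_eq[OF \<zeta> \<tau> N g]
    by (rule dYmat_eq[OF G \<zeta> \<tau> generic_qp_theta_nonzero[OF \<tau> gq] g]) (rule DERIV_Tfun[OF \<zeta> \<tau> N g])
qed

theorem mainTheorem3:
  fixes sc :: "complex \<Rightarrow> 'a::{ring_1, t2_space}"
    and G :: "(complex, 'n::nontriv) zmat"
    and \<zeta> \<tau> u v :: complex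
    and D :: "complex set"
    and Lm :: "int \<Rightarrow> ('a, 'n) zmat"
  assumes "Im \<zeta> > 0" and "Im \<tau> > 0"
    and "generic_qp \<zeta> \<tau>" and "generic_qp \<zeta> (\<tau> + of_nat CARD('n) * \<zeta>)"
    and "diag_sqrt_g G"
    and "elliptic_sl sc G \<zeta> \<tau> (- of_nat CARD('n)) D Lm"
    and "u - of_nat CARD('n) * \<zeta> \<in> D" and "u + \<tau> + 1 \<in> D"
    and "v - of_nat CARD('n) * \<zeta> \<in> D" and "v + \<tau> + 1 \<in> D"
    and "invertible (Lminus sc G \<tau> Lm u)" and "invertible (Lminus sc G \<tau> Lm v)"
    and "generic_arg \<zeta> \<tau> (v - u)"
  shows "poisson_t sc G \<zeta> \<tau> Lm u v =
           sc (f_poisson CARD('n) \<zeta> (exp (\<i> * pi * (v - u))))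
             * tgen sc G \<zeta> \<tau> (- of_nat CARD('n)) Lm u * tgen sc G \<zeta> \<tau> (- of_nat CARD('n)) Lm v
         \<and> (\<forall>\<tau>'. Im \<tau>' > 0 \<longrightarrow> generic_qp \<zeta> \<tau>' \<longrightarrow> generic_arg \<zeta> \<tau>' (v - u) \<longrightarrow>
              dYmat G \<zeta> \<tau>' (v - u) = dYmat G \<zeta> \<tau> (v - u))"
proof -
  have gl: "elliptic_gl sc G \<zeta> \<tau> (- of_nat CARD('n)) D Lm"
    using assms(6) by (simp add: elliptic_sl_def)
  have sc: "complex_algebra sc" using gl by (simp add: elliptic_gl_def)
  \<comment> \<open>The right side does not contain \<open>\<tau>'\<close>, so this one identity
    gives both the value of the bracket and its independence of \<open>p\<close>.\<close>
  have dY: "dYmat G \<zeta> \<tau>' (v - u) = mat (f_poisson CARD('n) \<zeta> (exp (\<i> * pi * (v - u))))"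
    if "Im \<tau>' > 0" "generic_qp \<zeta> \<tau>'" "generic_arg \<zeta> \<tau>' (v - u)" for \<tau>'
    using dYmat_eq_f_poisson[OF assms(1) that(1,2) assms(5) that(3)] .
  have "generic_arg \<zeta> \<tau> (u - v)" using generic_arg_minus[OF assms(13)] by simp
  note commute = tgen_commute[OF assms(1-5) gl assms(7-12) this]
  show ?thesis
    using poisson_t_scalar[OF sc dY[OF assms(2,3,13)], of Lm] dY dY[OF assms(2,3,13)]
    by (simp add: commute mult.assoc)
qed

end
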